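(* Fix $f\in\mathring{\mathcal V}=\mathcal V\cap\psi(\mathcal M)$. The map $q\mapsto\phi_f(q)=([\mathcal D],c,O,A)$ is an injection from $\psi^{-1}(f)\cap\mathring{\mathcal M}$ to the collection of data $([\mathcal D],c,O,A)\in\mathrm{Pic}^g(C_f)\times\mathcal S_f\times R_O\times R_A$ such that: (a) $\mathcal D$ is a positive divisor on $C_f$ of degree $g$, regular with respect to $P$ and the $O_j$; (b) $c=(c_1,\dots,c_M)\in\mathcal S_f$; (c) $O\in R_O$; (d) $A\in R_A$.
   Context: Setup. Fix integers $n\ge2$, $m\ge1$, $1\le k\le n$; $N=\gcd(n,k)$, $n'=n/N$, $k'=k/N$, $M=\gcd(n,m+k)$. $\mathcal M=\mathbb C^{mn}$ with coordinates $q=(q_{ij})_{1\le i\le m,1\le j\le n}$. $Q_i(x)$ is the $n\times n$ matrix with diagonal entries $q_{i1},\dots,q_{in}$, entries $1$ in positions $(j+1,j)$ ($1\le j\le n-1$), entry $x$ in position $(1,n)$, zeros elsewhere; $P(x)$ is the same with zero diagonal. $\mathcal L$ is the set of $A=(a_{ij})_{1\le i\le n,\,j\in\mathbb Z}$ with $a_{ij}=1$ if $j-i=-m-k$, $a_{ij}\in\mathbb C$ arbitrary if $-m-k+1\le j-i\le-k$, and $a_{ij}=0$ otherwise; $A$ is identified with the $n\times n$ matrix $L(x)$ with entries $l_{ij}(x)=\sum_{\ell\in\mathbb Z}a_{i,j-\ell n}x^\ell$. Maps: $\alpha:\mathcal M\to\mathcal L$, $\alpha(q)=Q_1(x)\cdots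 Q_m(x)P(x)^k$; $\beta:\mathcal L\to\mathbb C[x,y]$, $\beta(L)=\det(L(x)-y)$; $\psi=\beta\circ\alpha$. The set $\mathcal V$. Write $f_{i,j}$ for the coefficient of $x^jy^i$ in $f$. $V_{n,m,k}$ is the set of polynomials $((-y)^{n/M}+x^{(k+m)/M})^M+\sum f_{i,j}x^jy^i$, the sum over lattice points $(j,i)$ of the triangle with vertices $(k,0),(0,n),(k+m,0)$ not on the edge joining $(0,n)$ and $(k+m,0)$. Let $L_c=\{(j,i)\in\mathbb Z_{\ge0}^2:(m+k)i+nj=n(m+k)-M\}$ and $f_c=\epsilon_0\sum_{(j,i)\in L_c}f_{i,j}$, where $\epsilon_0=(-1)^{(n-i-1)j+i}$ (the same sign for all $(j,i)\in L_c$). Let $C'_f=\{f=0\}\subset\mathbb C^2$ and $C_f$ the normalization of its closure in $\mathbb P^2(\mathbb C)$. Points of $C_f$ are special if $x=0$ or $y=0$ there, or if they do not lie over $C_f'$. $\mathcal V$ is the set of $f\in V_{n,m,k}$ such that $f$ is irreducible, $C_f'$ is smooth away from $(0,0)$, $f_c\ne0$, and the special points of $C_f$ are exactly: $m$ distinct points $A_r=((-1)^n\epsilon_r,0)$ with $\epsilon_r\neq0$; $N$ distinct points $O_1,\dots,O_N$ over $(0,0)$, such that near $O_r$ there is a local coordinate $u$ with $(x,y)\sim(u^{n'},-(-\sigma_r)^{1/n'}u^{k'})$, $\sigma_r\ne0$; and a single point $P$ over the line at infinity. The genus of $C_f$ is $g=\frac12((n-1)m-M-N+2)$. Divisors. $\mathcal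 L(D)=\{h:(h)+D\ge0\}$. Given an ordering of the $N$ points over $(0,0)$, put $O_j=O_r$ for $j\equiv r\bmod N$, and for $i<j$ read $\sum_{r=j}^iO_r$ as $-\sum_{r=i+1}^{j-1}O_r$ (which is $0$ for $i=j-1$). A degree $g$ divisor $D$ is general if $\dim\mathcal L(D)=1$, and regular with respect to $P$ and the $O_j$ if it is general and $\dim\mathcal L(D+\kappa P-\sum_{j=n-\kappa}^nO_j)=0$ for all integers $\kappa>0$. Spectral data. For $L\in\beta^{-1}(f)$ let $\Delta_{i,j}=(-1)^{i+j}|L(x)-y|_{i,j}$ ($|\cdot|_{i,j}$: delete row $i$ and column $j$), a rational function on $C_f$, and $R=(k'-1)\sum_{r=1}^NO_r+((n-1)m-k-M)P$. The ordering $O=(O_1,\dots,O_N)$ attached to $L$ is the unique one for which there exist positive general divisors $D_1,\dots,D_n,\bar D_1,\dots,\bar D_n$ of degree $g$ with $(\Delta_{i,j})=D_j+\bar D_i+(j-i-1)P+\sum_{r=j+1}^{i-1}O_r-R$ for all $i,j\in[n]$. (For $L=\alpha(q)$, $O_r$ is the point where $y^{n'}/x^{k'}=(-1)^{n'+1}\sigma_r(q)$, $\sigma_r(q)=\prod_{i=1}^m\prod_{j=0}^{n'-1}q_{i,r+jN}$.) Put $h_i=\Delta_{n,i}/\Delta_{n,n}$; $\mathcal D=\mathcal D(L)$ is the minimum positive divisor with $(h_i)+\mathcal D\ge\sum_{j=i+1}^nO_j-(n-i)P$ for $i=1,\dots,n-1$ (it equals $D_n$). For $1\le\ell\le M$,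 $c_\ell$ is the coefficient of the maximal (for generic $L\in\mathcal L$) power of $x$ in the $(\ell,\ell+1)$ entry of $L(x)^{n/M}$ (column index mod $n$). $\mathcal S_f=\{(x_1,\dots,x_M)\in(\mathbb C^* )^M:\prod x_\ell=f_c\}$. $R_O$ and $R_A$ are the sets of the $N!$ orderings of $\{O_1,\dots,O_N\}$ and the $m!$ orderings of $\{A_1,\dots,A_m\}$. For $q\in\psi^{-1}(f)$: $\phi_f(q)=([\mathcal D],(c_1,\dots,c_M),O,A)$ where $\mathcal D,c,O$ are attached to $L=\alpha(q)$ and $A=(((-1)^n\epsilon_1(q),0),\dots,((-1)^n\epsilon_m(q),0))$ with $\epsilon_r(q)=\prod_{j=1}^nq_{rj}$. The set $\mathring{\mathcal M}$. It is the open subset of $\mathcal M$ on which (a) $\alpha$ is $m!$ to $1$ (that is, $\mathring{\mathcal M}=\alpha^{-1}(\alpha(\mathring{\mathcal M}))\to\alpha(\mathring{\mathcal M})$ is an $m!$ to $1$ map) and (b) the following action of $\mathfrak S_m$ is well defined: the $r$-th simple transposition ($1\le r\le m-1$) replaces $(\mathbf a,\mathbf b)=((q_{rj})_j,(q_{r+1,j})_j)$ by $(\mathbf b',\mathbf a')$, where $b_i'=b_iE_i/E_{i-1}$, $a_i'=a_iE_{i-1}/E_i$, $E_i=E(\mathbf a^{(i)},\mathbf b^{(i)})$, $E(\mathbf a,\mathbf b)=\sum_{i=0}^{n-1}\prod_{j=1}^ib_j\prod_{j=i+2}^na_j$, and $\mathbf a^{(i)}=(a_{i+1},\dots,a_n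,a_1,\dots,a_i)$.
   Formalization: Corrected: the divisor formula for (Δ_{i,j}) gets the extra term k·(x); the edge polynomial of V_{n,m,k} is ((-y)^{n/M}-(-1)^{n/M}x^{(k+m)/M})^M; "C_f has genus g" is made part of the definition of 𝒱, since the listed conditions admit smaller genus. *)

theory Defs
  imports
    "HOL-Analysis.Convex_Euclidean_Space"
    "HOL-Computational_Algebra.Polynomial_Factorial"
    "HOL-Algebra.Embedded_Algebras"
    "HOL-Algebra.Free_Abelian_Groups"
    "Jordan_Normal_Form.Determinant"
begin

text \<open>
  Conventions. A polynomial in \<open>x, y\<close> over the complex numbers is a \<^typ>\<open>complex poly poly\<close>
  whose outer variable is \<open>y\<close> and whose inner variable is \<open>x\<close>, so that the coefficient of
  \<open>x^j y^i\<close> in \<open>f\<close> is \<open>poly.coeff (poly.coeff f i) j\<close>.  Matrix entries are indexed from 0, as in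
  the matrix library: \<open>q $$ (i - 1, j - 1)\<close> is the coordinate written \<open>q_ij\<close> on paper.  The indices
  of the cofactors \<open>Delta_ij\<close>, of the divisors \<open>D_j\<close> and of the points \<open>O_j\<close> run from 1.
\<close>

section \<open>Curves, points and divisors\<close>

text \<open>
  The function field of the curve \<open>f = 0\<close> is \<open>C(x)[y]/(f)\<close>, realised on the remainders modulo \<open>f\<close>.
  It is meant for irreducible \<open>f\<close> of positive degree in \<open>y\<close>.
\<close>

type_synonym rat_fun = "complex poly fract poly"

definition function_field :: "complex poly poly \<Rightarrow> rat_fun ring" where
  "function_field f =
     \<lparr> carrier = range (\<lambda>h. h mod map_poly to_fract f),
       monoid.mult = (\<lambda>g h. (g * h) mod map_poly to_fract f),
       monoid.one = 1 mod map_poly to_fract f,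
       ring.zero = 0,
       ring.add = (+) \<rparr>"

definition fun_of :: "complex poly poly \<Rightarrow> complex poly poly \<Rightarrow> rat_fun" where
  "fun_of f h = map_poly to_fract h mod map_poly to_fract f"

definition x_fun :: "complex poly poly \<Rightarrow> rat_fun" where
  "x_fun f = fun_of f [:[:0, 1:]:]"

definition y_fun :: "complex poly poly \<Rightarrow> rat_fun" where
  "y_fun f = fun_of f [:0, 1:]"

definition const_fun :: "complex poly poly \<Rightarrow> complex \<Rightarrow> rat_fun" where
  "const_fun f a = fun_of f [:[:a:]:]"

definition constants :: "complex poly poly \<Rightarrow> rat_fun set" where
  "constants f = range (const_fun f)"

text \<open>
  The points of the normalization of the projective closure of an irreducible plane curve are the
  discrete valuation rings of its function field containing the constants.  A point \<open>p\<close> is given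
  here by its normalised valuation, so \<open>p h\<close> is the order of vanishing of \<open>h\<close> at \<open>p\<close>.  Being
  total functions, the valuations are set to 0 at 0 and outside the field.
\<close>

type_synonym point = "rat_fun \<Rightarrow> int"

definition points :: "complex poly poly \<Rightarrow> point set" where
  "points f = {p.
     (\<forall>h. h \<notin> carrier (function_field f) - {0} \<longrightarrow> p h = 0) \<and>
     (\<forall>a. a \<noteq> 0 \<longrightarrow> p (const_fun f a) = 0) \<and>
     (\<forall>g \<in> carrier (function_field f) - {0}. \<forall>h \<in> carrier (function_field f) - {0}.
        p (g \<otimes>\<^bsub>function_field f\<^esub> h) = p g + p h \<and>
        (g + h \<noteq> 0 \<longrightarrow> min (p g) (p h) \<le> p (g + h))) \<and>
     (\<exists>h \<in> carrier (function_field f) - {0}. p h = 1)}"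

definition vanishes_at :: "rat_fun \<Rightarrow> point \<Rightarrow> bool" where
  "vanishes_at h p \<longleftrightarrow> h = 0 \<or> p h > 0"

definition lies_over :: "complex poly poly \<Rightarrow> point \<Rightarrow> complex \<times> complex \<Rightarrow> bool" where
  "lies_over f p z \<longleftrightarrow>
     vanishes_at (x_fun f - const_fun f (fst z)) p \<and> vanishes_at (y_fun f - const_fun f (snd z)) p"

definition at_infinity :: "complex poly poly \<Rightarrow> point \<Rightarrow> bool" where
  "at_infinity f p \<longleftrightarrow> p (x_fun f) < 0 \<or> p (y_fun f) < 0"

definition special_points :: "complex poly poly \<Rightarrow> point set" where
  "special_points f =
     {p \<in> points f. vanishes_at (x_fun f) p \<or> vanishes_at (y_fun f) p \<or> at_infinity f p}"

text \<open>\<open>asymp_at p g h\<close> says that \<open>g / h\<close> takes the value 1 at \<open>p\<close> (for \<open>h\<close> nonzero).\<close>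

definition asymp_at :: "point \<Rightarrow> rat_fun \<Rightarrow> rat_fun \<Rightarrow> bool" where
  "asymp_at p g h \<longleftrightarrow> g - h = 0 \<or> p (g - h) > p h"

type_synonym divisor = "point \<Rightarrow>\<^sub>0 int"

abbreviation divisors :: "complex poly poly \<Rightarrow> divisor monoid" where
  "divisors f \<equiv> free_Abelian_group (points f)"

definition effective :: "divisor \<Rightarrow> bool" where
  "effective D \<longleftrightarrow> (\<forall>p. Poly_Mapping.lookup D p \<ge> 0)"

definition div_degree :: "divisor \<Rightarrow> int" where
  "div_degree D = (\<Sum>p \<in> Poly_Mapping.keys D. Poly_Mapping.lookup D p)"

definition div_of :: "complex poly poly \<Rightarrow> rat_fun \<Rightarrow> divisor" where
  "div_of f h = Abs_poly_mapping (\<lambda>p. if p \<in> points f then p h else 0)"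

definition principal_divisors :: "complex poly poly \<Rightarrow> divisor set" where
  "principal_divisors f = div_of f ` (carrier (function_field f) - {0})"

definition div_class :: "complex poly poly \<Rightarrow> divisor \<Rightarrow> divisor set" where
  "div_class f D = principal_divisors f #>\<^bsub>divisors f\<^esub> D"

text \<open>The elements of degree \<open>d\<close> of the Picard group \<open>divisors f Mod principal_divisors f\<close>.\<close>

definition Pic :: "complex poly poly \<Rightarrow> int \<Rightarrow> divisor set set" where
  "Pic f d = {div_class f D | D. D \<in> carrier (divisors f) \<and> div_degree D = d}"

definition RR_space :: "complex poly poly \<Rightarrow> divisor \<Rightarrow> rat_fun set" where
  "RR_space f D = {h \<in> carrier (function_field f). h = 0 \<or> effective (div_of f h + D)}"

abbreviation RR_dim :: "complex poly poly \<Rightarrow> divisor \<Rightarrow> nat \<Rightarrow> bool" where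
  "RR_dim f D d \<equiv> ring.dimension (function_field f) d (constants f) (RR_space f D)"

text \<open>The genus is the maximum of \<open>deg D - dim L(D) + 1\<close> over all divisors.\<close>

definition has_genus :: "complex poly poly \<Rightarrow> int \<Rightarrow> bool" where
  "has_genus f g \<longleftrightarrow>
     (\<forall>D \<in> carrier (divisors f). \<forall>d. RR_dim f D d \<longrightarrow> div_degree D - int d + 1 \<le> g) \<and>
     (\<exists>D \<in> carrier (divisors f). \<exists>d. RR_dim f D d \<and> div_degree D - int d + 1 = g)"

definition genus_value :: "nat \<Rightarrow> nat \<Rightarrow> nat \<Rightarrow> int" where
  "genus_value n m k =
     ((int n - 1) * int m - int (gcd n (m + k)) - int (gcd n k) + 2) div 2"

section \<open>The matrices\<close>

definition phase_space :: "nat \<Rightarrow> nat \<Rightarrow> complex mat set" where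
  "phase_space n m = carrier_mat m n"

definition Q_mat :: "nat \<Rightarrow> (nat \<Rightarrow> complex) \<Rightarrow> complex poly mat" where
  "Q_mat n d = mat n n (\<lambda>(i, j).
     if i = j then [:d i:] else if i = j + 1 then 1 else if i = 0 \<and> j = n - 1 then [:0, 1:] else 0)"

definition P_mat :: "nat \<Rightarrow> complex poly mat" where
  "P_mat n = Q_mat n (\<lambda>_. 0)"

definition alpha :: "nat \<Rightarrow> nat \<Rightarrow> nat \<Rightarrow> complex mat \<Rightarrow> complex poly mat" where
  "alpha n m k q =
     foldr (\<lambda>i B. Q_mat n (\<lambda>j. q $$ (i, j)) * B) [0..<m] (1\<^sub>m n) * (P_mat n ^\<^sub>m k)"

text \<open>
  The matrices \<open>L(x)\<close> attached to the arrays \<open>a\<close>.  Shifting both indices of \<open>a\<close> by one does not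
  affect the conditions, so the rows are indexed from 0.  Only \<open>l \<ge> 0\<close> matters in
  \<open>l_ij(x) = sum a_(i, j - l n) x^l\<close>: for \<open>l < 0\<close> we have \<open>j - l n - i \<ge> 1 > - k\<close>.
\<close>

definition lax_matrices :: "nat \<Rightarrow> nat \<Rightarrow> nat \<Rightarrow> complex poly mat set" where
  "lax_matrices n m k = {L \<in> carrier_mat n n. \<exists>a :: nat \<Rightarrow> int \<Rightarrow> complex.
     (\<forall>i < n. \<forall>j. (j - int i = - int m - int k \<longrightarrow> a i j = 1) \<and>
        (j - int i < - int m - int k \<or> j - int i > - int k \<longrightarrow> a i j = 0)) \<and>
     (\<forall>i < n. \<forall>j < n. \<forall>l. poly.coeff (L $$ (i, j)) l = a i (int j - int l * int n))}"

definition char_mat :: "nat \<Rightarrow> complex poly mat \<Rightarrow> complex poly poly mat" where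
  "char_mat n L = map_mat (\<lambda>c. [:c:]) L - [:0, 1:] \<cdot>\<^sub>m 1\<^sub>m n"

definition beta :: "nat \<Rightarrow> complex poly mat \<Rightarrow> complex poly poly" where
  "beta n L = det (char_mat n L)"

definition psi :: "nat \<Rightarrow> nat \<Rightarrow> nat \<Rightarrow> complex mat \<Rightarrow> complex poly poly" where
  "psi n m k q = beta n (alpha n m k q)"

section \<open>The set of spectral curves\<close>

definition coeff_xy :: "complex poly poly \<Rightarrow> nat \<Rightarrow> nat \<Rightarrow> complex" where
  "coeff_xy f j i = poly.coeff (poly.coeff f i) j"

text \<open>
  The part of \<open>det (L(x) - y)\<close> on the edge joining \<open>(0, n)\<close> and \<open>(k + m, 0)\<close>.  As \<open>P(x)^n = x\<close>, this
  is \<open>det (P(x)^(m + k) - y) = ((-y)^a - (-1)^a x^b)^M\<close> with \<open>a = n / M\<close> and \<open>b = (k + m) / M\<close>.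
  It is \<open>((-y)^a + x^b)^M\<close> if \<open>a\<close> is odd; the sign is necessary if \<open>a\<close> is even.
\<close>

definition edge_poly :: "nat \<Rightarrow> nat \<Rightarrow> nat \<Rightarrow> complex poly poly" where
  "edge_poly n m k = (let M = gcd n (m + k) in
     ((- [:0, 1:]) ^ (n div M) + (-1) ^ (n div M + 1) * [:[:0, 1:]:] ^ ((k + m) div M)) ^ M)"

definition V_poly :: "nat \<Rightarrow> nat \<Rightarrow> nat \<Rightarrow> complex poly poly set" where
  "V_poly n m k = {f. \<forall>j i. coeff_xy (f - edge_poly n m k) j i \<noteq> 0 \<longrightarrow>
     (real j, real i) \<in> convex hull {(real k, 0), (0, real n), (real (k + m), 0)} \<and>
     (real j, real i) \<notin> closed_segment (0, real n) (real (k + m), 0)}"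

text \<open>
  The sign does not depend on the point of \<open>L_c\<close> and can therefore be kept inside the sum; the
  truncated subtraction is harmless because \<open>i < n\<close> on \<open>L_c\<close>.
\<close>

definition f_c :: "nat \<Rightarrow> nat \<Rightarrow> nat \<Rightarrow> complex poly poly \<Rightarrow> complex" where
  "f_c n m k f =
     (\<Sum>(j, i) \<in> {(j, i). (m + k) * i + n * j = n * (m + k) - gcd n (m + k)}.
        (-1) ^ ((n - i - 1) * j + i) * coeff_xy f j i)"

definition eval_xy :: "complex poly poly \<Rightarrow> complex \<Rightarrow> complex \<Rightarrow> complex" where
  "eval_xy f a b = poly (poly f [:b:]) a"

definition smooth_away_from_origin :: "complex poly poly \<Rightarrow> bool" where
  "smooth_away_from_origin f \<longleftrightarrow>
     (\<forall>a b. (a, b) \<noteq> (0, 0) \<and> eval_xy f a b = 0 \<longrightarrow>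
        eval_xy (map_poly pderiv f) a b \<noteq> 0 \<or> eval_xy (pderiv f) a b \<noteq> 0)"

text \<open>
  \<open>(x, y) ~ (u^n', - (- \<sigma>)^(1/n') u^k')\<close> near \<open>p\<close>.  All choices \<open>s\<close> of the root \<open>(- \<sigma>)^(1/n')\<close> are
  equivalent: multiply \<open>u\<close> by roots of unity.  Only leading terms matter, so the local coordinate
  \<open>u\<close> can be taken to be a rational function.
\<close>

definition origin_expansion ::
  "complex poly poly \<Rightarrow> nat \<Rightarrow> nat \<Rightarrow> point \<Rightarrow> complex \<Rightarrow> bool" where
  "origin_expansion f n' k' p \<sigma> \<longleftrightarrow>
     (\<exists>u \<in> carrier (function_field f). \<exists>s. p u = 1 \<and> s ^ n' = - \<sigma> \<and>
        asymp_at p (x_fun f) (u [^]\<^bsub>function_field f\<^esub> n') \<and>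
        asymp_at p (y_fun f)
          (const_fun f (- s) \<otimes>\<^bsub>function_field f\<^esub> (u [^]\<^bsub>function_field f\<^esub> k')))"

definition special_point_condition :: "nat \<Rightarrow> nat \<Rightarrow> nat \<Rightarrow> complex poly poly \<Rightarrow> bool" where
  "special_point_condition n m k f \<longleftrightarrow> (let N = gcd n k in
     \<exists>(\<epsilon> :: nat \<Rightarrow> complex) A (\<sigma> :: nat \<Rightarrow> complex) Op P.
       special_points f = A ` {1..m} \<union> Op ` {1..N} \<union> {P} \<and>
       inj_on \<epsilon> {1..m} \<and> inj_on A {1..m} \<and>
       (\<forall>r \<in> {1..m}. \<epsilon> r \<noteq> 0 \<and> lies_over f (A r) ((-1) ^ n * \<epsilon> r, 0)) \<and>
       inj_on Op {1..N} \<and>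
       (\<forall>r \<in> {1..N}. \<sigma> r \<noteq> 0 \<and> lies_over f (Op r) (0, 0) \<and>
          origin_expansion f (n div N) (k div N) (Op r) (\<sigma> r)) \<and>
       at_infinity f P)"

text \<open>
  The genus is part of the definition: without it curves of smaller genus would be admitted, on
  which two points over the origin have the same \<open>\<sigma>\<close>.
\<close>

definition curly_V :: "nat \<Rightarrow> nat \<Rightarrow> nat \<Rightarrow> complex poly poly set" where
  "curly_V n m k = {f \<in> V_poly n m k.
     irreducible f \<and> smooth_away_from_origin f \<and> f_c n m k f \<noteq> 0 \<and>
     special_point_condition n m k f \<and> has_genus f (genus_value n m k)}"

definition ring_V :: "nat \<Rightarrow> nat \<Rightarrow> nat \<Rightarrow> complex poly poly set" where
  "ring_V n m k = curly_V n m k \<inter> psi n m k ` phase_space n m"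

definition P_inf :: "complex poly poly \<Rightarrow> point" where
  "P_inf f = (THE p. p \<in> points f \<and> at_infinity f p)"

definition O_points :: "complex poly poly \<Rightarrow> point set" where
  "O_points f = {p \<in> points f. lies_over f p (0, 0)}"

text \<open>The curve is smooth at the points \<open>A_r\<close>, which are identified with their images in the plane.\<close>

definition A_points :: "complex poly poly \<Rightarrow> (complex \<times> complex) set" where
  "A_points f = {(a, 0) | a. a \<noteq> 0 \<and> (\<exists>p \<in> special_points f. lies_over f p (a, 0))}"

definition orderings :: "'a set \<Rightarrow> 'a list set" where
  "orderings S = {xs. distinct xs \<and> set xs = S}"

section \<open>General and regular divisors\<close>

definition O_at :: "point list \<Rightarrow> int \<Rightarrow> point" where
  "O_at ord j = ord ! nat ((j - 1) mod int (length ord))"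

text \<open>The sum of \<open>O_r\<close> over \<open>r = j, ..., i\<close>, with the sign convention for \<open>i < j\<close>.\<close>

definition O_sum :: "point list \<Rightarrow> int \<Rightarrow> int \<Rightarrow> divisor" where
  "O_sum ord j i =
     (if j \<le> i then (\<Sum>r \<in> {j..i}. frag_of (O_at ord r))
      else - (\<Sum>r \<in> {i + 1..j - 1}. frag_of (O_at ord r)))"

definition general_div :: "nat \<Rightarrow> nat \<Rightarrow> nat \<Rightarrow> complex poly poly \<Rightarrow> divisor \<Rightarrow> bool" where
  "general_div n m k f D \<longleftrightarrow>
     D \<in> carrier (divisors f) \<and> div_degree D = genus_value n m k \<and> RR_dim f D 1"

definition regular_div ::
  "nat \<Rightarrow> nat \<Rightarrow> nat \<Rightarrow> complex poly poly \<Rightarrow> point list \<Rightarrow> divisor \<Rightarrow> bool" where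
  "regular_div n m k f ord D \<longleftrightarrow> general_div n m k f D \<and>
     (\<forall>\<kappa> :: int. \<kappa> > 0 \<longrightarrow>
        RR_dim f (D + frag_cmul \<kappa> (frag_of (P_inf f)) - O_sum ord (int n - \<kappa>) (int n)) 0)"

section \<open>Spectral data\<close>

definition Delta ::
  "nat \<Rightarrow> complex poly poly \<Rightarrow> complex poly mat \<Rightarrow> nat \<Rightarrow> nat \<Rightarrow> rat_fun" where
  "Delta n f L i j = fun_of f (cofactor (char_mat n L) (i - 1) (j - 1))"

definition R_div :: "nat \<Rightarrow> nat \<Rightarrow> nat \<Rightarrow> complex poly poly \<Rightarrow> divisor" where
  "R_div n m k f =
     frag_cmul (int (k div gcd n k) - 1) (\<Sum>p \<in> O_points f. frag_of p) +
     frag_cmul ((int n - 1) * int m - int k - int (gcd n (m + k))) (frag_of (P_inf f))"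

text \<open>
  With \<open>R\<close> as above, the divisor on the right-hand side (without the last summand) is that of
  \<open>x^(- k) Delta_ij\<close>.  For \<open>Delta_ij\<close> itself the divisor of \<open>x^k\<close> has to be added, as one sees already
  for \<open>n = 2\<close>, \<open>m = k = 1\<close>, where \<open>Delta_22 = x - y\<close> has a simple zero at \<open>O_1\<close> and a simple pole
  at \<open>P\<close>.
\<close>

definition attached_ordering ::
  "nat \<Rightarrow> nat \<Rightarrow> nat \<Rightarrow> complex poly poly \<Rightarrow> complex poly mat \<Rightarrow> point list" where
  "attached_ordering n m k f L = (THE ord. ord \<in> orderings (O_points f) \<and>
     (\<exists>D D' :: nat \<Rightarrow> divisor.
        (\<forall>j \<in> {1..n}. effective (D j) \<and> general_div n m k f (D j) \<and>
                       effective (D' j) \<and> general_div n m k f (D' j)) \<and>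
        (\<forall>i \<in> {1..n}. \<forall>j \<in> {1..n}.
           div_of f (Delta n f L i j) =
             D j + D' i + frag_cmul (int j - int i - 1) (frag_of (P_inf f))
             + O_sum ord (int j + 1) (int i - 1) - R_div n m k f
             + frag_cmul (int k) (div_of f (x_fun f)))))"

definition h_fun :: "nat \<Rightarrow> complex poly poly \<Rightarrow> complex poly mat \<Rightarrow> nat \<Rightarrow> rat_fun" where
  "h_fun n f L i = Delta n f L n i \<otimes>\<^bsub>function_field f\<^esub> inv\<^bsub>function_field f\<^esub> (Delta n f L n n)"

definition D_admissible ::
  "nat \<Rightarrow> nat \<Rightarrow> nat \<Rightarrow> complex poly poly \<Rightarrow> complex poly mat \<Rightarrow> divisor \<Rightarrow> bool" where
  "D_admissible n m k f L D \<longleftrightarrow> D \<in> carrier (divisors f) \<and> effective D \<and>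
     (\<forall>i \<in> {1..n - 1}.
        effective (div_of f (h_fun n f L i) + D
          - (O_sum (attached_ordering n m k f L) (int i + 1) (int n)
             - frag_cmul (int n - int i) (frag_of (P_inf f)))))"

definition attached_divisor ::
  "nat \<Rightarrow> nat \<Rightarrow> nat \<Rightarrow> complex poly poly \<Rightarrow> complex poly mat \<Rightarrow> divisor" where
  "attached_divisor n m k f L = (THE D. D_admissible n m k f L D \<and>
     (\<forall>E. D_admissible n m k f L E \<longrightarrow> effective (E - D)))"

text \<open>
  The \<open>(l, l + 1)\<close> entry of \<open>L(x)^(n / M)\<close>, \<open>l < M\<close>.  A generic \<open>L\<close> attains the
  maximum over \<open>lax_matrices n m k\<close> of the degree of this entry.
\<close>

definition c_entry :: "nat \<Rightarrow> nat \<Rightarrow> nat \<Rightarrow> complex poly mat \<Rightarrow> nat \<Rightarrow> complex poly" where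
  "c_entry n m k L l = (L ^\<^sub>m (n div gcd n (m + k))) $$ (l, (l + 1) mod n)"

definition c_power :: "nat \<Rightarrow> nat \<Rightarrow> nat \<Rightarrow> nat \<Rightarrow> nat" where
  "c_power n m k l =
     (GREATEST d. \<exists>L \<in> lax_matrices n m k. poly.coeff (c_entry n m k L l) d \<noteq> 0)"

definition attached_c :: "nat \<Rightarrow> nat \<Rightarrow> nat \<Rightarrow> complex poly mat \<Rightarrow> complex list" where
  "attached_c n m k L =
     map (\<lambda>l. poly.coeff (c_entry n m k L l) (c_power n m k l)) [0..<gcd n (m + k)]"

definition S_set :: "nat \<Rightarrow> nat \<Rightarrow> nat \<Rightarrow> complex poly poly \<Rightarrow> complex list set" where
  "S_set n m k f =
     {c. length c = gcd n (m + k) \<and> 0 \<notin> set c \<and> prod_list c = f_c n m k f}"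

definition attached_A :: "nat \<Rightarrow> nat \<Rightarrow> complex mat \<Rightarrow> (complex \<times> complex) list" where
  "attached_A n m q = map (\<lambda>r. ((-1) ^ n * (\<Prod>j < n. q $$ (r, j)), 0)) [0..<m]"

type_synonym spectral_datum =
  "divisor set \<times> complex list \<times> point list \<times> (complex \<times> complex) list"

definition phi ::
  "nat \<Rightarrow> nat \<Rightarrow> nat \<Rightarrow> complex poly poly \<Rightarrow> complex mat \<Rightarrow> spectral_datum" where
  "phi n m k f q = (let L = alpha n m k q in
     (div_class f (attached_divisor n m k f L), attached_c n m k L,
      attached_ordering n m k f L, attached_A n m q))"

definition regular_spectral_data ::
  "nat \<Rightarrow> nat \<Rightarrow> nat \<Rightarrow> complex poly poly \<Rightarrow> spectral_datum set" where
  "regular_spectral_data n m k f =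
     {(X, c, ord, A) \<in> Pic f (genus_value n m k) \<times> S_set n m k f
                         \<times> orderings (O_points f) \<times> orderings (A_points f).
        \<exists>D. X = div_class f D \<and> effective D \<and> div_degree D = genus_value n m k \<and>
            regular_div n m k f ord D}"

section \<open>The symmetric group action and the open set\<close>

definition E_fun :: "nat \<Rightarrow> (nat \<Rightarrow> complex) \<Rightarrow> (nat \<Rightarrow> complex) \<Rightarrow> complex" where
  "E_fun n a b = (\<Sum>i < n. (\<Prod>j < i. b j) * (\<Prod>j \<in> {i + 1..<n}. a j))"

definition E_rot :: "nat \<Rightarrow> complex mat \<Rightarrow> nat \<Rightarrow> nat \<Rightarrow> complex" where
  "E_rot n q r i =
     E_fun n (\<lambda>j. q $$ (r, (i + j) mod n)) (\<lambda>j. q $$ (r + 1, (i + j) mod n))"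

text \<open>The simple transposition acting on the rows \<open>r\<close> and \<open>r + 1\<close> (indexed from 0).\<close>

definition simple_transp :: "nat \<Rightarrow> nat \<Rightarrow> nat \<Rightarrow> complex mat \<Rightarrow> complex mat" where
  "simple_transp n m r q = mat m n (\<lambda>(s, t).
     if s = r then q $$ (r + 1, t) * E_rot n q r (t + 1) / E_rot n q r t
     else if s = r + 1 then q $$ (r, t) * E_rot n q r t / E_rot n q r (t + 1)
     else q $$ (s, t))"

definition action_well_defined_on :: "nat \<Rightarrow> nat \<Rightarrow> complex mat set \<Rightarrow> bool" where
  "action_well_defined_on n m U \<longleftrightarrow>
     (\<forall>q \<in> U. \<forall>r. r + 1 < m \<longrightarrow>
        (\<forall>i < n. E_rot n q r i \<noteq> 0) \<and> simple_transp n m r q \<in> U) \<and>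
     (\<forall>q \<in> U. \<forall>r. r + 1 < m \<longrightarrow> simple_transp n m r (simple_transp n m r q) = q) \<and>
     (\<forall>q \<in> U. \<forall>r. r + 2 < m \<longrightarrow>
        simple_transp n m r (simple_transp n m (r + 1) (simple_transp n m r q)) =
        simple_transp n m (r + 1) (simple_transp n m r (simple_transp n m (r + 1) q))) \<and>
     (\<forall>q \<in> U. \<forall>r s. r + 1 < s \<and> s + 1 < m \<longrightarrow>
        simple_transp n m r (simple_transp n m s q) = simple_transp n m s (simple_transp n m r q))"

text \<open>The largest set with the two defining properties; they are stable under unions.\<close>

definition ring_M :: "nat \<Rightarrow> nat \<Rightarrow> nat \<Rightarrow> complex mat set" where
  "ring_M n m k = \<Union> {U. U \<subseteq> phase_space n m \<and>
     U = {q \<in> phase_space n m. alpha n m k q \<in> alpha n m k ` U} \<and>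
     (\<forall>L \<in> alpha n m k ` U. card {q \<in> U. alpha n m k q = L} = fact m) \<and>
     action_well_defined_on n m U}"

end

theory Submission
  imports Defs "Jordan_Normal_Form.Char_Poly" "HOL-Computational_Algebra.Field_as_Ring"
begin

text \<open>
  Number the components of the right eigenvector of \<open>L(x)\<close> from the last one, normalised to
  \<open>e_0 = 1\<close>, backwards, and put \<open>e_(s + n) = x e_s\<close>. Since \<open>L(x)\<close> is banded, \<open>y e_s\<close> is \<open>e_(s + m + k)\<close>
  plus a combination of the \<open>e_t\<close> with \<open>s + k \<le> t < s + m + k\<close>, and with \<open>a = n / M\<close>, \<open>b = (m + k) / M\<close>
  the product \<open>(y^a - x^b) e_s\<close> is \<open>e_(s + b n - 1)\<close>, multiplied by one of the numbers \<open>c\<close>, plus lower terms.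
  As \<open>f_c \<noteq> 0\<close>, the function \<open>y^a - x^b\<close> has a pole of order \<open>b n - 1\<close> at \<open>P\<close>, which forces \<open>e_s\<close> to have a
  pole of order \<open>s\<close> there and the \<open>c\<close> to be nonzero with product \<open>f_c\<close>.

  Let \<open>D_s\<close> be the least divisor away from \<open>P\<close> bounding the poles of \<open>e_s, e_(s + 1), \<dots>\<close>. Riemann's
  inequality yields \<open>deg D_s \<ge> g - s\<close>, and likewise for the left eigenvector. The Leibniz formula bounds
  the cofactors of \<open>L(x) - y\<close> at the points over the origin, and their orders at \<open>P\<close> are known from their
  trace \<open>- df/dy\<close>; this gives the opposite inequality for the sum of the two degrees. Hence
  \<open>deg D_s = g - s\<close>, \<open>dim L(D_s + \<kappa> P) = \<kappa> - s + 1\<close> for \<open>\<kappa> \<ge> s - 1\<close>, and \<open>D_s - D_(s + 1)\<close> is a point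
  \<open>O_(n - s)\<close>; the attached divisor is \<open>D_0\<close>.

  Conversely, \<open>D_0\<close> and the ordering determine all \<open>D_s\<close>, hence \<open>e_s\<close> up to a constant factor, since
  \<open>L(D_s + (s - 1) P) = 0\<close>. The factors have the periods \<open>n\<close> and \<open>m + k\<close>, hence \<open>M\<close>, and the numbers \<open>c\<close> fix
  their ratios, so the \<open>e_s\<close> and then \<open>L\<close> are determined. Finally \<open>Q_1\<close> is recovered from the left kernel of
  \<open>L(x)\<close> at \<open>x = (-1)^n \<epsilon>_1\<close>, where it is the only singular factor, and the other factors follow by induction.
\<close>

section \<open>Discrete valuations\<close>

text \<open>Points are bare valuations and the genus is by definition a maximum over divisors, so
  degree 0 of principal divisors and Riemann's theorem are both drawn from that maximality: a
  divisor attaining it can be translated by functions, and a polynomial in x moves it below any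
  other divisor away from P. This yields only lower bounds for the degrees of pole divisors. That is
  why the left eigenvector is carried along: a right component times a left component times one
  fixed cofactor is again a cofactor, up to a power of x, and since the divisor of the fixed
  cofactor has degree 0, the sum of the two degrees is bounded from above. The lower bounds g - s
  and g - (n - s) add up to 2 g - n. The upper bound has the same value because of a gain of 1 at
  each of the N points over the origin: there N times an order exceeds a multiple of N, and orders
  are integers. Passing to infinite sequences with e_(s + n) = x e_s makes L a constant band array,
  so that leading terms at P can be compared one index at a time.\<close>

text \<open>\<open>ge h d\<close> says that the order of \<open>h\<close> is at least \<open>d\<close>; it holds for all \<open>d\<close> if the order is infinite.\<close>

locale valuation =
  fixes ge :: "'a::comm_ring_1 \<Rightarrow> int \<Rightarrow> bool"
  assumes ge_zero [simp]: "ge 0 d"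
    and ge_one: "ge 1 0"
    and ge_uminus: "ge g d \<Longrightarrow> ge (- g) d"
    and ge_mono: "ge g d \<Longrightarrow> e \<le> d \<Longrightarrow> ge g e"
    and ge_add: "ge g d \<Longrightarrow> ge h d \<Longrightarrow> ge (g + h) d"
    and ge_mult: "ge g d \<Longrightarrow> ge h e \<Longrightarrow> ge (g * h) (d + e)"
    and not_ge_mult: "ge g d \<Longrightarrow> \<not> ge g (d + 1) \<Longrightarrow> ge h e \<Longrightarrow> \<not> ge h (e + 1) \<Longrightarrow> \<not> ge (g * h) (d + e + 1)"
    and not_geE: "\<not> ge g d \<Longrightarrow> \<exists>e < d. ge g e \<and> \<not> ge g (e + 1)"
begin

definition eq :: "'a \<Rightarrow> int \<Rightarrow> bool" where
  "eq g d \<longleftrightarrow> ge g d \<and> \<not> ge g (d + 1)"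

lemma eq_imp_ge: "eq g d \<Longrightarrow> ge g d"
  by (simp add: eq_def)

lemma eq_ge_iff: "eq g d \<Longrightarrow> ge g e \<longleftrightarrow> e \<le> d"
  unfolding eq_def using ge_mono[of g e "d + 1"] ge_mono[of g d e] by (cases "e \<le> d") auto

lemma eq_unique: "eq g d \<Longrightarrow> eq g e \<Longrightarrow> d = e"
  using eq_ge_iff eq_imp_ge by (meson order_antisym)

lemma ge_or_eq: "ge g d \<or> (\<exists>e < d. eq g e)"
  using not_geE eq_def by blast

lemma ge_uminus_iff [simp]: "ge (- g) d \<longleftrightarrow> ge g d"
  using ge_uminus[of g d] ge_uminus[of "- g" d] by auto

lemma ge_diff: "ge g d \<Longrightarrow> ge h d \<Longrightarrow> ge (g - h) d"
  using ge_add[of g d "- h"] by simp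

lemma ge_minus_commute: "ge (g - h) d \<longleftrightarrow> ge (h - g) d"
  using ge_uminus_iff[of "g - h" d] by simp

lemma ge_sum: "(\<And>i. i \<in> I \<Longrightarrow> ge (g i) d) \<Longrightarrow> ge (\<Sum>i\<in>I. g i) d"
  by (induction I rule: infinite_finite_induct) (auto intro: ge_add)

lemma ge_prod: "(\<And>i. i \<in> I \<Longrightarrow> ge (g i) (d i)) \<Longrightarrow> ge (\<Prod>i\<in>I. g i) (\<Sum>i\<in>I. d i)"
  by (induction I rule: infinite_finite_induct) (auto intro: ge_mult ge_one)

lemma ge_power: "ge g d \<Longrightarrow> ge (g ^ i) (int i * d)"
  by (induction i) (use ge_mult in \<open>auto simp: ge_one algebra_simps\<close>)

lemma eq_uminus [simp]: "eq (- g) d \<longleftrightarrow> eq g d"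
  by (simp add: eq_def)

lemma eq_mult: "eq g d \<Longrightarrow> eq h e \<Longrightarrow> eq (g * h) (d + e)"
  using ge_mult not_ge_mult unfolding eq_def by blast

lemma eq_cong: "ge (g - h) (d + 1) \<Longrightarrow> eq g d \<longleftrightarrow> eq h d"
proof -
  have "eq g d" if "ge (g - h) (d + 1)" "eq h d" for g h
  proof -
    have "ge (g - h) d" using that(1) by (rule ge_mono) simp
    then have "ge g d" using ge_add[of "g - h" d h] eq_imp_ge[OF that(2)] by simp
    moreover have "\<not> ge g (d + 1)"
    proof
      assume "ge g (d + 1)"
      then have "ge h (d + 1)" using ge_diff[OF _ that(1), of g] by simp
      then show False using that(2) by (simp add: eq_def)
    qed
    ultimately show ?thesis by (simp add: eq_def)
  qed
  then show "ge (g - h) (d + 1) \<Longrightarrow> eq g d \<longleftrightarrow> eq h d"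
    using ge_minus_commute by blast
qed

lemma eq_add_ge: "eq g d \<Longrightarrow> ge h (d + 1) \<Longrightarrow> eq (g + h) d"
  using eq_cong[of "g + h" g d] by simp

lemma not_eq_zero [simp]: "\<not> eq 0 d"
  by (simp add: eq_def)

text \<open>The axioms admit the degenerate case in which every element has infinite order, so the
  order of 1 is derived from the presence of some element of finite order.\<close>

lemma eq_one_exists: "eq g d \<Longrightarrow> eq 1 0"
proof (rule ccontr)
  assume *: "eq g d" "\<not> eq 1 0"
  then have "ge 1 1" using ge_one by (simp add: eq_def)
  then have "ge (1 * g) (1 + d)" by (rule ge_mult[OF _ eq_imp_ge[OF *(1)]])
  then show False using *(1) by (simp add: eq_def add.commute)
qed

lemma eq_power: "eq g d \<Longrightarrow> eq (g ^ i) (int i * d)"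
proof (induction i)
  case (Suc i)
  then show ?case using eq_mult[of g d "g ^ i" "int i * d"] by (simp add: algebra_simps)
qed (simp add: eq_one_exists)

lemma ge_mult_cancel: "eq g d \<Longrightarrow> ge (g * h) (d + e) \<longleftrightarrow> ge h e"
proof
  assume g: "eq g d" and "ge (g * h) (d + e)"
  show "ge h e"
  proof (rule ccontr)
    assume "\<not> ge h e"
    then obtain e' where e': "e' < e" "eq h e'" using ge_or_eq by blast
    with eq_mult[OF g e'(2)] \<open>ge (g * h) (d + e)\<close> show False by (simp add: eq_ge_iff)
  qed
qed (auto intro: ge_mult eq_imp_ge)

lemma eq_mult_cancel: "eq g d \<Longrightarrow> eq (g * h) (d + e) \<longleftrightarrow> eq h e"
  unfolding eq_def[of "g * h"] eq_def[of h] using ge_mult_cancel[of g d h] by (metis add.assoc)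

lemma eq_power_iff: "eq (g ^ Suc i) (int (Suc i) * d) \<longleftrightarrow> eq g d"
proof
  assume *: "eq (g ^ Suc i) (int (Suc i) * d)"
  have "\<not> ge (g ^ Suc i) (int (Suc i) * d + 1)" using * by (simp add: eq_def)
  show "eq g d"
  proof (cases "ge g (d + 1)")
    case True
    from ge_power[OF this, of "Suc i"] have "ge (g ^ Suc i) (int (Suc i) * d + 1)"
      by (rule ge_mono) (simp add: algebra_simps)
    then show ?thesis using * by (simp add: eq_def)
  next
    case False
    then obtain e where e: "e < d + 1" "eq g e" using ge_or_eq by blast
    from eq_unique[OF eq_power[OF e(2)] *] have "e = d" by (metis mult_cancel_left of_nat_eq_0_iff nat.distinct(1))
    then show ?thesis using e by simp
  qed
qed (rule eq_power)

lemma asymp_trans: "ge (g - h) d \<Longrightarrow> ge (h - k) d \<Longrightarrow> ge (g - k) d"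
  using ge_add[of "g - h" d "h - k"] by simp

lemma asymp_mult:
  assumes "ge (g - g') (d + 1)" "ge (h - h') (e + 1)" "ge g d" "ge h' e"
  shows "ge (g * h - g' * h') (d + e + 1)"
proof -
  have "g * h - g' * h' = g * (h - h') + (g - g') * h'" by (simp add: algebra_simps)
  moreover have "ge (g * (h - h')) (d + e + 1)" using ge_mult[OF assms(3,2)] by (simp add: algebra_simps)
  moreover have "ge ((g - g') * h') (d + e + 1)" using ge_mult[OF assms(1,4)] by (simp add: algebra_simps)
  ultimately show ?thesis by (metis ge_add)
qed

lemma asymp_mult_left: "ge g d \<Longrightarrow> ge (h - h') (e + 1) \<Longrightarrow> ge (g * h - g * h') (d + e + 1)"
  using ge_mult[of g d "h - h'" "e + 1"] by (simp add: algebra_simps)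

text \<open>In the Leibniz formula every summand of \<open>det A\<close> has one factor from each row and column.\<close>

lemma scaled_ge_det:
  assumes A: "A \<in> carrier_mat n n" and N: "N > 0"
    and "\<And>i j. i < n \<Longrightarrow> j < n \<Longrightarrow> \<exists>d. ge (A $$ (i, j)) d \<and> c j - r i \<le> N * d"
    and D: "N * (D - 1) < (\<Sum>i<n. c i) - (\<Sum>i<n. r i)"
  shows "ge (det A) D"
proof -
  obtain d where d: "\<And>i j. i < n \<Longrightarrow> j < n \<Longrightarrow> ge (A $$ (i, j)) (d i j) \<and> c j - r i \<le> N * d i j"
    using assms(3) by metis
  have signof: "ge (signof p) 0" for p
    using ge_one ge_uminus[OF ge_one] by (auto simp: sign_def)
  have "ge (signof p * (\<Prod>i = 0..<n. A $$ (i, p i))) D" if p: "p permutes {0..<n}" for p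
  proof -
    have pn: "p i < n" if "i < n" for i using p that permutes_in_image[OF p, of i] by simp
    have "ge (\<Prod>i = 0..<n. A $$ (i, p i)) (\<Sum>i = 0..<n. d i (p i))"
      by (rule ge_prod) (use d pn in auto)
    moreover have "D \<le> (\<Sum>i = 0..<n. d i (p i))"
    proof -
      have "(\<Sum>i<n. c i) = (\<Sum>i = 0..<n. c (p i))"
        using sum.permute[OF p, of c] by (simp add: o_def lessThan_atLeast0)
      then have "(\<Sum>i<n. c i) - (\<Sum>i<n. r i) = (\<Sum>i = 0..<n. c (p i) - r i)"
        by (simp add: sum_subtractf lessThan_atLeast0)
      also have "\<dots> \<le> (\<Sum>i = 0..<n. N * d i (p i))"
        by (rule sum_mono) (use d pn in auto)
      also have "\<dots> = N * (\<Sum>i = 0..<n. d i (p i))" by (simp add: sum_distrib_left)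
      \<comment> \<open>The hypothesis on \<open>D\<close> encodes
        \<open>D <= ceiling (S / N)\<close> without division; here it meets an integer sum of
        orders.\<close>
      finally have "N * (D - 1) < N * (\<Sum>i = 0..<n. d i (p i))" using D by linarith
      then show ?thesis using N by (simp add: mult_less_cancel_left_pos)
    qed
    ultimately have "ge (\<Prod>i = 0..<n. A $$ (i, p i)) D" by (rule ge_mono)
    with ge_mult[OF signof] show ?thesis by fastforce
  qed
  then show ?thesis unfolding det_def'[OF A] by (intro ge_sum) auto
qed

end

section \<open>The function field of an irreducible plane curve\<close>

locale plane_curve =
  fixes f :: "complex poly poly"
  assumes irreducible_f: "irreducible f" and degree_f: "degree f > 0"
begin

definition F :: rat_fun where "F = map_poly to_fract f"

text \<open>Elements of the function field are handled as arbitrary polynomials in \<open>y\<close> over \<open>\<complex>(x)\<close>, modulo \<open>F\<close>.\<close>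

abbreviation emb :: "complex poly poly \<Rightarrow> rat_fun" where "emb \<equiv> map_poly to_fract"

abbreviation K where "K \<equiv> function_field f"

definition const :: "complex \<Rightarrow> rat_fun" where "const a = emb [:[:a:]:]"

definition X :: rat_fun where "X = emb [:[:0, 1:]:]"

definition Y :: rat_fun where "Y = emb [:0, 1:]"

lemma emb_pCons: "emb (pCons a h) = pCons (to_fract a) (emb h)"
  by (simp add: Polynomial.map_poly_pCons)

lemma irreducible_F: "irreducible F"
  using nonconst_poly_irreducible_iff[of f] degree_f irreducible_f unfolding F_def by simp

lemma prime_F: "prime_elem F"
  using field_poly_irreducible_imp_prime irreducible_F by blast

lemma degree_F: "degree F = degree f"
  unfolding F_def by (simp add: degree_map_poly)

lemma degree_F_pos [simp]: "degree F > 0"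
  using degree_F degree_f by simp

lemma F_nonzero [simp]: "F \<noteq> 0"
  using degree_F degree_f by auto

lemma not_F_dvd_one: "\<not> F dvd 1"
  using prime_F by (simp add: prime_elem_def)

lemma F_dvd_mult_iff: "F dvd g * h \<longleftrightarrow> F dvd g \<or> F dvd h"
  using prime_elem_dvd_mult_iff[OF prime_F] .

lemma F_dvd_power_iff: "F dvd g ^ n \<longleftrightarrow> F dvd g \<and> n > 0"
  by (induction n) (auto simp: F_dvd_mult_iff not_F_dvd_one)

lemma F_dvd_emb_f: "F dvd emb f"
  by (simp add: F_def)

lemma degree_less_not_F_dvd: "h \<noteq> 0 \<Longrightarrow> degree h < degree f \<Longrightarrow> \<not> F dvd h"
  using dvd_imp_degree_le[of F h] degree_F by auto

lemma F_dvd_diff_iff: "F dvd g - h \<longleftrightarrow> g mod F = h mod F"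
  by (simp add: mod_eq_dvd_iff)

lemma mod_F_of_const [simp]: "[:c:] mod F = [:c:]"
  by (rule mod_poly_less) simp

lemma const_0 [simp]: "const 0 = 0" and const_1 [simp]: "const 1 = 1"
  and const_add: "const (a + b) = const a + const b"
  and const_diff: "const (a - b) = const a - const b"
  and const_uminus: "const (- a) = - const a"
  and const_mult: "const (a * b) = const a * const b"
  by (simp_all add: const_def emb_pCons flip: to_fract_add to_fract_diff to_fract_uminus to_fract_mult)
     (simp add: flip: one_pCons)

lemma const_power: "const (a ^ i) = const a ^ i"
  by (induction i) (simp_all add: const_mult)

lemma const_inverse: "a \<noteq> 0 \<Longrightarrow> const a * const (inverse a) = 1"
  by (simp flip: const_mult)

lemma const_eq_0_iff [simp]: "const a = 0 \<longleftrightarrow> a = 0"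
  by (simp add: const_def emb_pCons)

lemma not_F_dvd_const: "a \<noteq> 0 \<Longrightarrow> \<not> F dvd const a"
  by (rule degree_less_not_F_dvd) (use degree_f in \<open>auto simp: const_def emb_pCons\<close>)

lemma fun_of_eq: "fun_of f h = emb h mod F"
  by (simp add: fun_of_def F_def)

lemma x_fun_eq: "x_fun f = X mod F" and y_fun_eq: "y_fun f = Y mod F"
  and const_fun_eq: "const_fun f a = const a"
  using mod_F_of_const[of "to_fract [:a:]"]
  by (simp_all add: x_fun_def y_fun_def const_fun_def fun_of_eq X_def Y_def const_def emb_pCons)

lemma not_F_dvd_emb_const: "g \<noteq> 0 \<Longrightarrow> \<not> F dvd emb [:g:]"
  by (rule degree_less_not_F_dvd) (use degree_f in \<open>auto simp: emb_pCons\<close>)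

lemma not_F_dvd_X: "\<not> F dvd X"
  unfolding X_def by (rule not_F_dvd_emb_const) simp

lemma F_dvd_mod_iff: "F dvd h mod F \<longleftrightarrow> F dvd h"
  by (simp add: dvd_mod_iff)

text \<open>The nonzero combination of \<open>F\<close> and \<open>h\<close> of least degree divides
  both. It divides the irreducible \<open>F\<close> without being an associate of it, since
  \<open>F\<close> does not divide \<open>h\<close>, and hence is a unit.\<close>

lemma exists_inverse:
  assumes "\<not> F dvd h"
  obtains g where "F dvd g * h - 1" "\<not> F dvd g"
proof -
  define S where "S = {g. g \<noteq> 0 \<and> (\<exists>a b. g = a * F + b * h)}"
  have "F \<in> S" unfolding S_def by (auto intro: exI[of _ 1] exI[of _ 0])
  then obtain g where g: "g \<in> S" "\<And>g'. g' \<in> S \<Longrightarrow> degree g \<le> degree g'"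
    using ex_has_least_nat[of "\<lambda>g. g \<in> S" F degree] by blast
  then obtain a b where ab: "g = a * F + b * h" by (auto simp: S_def)
  have dvd: "g dvd a' * F + b' * h" for a' b'
  proof (rule ccontr)
    let ?r = "(a' * F + b' * h) mod g"
    assume "\<not> ?thesis"
    then have r: "?r \<noteq> 0" by (simp add: dvd_eq_mod_eq_0)
    have "?r = (a' * F + b' * h) - ((a' * F + b' * h) div g) * g" by (simp add: minus_div_mult_eq_mod)
    also have "\<dots> = (a' - (a' * F + b' * h) div g * a) * F + (b' - (a' * F + b' * h) div g * b) * h"
      by (subst (2) ab) (simp add: algebra_simps)
    finally have "?r \<in> S" using r unfolding S_def by blast
    moreover have "degree ?r < degree g" using degree_mod_less'[OF _ r] g(1) by (simp add: S_def)
    ultimately show False using g(2) by fastforce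
  qed
  have "g dvd F" "g dvd h" using dvd[of 1 0] dvd[of 0 1] by simp_all
  then have "g dvd 1" using irreducible_F assms by (metis dvd_trans irreducibleD')
  then obtain u where "1 = g * u" by (rule dvdE)
  then have "(u * a) * F + (u * b) * h = 1" using ab by (simp add: algebra_simps)
  then obtain a b where "a * F + b * h = 1" by blast
  then have *: "b * h - 1 = F * (- a)" by (simp add: algebra_simps)
  moreover have "\<not> F dvd b"
  proof
    assume "F dvd b"
    then have "F dvd b * h" by simp
    moreover have "F dvd b * h - 1" using * by simp
    ultimately have "F dvd b * h - (b * h - 1)" by (rule dvd_diff)
    then show False using not_F_dvd_one by simp
  qed
  ultimately show thesis using that[of b] by simp
qed

subsection \<open>The field structure\<close>

lemma K_simps [simp]:
  "monoid.mult K g h = (g * h) mod F" "monoid.one K = 1" "ring.zero K = 0" "ring.add K g h = g + h"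
  using mod_F_of_const[of 1] by (simp_all add: function_field_def F_def one_pCons)

lemma K_carrier: "carrier K = {h. h mod F = h}"
  unfolding function_field_def F_def by (auto simp: image_iff) metis

lemma one_mod_F [simp]: "1 mod F = 1"
  using mod_F_of_const[of 1] by (simp add: one_pCons)

lemma const_mod_F [simp]: "const a mod F = const a"
  using mod_F_of_const[of "to_fract [:a:]"] by (simp add: const_def emb_pCons)

lemma mod_in_K [simp]: "h mod F \<in> carrier K"
  by (simp add: K_carrier)

lemma K_add_closed: "g \<in> carrier K \<Longrightarrow> h \<in> carrier K \<Longrightarrow> g + h \<in> carrier K"
  by (simp add: K_carrier poly_mod_add_left)

lemma const_in_K [simp]: "const a \<in> carrier K"
  by (simp add: K_carrier)

lemma K_nonzero: "h \<in> carrier K \<Longrightarrow> h \<noteq> 0 \<Longrightarrow> \<not> F dvd h"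
  by (auto simp: K_carrier dvd_eq_mod_eq_0)

lemma cring_K: "cring K"
proof (rule cringI)
  show "abelian_group K"
  proof (rule abelian_groupI)
    fix g assume "g \<in> carrier K"
    then show "\<exists>h\<in>carrier K. h \<oplus>\<^bsub>K\<^esub> g = \<zero>\<^bsub>K\<^esub>"
      by (intro bexI[of _ "- g"]) (simp_all add: K_carrier poly_mod_minus_left)
  qed (auto simp: K_add_closed algebra_simps, simp add: K_carrier)
  show "Group.comm_monoid K"
    by (rule comm_monoidI)
       (auto simp: mod_mult_left_eq mod_mult_right_eq algebra_simps, auto simp: K_carrier)
qed (simp add: mod_mult_left_eq distrib_right poly_mod_add_left)

lemma field_K: "field K"
proof -
  interpret cring K by (rule cring_K)
  show ?thesis
  proof (rule cring_fieldI)
    show "Units K = carrier K - {\<zero>\<^bsub>K\<^esub>}"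
    proof (intro equalityI subsetI)
      fix h assume h: "h \<in> Units K"
      then obtain g where "(g * h) mod F = 1" by (auto simp: Units_def)
      then have "h \<noteq> 0" by auto
      then show "h \<in> carrier K - {\<zero>\<^bsub>K\<^esub>}" using h Units_closed by auto
    next
      fix h assume h: "h \<in> carrier K - {\<zero>\<^bsub>K\<^esub>}"
      then obtain g where "F dvd g * h - 1" using exists_inverse[of h] K_nonzero[of h] by auto
      then have "(g mod F * h) mod F = 1" using F_dvd_diff_iff[of "g * h" 1] K_simps(2) one_closed
        by (simp add: mod_mult_left_eq K_carrier)
      then show "h \<in> Units K" using h
        by (auto simp: Units_def mult.commute intro!: bexI[of _ "g mod F"])
    qed
  qed
qed

lemma constants_eq: "constants f = range const"
  by (simp add: constants_def const_fun_eq fun_eq_iff)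

lemma const_mult_mod: "h \<in> carrier K \<Longrightarrow> (const a * h) mod F = const a * h"
  unfolding const_def by (simp add: emb_pCons K_carrier mod_smult_left)

lemma subfield_constants: "subfield (constants f) K"
proof -
  interpret field K by (rule field_K)
  have inv: "inv\<^bsub>K\<^esub> (const a) = const (inverse a)" if "a \<noteq> 0" for a
    by (rule comm_inv_char) (use that const_mult_mod[of 1 1] in \<open>auto simp: const_inverse K_carrier\<close>)
  show ?thesis
  proof (rule subfieldI')
    show "subring (constants f) K"
    proof (rule subringI)
      fix h assume "h \<in> constants f"
      then obtain a where h: "h = const a" by (auto simp: constants_eq)
      have "\<ominus>\<^bsub>K\<^esub> h = const (- a)" by (rule minus_equality) (use const_in_K[of "- a"] in \<open>simp_all add: h const_uminus\<close>)
      then show "\<ominus>\<^bsub>K\<^esub> h \<in> constants f" by (auto simp: constants_eq)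
    next
      show "\<one>\<^bsub>K\<^esub> \<in> constants f" unfolding constants_eq K_simps by (metis const_1 rangeI)
    next
      fix g h assume "g \<in> constants f" "h \<in> constants f"
      then obtain a b where "g = const a" "h = const b" by (auto simp: constants_eq)
      then show "g \<otimes>\<^bsub>K\<^esub> h \<in> constants f" "g \<oplus>\<^bsub>K\<^esub> h \<in> constants f"
        using const_mult_mod[of "const b" a]
        by (auto simp: constants_eq simp flip: const_add const_mult)
    qed (auto simp: constants_eq)
    fix k assume "k \<in> constants f - {\<zero>\<^bsub>K\<^esub>}"
    then obtain a where "k = const a" "a \<noteq> 0" by (auto simp: constants_eq)
    then show "inv\<^bsub>K\<^esub> k \<in> constants f" using inv by (auto simp: constants_eq)
  qed
qed

end

context plane_curve begin

subsection \<open>Polynomial expressions\<close>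

lemma comm_ring_hom_const: "comm_ring_hom const"
  by standard (simp_all add: const_add const_mult)

lemma comm_ring_hom_emb: "comm_ring_hom emb"
  by standard simp_all

definition ev :: "complex poly \<Rightarrow> rat_fun \<Rightarrow> rat_fun" where
  "ev q h = poly (map_poly const q) h"

lemma ev_pCons: "ev (pCons a q) h = const a + h * ev q h"
  by (simp add: ev_def Polynomial.map_poly_pCons)

lemma ev_0 [simp]: "ev 0 h = 0" and ev_1 [simp]: "ev 1 h = 1"
  by (simp_all add: ev_def one_pCons Polynomial.map_poly_pCons)

lemma ev_add: "ev (q + r) h = ev q h + ev r h"
  and ev_mult: "ev (q * r) h = ev q h * ev r h"
proof -
  interpret c: comm_ring_hom const by (rule comm_ring_hom_const)
  interpret m: map_poly_comm_ring_hom const ..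
  show "ev (q + r) h = ev q h + ev r h" "ev (q * r) h = ev q h * ev r h"
    by (simp_all add: ev_def m.hom_add m.hom_mult)
qed

lemma ev_smult: "ev (Polynomial.smult c q) h = const c * ev q h"
  using ev_mult[of "[:c:]" q h] by (simp add: ev_pCons)

lemma ev_power: "ev (q ^ i) h = ev q h ^ i"
  by (induction i) (simp_all add: ev_mult)

lemma ev_linear: "ev ([:- a, 1:] * q) h = (h - const a) * ev q h"
  unfolding ev_mult by (simp add: ev_pCons const_uminus)

lemma ev_altdef: "ev q h = (\<Sum>i\<le>degree q. const (poly.coeff q i) * h ^ i)"
  unfolding ev_def poly_altdef
  by (rule sum.mono_neutral_cong_left) (auto simp: coeff_map_poly degree_map_poly coeff_eq_0)

lemma ev_altdef': "degree q \<le> n \<Longrightarrow> ev q h = (\<Sum>i\<le>n. const (poly.coeff q i) * h ^ i)"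
  unfolding ev_altdef by (rule sum.mono_neutral_left) (auto simp: coeff_eq_0)

lemma emb_const: "emb [:q:] = ev q X"
proof (induction q)
  case (pCons a q)
  have "emb [:pCons a q:] = emb [:[:a:]:] + X * emb [:q:]"
    by (simp add: X_def emb_pCons flip: to_fract_add to_fract_mult)
  then show ?case by (simp add: pCons ev_pCons const_def)
qed simp

lemma ev_X_pCons: "emb (pCons q h) = ev q X + Y * emb h"
  unfolding emb_const[symmetric] by (simp add: Y_def emb_pCons)

lemma emb_altdef: "emb h = (\<Sum>i\<le>degree h. ev (poly.coeff h i) X * Y ^ i)"
proof -
  have "emb h = emb (\<Sum>i\<le>degree h. Polynomial.monom (poly.coeff h i) i)"
    by (simp add: poly_as_sum_of_monoms)
  also have "\<dots> = (\<Sum>i\<le>degree h. emb ([:poly.coeff h i:] * [:0, 1:] ^ i))"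
  proof -
    interpret comm_ring_hom emb by (rule comm_ring_hom_emb)
    show ?thesis by (simp add: hom_sum monom_altdef)
  qed
  also have "\<dots> = (\<Sum>i\<le>degree h. ev (poly.coeff h i) X * Y ^ i)"
  proof -
    interpret comm_ring_hom emb by (rule comm_ring_hom_emb)
    show ?thesis by (simp only: hom_mult hom_power emb_const Y_def)
  qed
  finally show ?thesis .
qed

lemma not_F_dvd_ev_X: "q \<noteq> 0 \<Longrightarrow> \<not> F dvd ev q X"
  using not_F_dvd_emb_const by (simp add: emb_const)

text \<open>The denominator of the content of \<open>g\<close> clears all denominators at
  once.\<close>

lemma common_denominator:
  obtains q h where "q \<noteq> 0" "ev q X * g = emb h"
proof -
  obtain a b where ab: "fract_content g = to_fract a / to_fract b" "b \<noteq> 0"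
    by (cases "fract_content g") (auto simp: Fract_conv_to_fract)
  have "emb [:b:] * g = Polynomial.smult (to_fract b) (Polynomial.smult (fract_content g) (emb (primitive_part_fract g)))"
    by (simp add: content_times_primitive_part_fract emb_pCons)
  also have "\<dots> = emb [:a:] * emb (primitive_part_fract g)" using ab by (simp add: emb_pCons)
  finally have "ev b X * g = emb ([:a:] * primitive_part_fract g)" unfolding emb_const[symmetric] fract_poly_mult .
  then show thesis by (rule that[OF ab(2)])
qed

text \<open>The powers of \<open>h\<close> up to the degree of \<open>f\<close> are linearly dependent over \<open>\<complex>(x)\<close>.\<close>

lemma algebraic_relation:
  obtains G :: "complex poly poly" where "G \<noteq> 0" "F dvd (\<Sum>i\<le>degree G. ev (poly.coeff G i) X * h ^ i)"
proof -
  define n where "n = degree F"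
  define P where "P i = h ^ i mod F" for i
  obtain u where u: "\<exists>i\<le>n. u i \<noteq> 0" "F dvd (\<Sum>i\<le>n. Polynomial.smult (u i) (h ^ i))"
  \<comment> \<open>Linear dependence is stated for sets, not for families. A repeated remainder is
    a relation in itself and is treated first.\<close>
  proof (cases "inj_on P {..n}")
    case False
    then obtain i j where ij: "i \<le> n" "j \<le> n" "i \<noteq> j" "P i = P j" by (auto simp: inj_on_def)
    define u where "u k = (if k = i then 1 else if k = j then - 1 else 0 :: complex poly fract)" for k
    have "(\<Sum>k\<le>n. Polynomial.smult (u k) (h ^ k)) = (\<Sum>k\<in>{i, j}. Polynomial.smult (u k) (h ^ k))"
      by (rule sum.mono_neutral_right) (use ij in \<open>auto simp: u_def\<close>)
    also have "\<dots> = h ^ i - h ^ j" using ij(3) by (simp add: u_def)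
    finally have "F dvd (\<Sum>k\<le>n. Polynomial.smult (u k) (h ^ k))"
      using ij(4) by (simp add: F_dvd_diff_iff P_def)
    moreover have "\<exists>k\<le>n. u k \<noteq> 0" using ij(1) by (auto simp: u_def)
    ultimately show thesis using that[of u] by blast
  next
    case True
    interpret V: vector_space "Polynomial.smult :: complex poly fract \<Rightarrow> rat_fun \<Rightarrow> rat_fun"
      by standard (simp_all add: smult_add_left smult_add_right)
    let ?T = "(\<lambda>i. Polynomial.monom 1 i) ` {..<n} :: rat_fun set"
    have "P i \<in> V.span ?T" for i
    proof -
      have "degree (P i) < n \<or> P i = 0"
        unfolding P_def n_def using degree_mod_less[OF F_nonzero] by blast
      then have "P i = (\<Sum>j<n. Polynomial.monom (poly.coeff (P i) j) j)"
        by (intro poly_eqI) (auto simp: coeff_sum coeff_eq_0 not_less)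
      also have "\<dots> = (\<Sum>j<n. Polynomial.smult (poly.coeff (P i) j) (Polynomial.monom 1 j))"
        by (simp add: smult_monom)
      also have "\<dots> \<in> V.span ?T"
        by (intro V.span_sum V.span_scale V.span_base) auto
      finally show ?thesis .
    qed
    then have sub: "P ` {..n} \<subseteq> V.span ?T" by auto
    have "V.dependent (P ` {..n})"
    proof (rule ccontr)
      assume "\<not> ?thesis"
      from V.independent_span_bound[OF _ this sub] have "card (P ` {..n}) \<le> card ?T" by simp
      also have "\<dots> \<le> n" using card_image_le[of "{..<n}"] by force
      finally show False using card_image[OF True] by simp
    qed
    then obtain w where w: "\<exists>v\<in>P ` {..n}. w v \<noteq> 0" "(\<Sum>v\<in>P ` {..n}. Polynomial.smult (w v) v) = 0"
      using V.dependent_finite[of "P ` {..n}"] by auto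
    have "(\<Sum>i\<le>n. Polynomial.smult (w (P i)) (P i)) = 0"
      using w(2) sum.reindex[OF True, of "\<lambda>v. Polynomial.smult (w v) v"] by (simp add: o_def)
    moreover have "(\<Sum>i\<le>n. Polynomial.smult (w (P i)) (h ^ i)) mod F = (\<Sum>i\<le>n. Polynomial.smult (w (P i)) (P i)) mod F"
      unfolding P_def by (subst (1 2) mod_sum_eq[symmetric]) (simp add: mod_smult_left)
    ultimately have "F dvd (\<Sum>i\<le>n. Polynomial.smult (w (P i)) (h ^ i))" by (simp add: dvd_eq_mod_eq_0)
    then show thesis using that[of "\<lambda>i. w (P i)"] w(1) by auto
  qed
  define U where "U = (\<Sum>i\<le>n. Polynomial.monom (u i) i)"
  have coeff_U: "poly.coeff U i = (if i \<le> n then u i else 0)" for i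
    by (simp add: U_def coeff_sum)
  then have "U \<noteq> 0" using u(1) by (metis coeff_0)
  have deg_U: "degree U \<le> n" by (rule degree_le) (simp add: coeff_U)
  \<comment> \<open>Removing the content makes the coefficients polynomials in x and does not affect
    divisibility by \<open>F\<close>.\<close>
  define G where "G = primitive_part_fract U"
  define c where "c = fract_content U"
  have UG: "U = Polynomial.smult c (emb G)" by (simp add: G_def c_def content_times_primitive_part_fract)
  with \<open>U \<noteq> 0\<close> have c: "c \<noteq> 0" and G: "G \<noteq> 0" by auto
  have dG: "degree G = degree U" unfolding UG using c by (simp add: degree_map_poly)
  have "Polynomial.smult (u i) (h ^ i) = Polynomial.smult c (ev (poly.coeff G i) X * h ^ i)" if "i \<le> n" for i
  proof -
    have "u i = poly.coeff U i" using that by (simp add: coeff_U)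
    then have "u i = c * to_fract (poly.coeff G i)" by (simp add: UG coeff_map_poly)
    then show ?thesis by (simp add: emb_const[symmetric] emb_pCons)
  qed
  then have "(\<Sum>i\<le>n. Polynomial.smult (u i) (h ^ i)) = Polynomial.smult c (\<Sum>i\<le>n. ev (poly.coeff G i) X * h ^ i)"
    by (simp add: smult_sum2)
  then have "F dvd (\<Sum>i\<le>n. ev (poly.coeff G i) X * h ^ i)" using u(2) c by (simp add: dvd_smult_iff)
  also have "(\<Sum>i\<le>n. ev (poly.coeff G i) X * h ^ i) = (\<Sum>i\<le>degree G. ev (poly.coeff G i) X * h ^ i)"
    by (rule sum.mono_neutral_right) (use deg_U dG in \<open>auto simp: coeff_eq_0\<close>)
  finally show thesis using that G by blast
qed

text \<open>While the constant term vanishes, a factor \<open>h\<close> can be cancelled, because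
  \<open>F\<close> is prime. Once it is nonzero, a zero of \<open>h\<close> that is not a pole of x
  forces a zero of this polynomial in x.\<close>

lemma algebraic_relation_nonzero_constant_term:
  assumes "\<not> F dvd h"
  obtains G :: "complex poly poly" where "poly.coeff G 0 \<noteq> 0" "F dvd (\<Sum>i\<le>degree G. ev (poly.coeff G i) X * h ^ i)"
proof -
  have "\<exists>G'. poly.coeff G' 0 \<noteq> 0 \<and> F dvd (\<Sum>i\<le>degree G'. ev (poly.coeff G' i) X * h ^ i)"
    if "G \<noteq> 0" "F dvd (\<Sum>i\<le>degree G. ev (poly.coeff G i) X * h ^ i)" for G :: "complex poly poly"
    using that
  proof (induction G)
    case (pCons c G)
    show ?case
    proof (cases "c = 0")
      case True
      then have "G \<noteq> 0" using pCons.prems by auto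
      have "(\<Sum>i\<le>degree (pCons c G). ev (poly.coeff (pCons c G) i) X * h ^ i) = h * (\<Sum>i\<le>degree G. ev (poly.coeff G i) X * h ^ i)"
        using True \<open>G \<noteq> 0\<close> by (simp add: sum.atMost_Suc_shift sum_distrib_left mult_ac del: sum.atMost_Suc)
      with pCons.prems(2) assms have "F dvd (\<Sum>i\<le>degree G. ev (poly.coeff G i) X * h ^ i)"
        by (simp add: F_dvd_mult_iff)
      then show ?thesis using pCons.IH \<open>G \<noteq> 0\<close> by blast
    next
      case False
      then show ?thesis using pCons.prems by (intro exI[of _ "pCons c G"]) auto
    qed
  qed simp
  moreover obtain G where "G \<noteq> 0" "F dvd (\<Sum>i\<le>degree G. ev (poly.coeff G i) X * h ^ i)"
    using algebraic_relation[of h] .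
  ultimately show thesis using that by blast
qed

subsection \<open>Points as valuations\<close>

text \<open>A point assigns 0 to the zero function, so infinite order has to be expressed by
  divisibility by \<open>F\<close>.\<close>

definition ord_ge :: "point \<Rightarrow> rat_fun \<Rightarrow> int \<Rightarrow> bool" where
  "ord_ge p h d \<longleftrightarrow> F dvd h \<or> d \<le> p (h mod F)"

lemma ord_ge_mod [simp]: "ord_ge p (h mod F) d \<longleftrightarrow> ord_ge p h d"
  by (simp add: ord_ge_def F_dvd_mod_iff)

lemma ord_ge_cong: "F dvd g - h \<Longrightarrow> ord_ge p g d \<longleftrightarrow> ord_ge p h d"
  using ord_ge_mod by (metis F_dvd_diff_iff)

lemma ord_ge_F: "F dvd h \<Longrightarrow> ord_ge p h d"
  by (simp add: ord_ge_def)

end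

locale curve_point = plane_curve +
  fixes p :: point
  assumes point: "p \<in> points f"
begin

lemma point_mult: "\<not> F dvd g \<Longrightarrow> \<not> F dvd h \<Longrightarrow> p ((g * h) mod F) = p (g mod F) + p (h mod F)"
proof -
  assume *: "\<not> F dvd g" "\<not> F dvd h"
  then have "g mod F \<in> carrier K - {0}" "h mod F \<in> carrier K - {0}" by (auto simp: dvd_eq_mod_eq_0)
  then have "p (monoid.mult K (g mod F) (h mod F)) = p (g mod F) + p (h mod F)"
    using point by (simp add: points_def)
  then show ?thesis by (simp add: mod_mult_eq)
qed

lemma point_add: "\<not> F dvd g \<Longrightarrow> \<not> F dvd h \<Longrightarrow> \<not> F dvd g + h \<Longrightarrow>
    min (p (g mod F)) (p (h mod F)) \<le> p ((g + h) mod F)"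
proof -
  assume *: "\<not> F dvd g" "\<not> F dvd h" "\<not> F dvd g + h"
  then have "g mod F \<in> carrier K - {0}" "h mod F \<in> carrier K - {0}" "g mod F + h mod F \<noteq> 0"
    by (auto simp: dvd_eq_mod_eq_0 poly_mod_add_left)
  then have "min (p (g mod F)) (p (h mod F)) \<le> p (g mod F + h mod F)"
    using point by (simp add: points_def)
  then show ?thesis by (simp add: poly_mod_add_left)
qed

lemma point_const: "a \<noteq> 0 \<Longrightarrow> p (const a) = 0"
  using point by (simp add: points_def const_fun_eq)

lemma point_one: "p 1 = 0"
  using point_const[of 1] by simp

sublocale valuation "ord_ge p"
proof
  show "ord_ge p g d \<Longrightarrow> ord_ge p (- g) d" for g d
  proof (cases "F dvd g")
    case False
    have "p ((const (- 1) * g) mod F) = p (g mod F)"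
      using point_mult[OF not_F_dvd_const[of "- 1"] False] point_const[of "- 1"] by simp
    moreover assume "ord_ge p g d"
    ultimately show ?thesis by (simp add: ord_ge_def const_uminus)
  qed (simp add: ord_ge_def)
  show "ord_ge p (g + h) d" if "ord_ge p g d" "ord_ge p h d" for g h d
  proof (cases "F dvd g \<or> F dvd h \<or> F dvd g + h")
    case True
    then consider "F dvd g" | "F dvd h" | "F dvd g + h" by blast
    then show ?thesis
    proof cases
      case 1
      then show ?thesis using that(2) ord_ge_cong[of "g + h" h] by simp
    next
      case 2
      then show ?thesis using that(1) ord_ge_cong[of "g + h" g] by simp
    qed (rule ord_ge_F)
  next
    case False
    then show ?thesis using that point_add[of g h] by (auto simp: ord_ge_def)
  qed
  show "ord_ge p g d \<Longrightarrow> ord_ge p h e \<Longrightarrow> ord_ge p (g * h) (d + e)" for g h d e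
    unfolding ord_ge_def using point_mult[of g h] F_dvd_mult_iff by fastforce
  show "ord_ge p g d \<Longrightarrow> \<not> ord_ge p g (d + 1) \<Longrightarrow> ord_ge p h e \<Longrightarrow> \<not> ord_ge p h (e + 1) \<Longrightarrow> \<not> ord_ge p (g * h) (d + e + 1)" for g h d e
    unfolding ord_ge_def using point_mult[of g h] F_dvd_mult_iff by fastforce
  show "\<exists>e<d. ord_ge p g e \<and> \<not> ord_ge p g (e + 1)" if "\<not> ord_ge p g d" for g d
    using that by (intro exI[of _ "p (g mod F)"]) (auto simp: ord_ge_def)
qed (auto simp: ord_ge_def point_one)

lemma eq_iff: "eq h d \<longleftrightarrow> \<not> F dvd h \<and> p (h mod F) = d"
  unfolding eq_def ord_ge_def by auto

lemma eq_imp_not_F_dvd: "eq h d \<Longrightarrow> \<not> F dvd h"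
  by (simp add: eq_iff)

lemma eq_point: "\<not> F dvd h \<Longrightarrow> eq h (p (h mod F))"
  by (simp add: eq_iff)

lemma eq_cong_F: "F dvd g - h \<Longrightarrow> eq g d \<longleftrightarrow> eq h d"
  by (simp add: eq_def ord_ge_cong)

lemma eq_const: "a \<noteq> 0 \<Longrightarrow> eq (const a) 0"
  by (simp add: eq_iff not_F_dvd_const point_const)

lemma eq_1: "eq 1 0"
  using eq_const[of 1] by simp

lemma ge_const: "ord_ge p (const a) 0"
  using eq_const eq_imp_ge by (cases "a = 0") auto

lemma ge_const_mult: "ord_ge p h d \<Longrightarrow> ord_ge p (const a * h) d"
  using ge_mult[OF ge_const] by fastforce

lemma ge_const_pos_iff: "d > 0 \<Longrightarrow> ord_ge p (const a) d \<longleftrightarrow> a = 0"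
  using eq_ge_iff[OF eq_const, of a d] by auto

lemma uniformizer: obtains u where "u \<in> carrier K" "eq u 1"
proof -
  obtain u where "u \<in> carrier K - {0}" "p u = 1" using point by (auto simp: points_def)
  then show thesis using that[of u] by (auto simp: eq_iff K_carrier dvd_eq_mod_eq_0)
qed

lemma ge_ev: "ord_ge p h 0 \<Longrightarrow> ord_ge p (ev q h) 0"
  by (induction q) (auto simp: ev_pCons intro!: ge_add ge_const ge_mult[of _ 0 _ 0, simplified])

lemma ge_ev_diff: "ord_ge p (h - const a) 1 \<Longrightarrow> ord_ge p (ev q h - const (poly q a)) 1"
proof (induction q)
  case (pCons c q)
  have "ord_ge p (h - const a + const a) 0"
    by (rule ge_add) (use ge_mono[OF pCons.prems] ge_const in auto)
  then have h: "ord_ge p h 0" by simp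
  have "ord_ge p (h * ev q h - const a * const (poly q a)) 1"
    using asymp_mult[of h "const a" 0 "ev q h" "const (poly q a)" 0] pCons h ge_const by simp
  then show ?case by (simp add: ev_pCons const_add const_mult)
qed simp

text \<open>The polynomial \<open>q\<close> splits into linear factors, none of which vanishes at the point.\<close>

lemma eq_ev:
  assumes "\<And>a. eq (h - const a) 0" "q \<noteq> 0"
  shows "eq (ev q h) 0"
proof -
  obtain as where as: "Polynomial.smult (lead_coeff q) (\<Prod>a\<leftarrow>as. [:- a, 1:]) = q"
    using fundamental_theorem_algebra_factorized by blast
  have "eq (ev (\<Prod>a\<leftarrow>as. [:- a, 1:]) h) 0"
  proof (induction as)
    case Nil
    show ?case by (simp add: eq_1)
  next
    case (Cons a as)
    then show ?case using eq_mult[OF assms(1)[of a] Cons.IH]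
      by (simp add: ev_mult ev_pCons const_uminus del: mult_pCons_left)
  qed
  then have "eq (const (lead_coeff q) * ev (\<Prod>a\<leftarrow>as. [:- a, 1:]) h) (0 + 0)"
    by (intro eq_mult eq_const) (use assms(2) in simp_all)
  then show ?thesis by (metis as ev_smult add_0)
qed

lemma ge_0_cases: "ord_ge p h 0 \<Longrightarrow> eq h 0 \<or> ord_ge p h 1"
  by (auto simp: eq_def)

text \<open>If x had no value, every nonzero polynomial in x would have order 0 by
  \<open>eq_ev\<close>. In an algebraic relation for a uniformizer with nonzero constant term, that
  term alone would then have order 0 and could not cancel.\<close>

lemma X_value:
  assumes "ord_ge p X 0"
  obtains a where "ord_ge p (X - const a) 1"
proof (rule ccontr)
  assume "\<not> thesis"
  then have no: "\<not> ord_ge p (X - const a) 1" for a using that by blast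
  have "eq (X - const a) 0" for a
    using ge_0_cases[OF ge_diff[OF assms ge_const]] no by blast
  then have ev: "q \<noteq> 0 \<Longrightarrow> eq (ev q X) 0" for q by (rule eq_ev)
  obtain u where u: "eq u 1" using uniformizer by blast
  obtain G where G: "poly.coeff G 0 \<noteq> 0" "F dvd (\<Sum>i\<le>degree G. ev (poly.coeff G i) X * u ^ i)"
    using algebraic_relation_nonzero_constant_term[OF eq_imp_not_F_dvd[OF u]] .
  have "ord_ge p (ev (poly.coeff G (Suc i)) X * u ^ Suc i) 1" for i
  proof -
    have "ord_ge p (ev (poly.coeff G (Suc i)) X * u ^ Suc i) (0 + int (Suc i) * 1)"
      by (intro ge_mult ge_ev ge_power assms eq_imp_ge u)
    then show ?thesis by (rule ge_mono) simp
  qed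
  then have "ord_ge p (\<Sum>i<degree G. ev (poly.coeff G (Suc i)) X * u ^ Suc i) (0 + 1)"
    by (intro ge_sum) simp
  from eq_add_ge[OF ev[OF G(1)] this]
  have "eq (\<Sum>i\<le>degree G. ev (poly.coeff G i) X * u ^ i) 0"
    by (simp add: sum.atMost_shift)
  then show False using G(2) eq_imp_not_F_dvd by blast
qed

text \<open>Specialising an algebraic relation for \<open>h\<close> over \<open>\<complex>(x)\<close> at the point gives one over \<open>\<complex>\<close>.\<close>

lemma residue:
  assumes "ord_ge p h 0"
  obtains c where "ord_ge p (h - const c) 1"
proof -
  obtain G where G: "G \<noteq> 0" "F dvd (\<Sum>i\<le>degree G. ev (poly.coeff G i) X * h ^ i)"
    using algebraic_relation[of h] .
  obtain q :: "complex poly" where q: "q \<noteq> 0" "ord_ge p (ev q h) 1"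
  proof (cases "ord_ge p X 0")
    case True
    then obtain a where a: "ord_ge p (X - const a) 1" by (rule X_value)
    have "\<exists>q. q \<noteq> 0 \<and> ord_ge p (ev q h) 1"
      using G
    proof (induction "\<Sum>i\<le>degree G. degree (poly.coeff G i)" arbitrary: G rule: less_induct)
      case less
      let ?q = "map_poly (\<lambda>c. poly c a) G"
      show ?case
      proof (cases "?q = 0")
        case False
        have "ord_ge p ((\<Sum>i\<le>degree G. ev (poly.coeff G i) X * h ^ i) - (\<Sum>i\<le>degree G. const (poly (poly.coeff G i) a) * h ^ i)) 1"
          unfolding sum_subtractf[symmetric] left_diff_distrib[symmetric]
        proof (rule ge_sum)
          fix i
          show "ord_ge p ((ev (poly.coeff G i) X - const (poly (poly.coeff G i) a)) * h ^ i) 1"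
            using ge_mult[OF ge_ev_diff[OF a] ge_power[OF assms]] by simp
        qed
        from ge_diff[OF ord_ge_F[OF less.prems(2)] this]
        have "ord_ge p (\<Sum>i\<le>degree G. const (poly (poly.coeff G i) a) * h ^ i) 1" by simp
        also have "(\<Sum>i\<le>degree G. const (poly (poly.coeff G i) a) * h ^ i) = ev ?q h"
          by (simp add: ev_altdef'[OF degree_map_poly_le] coeff_map_poly)
        finally show ?thesis using False by blast
      next
        \<comment> \<open>All coefficients vanish at \<open>a\<close>. The factor
          \<open>x - a\<close> is divided out of the relation, which lowers the sum of their
          degrees.\<close>
        case True
        have "poly (poly.coeff G i) a = 0" for i
          using arg_cong[OF True, of "\<lambda>q. poly.coeff q i"] by (simp add: coeff_map_poly)
        then have "\<forall>i. \<exists>r. poly.coeff G i = [:- a, 1:] * r" by (metis dvdE poly_eq_0_iff_dvd)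
        then obtain r where r: "\<And>i. poly.coeff G i = [:- a, 1:] * r i" by metis
        define H where "H = (\<Sum>i\<le>degree G. Polynomial.monom (r i) i)"
        have r0: "r i = 0" if "degree G < i" for i
        proof -
          have "[:- a, 1:] * r i = 0" using r[of i] that by (simp add: coeff_eq_0)
          then show ?thesis by (simp del: mult_pCons_left)
        qed
        have cH: "poly.coeff H i = r i" for i by (auto simp: H_def coeff_sum r0)
        have GH: "G = Polynomial.smult [:- a, 1:] H" by (rule poly_eqI) (simp add: r cH)
        have dGH: "degree H = degree G" unfolding GH by simp
        have "H \<noteq> 0" using GH less.prems(1) by auto
        have "(\<Sum>i\<le>degree G. ev (poly.coeff G i) X * h ^ i) = (X - const a) * (\<Sum>i\<le>degree H. ev (poly.coeff H i) X * h ^ i)"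
          by (simp only: r ev_linear dGH cH sum_distrib_left mult.assoc)
        then have "F dvd (X - const a) * (\<Sum>i\<le>degree H. ev (poly.coeff H i) X * h ^ i)"
          using less.prems(2) by simp
        moreover have "\<not> F dvd X - const a"
          using not_F_dvd_ev_X[of "[:- a, 1:]"] by (simp add: ev_pCons const_uminus)
        ultimately have "F dvd (\<Sum>i\<le>degree H. ev (poly.coeff H i) X * h ^ i)"
          by (simp add: F_dvd_mult_iff)
        moreover have "(\<Sum>i\<le>degree H. degree (poly.coeff H i)) < (\<Sum>i\<le>degree G. degree (poly.coeff G i))"
          unfolding dGH
        proof (rule sum_strict_mono_ex1)
          have le: "degree (r i) \<le> degree ([:- a, 1:] * r i)" for i
            by (cases "r i = 0") (auto simp: degree_mult_eq simp del: mult_pCons_left)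
          show "\<forall>i\<in>{..degree G}. degree (poly.coeff H i) \<le> degree (poly.coeff G i)"
            using le unfolding r cH by blast
          have "r (degree G) = lead_coeff H" by (simp add: cH dGH)
          then have "r (degree G) \<noteq> 0" using \<open>H \<noteq> 0\<close> by simp
          then have "degree (r (degree G)) < degree ([:- a, 1:] * r (degree G))"
            by (subst degree_mult_eq) auto
          then have "degree (poly.coeff H (degree G)) < degree (poly.coeff G (degree G))"
            unfolding r cH .
          then show "\<exists>i\<in>{..degree G}. degree (poly.coeff H i) < degree (poly.coeff G i)" by blast
        qed simp
        ultimately show ?thesis using less.hyps \<open>H \<noteq> 0\<close> by blast
      qed
    qed
    then show thesis using that by blast
  next
    case False
    then obtain e where e: "e < 0" "eq X e" using ge_or_eq by blast
    \<comment> \<open>At a pole of x there is no value to specialise at. Instead only the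
      coefficients of \<open>x ^ D\<close> are kept, where \<open>D\<close> is the largest degree
      that occurs: all lower powers of x have strictly larger order.\<close>
    define D where "D = Max ((\<lambda>i. degree (poly.coeff G i)) ` {..degree G})"
    have D: "degree (poly.coeff G i) \<le> D" for i
    proof (cases "i \<le> degree G")
      case True
      then show ?thesis unfolding D_def by (intro Max_ge) auto
    qed (simp add: coeff_eq_0)
    have "D \<in> (\<lambda>i. degree (poly.coeff G i)) ` {..degree G}" unfolding D_def by (intro Max_in) auto
    then obtain i0 where i0: "D = degree (poly.coeff G i0)" "i0 \<le> degree G" by auto
    define q where "q = map_poly (\<lambda>c. poly.coeff c D) G"
    have cq: "poly.coeff q i = poly.coeff (poly.coeff G i) D" for i by (simp add: q_def coeff_map_poly)
    have "q \<noteq> 0"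
    proof (cases "D = 0")
      case False
      then have "poly.coeff G i0 \<noteq> 0" using i0(1) by auto
      then have "poly.coeff q i0 \<noteq> 0" unfolding cq i0(1) by simp
      then show ?thesis by auto
    next
      \<comment> \<open>For \<open>D = 0\<close> the maximum may be attained by a zero coefficient,
        so the leading coefficient, a nonzero constant, serves as witness.\<close>
      case True
      then have "degree (lead_coeff G) = 0" using D[of "degree G"] by simp
      then have "poly.coeff q (degree G) = lead_coeff (lead_coeff G)" unfolding cq True by simp
      then have "poly.coeff q (degree G) \<noteq> 0" using G(1) by simp
      then show ?thesis by auto
    qed
    have lead: "ord_ge p (ev c X - const (poly.coeff c D) * X ^ D) (int D * e + 1)" if "degree c \<le> D" for c
    proof -
      have "ev c X = (\<Sum>i\<le>D. const (poly.coeff c i) * X ^ i)"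
        by (rule ev_altdef'[OF that])
      also have "\<dots> = (\<Sum>i<D. const (poly.coeff c i) * X ^ i) + const (poly.coeff c D) * X ^ D"
        by (simp flip: lessThan_Suc_atMost)
      finally have "ev c X - const (poly.coeff c D) * X ^ D = (\<Sum>i<D. const (poly.coeff c i) * X ^ i)" by simp
      moreover have "ord_ge p (\<Sum>i<D. const (poly.coeff c i) * X ^ i) (int D * e + 1)"
      proof (rule ge_sum)
        fix i assume "i \<in> {..<D}"
        then have "i < D" by simp
        have "(int D - int i) * e \<le> (int D - int i) * (- 1)" using \<open>i < D\<close> e by (intro mult_left_mono) auto
        then have "int D * e + 1 \<le> int i * e" using \<open>i < D\<close> by (simp add: algebra_simps)
        with ge_const_mult[OF ge_power[OF eq_imp_ge[OF e(2)], of i]]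
        show "ord_ge p (const (poly.coeff c i) * X ^ i) (int D * e + 1)" by (rule ge_mono)
      qed
      ultimately show ?thesis by simp
    qed
    have "ord_ge p ((\<Sum>i\<le>degree G. ev (poly.coeff G i) X * h ^ i) - (\<Sum>i\<le>degree G. (const (poly.coeff q i) * X ^ D) * h ^ i)) (int D * e + 1)"
      unfolding sum_subtractf[symmetric] left_diff_distrib[symmetric]
    proof (rule ge_sum)
      fix i
      show "ord_ge p ((ev (poly.coeff G i) X - const (poly.coeff q i) * X ^ D) * h ^ i) (int D * e + 1)"
        using ge_mult[OF lead[OF D[of i]] ge_power[OF assms]] by (simp add: cq)
    qed
    from ge_diff[OF ord_ge_F[OF G(2)] this]
    have "ord_ge p (\<Sum>i\<le>degree G. (const (poly.coeff q i) * X ^ D) * h ^ i) (int D * e + 1)" by simp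
    also have "(\<Sum>i\<le>degree G. (const (poly.coeff q i) * X ^ D) * h ^ i) = X ^ D * ev q h"
    proof -
      have "ev q h = (\<Sum>i\<le>degree G. const (poly.coeff q i) * h ^ i)"
        unfolding q_def by (rule ev_altdef'[OF degree_map_poly_le])
      then show ?thesis by (simp add: sum_distrib_left mult_ac)
    qed
    finally have "ord_ge p (ev q h) 1" using ge_mult_cancel[OF eq_power[OF e(2)]] by blast
    then show thesis using that \<open>q \<noteq> 0\<close> by blast
  qed
  \<comment> \<open>If no \<open>h - c\<close> vanished at the point, all linear factors of
    \<open>q\<close> at \<open>h\<close> would have order 0, against \<open>q (h)\<close> having
    positive order.\<close>
  show thesis
  proof (rule ccontr)
    assume "\<not> thesis"
    then have "\<not> ord_ge p (h - const c) 1" for c using that by blast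
    then have "eq (h - const c) 0" for c using ge_0_cases[OF ge_diff[OF assms ge_const]] by blast
    from eq_ev[OF this q(1)] q(2) show False by (simp add: eq_ge_iff)
  qed
qed

text \<open>The constant is the residue of \<open>h / g\<close>. This is what limits the growth of
  L(D) to one dimension per added point.\<close>

lemma residue_quotient:
  assumes "ord_ge p h d" "eq g d"
  obtains c where "ord_ge p (h - const c * g) (d + 1)"
proof -
  obtain g' where g': "F dvd g' * g - 1" "\<not> F dvd g'"
    using exists_inverse[OF eq_imp_not_F_dvd[OF assms(2)]] .
  obtain e where e: "eq g' e" using eq_point[OF g'(2)] by blast
  have "eq (g' * g) (e + d)" using eq_mult[OF e assms(2)] .
  then have "eq 1 (e + d)" using eq_cong_F[OF g'(1)] by simp
  then have "e = - d" using eq_unique[OF eq_1] by fastforce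
  have "ord_ge p (g' * h) 0" using ge_mult[OF eq_imp_ge[OF e] assms(1)] \<open>e = - d\<close> by simp
  then obtain c where c: "ord_ge p (g' * h - const c) 1" by (rule residue)
  from ge_mult[OF this eq_imp_ge[OF assms(2)]]
  have "ord_ge p ((g' * h - const c) * g) (d + 1)" by (simp add: add.commute)
  moreover have "F dvd (g' * h - const c) * g - (h - const c * g)"
  proof -
    have "(g' * h - const c) * g - (h - const c * g) = (g' * g - 1) * h" by (simp add: algebra_simps)
    then show ?thesis using g'(1) by simp
  qed
  ultimately have "ord_ge p (h - const c * g) (d + 1)" using ord_ge_cong by blast
  then show thesis using that by blast
qed

end

context curve_point begin

lemma ge_emb: "ord_ge p X 0 \<Longrightarrow> ord_ge p Y 0 \<Longrightarrow> ord_ge p (emb h) 0"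
  by (induction h) (auto simp: ev_X_pCons intro!: ge_add ge_ev ge_mult[of _ 0 _ 0, simplified])

lemma ge_regular: "ord_ge p (h - const a) 1 \<Longrightarrow> ord_ge p h 0"
  using ge_add[OF ge_mono[of "h - const a" 1 0] ge_const[of a]] by simp

lemma ge_emb_diff:
  assumes "ord_ge p (X - const a) 1" "ord_ge p (Y - const b) 1"
  shows "ord_ge p (emb h - const (eval_xy h a b)) 1"
proof (induction h)
  case (pCons q h)
  have "ord_ge p (Y * emb h - const b * const (eval_xy h a b)) 1"
    using asymp_mult[of Y "const b" 0 "emb h" "const (eval_xy h a b)" 0] assms pCons.IH ge_regular ge_const by simp
  from ge_add[OF ge_ev_diff[OF assms(1), of q] this] show ?case
    by (simp add: ev_X_pCons eval_xy_def const_add const_mult add_diff_add)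
qed (simp add: eval_xy_def)

lemma eval_f_eq_0:
  assumes "ord_ge p (X - const a) 1" "ord_ge p (Y - const b) 1"
  shows "eval_xy f a b = 0"
proof -
  have "ord_ge p (emb f - (emb f - const (eval_xy f a b))) 1"
    by (rule ge_diff[OF ord_ge_F[OF F_dvd_emb_f] ge_emb_diff[OF assms]])
  then show ?thesis by (simp add: ge_const_pos_iff)
qed

lemma eq_emb:
  assumes "ord_ge p (X - const a) 1" "ord_ge p (Y - const b) 1" "eval_xy h a b \<noteq> 0"
  shows "eq (emb h) 0"
  using eq_cong[of "emb h" "const (eval_xy h a b)" 0] ge_emb_diff[OF assms(1,2), of h] eq_const[OF assms(3)] by simp

end

section \<open>Points of the normalization over a smooth point of the plane curve\<close>

lemma eval_xy_mult: "eval_xy (g * h) a b = eval_xy g a b * eval_xy h a b"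
  and eval_xy_add: "eval_xy (g + h) a b = eval_xy g a b + eval_xy h a b"
  by (simp_all add: eval_xy_def)

lemma map_poly_pderiv_add: "map_poly pderiv (g + h) = map_poly pderiv g + map_poly pderiv (h :: 'a::idom poly poly)"
  by (rule poly_eqI) (simp add: coeff_map_poly pderiv_add)

lemma map_poly_pderiv_mult:
  "map_poly pderiv (g * h) = map_poly pderiv g * h + g * map_poly pderiv (h :: 'a::idom poly poly)"
proof (rule poly_eqI)
  fix i
  show "poly.coeff (map_poly pderiv (g * h)) i = poly.coeff (map_poly pderiv g * h + g * map_poly pderiv h) i"
    by (simp add: coeff_map_poly coeff_mult pderiv_mult pderiv_sum sum.distrib add.commute mult.commute[of _ "pderiv _"])
qed

text \<open>At a common zero of \<open>f\<close>, \<open>s\<close> and \<open>t\<close> with \<open>f = u s + w t\<close> and \<open>u \<noteq> 0\<close>, the function \<open>t\<close> generates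
  the maximal ideal: the order of a function is a multiple of the order of \<open>t\<close>, with a factor that
  does not depend on the point of the normalization.\<close>

lemma (in plane_curve) order_multiple:
  assumes p: "curve_point f p" and p': "curve_point f p'"
    and over: "ord_ge p (X - const a) 1" "ord_ge p (Y - const b) 1"
      "ord_ge p' (X - const a) 1" "ord_ge p' (Y - const b) 1"
    and decomp: "\<And>h. eval_xy h a b = 0 \<Longrightarrow> \<exists>h1 h2. h = s * h1 + t * h2"
    and f: "f = u * s + w * t" "eval_xy u a b \<noteq> 0" "eval_xy t a b = 0"
    and t: "valuation.eq (ord_ge p) (emb t) e" "valuation.eq (ord_ge p') (emb t) e'"
    and h: "valuation.eq (ord_ge p) (emb h) d"
  shows "\<exists>k::int. d = k * e \<and> valuation.eq (ord_ge p') (emb h) (k * e')"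
proof -
  interpret p: curve_point f p by (rule p)
  interpret p': curve_point f p' by (rule p')
  have "ord_ge p (emb t) 1" using p.ge_emb_diff[OF over(1,2), of t] f(3) by simp
  then have e: "e \<ge> 1" using p.eq_ge_iff[OF t(1)] by simp
  have d0: "d \<ge> 0" if "p.eq (emb h) d" for h d
    using p.ge_emb[OF p.ge_regular[OF over(1)] p.ge_regular[OF over(2)], of h] p.eq_ge_iff[OF that] by simp
  show ?thesis using h
  proof (induction "nat d" arbitrary: d h rule: less_induct)
    case less
    show ?case
    proof (cases "eval_xy h a b = 0")
      case False
      have "d = 0" using p.eq_unique[OF less.prems p.eq_emb[OF over(1,2) False]] .
      then show ?thesis using p'.eq_emb[OF over(3,4) False] by (intro exI[of _ 0]) simp
    next
      case True
      then obtain h1 h2 where h12: "h = s * h1 + t * h2" using decomp by blast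
      \<comment> \<open>Substituting \<open>u s = f - w t\<close> into \<open>u h\<close> gives
        \<open>u h = t h'\<close> modulo \<open>f\<close>. As \<open>u\<close> has order 0, the
        order of \<open>h'\<close> is smaller by \<open>e\<close>, at least 1.\<close>
      define h' where "h' = u * h2 - w * h1"
      have "u * h - t * h' = f * h1" by (simp add: h'_def h12 f(1) algebra_simps)
      then have "emb u * emb h - emb t * emb h' = emb f * emb h1"
        by (simp only: fract_poly_mult[symmetric] fract_poly_diff[symmetric])
      then have "F dvd emb u * emb h - emb t * emb h'" using F_dvd_emb_f by simp
      note cong = p.eq_cong_F[OF this] p'.eq_cong_F[OF this]
      have u: "p.eq (emb u) 0" "p'.eq (emb u) 0" using p.eq_emb[OF over(1,2) f(2)] p'.eq_emb[OF over(3,4) f(2)] .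
      have "p.eq (emb u * emb h) (0 + d)" by (rule p.eq_mult[OF u(1) less.prems])
      then have "p.eq (emb t * emb h') (e + (d - e))" using cong(1)[of d] by simp
      then have h': "p.eq (emb h') (d - e)" using p.eq_mult_cancel[OF t(1)] by blast
      have "nat (d - e) < nat d" using d0[OF h'] e by simp
      then obtain k where k: "d - e = k * e" "p'.eq (emb h') (k * e')" using less.hyps[OF _ h'] by blast
      have "p'.eq (emb t * emb h') (e' + k * e')" by (rule p'.eq_mult[OF t(2) k(2)])
      then have "p'.eq (emb u * emb h) (0 + (k + 1) * e')" using cong(2) by (simp add: algebra_simps)
      then have "p'.eq (emb h) ((k + 1) * e')" using p'.eq_mult_cancel[OF u(2)] by blast
      then show ?thesis using k(1) by (intro exI[of _ "k + 1"]) (simp add: algebra_simps)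
    qed
  qed
qed

text \<open>By \<open>order_multiple\<close> all orders at \<open>p\<close> are multiples of
  \<open>e\<close>, and those at \<open>p'\<close> are the same multiples of \<open>e'\<close>. Each
  point has a uniformizer, so \<open>e = e' = 1\<close> and the valuations agree.\<close>

lemma (in plane_curve) point_unique_aux:
  assumes p: "curve_point f p" and p': "curve_point f p'"
    and over: "ord_ge p (X - const a) 1" "ord_ge p (Y - const b) 1"
      "ord_ge p' (X - const a) 1" "ord_ge p' (Y - const b) 1"
    and decomp: "\<And>h. eval_xy h a b = 0 \<Longrightarrow> \<exists>h1 h2. h = s * h1 + t * h2"
    and f: "f = u * s + w * t" "eval_xy u a b \<noteq> 0" "eval_xy t a b = 0" "\<not> F dvd emb t"
  shows "p = p'"
proof -
  interpret p: curve_point f p by (rule p)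
  interpret p': curve_point f p' by (rule p')
  obtain e where e: "p.eq (emb t) e" using p.eq_point[OF f(4)] by blast
  obtain e' where e': "p'.eq (emb t) e'" using p'.eq_point[OF f(4)] by blast
  have pos: "e \<ge> 1" "e' \<ge> 1"
    using p.ge_emb_diff[OF over(1,2), of t] p'.ge_emb_diff[OF over(3,4), of t] f(3)
      p.eq_ge_iff[OF e] p'.eq_ge_iff[OF e'] by simp_all
  note om = order_multiple[OF p p' over decomp f(1-3) e e']
  have mult: "\<exists>k::int. d = k * e \<and> p'.eq h (k * e')" if hd: "p.eq h d" for h d
  proof -
    obtain q g where q: "q \<noteq> 0" "emb [:q:] * h = emb g" using common_denominator[of h] unfolding emb_const[symmetric] .
    obtain c where c: "p.eq (emb [:q:]) c" using p.eq_point[OF not_F_dvd_emb_const[OF q(1)]] by blast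
    obtain k where k: "c = k * e" "p'.eq (emb [:q:]) (k * e')" using om[OF _ c] by blast
    have "p.eq (emb g) (c + d)" using p.eq_mult[OF c hd] unfolding q(2) .
    then obtain l where l: "c + d = l * e" "p'.eq (emb g) (l * e')" using om by blast
    have "p'.eq (emb [:q:] * h) (k * e' + (l - k) * e')" unfolding q(2) using l(2) by (simp add: algebra_simps)
    then have "p'.eq h ((l - k) * e')" using p'.eq_mult_cancel[OF k(2)] by blast
    then show ?thesis using k(1) l(1) by (intro exI[of _ "l - k"]) (simp add: algebra_simps)
  qed
  have one: "e = 1" if "1 = k * e" "e \<ge> 1" for e k :: int
    using that zdvd_imp_le[of e 1] dvd_triv_right[of e k] by simp
  obtain h where "p.eq h 1" using p.uniformizer by blast
  then obtain k where "1 = k * e" using mult by blast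
  then have "e = 1" using one pos by blast
  obtain h where h: "p'.eq h 1" using p'.uniformizer by blast
  obtain d where "p.eq h d" using p.eq_point[OF p'.eq_imp_not_F_dvd[OF h]] by blast
  then obtain k where "p'.eq h (k * e')" using mult by blast
  then have "1 = k * e'" using p'.eq_unique[OF h] by blast
  then have "e' = 1" using one pos by blast
  show "p = p'"
  proof
    fix h
    show "p h = p' h"
    proof (cases "h \<in> carrier K - {0}")
      case True
      then have h: "\<not> F dvd h" "h mod F = h" using K_nonzero[of h] by (simp_all add: K_carrier)
      obtain k where "p (h mod F) = k * e" "p'.eq h (k * e')" using mult[OF p.eq_point[OF h(1)]] by blast
      then show ?thesis using h \<open>e = 1\<close> \<open>e' = 1\<close> by (simp add: p'.eq_iff)
    next
      case False
      then show ?thesis using p.point p'.point by (simp add: points_def)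
    qed
  qed
qed

text \<open>With \<open>s = y - b\<close> and \<open>t = x - a\<close>, the coefficients
  \<open>u\<close> and \<open>w\<close> in \<open>f = u s + w t\<close> take the values of the two
  partial derivatives at the point. Whichever is nonzero decides which of \<open>s\<close> and
  \<open>t\<close> generates the maximal ideal.\<close>

lemma (in plane_curve) point_unique:
  assumes p: "curve_point f p" and p': "curve_point f p'"
    and over: "ord_ge p (X - const a) 1" "ord_ge p (Y - const b) 1"
      "ord_ge p' (X - const a) 1" "ord_ge p' (Y - const b) 1"
    and smooth: "eval_xy (map_poly pderiv f) a b \<noteq> 0 \<or> eval_xy (pderiv f) a b \<noteq> 0"
    and deg: "degree f > 1"
  shows "p = p'"
proof -
  define s :: "complex poly poly" where "s = [:[:- b:], 1:]"
  define t :: "complex poly poly" where "t = [:[:- a, 1:]:]"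
  have st: "eval_xy s a b = 0" "eval_xy t a b = 0" by (simp_all add: s_def t_def eval_xy_def)
  have decomp: "\<exists>h1 h2. h = s * h1 + t * h2" if "eval_xy h a b = 0" for h
  proof -
    have "poly (poly h [:b:]) a = 0" using that by (simp add: eval_xy_def)
    then obtain r where r: "poly h [:b:] = [:- a, 1:] * r" by (metis dvdE poly_eq_0_iff_dvd)
    have "h = [:- [:b:], 1:] * synthetic_div h [:b:] + [:poly h [:b:]:]"
      by (rule synthetic_div_correct'[symmetric])
    also have "[:poly h [:b:]:] = t * [:r:]" by (simp add: t_def r)
    also have "[:- [:b:], 1:] = s" by (simp add: s_def)
    finally show ?thesis by blast
  qed
  have "\<exists>h1 h2. f = s * h1 + t * h2" using decomp curve_point.eval_f_eq_0[OF p over(1,2)] by blast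
  then obtain u w where "f = s * u + t * w" by blast
  then have f: "f = u * s + w * t" by (simp add: mult.commute)
  have dy: "pderiv s = 1" "pderiv t = 0" and dx: "map_poly pderiv s = 0" "map_poly pderiv t = 1"
    by (simp_all add: s_def t_def pderiv_pCons Polynomial.map_poly_pCons one_pCons)
  have "eval_xy (pderiv f) a b = eval_xy u a b"
    by (simp add: f pderiv_add pderiv_mult dy eval_xy_add eval_xy_mult st)
  moreover have "eval_xy (map_poly pderiv f) a b = eval_xy w a b"
    by (simp add: f map_poly_pderiv_add map_poly_pderiv_mult dx eval_xy_add eval_xy_mult st)
  ultimately consider "eval_xy u a b \<noteq> 0" | "eval_xy w a b \<noteq> 0" using smooth by auto
  then show ?thesis
  proof cases
    case 1
    have "\<not> F dvd emb t" unfolding t_def by (rule not_F_dvd_emb_const) simp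
    then show ?thesis using point_unique_aux[OF p p' over decomp f 1 st(2)] by blast
  next
    case 2
    have "\<not> F dvd emb s" by (rule degree_less_not_F_dvd) (use deg in \<open>simp_all add: s_def emb_pCons\<close>)
    moreover have "f = w * t + u * s" using f by (simp add: add.commute)
    moreover have "\<exists>h1 h2. h = t * h1 + s * h2" if "eval_xy h a b = 0" for h
      using decomp[OF that] by (metis add.commute)
    ultimately show ?thesis using point_unique_aux[OF p p' over, of t s w u] 2 st(1) by blast
  qed
qed

section \<open>Divisors\<close>

abbreviation mult_at :: "divisor \<Rightarrow> point \<Rightarrow> int" where
  "mult_at \<equiv> Poly_Mapping.lookup"

lemma mult_at_minus [simp]: "mult_at (D - E) p = mult_at D p - mult_at E p"
  and mult_at_uminus [simp]: "mult_at (- D) p = - mult_at D p"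
  and mult_at_add [simp]: "mult_at (D + E) p = mult_at D p + mult_at E p"
  by (simp_all add: lookup_minus lookup_add)

lemma div_degree_eq:
  assumes "finite S" "Poly_Mapping.keys D \<subseteq> S"
  shows "div_degree D = (\<Sum>p\<in>S. mult_at D p)"
  unfolding div_degree_def
  by (rule sum.mono_neutral_left) (use assms in \<open>auto simp: in_keys_iff\<close>)

lemma div_degree_add [simp]: "div_degree (D + E) = div_degree D + div_degree E"
proof -
  let ?S = "Poly_Mapping.keys D \<union> Poly_Mapping.keys E"
  have "div_degree (D + E) = (\<Sum>p\<in>?S. mult_at (D + E) p)"
    by (rule div_degree_eq) (simp_all add: Poly_Mapping.keys_add)
  also have "\<dots> = div_degree D + div_degree E"
    using div_degree_eq[of ?S D] div_degree_eq[of ?S E] by (simp add: sum.distrib)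
  finally show ?thesis .
qed

lemma div_degree_zero [simp]: "div_degree 0 = 0"
  by (simp add: div_degree_def)

lemma div_degree_uminus [simp]: "div_degree (- D) = - div_degree D"
  using div_degree_add[of D "- D"] by simp

lemma div_degree_diff [simp]: "div_degree (D - E) = div_degree D - div_degree E"
  using div_degree_add[of D "- E"] by simp

lemma div_degree_frag_of [simp]: "div_degree (frag_of p) = 1"
  by (simp add: div_degree_def)

lemma div_degree_cmul [simp]: "div_degree (frag_cmul c D) = c * div_degree D"
proof -
  have "div_degree (frag_cmul c D) = (\<Sum>p\<in>Poly_Mapping.keys D. c * mult_at D p)"
    by (subst div_degree_eq[of "Poly_Mapping.keys D"]) (auto simp: in_keys_iff)
  then show ?thesis by (simp add: div_degree_def sum_distrib_left)
qed

lemma div_degree_sum [simp]: "div_degree (\<Sum>i\<in>I. D i) = (\<Sum>i\<in>I. div_degree (D i))"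
  by (induction I rule: infinite_finite_induct) auto

lemma effective_degree_nonneg: "effective D \<Longrightarrow> div_degree D \<ge> 0"
  unfolding div_degree_def effective_def by (intro sum_nonneg) auto

lemma effective_degree_zero: "effective D \<Longrightarrow> div_degree D = 0 \<Longrightarrow> D = 0"
proof -
  assume *: "effective D" "div_degree D = 0"
  have "\<forall>p\<in>Poly_Mapping.keys D. mult_at D p = 0"
    using *(2) unfolding div_degree_def
    by (subst (asm) sum_nonneg_eq_0_iff) (use *(1) in \<open>auto simp: effective_def\<close>)
  then show "D = 0" by (intro poly_mapping_eqI) (metis in_keys_iff lookup_zero)
qed

lemma effective_degree_eq: "effective (D - E) \<Longrightarrow> div_degree D = div_degree E \<Longrightarrow> D = E"
  using effective_degree_zero[of "D - E"] by simp

lemma effective_induct [consumes 2, case_names zero add]: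
  assumes "effective D" "Poly_Mapping.keys D \<subseteq> S"
    and "Q 0" "\<And>D p. Q D \<Longrightarrow> Poly_Mapping.keys D \<subseteq> S \<Longrightarrow> p \<in> S \<Longrightarrow> Q (D + frag_of p)"
  shows "Q D"
  using assms(1,2)
proof (induction "nat (div_degree D)" arbitrary: D)
  case 0
  then have "D = 0" using effective_degree_zero[of D] effective_degree_nonneg[of D] by simp
  then show ?case using assms(3) by simp
next
  case (Suc n)
  then have "D \<noteq> 0" by auto
  then obtain p where p: "p \<in> Poly_Mapping.keys D" by fastforce
  then have "mult_at D p \<ge> 1" using Suc.prems(1) by (simp add: effective_def in_keys_iff order.not_eq_order_implies_strict int_one_le_iff_zero_less)
  then have eff: "effective (D - frag_of p)" using Suc.prems(1) by (auto simp: effective_def)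
  have keys: "Poly_Mapping.keys (D - frag_of p) \<subseteq> S"
    using p Suc.prems(2) by (auto simp: in_keys_iff split: if_splits)
  have "n = nat (div_degree (D - frag_of p))" using Suc.hyps(2) by simp
  from assms(4)[OF Suc.hyps(1)[OF this eff keys] keys, of p] show ?case
    using p Suc.prems(2) by auto
qed

section \<open>Riemann's theorem\<close>

declare carrier_free_Abelian_group_iff [simp del]

text \<open>\<open>finite_support\<close> makes \<open>div_of\<close> a genuine divisor. That x has
  no pole except \<open>P\<close> allows zeros at all other points to be prescribed by a polynomial
  in x.\<close>

locale riemann_curve = plane_curve +
  fixes P :: point and \<gamma> :: int
  assumes finite_support: "\<not> F dvd h \<Longrightarrow> finite {p \<in> points f. p (h mod F) \<noteq> 0}"
    and P_point: "P \<in> points f"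
    and affine: "p \<in> points f \<Longrightarrow> p \<noteq> P \<Longrightarrow> ord_ge p X 0"
    and genus: "has_genus f \<gamma>"
begin

abbreviation Div :: "divisor set" where "Div \<equiv> carrier (divisors f)"

lemma curve_point [intro]: "p \<in> points f \<Longrightarrow> curve_point f p"
  by unfold_locales

lemma Div_iff: "D \<in> Div \<longleftrightarrow> (\<forall>p. p \<notin> points f \<longrightarrow> mult_at D p = 0)"
  by (auto simp: in_keys_iff carrier_free_Abelian_group_iff)

lemma Div_keys: "D \<in> Div \<longleftrightarrow> Poly_Mapping.keys D \<subseteq> points f"
  by (rule carrier_free_Abelian_group_iff)

lemma Div_closed [simp]: "0 \<in> Div" "D \<in> Div \<Longrightarrow> E \<in> Div \<Longrightarrow> D + E \<in> Div" "D \<in> Div \<Longrightarrow> - D \<in> Div"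
  "D \<in> Div \<Longrightarrow> E \<in> Div \<Longrightarrow> D - E \<in> Div" "D \<in> Div \<Longrightarrow> frag_cmul c D \<in> Div" "p \<in> points f \<Longrightarrow> frag_of p \<in> Div"
  unfolding Div_iff by auto

definition pdiv :: "rat_fun \<Rightarrow> divisor" where "pdiv h = div_of f (h mod F)"

lemma mult_at_pdiv: "\<not> F dvd h \<Longrightarrow> p \<in> points f \<Longrightarrow> mult_at (pdiv h) p = p (h mod F)"
  and mult_at_pdiv_outside: "\<not> F dvd h \<Longrightarrow> p \<notin> points f \<Longrightarrow> mult_at (pdiv h) p = 0"
proof -
  assume "\<not> F dvd h"
  from finite_support[OF this]
  have "finite {p. (if p \<in> points f then p (h mod F) else 0) \<noteq> 0}" by (rule rev_finite_subset) auto
  then show "p \<in> points f \<Longrightarrow> mult_at (pdiv h) p = p (h mod F)"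
    "p \<notin> points f \<Longrightarrow> mult_at (pdiv h) p = 0"
    by (simp_all add: pdiv_def div_of_def)
qed

lemma pdiv_in_Div: "\<not> F dvd h \<Longrightarrow> pdiv h \<in> Div"
  unfolding Div_iff using mult_at_pdiv_outside by blast

lemma pdiv_eq: "\<not> F dvd h \<Longrightarrow> p \<in> points f \<Longrightarrow> valuation.eq (ord_ge p) h (mult_at (pdiv h) p)"
  by (simp add: curve_point.eq_iff[OF curve_point] mult_at_pdiv)

lemma pdiv_eqI: "p \<in> points f \<Longrightarrow> valuation.eq (ord_ge p) h d \<Longrightarrow> mult_at (pdiv h) p = d"
  by (simp add: curve_point.eq_iff[OF curve_point] mult_at_pdiv)

lemma pdiv_mult: "\<not> F dvd g \<Longrightarrow> \<not> F dvd h \<Longrightarrow> pdiv (g * h) = pdiv g + pdiv h"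
proof (rule poly_mapping_eqI)
  fix p assume *: "\<not> F dvd g" "\<not> F dvd h"
  show "mult_at (pdiv (g * h)) p = mult_at (pdiv g + pdiv h) p"
  proof (cases "p \<in> points f")
    case True
    then interpret curve_point f p by auto
    show ?thesis using * True point_mult by (simp add: mult_at_pdiv F_dvd_mult_iff)
  qed (use * in \<open>simp add: mult_at_pdiv_outside F_dvd_mult_iff\<close>)
qed

lemma pdiv_cong: "F dvd g - h \<Longrightarrow> pdiv g = pdiv h"
  by (simp add: pdiv_def F_dvd_diff_iff)

lemma pdiv_const [simp]: "a \<noteq> 0 \<Longrightarrow> pdiv (const a) = 0"
proof (rule poly_mapping_eqI)
  fix p assume a: "a \<noteq> 0"
  show "mult_at (pdiv (const a)) p = mult_at 0 p"
    using a curve_point.point_const[OF curve_point] not_F_dvd_const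
    by (cases "p \<in> points f") (simp_all add: mult_at_pdiv mult_at_pdiv_outside)
qed

lemma pdiv_1 [simp]: "pdiv 1 = 0"
  using pdiv_const[of 1] by simp

text \<open>Since \<open>ord_ge\<close> holds for 0 at every order, the zero function requires no
  separate clause.\<close>

definition LL :: "divisor \<Rightarrow> rat_fun set" where
  "LL D = {h \<in> carrier K. \<forall>p\<in>points f. ord_ge p h (- mult_at D p)}"

lemma RR_space_eq: "D \<in> Div \<Longrightarrow> RR_space f D = LL D"
proof -
  assume D: "D \<in> Div"
  have "effective (div_of f h + D) \<longleftrightarrow> (\<forall>p\<in>points f. ord_ge p h (- mult_at D p))"
    if "h \<in> carrier K" "h \<noteq> 0" for h
  proof -
    have h: "\<not> F dvd h" "h mod F = h" using K_nonzero that by (simp_all add: K_carrier)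
    then have "div_of f h = pdiv h" by (simp add: pdiv_def)
    then have "effective (div_of f h + D) \<longleftrightarrow> (\<forall>p. 0 \<le> mult_at (pdiv h) p + mult_at D p)"
      by (simp add: effective_def)
    also have "\<dots> \<longleftrightarrow> (\<forall>p\<in>points f. 0 \<le> mult_at (pdiv h) p + mult_at D p)"
      using D mult_at_pdiv_outside[OF h(1)] unfolding Div_iff by (metis add_0 order_refl)
    also have "\<dots> \<longleftrightarrow> (\<forall>p\<in>points f. ord_ge p h (- mult_at D p))"
      using h by (intro ball_cong refl) (auto simp: mult_at_pdiv ord_ge_def)
    finally show ?thesis .
  qed
  then have "h \<in> carrier K \<and> (h = 0 \<or> effective (div_of f h + D)) \<longleftrightarrow> h \<in> carrier K \<and> (\<forall>p\<in>points f. ord_ge p h (- mult_at D p))" for h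
    by (cases "h = 0") (auto simp: ord_ge_F)
  then show ?thesis by (simp add: RR_space_def LL_def)
qed

lemma valuation_point: "p \<in> points f \<Longrightarrow> valuation (ord_ge p)"
proof -
  assume "p \<in> points f"
  then interpret curve_point f p by auto
  show ?thesis by (rule valuation_axioms)
qed

lemma LL_mono:
  assumes "\<And>p. p \<in> points f \<Longrightarrow> mult_at D p \<le> mult_at E p"
  shows "LL D \<subseteq> LL E"
  unfolding LL_def using assms valuation.ge_mono[OF valuation_point] by fastforce

lemma LL_zero: "0 \<in> LL D"
  unfolding LL_def by (simp add: K_carrier ord_ge_F)

lemma LL_add: "h \<in> LL D \<Longrightarrow> k \<in> LL D \<Longrightarrow> h + k \<in> LL D"
  unfolding LL_def using valuation.ge_add[OF valuation_point] by (auto intro: K_add_closed)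

lemma LL_const_mult: "h \<in> LL D \<Longrightarrow> const a * h \<in> LL D"
  unfolding LL_def using curve_point.ge_const_mult[OF curve_point] const_mult_mod
  by (auto simp: K_carrier)

lemma LL_diff: "h \<in> LL D \<Longrightarrow> k \<in> LL D \<Longrightarrow> h - k \<in> LL D"
  using LL_add[of h D "const (- 1) * k"] LL_const_mult[of k D "- 1"] by (simp add: const_uminus)

abbreviation dimension where "dimension \<equiv> ring.dimension K"
abbreviation line where "line \<equiv> ring.line_extension K (constants f)"

lemma ring_K: "ring K"
  using field_K by (simp add: field_def domain_def cring_def)

lemma line_iff: "v \<in> carrier K \<Longrightarrow> h \<in> line v E \<longleftrightarrow> (\<exists>a. \<exists>e\<in>E. h = const a * v + e)"
  unfolding ring.line_extension_mem_iff[OF ring_K]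
  by (auto simp: constants_eq const_mult_mod)

lemma dimension_line: "v \<in> carrier K \<Longrightarrow> v \<notin> E \<Longrightarrow> dimension d (constants f) E \<Longrightarrow> dimension (Suc d) (constants f) (line v E)"
  by (rule ring.Suc_dim[OF ring_K])

lemma dimension_unique: "dimension d (constants f) E \<Longrightarrow> dimension e (constants f) E \<Longrightarrow> d = e"
  by (rule ring.dimension_is_inj[OF ring_K subfield_constants])

lemma dimension_0_iff: "dimension 0 (constants f) E \<longleftrightarrow> E = {0}"
  using ring.dimension_zero[OF ring_K subfield_constants, of E] ring.zero_dim[OF ring_K, of "constants f"] by auto

lemma dimension_1D: "dimension 1 (constants f) E \<Longrightarrow> \<exists>v. E = {const a * v | a. True}"
proof -
  assume "dimension 1 (constants f) E"
  then obtain v where v: "v \<in> carrier K" "E = line v {0}"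
    using dimension_0_iff by (auto elim: ring.dimension.cases[OF ring_K])
  then show ?thesis using line_iff[OF v(1), of _ "{0}"] by auto
qed

text \<open>Two functions with the same pole order at \<open>p\<close> differ, up to a constant factor, by a function
  with a smaller pole order.\<close>

lemma LL_add_point:
  assumes "D \<in> Div" "p \<in> points f" "v \<in> LL (D + frag_of p)" "v \<notin> LL D"
  shows "LL (D + frag_of p) = line v (LL D)"
proof -
  interpret curve_point f p using assms(2) by auto
  have vK: "v \<in> carrier K" using assms(3) by (simp add: LL_def)
  have lower: "h \<in> LL D \<longleftrightarrow> h \<in> LL (D + frag_of p) \<and> ord_ge p h (- mult_at D p)" for h
  proof
    assume "h \<in> LL D"
    moreover have "LL D \<subseteq> LL (D + frag_of p)" by (rule LL_mono) simp
    ultimately show "h \<in> LL (D + frag_of p) \<and> ord_ge p h (- mult_at D p)"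
      using assms(2) by (auto simp: LL_def[of D])
  next
    assume *: "h \<in> LL (D + frag_of p) \<and> ord_ge p h (- mult_at D p)"
    have "ord_ge q h (- mult_at D q)" if "q \<in> points f" for q
      using * that unfolding LL_def by (cases "q = p") auto
    with * show "h \<in> LL D" by (simp add: LL_def)
  qed
  have "ord_ge p v (- mult_at D p - 1)" using assms(2,3) by (auto simp: LL_def)
  moreover have "\<not> ord_ge p v (- mult_at D p)" using assms(3,4) lower[of v] by simp
  ultimately have v: "eq v (- mult_at D p - 1)" by (simp add: eq_def)
  show ?thesis
  proof (intro equalityI subsetI)
    fix h assume h: "h \<in> LL (D + frag_of p)"
    then have "ord_ge p h (- mult_at D p - 1)" using assms(2) by (auto simp: LL_def)
    then obtain c where "ord_ge p (h - const c * v) (- mult_at D p - 1 + 1)"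
      using residue_quotient[OF _ v] by blast
    then have "h - const c * v \<in> LL D"
      unfolding lower using LL_diff[OF h LL_const_mult[OF assms(3)]] by simp
    then show "h \<in> line v (LL D)"
      unfolding line_iff[OF vK] by (intro exI[of _ c] bexI[of _ "h - const c * v"]) auto
  next
    fix h assume "h \<in> line v (LL D)"
    then obtain a e where "e \<in> LL D" "h = const a * v + e" unfolding line_iff[OF vK] by blast
    then show "h \<in> LL (D + frag_of p)" using lower LL_add LL_const_mult assms(3) by blast
  qed
qed

lemma dimension_add_point:
  assumes "D \<in> Div" "p \<in> points f" "dimension d (constants f) (LL D)"
  shows "dimension d (constants f) (LL (D + frag_of p)) \<or> dimension (Suc d) (constants f) (LL (D + frag_of p))"
proof (cases "LL (D + frag_of p) \<subseteq> LL D")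
  case True
  then have "LL (D + frag_of p) = LL D" using LL_mono[of D "D + frag_of p"] by auto
  then show ?thesis using assms(3) by simp
next
  case False
  then obtain v where v: "v \<in> LL (D + frag_of p)" "v \<notin> LL D" by blast
  then have "v \<in> carrier K" by (simp add: LL_def)
  from dimension_line[OF this v(2) assms(3)] LL_add_point[OF assms(1,2) v] show ?thesis by simp
qed

lemma subalgebra_LL: "subalgebra (constants f) (LL D) K"
proof -
  interpret K: ring K by (rule ring_K)
  show ?thesis
  proof (intro subalgebra.intro subalgebra_axioms.intro)
    show "subgroup (LL D) (add_monoid K)"
    proof (rule K.add.subgroupI)
      show "LL D \<subseteq> carrier K" "LL D \<noteq> {}" using LL_zero by (auto simp: LL_def)
      fix h k assume hk: "h \<in> LL D" "k \<in> LL D"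
      then show "h \<oplus>\<^bsub>K\<^esub> k \<in> LL D" by (simp add: LL_add)
      have "- h \<in> LL D" using LL_diff[OF LL_zero hk(1)] by simp
      moreover have "\<ominus>\<^bsub>K\<^esub> h = - h"
        by (rule K.minus_equality) (use calculation hk in \<open>auto simp: LL_def\<close>)
      ultimately show "\<ominus>\<^bsub>K\<^esub> h \<in> LL D" by simp
    qed
    fix k v assume "k \<in> constants f" "v \<in> LL D"
    then show "k \<otimes>\<^bsub>K\<^esub> v \<in> LL D"
      using LL_const_mult const_mult_mod[of v] by (auto simp: constants_eq LL_def)
  qed
qed

lemma dimension_mult_image:
  assumes "\<not> F dvd h" "dimension d (constants f) E"
  shows "E \<subseteq> carrier K \<and> dimension d (constants f) ((\<lambda>e. (h * e) mod F) ` E)"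
proof -
  interpret K: ring K by (rule ring_K)
  let ?m = "\<lambda>e. (h * e) mod F"
  have inj: "e = e'" if "?m e = ?m e'" "e \<in> carrier K" "e' \<in> carrier K" for e e'
  proof -
    have "F dvd h * (e - e')" using that(1) by (simp add: right_diff_distrib F_dvd_diff_iff)
    then have "e mod F = e' mod F" using assms(1) by (simp add: F_dvd_mult_iff F_dvd_diff_iff)
    then show ?thesis using that by (simp add: K_carrier)
  qed
  show ?thesis using assms(2)
  proof (induction d "constants f" E rule: K.dimension.induct)
    case zero_dim
    show ?case using dimension_0_iff by (auto simp: K_carrier)
  next
    case (Suc_dim v E d)
    have v: "v \<in> carrier K" and E: "E \<subseteq> carrier K" using Suc_dim by simp_all
    have lin: "?m (const a * v + e) = const a * ?m v + ?m e" for a e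
    proof -
      have "?m (const a * v + e) = (const a * (h * v)) mod F + ?m e"
        by (simp add: algebra_simps poly_mod_add_left)
      also have "(const a * (h * v)) mod F = const a * ?m v"
        by (simp add: const_def emb_pCons mod_smult_left)
      finally show ?thesis .
    qed
    have line_K: "line v E \<subseteq> carrier K"
      using v E const_mult_mod[OF v] by (auto simp: line_iff[OF v] K_carrier poly_mod_add_left subset_eq)
    have "?m v \<notin> ?m ` E" using inj[OF _ v] E Suc_dim.hyps(2) by auto
    then have "dimension (Suc d) (constants f) (line (?m v) (?m ` E))"
      using dimension_line Suc_dim.hyps by simp
    moreover have "line (?m v) (?m ` E) = ?m ` line v E"
    proof (intro equalityI subsetI)
      fix u assume "u \<in> line (?m v) (?m ` E)"
      then obtain a e where ae: "e \<in> E" "u = const a * ?m v + ?m e" by (auto simp: line_iff)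
      then have "u = ?m (const a * v + e)" by (simp add: lin)
      moreover have "const a * v + e \<in> line v E" using ae(1) by (auto simp: line_iff[OF v])
      ultimately show "u \<in> ?m ` line v E" by blast
    next
      fix u assume "u \<in> ?m ` line v E"
      then obtain a e where ae: "e \<in> E" "u = ?m (const a * v + e)" by (auto simp: line_iff[OF v])
      then show "u \<in> line (?m v) (?m ` E)" unfolding lin by (auto simp: line_iff)
    qed
    ultimately show ?case using line_K by simp
  qed
qed

text \<open>\<open>dim L(D)\<close>; it exists for every divisor by \<open>finite_dimensional\<close> below.\<close>

definition ell :: "divisor \<Rightarrow> nat" where "ell D = (THE d. dimension d (constants f) (LL D))"

lemma ellI: "dimension d (constants f) (LL D) \<Longrightarrow> ell D = d"
  unfolding ell_def using dimension_unique by blast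

lemma maximal_divisor:
  obtains D where "D \<in> Div" "\<exists>d. dimension d (constants f) (LL D)" "div_degree D - int (ell D) + 1 = \<gamma>"
proof -
  obtain D d where *: "D \<in> Div" "RR_dim f D d" "div_degree D - int d + 1 = \<gamma>"
    using genus unfolding has_genus_def by blast
  then have "dimension d (constants f) (LL D)" by (simp add: RR_space_eq)
  then show thesis using that[of D] * ellI by blast
qed

text \<open>The definition of the genus supplies one divisor \<open>D0\<close> with a
  finite-dimensional space. Adding points until it dominates \<open>D\<close> keeps the dimension
  finite, and L(D) is a subspace of the result.\<close>

lemma finite_dimensional: "D \<in> Div \<Longrightarrow> \<exists>d. dimension d (constants f) (LL D)"
proof -
  assume D: "D \<in> Div"
  interpret K: ring K by (rule ring_K)
  obtain D0 where D0: "D0 \<in> Div" "\<exists>d. dimension d (constants f) (LL D0)" using maximal_divisor by blast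
  define E where "E = (\<Sum>p\<in>Poly_Mapping.keys D \<union> Poly_Mapping.keys D0. frag_cmul (max 0 (mult_at D p - mult_at D0 p)) (frag_of p))"
  have E: "mult_at E p = max 0 (mult_at D p - mult_at D0 p)" for p
  proof -
    have "mult_at E p = (\<Sum>q\<in>Poly_Mapping.keys D \<union> Poly_Mapping.keys D0. if p = q then max 0 (mult_at D p - mult_at D0 p) else 0)"
      unfolding E_def lookup_sum by (intro sum.cong refl) simp
    also have "\<dots> = max 0 (mult_at D p - mult_at D0 p)"
      by (simp add: in_keys_iff)
    finally show ?thesis .
  qed
  have "effective E" by (simp add: effective_def E)
  moreover have "Poly_Mapping.keys E \<subseteq> points f"
    using D D0(1) unfolding Div_iff by (auto simp: in_keys_iff E) fastforce
  ultimately have "\<exists>d. dimension d (constants f) (LL (D0 + E))"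
  proof (induction E rule: effective_induct)
    case zero
    then show ?case using D0(2) by simp
  next
    case (add E p)
    then have "D0 + E \<in> Div" using D0(1) by (simp add: Div_keys[symmetric])
    moreover obtain d where "dimension d (constants f) (LL (D0 + E))" using add by blast
    ultimately show ?case
      using dimension_add_point[of "D0 + E" p d] add(3) unfolding add.assoc by blast
  qed
  then have "K.finite_dimension (constants f) (LL (D0 + E))" by (simp add: K.finite_dimension_def)
  moreover have "LL D \<subseteq> LL (D0 + E)" by (rule LL_mono) (simp add: E)
  ultimately have "K.finite_dimension (constants f) (LL D)"
    using K.subalbegra_incl_imp_finite_dimension[OF subfield_constants _ subalgebra_LL] by blast
  then show ?thesis by (simp add: K.finite_dimension_def)
qed

lemma ell: "D \<in> Div \<Longrightarrow> dimension (ell D) (constants f) (LL D)"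
  using finite_dimensional ellI by blast

lemma RR_dim_iff: "D \<in> Div \<Longrightarrow> RR_dim f D d \<longleftrightarrow> ell D = d"
  using ell ellI by (auto simp: RR_space_eq)

lemma ell_le_genus: "D \<in> Div \<Longrightarrow> div_degree D - int (ell D) + 1 \<le> \<gamma>"
  using genus RR_dim_iff unfolding has_genus_def by blast

lemma ell_add_point: "D \<in> Div \<Longrightarrow> p \<in> points f \<Longrightarrow> ell (D + frag_of p) = ell D \<or> ell (D + frag_of p) = Suc (ell D)"
  using dimension_add_point[of D p "ell D"] ell ellI by blast

lemma ell_add_point_strict:
  assumes "D \<in> Div" "p \<in> points f" "v \<in> LL (D + frag_of p)" "v \<notin> LL D"
  shows "ell (D + frag_of p) = Suc (ell D)"
proof (rule ellI)
  have "v \<in> carrier K" using assms(3) by (simp add: LL_def)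
  from dimension_line[OF this assms(4) ell[OF assms(1)]] LL_add_point[OF assms]
  show "dimension (Suc (ell D)) (constants f) (LL (D + frag_of p))" by simp
qed

lemma ell_0_iff: "D \<in> Div \<Longrightarrow> ell D = 0 \<longleftrightarrow> LL D = {0}"
  using ell[of D] dimension_0_iff ellI by metis

lemma ell_add_effective:
  assumes "effective E" "E \<in> Div" "D \<in> Div"
  shows "ell D \<le> ell (D + E)" "int (ell (D + E)) \<le> int (ell D) + div_degree E"
proof -
  have "Poly_Mapping.keys E \<subseteq> points f" using assms(2) by (simp add: Div_keys)
  with assms(1) have "ell D \<le> ell (D + E) \<and> int (ell (D + E)) \<le> int (ell D) + div_degree E"
  proof (induction E rule: effective_induct)
    case (add E p)
    then have "D + E \<in> Div" using assms(3) by (simp add: Div_keys[symmetric])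
    from ell_add_point[OF this add(3)] show ?case using add(1) by (auto simp: add.assoc)
  qed simp
  then show "ell D \<le> ell (D + E)" "int (ell (D + E)) \<le> int (ell D) + div_degree E" by auto
qed

text \<open>Multiplication by \<open>h\<close> is an isomorphism between the two spaces.\<close>

lemma ell_diff_pdiv:
  assumes "D \<in> Div" "\<not> F dvd h"
  shows "ell (D - pdiv h) = ell D"
proof (rule ellI)
  obtain k where k: "F dvd k * h - 1" "\<not> F dvd k" using exists_inverse[OF assms(2)] .
  have "LL (D - pdiv h) = (\<lambda>e. (h * e) mod F) ` LL D"
  proof (intro equalityI subsetI)
    fix v assume v: "v \<in> LL (D - pdiv h)"
    have "(k * v) mod F \<in> LL D"
      unfolding LL_def
    proof safe
      fix p assume p: "p \<in> points f"
      interpret curve_point f p using p by auto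
      have "F dvd h * (k * v) - v"
      proof -
        have "h * (k * v) - v = (k * h - 1) * v" by (simp add: algebra_simps)
        then show ?thesis using k(1) by simp
      qed
      then have "ord_ge p (h * (k * v)) (mult_at (pdiv h) p + (- mult_at D p))"
        using v p ord_ge_cong by (auto simp: LL_def)
      then show "ord_ge p ((k * v) mod F) (- mult_at D p)"
        unfolding ord_ge_mod ge_mult_cancel[OF pdiv_eq[OF assms(2) p]] .
    qed simp
    moreover have "v = (h * ((k * v) mod F)) mod F"
    proof -
      have "(h * (k * v)) mod F = v mod F"
      proof -
        have "h * (k * v) - v = (k * h - 1) * v" by (simp add: algebra_simps)
        then have "F dvd h * (k * v) - v" using k(1) by simp
        then show ?thesis by (simp add: F_dvd_diff_iff)
      qed
      then show ?thesis using v by (simp add: mod_mult_right_eq LL_def K_carrier)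
    qed
    ultimately show "v \<in> (\<lambda>e. (h * e) mod F) ` LL D" by blast
  next
    fix v assume "v \<in> (\<lambda>e. (h * e) mod F) ` LL D"
    then obtain e where e: "e \<in> LL D" "v = (h * e) mod F" by blast
    have "ord_ge p v (- mult_at (D - pdiv h) p)" if p: "p \<in> points f" for p
    proof -
      interpret curve_point f p using p by auto
      show ?thesis using e p ge_mult_cancel[OF pdiv_eq[OF assms(2) p], of e "- mult_at D p"] by (simp add: LL_def)
    qed
    then show "v \<in> LL (D - pdiv h)" using e(2) by (simp add: LL_def)
  qed
  then show "dimension (ell D) (constants f) (LL (D - pdiv h))"
    using dimension_mult_image[OF assms(2) ell[OF assms(1)]] by simp
qed

text \<open>Shifting a divisor that attains the genus by a principal divisor cannot increase its degree.\<close>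

lemma degree_pdiv [simp]: "\<not> F dvd h \<Longrightarrow> div_degree (pdiv h) = 0"
proof -
  assume h: "\<not> F dvd h"
  obtain D where D: "D \<in> Div" "div_degree D - int (ell D) + 1 = \<gamma>" using maximal_divisor by blast
  have *: "div_degree (pdiv k) \<ge> 0" if k: "\<not> F dvd k" for k
  proof -
    have "D - pdiv k \<in> Div" using D(1) pdiv_in_Div[OF k] by simp
    from ell_le_genus[OF this] show ?thesis using ell_diff_pdiv[OF D(1) k] D(2) by simp
  qed
  \<comment> \<open>The reciprocal function supplies the opposite inequality.\<close>
  obtain k where k: "F dvd k * h - 1" "\<not> F dvd k" using exists_inverse[OF h] .
  have "pdiv k + pdiv h = 0" using pdiv_mult[OF k(2) h] pdiv_cong[OF k(1)] by simp
  then have "div_degree (pdiv k) + div_degree (pdiv h) = 0" by (metis div_degree_add div_degree_zero)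
  then show ?thesis using *[OF h] *[OF k(2)] by simp
qed

text \<open>A polynomial in x suffices: it is regular away from \<open>P\<close>, and powers of
  \<open>x - a p\<close>, where \<open>a p\<close> is the value of x at \<open>p\<close>, vanish
  there to any prescribed order. Negative multiplicities are cut off to exponent 0 by
  \<open>nat\<close>.\<close>

lemma affine_bound:
  assumes "E \<in> Div"
  obtains h where "\<not> F dvd h" "\<And>p. p \<in> points f \<Longrightarrow> p \<noteq> P \<Longrightarrow> ord_ge p h (mult_at E p)"
proof -
  have "\<exists>a. ord_ge p (X - const a) 1" if "p \<in> points f" "p \<noteq> P" for p
    using curve_point.X_value[OF curve_point affine] that by metis
  then obtain a where a: "\<And>p. p \<in> points f \<Longrightarrow> p \<noteq> P \<Longrightarrow> ord_ge p (X - const (a p)) 1" by metis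
  define S where "S = Poly_Mapping.keys E - {P}"
  have S: "finite S" "S \<subseteq> points f" using assms by (auto simp: S_def Div_keys)
  define q where "q = (\<Prod>p\<in>S. [:- a p, 1:] ^ nat (mult_at E p))"
  have evq: "ev q X = (\<Prod>p\<in>S. (X - const (a p)) ^ nat (mult_at E p))"
    unfolding q_def using S(1)
    by (induction S) (simp_all add: ev_mult ev_power ev_pCons const_uminus)
  show thesis
  proof (rule that)
    show "\<not> F dvd ev q X" by (rule not_F_dvd_ev_X) (use S(1) in \<open>auto simp: q_def\<close>)
    fix p assume p: "p \<in> points f" "p \<noteq> P"
    interpret curve_point f p using p by auto
    have reg: "ord_ge p (X - const b) 0" for b using affine[OF p] by (intro ge_diff ge_const)
    have reg': "ord_ge p (\<Prod>q\<in>S'. (X - const (a q)) ^ nat (mult_at E q)) 0" for S'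
      using ge_prod[of S' "\<lambda>q. (X - const (a q)) ^ nat (mult_at E q)" "\<lambda>_. 0"] ge_power[OF reg] by simp
    show "ord_ge p (ev q X) (mult_at E p)"
    proof (cases "p \<in> S")
      case True
      have "ord_ge p ((X - const (a p)) ^ nat (mult_at E p) * (\<Prod>q\<in>S - {p}. (X - const (a q)) ^ nat (mult_at E q))) (int (nat (mult_at E p)) * 1 + 0)"
        by (intro ge_mult ge_power reg' a p)
      then show ?thesis unfolding evq prod.remove[OF S(1) True] by (rule ge_mono) simp
    next
      case False
      then have "mult_at E p = 0" using p(2) by (simp add: S_def in_keys_iff)
      then show ?thesis unfolding evq using reg' by simp
    qed
  qed
qed

text \<open>Enlarging a divisor by an effective one cannot lower \<open>deg - ell\<close>. A divisor
  at which the maximum is attained is translated by a function until it lies below \<open>D\<close>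
  away from \<open>P\<close>; for large \<open>\<kappa>\<close> it lies below
  \<open>D + \<kappa> P\<close> everywhere, which therefore attains the maximum too.\<close>

lemma riemann:
  assumes "D \<in> Div"
  shows "\<exists>\<kappa>0. \<forall>\<kappa>\<ge>\<kappa>0. int (ell (D + frag_cmul \<kappa> (frag_of P))) = div_degree D + \<kappa> + 1 - \<gamma>"
proof -
  obtain D0 where D0: "D0 \<in> Div" "div_degree D0 - int (ell D0) + 1 = \<gamma>" using maximal_divisor by blast
  obtain h where h: "\<not> F dvd h" "\<And>p. p \<in> points f \<Longrightarrow> p \<noteq> P \<Longrightarrow> ord_ge p h (mult_at (D0 - D) p)"
    using affine_bound[OF Div_closed(4)[OF D0(1) assms]] by blast
  define D1 where "D1 = D0 - pdiv h"
  have D1: "D1 \<in> Div" "div_degree D1 - int (ell D1) + 1 = \<gamma>"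
    using D0 pdiv_in_Div[OF h(1)] ell_diff_pdiv[OF D0(1) h(1)] h(1) by (simp_all add: D1_def)
  have "int (ell (D + frag_cmul \<kappa> (frag_of P))) = div_degree D + \<kappa> + 1 - \<gamma>"
    if \<kappa>: "\<kappa> \<ge> mult_at D1 P - mult_at D P" for \<kappa>
  proof -
    let ?D = "D + frag_cmul \<kappa> (frag_of P)"
    have D': "?D \<in> Div" using assms P_point by simp
    have "mult_at D1 p \<le> mult_at ?D p" for p
    proof (cases "p \<in> points f \<and> p \<noteq> P")
      case True
      then have "mult_at (D0 - D) p \<le> mult_at (pdiv h) p"
        using h(2)[of p] valuation.eq_ge_iff[OF valuation_point pdiv_eq[OF h(1)], of p "mult_at (D0 - D) p"] True by blast
      then show ?thesis using True by (simp add: D1_def)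
    next
      case False
      then show ?thesis using \<kappa> D1(1) D' P_point unfolding Div_iff by (cases "p = P") auto
    qed
    then have eff: "effective (?D - D1)" by (simp add: effective_def)
    have "?D - D1 \<in> Div" using D' D1(1) by (rule Div_closed)
    from ell_add_effective(2)[OF eff this D1(1)] D1(2)
    have "div_degree ?D - int (ell ?D) + 1 \<ge> \<gamma>" by simp
    with ell_le_genus[OF D'] show ?thesis by simp
  qed
  then show ?thesis by blast
qed

text \<open>From \<open>\<kappa> = s - 1\<close> on, each further multiple of \<open>P\<close>
  admits one new function, namely the \<open>e t\<close> of exactly that pole order. So
  \<open>ell\<close> grows with slope 1, and comparison with Riemann's theorem far out determines
  the degree of \<open>D\<close>.\<close>

lemma pole_sequence:
  assumes D: "D \<in> Div" "mult_at D P = 0"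
    and e: "\<And>t. t \<ge> s \<Longrightarrow> valuation.eq (ord_ge P) (e t) (- int t)"
    and e': "\<And>t p. t \<ge> s \<Longrightarrow> p \<in> points f \<Longrightarrow> p \<noteq> P \<Longrightarrow> ord_ge p (e t) (- mult_at D p)"
  shows "div_degree D = \<gamma> - int s + int (ell (D + frag_cmul (int s - 1) (frag_of P)))" (is ?A)
    and "ell (D + frag_cmul (int s - 1 + int r) (frag_of P)) = ell (D + frag_cmul (int s - 1) (frag_of P)) + r" (is "?B r")
proof -
  let ?D = "\<lambda>\<kappa>. D + frag_cmul \<kappa> (frag_of P)"
  have DD: "?D \<kappa> \<in> Div" for \<kappa> using D(1) P_point by simp
  interpret curve_point f P using P_point by auto
  show B: "?B r" for r
  proof (induction r)
    case (Suc r)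
    have mult_D: "mult_at (?D \<kappa>) p = mult_at D p + (if p = P then \<kappa> else 0)" for p \<kappa> by simp
    let ?\<kappa> = "int s - 1 + int r" and ?e = "e (s + r) mod F"
    have "?e \<in> LL (?D (?\<kappa> + 1))"
      unfolding LL_def mult_D
      using e[of "s + r"] e'[of "s + r"] D(2) eq_imp_ge[OF e[of "s + r"]] by auto
    moreover have "?e \<notin> LL (?D ?\<kappa>)"
      using e[of "s + r"] D(2) P_point unfolding LL_def mult_D by (auto simp: eq_ge_iff[OF e])
    moreover have "?D (?\<kappa> + 1) = ?D ?\<kappa> + frag_of P"
      by (intro poly_mapping_eqI) simp
    ultimately have "ell (?D (?\<kappa> + 1)) = Suc (ell (?D ?\<kappa>))"
      using ell_add_point_strict[OF DD P_point] by metis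
    then show ?case using Suc.IH by (simp add: add.assoc)
  qed simp
  obtain \<kappa>0 where \<kappa>0: "\<And>\<kappa>. \<kappa> \<ge> \<kappa>0 \<Longrightarrow> int (ell (?D \<kappa>)) = div_degree D + \<kappa> + 1 - \<gamma>"
    using riemann[OF D(1)] by blast
  \<comment> \<open>Chosen so that \<open>s - 1 + r\<close> reaches the range where Riemann's
    theorem is an equality.\<close>
  define r where "r = nat (max 0 (\<kappa>0 - int s + 1))"
  have "int (ell (?D (int s - 1 + int r))) = div_degree D + (int s - 1 + int r) + 1 - \<gamma>"
    by (rule \<kappa>0) (simp add: r_def)
  then show ?A using B[of r] by simp
qed

text \<open>An effective \<open>D\<close> with \<open>ell D = 1\<close> has only the constants in
  L(D). The function relating \<open>D\<close> to an effective \<open>E\<close> lies in L(D), so it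
  is constant.\<close>

lemma linearly_equivalent_unique:
  assumes D: "D \<in> Div" "effective D" "ell D = 1" and E: "E \<in> Div" "effective E"
    and cls: "div_class f D = div_class f E"
  shows "D = E"
proof -
  have "E \<in> div_class f E"
  proof -
    have "div_of f 1 \<in> principal_divisors f"
      unfolding principal_divisors_def by (rule imageI) (auto simp: K_carrier)
    moreover have "div_of f 1 = 0" using pdiv_1 by (simp add: pdiv_def)
    ultimately show ?thesis unfolding div_class_def r_coset_def by force
  qed
  then obtain h where h: "h \<in> carrier K" "h \<noteq> 0" "E = div_of f h + D"
    unfolding cls[symmetric] unfolding div_class_def r_coset_def principal_divisors_def by auto
  then have h': "\<not> F dvd h" "E = pdiv h + D"
    using K_nonzero[OF h(1,2)] h(1,3) by (simp_all add: pdiv_def K_carrier)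
  have "effective (div_of f h + D)" using h(3) E(2) by simp
  then have "h \<in> LL D" unfolding RR_space_eq[OF D(1), symmetric] RR_space_def using h(1) by simp
  moreover have "1 \<in> LL D"
    using D(2) by (auto simp: LL_def K_carrier effective_def intro!: valuation.ge_mono[OF valuation_point valuation.ge_one[OF valuation_point]])
  moreover obtain v where "LL D = {const a * v | a. True}"
    using dimension_1D ell[OF D(1)] D(3) by force
  ultimately obtain a b where ab: "h = const a * v" "1 = const b * v" by blast
  have "b \<noteq> 0" "a \<noteq> 0" using ab h(2) by auto
  have "const (a / b) * (const b * v) = const a * v"
    using \<open>b \<noteq> 0\<close> by (simp add: mult.assoc[symmetric] flip: const_mult)
  then have "h = const (a / b)" using ab by simp
  then have "pdiv h = 0" using \<open>b \<noteq> 0\<close> \<open>a \<noteq> 0\<close> by simp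
  then show ?thesis using h'(2) by simp
qed

end

section \<open>The spectral curve\<close>

context plane_curve begin

lemma emb_sum_support:
  assumes "finite T" "\<And>j i. coeff_xy h j i \<noteq> 0 \<Longrightarrow> (j, i) \<in> T"
  shows "emb h = (\<Sum>(j, i)\<in>T. const (coeff_xy h j i) * X ^ j * Y ^ i)"
proof -
  define d where "d = Max (insert 0 (fst ` T))"
  define e where "e = Max (insert (degree h) (snd ` T))"
  have d: "j \<le> d" and e: "i \<le> e" if "(j, i) \<in> T" for j i
    using that assms(1) by (auto simp: d_def e_def intro!: Max_ge image_eqI[of _ fst "(j, i)"] image_eqI[of _ snd "(j, i)"])
  have "degree h \<le> e" using assms(1) by (auto simp: e_def intro!: Max_ge)
  have deg: "degree (poly.coeff h i) \<le> d" for i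
    using assms(2) d by (intro degree_le allI impI) (metis coeff_xy_def not_less)
  have "emb h = (\<Sum>i\<le>e. ev (poly.coeff h i) X * Y ^ i)"
    unfolding emb_altdef by (rule sum.mono_neutral_left) (use \<open>degree h \<le> e\<close> in \<open>auto simp: coeff_eq_0\<close>)
  also have "\<dots> = (\<Sum>i\<le>e. \<Sum>j\<le>d. const (coeff_xy h j i) * X ^ j * Y ^ i)"
    by (simp add: ev_altdef'[OF deg] sum_distrib_right coeff_xy_def)
  also have "\<dots> = (\<Sum>(j, i)\<in>{..d} \<times> {..e}. const (coeff_xy h j i) * X ^ j * Y ^ i)"
    by (subst sum.swap) (simp add: sum.cartesian_product)
  also have "\<dots> = (\<Sum>(j, i)\<in>T. const (coeff_xy h j i) * X ^ j * Y ^ i)"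
  proof (rule sum.mono_neutral_right)
    show "T \<subseteq> {..d} \<times> {..e}" using d e by auto
    show "\<forall>z\<in>{..d} \<times> {..e} - T. (case z of (j, i) \<Rightarrow> const (coeff_xy h j i) * X ^ j * Y ^ i) = 0"
      using assms(2) by auto
  qed simp
  finally show ?thesis .
qed

lemma finite_support_xy: "finite {(j, i). coeff_xy h j i \<noteq> 0}"
proof (rule finite_subset)
  show "{(j, i). coeff_xy h j i \<noteq> 0} \<subseteq> (\<lambda>(i, j). (j, i)) ` (SIGMA i:{..degree h}. {..degree (poly.coeff h i)})"
  proof clarify
    fix j i assume *: "coeff_xy h j i \<noteq> 0"
    then have "j \<le> degree (poly.coeff h i)" by (simp add: coeff_xy_def le_degree)
    moreover have "poly.coeff h i \<noteq> 0" using * by (auto simp: coeff_xy_def)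
    then have "i \<le> degree h" by (rule le_degree)
    ultimately show "(j, i) \<in> (\<lambda>(i, j). (j, i)) ` (SIGMA i:{..degree h}. {..degree (poly.coeff h i)})"
      by (auto intro!: image_eqI[of _ _ "(i, j)"])
  qed
qed auto

lemma vanishes_at_iff: "vanishes_at (h mod F) p \<longleftrightarrow> ord_ge p h 1"
  by (auto simp: vanishes_at_def ord_ge_def dvd_eq_mod_eq_0)

lemma lies_over_iff: "lies_over f p (a, b) \<longleftrightarrow> ord_ge p (X - const a) 1 \<and> ord_ge p (Y - const b) 1"
proof -
  have "x_fun f - const_fun f a = (X - const a) mod F" "y_fun f - const_fun f b = (Y - const b) mod F"
    using const_mod_F by (simp_all add: x_fun_eq y_fun_eq const_fun_eq poly_mod_diff_left)
  then show ?thesis by (simp add: lies_over_def vanishes_at_iff)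
qed

lemma nat_pow_K: "u \<in> carrier K \<Longrightarrow> u [^]\<^bsub>K\<^esub> (i::nat) = u ^ i mod F"
  by (induction i) (simp_all add: Group.nat_pow_def mod_mult_left_eq mod_mult_right_eq mult.commute)

end

context curve_point begin

lemma ge_emb_bound:
  assumes "\<And>j i. coeff_xy h j i \<noteq> 0 \<Longrightarrow> ord_ge p (X ^ j * Y ^ i) d"
  shows "ord_ge p (emb h) d"
proof -
  have "emb h = (\<Sum>(j, i)\<in>{(j, i). coeff_xy h j i \<noteq> 0}. const (coeff_xy h j i) * X ^ j * Y ^ i)"
    by (rule emb_sum_support[OF finite_support_xy]) auto
  then show ?thesis
    using assms ge_const_mult by (auto intro!: ge_sum simp: mult.assoc)
qed

lemma asymp_at_eq:
  assumes "asymp_at p (g mod F) (h mod F)" "eq h d"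
  shows "eq g d"
proof -
  have "ord_ge p (g - h) (d + 1)"
    using assms unfolding asymp_at_def eq_iff ord_ge_def
    by (auto simp: F_dvd_diff_iff poly_mod_diff_left)
  then show ?thesis using eq_cong assms(2) by blast
qed

end

text \<open>Used with \<open>s = m + k\<close>; the weight of a monomial is then its pole order at
  \<open>P\<close>, see \<open>monomial_P\<close>.\<close>

definition homogeneous_xy :: "nat \<Rightarrow> nat \<Rightarrow> nat \<Rightarrow> complex poly poly \<Rightarrow> bool" where
  "homogeneous_xy n s w h \<longleftrightarrow> (\<forall>j i. coeff_xy h j i \<noteq> 0 \<longrightarrow> n * j + s * i = w)"

lemma homogeneous_xy_mult:
  assumes "homogeneous_xy n s v g" "homogeneous_xy n s w h"
  shows "homogeneous_xy n s (v + w) (g * h)"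
  unfolding homogeneous_xy_def
proof (intro allI impI)
  fix j i assume "coeff_xy (g * h) j i \<noteq> 0"
  then have "(\<Sum>i'\<le>i. \<Sum>j'\<le>j. coeff_xy g j' i' * coeff_xy h (j - j') (i - i')) \<noteq> 0"
    by (simp add: coeff_xy_def coeff_mult coeff_sum)
  then obtain i' where i': "i' \<le> i" "(\<Sum>j'\<le>j. coeff_xy g j' i' * coeff_xy h (j - j') (i - i')) \<noteq> 0"
    by (meson atMost_iff sum.neutral)
  then obtain j' where j': "j' \<le> j" "coeff_xy g j' i' * coeff_xy h (j - j') (i - i') \<noteq> 0"
    by (meson atMost_iff sum.neutral)
  then have "n * j' + s * i' = v" "n * (j - j') + s * (i - i') = w"
    using assms by (auto simp: homogeneous_xy_def)
  then have "n * (j' + (j - j')) + s * (i' + (i - i')) = v + w" by (simp only: distrib_left)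
  then show "n * j + s * i = v + w" using i'(1) j'(1) by simp
qed

lemma homogeneous_xy_diff: "homogeneous_xy n s w g \<Longrightarrow> homogeneous_xy n s w h \<Longrightarrow> homogeneous_xy n s w (g - h)"
  unfolding homogeneous_xy_def coeff_xy_def by (metis coeff_diff diff_self)

lemma homogeneous_xy_const: "homogeneous_xy n s 0 [:[:c:]:]"
  by (auto simp: homogeneous_xy_def coeff_xy_def coeff_pCons split: nat.splits)

lemma homogeneous_xy_power: "homogeneous_xy n s w h \<Longrightarrow> homogeneous_xy n s (i * w) (h ^ i)"
proof (induction i)
  case 0
  then show ?case using homogeneous_xy_const[of n s 1] by (simp add: one_pCons)
qed (simp add: homogeneous_xy_mult)

lemma homogeneous_xy_x: "homogeneous_xy n s n [:[:0, 1:]:]" and homogeneous_xy_y: "homogeneous_xy n s s [:0, 1:]"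
  by (auto simp: homogeneous_xy_def coeff_xy_def coeff_pCons split: nat.splits)

section \<open>The Newton polygon: \<open>f\<close> as edge polynomial plus terms of smaller
  weight\<close>

locale spectral_curve =
  fixes n m k :: nat and f :: "complex poly poly"
  assumes n: "n \<ge> 2" and m: "m \<ge> 1" and k: "1 \<le> k" "k \<le> n" and f: "f \<in> curly_V n m k"
begin

definition "M = gcd n (m + k)"
definition "N = gcd n k"
definition "a = n div M"
definition "b = (m + k) div M"
definition "n' = n div N"
definition "k' = k div N"

text \<open>The weight of the points of \<open>L_c\<close>.\<close>

definition W :: int where "W = int n * int (m + k) - int M"

definition rest :: "complex poly poly" where "rest = f - edge_poly n m k"

definition Lc :: "(nat \<times> nat) set" where
  "Lc = {(j, i). (m + k) * i + n * j = n * (m + k) - gcd n (m + k)}"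

lemma M_pos: "M > 0" and N_pos: "N > 0" and aM: "a * M = n" and bM: "b * M = m + k"
  and n'N: "n' * N = n" and k'N: "k' * N = k" and a_pos: "a > 0" and b_pos: "b > 0" and n'_pos: "n' > 0" and k'_pos: "k' > 0"
proof -
  show MN: "M > 0" "N > 0" using n by (simp_all add: M_def N_def)
  show "a * M = n" "b * M = m + k" "n' * N = n" "k' * N = k"
    by (simp_all add: a_def b_def n'_def k'_def M_def N_def)
  then show "a > 0" "b > 0" "n' > 0" "k' > 0" using n m k by (auto intro!: Nat.gr0I)
qed

lemma a_weight: "a * (m + k) = b * n"
  by (metis aM bM mult.assoc mult.commute)

lemma M_le: "M \<le> n"
  unfolding M_def using n by (intro gcd_le1_nat) simp

lemma irr: "irreducible f" and smooth: "smooth_away_from_origin f" and fc: "f_c n m k f \<noteq> 0"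
  and special: "special_point_condition n m k f" and gen: "has_genus f (genus_value n m k)"
  and Vpoly: "f \<in> V_poly n m k"
  using f by (auto simp: curly_V_def)

lemma edge_eq: "edge_poly n m k = (- 1) ^ n * ([:0, 1:] ^ a - [:[:0, 1:]:] ^ b) ^ M"
proof -
  let ?y = "[:0, 1:] :: complex poly poly" and ?x = "[:[:0, 1:]:] :: complex poly poly"
  have "(- ?y) ^ a + (- 1) ^ (a + 1) * ?x ^ b = (- 1) ^ a * (?y ^ a - ?x ^ b)"
    by (subst power_minus) (simp add: algebra_simps)
  then have "edge_poly n m k = ((- 1) ^ a * (?y ^ a - ?x ^ b)) ^ M"
    by (simp add: edge_poly_def Let_def M_def a_def b_def add.commute)
  also have "\<dots> = (- 1) ^ (a * M) * (?y ^ a - ?x ^ b) ^ M"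
    by (simp only: power_mult_distrib power_mult)
  finally show ?thesis by (simp add: aM)
qed

text \<open>The triangle lies in the half plane of weight at most \<open>n (m + k)\<close>, and its
  points with equality form the excluded edge. All weights are multiples of \<open>M\<close>, so a
  strict inequality leaves a gap of at least \<open>M\<close>.\<close>

lemma rest_weight:
  assumes "coeff_xy rest j i \<noteq> 0"
  shows "int n * int j + int (m + k) * int i \<le> W"
proof -
  have *: "(real j, real i) \<in> convex hull {(real k, 0), (0, real n), (real (k + m), 0)}"
      "(real j, real i) \<notin> closed_segment (0, real n) (real (k + m), 0)"
    using Vpoly assms unfolding V_poly_def rest_def by blast+
  have "convex {z :: real \<times> real. inner (real n, real (m + k)) z \<le> real n * real (m + k)}"
    by (rule convex_halfspace_le)
  moreover have "{(real k, 0), (0, real n), (real (k + m), 0)} \<subseteq> {z :: real \<times> real. inner (real n, real (m + k)) z \<le> real n * real (m + k)}"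
    using n by (auto simp: algebra_simps)
  ultimately have "convex hull {(real k, 0), (0, real n), (real (k + m), 0)} \<subseteq> {z :: real \<times> real. inner (real n, real (m + k)) z \<le> real n * real (m + k)}"
    by (rule hull_minimal[rotated])
  with *(1) have "inner (real n, real (m + k)) (real j, real i) \<le> real n * real (m + k)" by blast
  then have le: "n * j + (m + k) * i \<le> n * (m + k)"
    by (simp flip: of_nat_mult of_nat_add)
  have "n * j + (m + k) * i \<noteq> n * (m + k)"
  proof
    assume eq: "n * j + (m + k) * i = n * (m + k)"
    have "j \<le> m + k" using eq n by (metis le_add1 mult_le_cancel1 not_numeral_le_zero not_gr0)
    define r where "r = real (m + k)"
    define u where "u = real j / r"
    have u: "0 \<le> u" "u \<le> 1" "u * r = real j" using \<open>j \<le> m + k\<close> m by (simp_all add: u_def r_def)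
    have "real n * real j + r * real i = real n * r"
      unfolding r_def using arg_cong[OF eq, of real] by (simp only: of_nat_mult of_nat_add)
    then have "r * ((1 - u) * real n) = r * real i"
      unfolding u(3)[symmetric] by (simp add: algebra_simps)
    moreover have "r \<noteq> 0" using m by (simp add: r_def)
    ultimately have "(1 - u) * real n = real i" by simp
    then have "(real j, real i) = (1 - u) *\<^sub>R (0, real n) + u *\<^sub>R (real (k + m), 0)"
      using u(3) by (simp add: r_def add.commute)
    then show False using *(2) u(1,2) unfolding closed_segment_def by blast
  qed
  with le have lt: "int n * int j + int (m + k) * int i < int n * int (m + k)"
    by (simp flip: of_nat_mult of_nat_add)
  have "int M dvd int n * int (m + k) - (int n * int j + int (m + k) * int i)"
    unfolding M_def by (intro dvd_diff dvd_add dvd_mult2) (simp_all del: of_nat_add)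
  with zdvd_imp_le[OF this] lt show ?thesis by (simp add: W_def)
qed

lemma rest_coeff_0: "i \<ge> n \<Longrightarrow> poly.coeff rest i = 0"
proof (rule poly_eqI)
  fix j assume i: "i \<ge> n"
  have "int (m + k) * int n \<le> int (m + k) * int i" using i by (intro mult_left_mono) auto
  moreover have "0 \<le> int n * int j" by simp
  ultimately have "coeff_xy rest j i = 0"
    using rest_weight[of j i] M_pos unfolding W_def mult.commute[of "int n" "int (m + k)"] by linarith
  then show "poly.coeff (poly.coeff rest i) j = poly.coeff 0 j" by (simp add: coeff_xy_def)
qed

lemma degree_f_eq: "degree f = n" and lead_coeff_f: "lead_coeff f = (- 1) ^ n"
proof -
  let ?y = "[:0, 1:] :: complex poly poly" and ?x = "[:[:0, 1:]:] :: complex poly poly"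
  have x: "?x ^ e = [:[:0, 1:] ^ e:]" for e by (induction e) (simp_all add: one_pCons)
  have dy: "degree (?y ^ a) = a" by (simp add: degree_power_eq)
  have dlt: "degree (?x ^ b) < degree (?y ^ a)" unfolding x dy using a_pos by simp
  then have "degree (- (?x ^ b)) < degree (?y ^ a)" by simp
  from degree_add_eq_left[OF this] lead_coeff_add_le[OF this]
  have "degree (?y ^ a - ?x ^ b) = a" "lead_coeff (?y ^ a - ?x ^ b) = lead_coeff (?y ^ a)"
    using dy by (simp_all add: add.commute)
  moreover have "lead_coeff (?y ^ a) = 1" by (simp only: lead_coeff_power) simp
  ultimately have "degree ((?y ^ a - ?x ^ b) ^ M) = n" "lead_coeff ((?y ^ a - ?x ^ b) ^ M) = 1"
    using degree_power_eq[of "?y ^ a - ?x ^ b" M] a_pos aM by (force simp: mult.commute, simp add: lead_coeff_power)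
  moreover have "(- 1 :: complex poly poly) ^ n = [:(- 1) ^ n:]" by (induction n) (simp_all add: one_pCons)
  ultimately have edge: "degree (edge_poly n m k) = n" "lead_coeff (edge_poly n m k) = (- 1) ^ n"
    unfolding edge_eq by simp_all
  have "degree rest < n" using rest_coeff_0 n by (intro degree_lessI) auto
  then have lt: "degree rest < degree (edge_poly n m k)" using edge by simp
  have "rest + edge_poly n m k = f" by (simp add: rest_def)
  with degree_add_eq_right[OF lt] lead_coeff_add_le[OF lt]
  show "degree f = n" "lead_coeff f = (- 1) ^ n" using edge by simp_all
qed

end

sublocale spectral_curve \<subseteq> plane_curve f
  by unfold_locales (use irr degree_f_eq n in auto)

section \<open>The points at infinity and over the origin; finiteness of zeros and poles\<close>

context spectral_curve begin

lemma emb_f: "emb f = const ((- 1) ^ n) * (Y ^ a - X ^ b) ^ M + emb rest"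
proof -
  interpret e: comm_ring_hom emb by (rule comm_ring_hom_emb)
  have "emb f = emb (edge_poly n m k) + emb rest" by (simp add: rest_def flip: fract_poly_add)
  then show ?thesis
    by (simp add: edge_eq e.hom_mult e.hom_power e.hom_uminus X_def Y_def const_power const_uminus)
qed

text \<open>Up to sign \<open>f\<close> is monic in y, so y is integral over the polynomials in x:
  at a pole of y that is not a pole of x the term \<open>y ^ n\<close> would dominate, and
  \<open>f\<close> could not vanish.\<close>

lemma Y_regular:
  assumes "p \<in> points f" "ord_ge p X 0"
  shows "ord_ge p Y 0"
proof (rule ccontr)
  interpret curve_point f p by unfold_locales (rule assms(1))
  assume "\<not> ord_ge p Y 0"
  then obtain e where e: "e < 0" "eq Y e" using ge_or_eq by blast
  have "emb f = (\<Sum>i<n. ev (poly.coeff f i) X * Y ^ i) + ev (lead_coeff f) X * Y ^ n"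
    unfolding emb_altdef degree_f_eq lessThan_Suc_atMost[symmetric] by simp
  moreover have "ord_ge p (\<Sum>i<n. ev (poly.coeff f i) X * Y ^ i) (int n * e + 1)"
  proof (rule ge_sum)
    fix i assume "i \<in> {..<n}"
    then have "(int n - int i) * e \<le> (int n - int i) * (- 1)" using e by (intro mult_left_mono) auto
    then have "int n * e + 1 \<le> 0 + int i * e" using \<open>i \<in> {..<n}\<close> by (simp add: algebra_simps)
    then show "ord_ge p (ev (poly.coeff f i) X * Y ^ i) (int n * e + 1)"
      using ge_mult[OF ge_ev[OF assms(2)] ge_power[OF eq_imp_ge[OF e(2)]]] ge_mono by blast
  qed
  moreover have "eq (ev (lead_coeff f) X * Y ^ n) (int n * e)"
  proof -
    have "ev 1 X + ev (- 1) X = 0" by (simp only: ev_add[symmetric]) simp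
    then have "ev (- 1) X = const (- 1)" by (simp add: const_uminus add_eq_0_iff)
    then have "ev (lead_coeff f) X = const ((- 1) ^ n)" unfolding lead_coeff_f by (simp add: ev_power const_power)
    then show ?thesis using eq_mult[OF eq_const eq_power[OF e(2)], of "(- 1) ^ n" n] by simp
  qed
  ultimately have "eq (emb f) (int n * e)" using eq_add_ge by (simp only: add.commute)
  then show False using eq_imp_not_F_dvd F_dvd_emb_f by blast
qed

lemma at_infinity_iff: "p \<in> points f \<Longrightarrow> at_infinity f p \<longleftrightarrow> \<not> ord_ge p X 0"
proof -
  assume p: "p \<in> points f"
  have Y: "\<not> F dvd Y"
    by (rule degree_less_not_F_dvd) (use n in \<open>simp_all add: Y_def emb_pCons degree_f_eq\<close>)
  have "ord_ge p X 0 \<longleftrightarrow> \<not> p (x_fun f) < 0" "ord_ge p Y 0 \<longleftrightarrow> \<not> p (y_fun f) < 0"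
    using Y not_F_dvd_X by (auto simp: ord_ge_def x_fun_eq y_fun_eq)
  then show ?thesis using Y_regular[OF p] by (auto simp: at_infinity_def)
qed

lemma special_points_iff:
  "p \<in> special_points f \<longleftrightarrow> p \<in> points f \<and> (ord_ge p X 1 \<or> ord_ge p Y 1 \<or> \<not> ord_ge p X 0)"
  using at_infinity_iff by (auto simp: special_points_def x_fun_eq y_fun_eq vanishes_at_iff)

text \<open>All special points except \<open>P\<close> lie over finite points, so \<open>P\<close>
  is the only pole of x and is the point described by \<open>P_inf f\<close>. The \<open>A r\<close>
  have nonzero abscissas, which leaves exactly the \<open>Op r\<close> over the origin, and their
  expansions give the orders of x and y.\<close>

lemma special_data:
  obtains \<epsilon> A Op where
    "special_points f = A ` {1..m} \<union> Op ` {1..N} \<union> {P_inf f}"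
    "inj_on (\<epsilon> :: nat \<Rightarrow> complex) {1..m}" "\<And>r. r \<in> {1..m} \<Longrightarrow> \<epsilon> r \<noteq> 0 \<and> lies_over f (A r) ((- 1) ^ n * \<epsilon> r, 0)"
    "inj_on Op {1..N}" "O_points f = Op ` {1..N}"
    "\<And>p. p \<in> O_points f \<Longrightarrow> valuation.eq (ord_ge p) X (int n') \<and> valuation.eq (ord_ge p) Y (int k')"
    "P_inf f \<in> points f" "\<not> ord_ge (P_inf f) X 0"
    "\<And>p. p \<in> points f \<Longrightarrow> p \<noteq> P_inf f \<Longrightarrow> ord_ge p X 0"
proof -
  obtain \<epsilon> :: "nat \<Rightarrow> complex" and A and \<sigma> :: "nat \<Rightarrow> complex" and Op P where *:
    "special_points f = A ` {1..m} \<union> Op ` {1..N} \<union> {P}" "inj_on \<epsilon> {1..m}"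
    "\<And>r. r \<in> {1..m} \<Longrightarrow> \<epsilon> r \<noteq> 0 \<and> lies_over f (A r) ((- 1) ^ n * \<epsilon> r, 0)" "inj_on Op {1..N}"
    "\<And>r. r \<in> {1..N} \<Longrightarrow> \<sigma> r \<noteq> 0 \<and> lies_over f (Op r) (0, 0) \<and> origin_expansion f n' k' (Op r) (\<sigma> r)"
    "at_infinity f P"
    using special unfolding special_point_condition_def Let_def N_def n'_def k'_def by metis
  have pts: "special_points f \<subseteq> points f" by (auto simp: special_points_def)
  have regular: "ord_ge p X 0" if "p \<in> points f" "lies_over f p (c, d)" for p c d
    using that curve_point.ge_regular[of f p X c] by (auto simp: lies_over_iff curve_point_def curve_point_axioms_def plane_curve_axioms)
  have P: "P \<in> points f" "\<not> ord_ge P X 0" using *(1,6) pts at_infinity_iff by auto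
  have Pu: "p = P" if "p \<in> points f" "\<not> ord_ge p X 0" for p
  proof -
    have "p \<in> special_points f" using that by (simp add: special_points_iff)
    then consider r where "r \<in> {1..m}" "p = A r" | r where "r \<in> {1..N}" "p = Op r" | "p = P" unfolding *(1) by blast
    then show ?thesis using *(3,5) regular that by cases blast+
  qed
  have Pinf: "P_inf f = P"
    unfolding P_inf_def
  proof (rule the_equality)
    show "P \<in> points f \<and> at_infinity f P" using P *(6) by simp
    fix p assume "p \<in> points f \<and> at_infinity f p"
    then show "p = P" using Pu at_infinity_iff by blast
  qed
  have O: "O_points f = Op ` {1..N}"
  proof (intro equalityI subsetI)
    fix p assume p: "p \<in> O_points f"
    then have "p \<in> points f" "ord_ge p X 1" by (auto simp: O_points_def lies_over_iff)
    then interpret curve_point f p by unfold_locales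
    have "p \<in> special_points f" using \<open>p \<in> points f\<close> \<open>ord_ge p X 1\<close> by (simp add: special_points_iff)
    then consider r where "r \<in> {1..m}" "p = A r" | "p \<in> Op ` {1..N}" | "p = P" unfolding *(1) by blast
    then show "p \<in> Op ` {1..N}"
    proof cases
      case 1
      then have e: "\<epsilon> r \<noteq> 0" "ord_ge p (X - const ((- 1) ^ n * \<epsilon> r)) 1" using *(3) by (auto simp: lies_over_iff)
      from ge_diff[OF \<open>ord_ge p X 1\<close> e(2)] have "(- 1) ^ n * \<epsilon> r = 0" by (simp add: ge_const_pos_iff)
      then show ?thesis using e(1) by simp
    next
      case 3
      then show ?thesis using P(2) ge_mono[OF \<open>ord_ge p X 1\<close>, of 0] by simp
    qed
  next
    fix p assume "p \<in> Op ` {1..N}"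
    then show "p \<in> O_points f" using *(1,5) pts by (auto simp: O_points_def)
  qed
  have exp: "valuation.eq (ord_ge p) X (int n') \<and> valuation.eq (ord_ge p) Y (int k')" if pO: "p \<in> O_points f" for p
  proof -
    interpret curve_point f p using pO by unfold_locales (simp add: O_points_def)
    obtain r where r: "r \<in> {1..N}" "p = Op r" using pO O by auto
    then obtain u s where u: "u \<in> carrier K" "p u = 1" "s ^ n' = - \<sigma> r"
      "asymp_at p (X mod F) (u ^ n' mod F)" "asymp_at p (Y mod F) ((const (- s) * (u ^ k' mod F)) mod F)"
      using *(5)[OF r(1)] unfolding origin_expansion_def by (auto simp: nat_pow_K x_fun_eq y_fun_eq const_fun_eq)
    have "u \<noteq> 0" using u(2) point by (auto simp: points_def)
    then have "\<not> F dvd u" using K_nonzero u(1) by blast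
    then have "eq u 1" using u(1,2) by (simp add: eq_iff K_carrier)
    have "eq X (int n' * 1)" by (rule asymp_at_eq[OF u(4) eq_power[OF \<open>eq u 1\<close>]])
    have "s \<noteq> 0" using u(3) *(5)[OF r(1)] n'_pos by (auto simp: zero_power)
    have "eq (const (- s) * u ^ k') (0 + int k' * 1)"
      by (intro eq_mult eq_const eq_power \<open>eq u 1\<close>) (use \<open>s \<noteq> 0\<close> in simp)
    then have "eq Y (0 + int k' * 1)" using asymp_at_eq[of Y "const (- s) * u ^ k'"] u(5) by (simp add: mod_mult_right_eq)
    with \<open>eq X (int n' * 1)\<close> show ?thesis by simp
  qed
  show thesis using that[OF *(1)[folded Pinf] *(2,3,4) O exp] P Pu unfolding Pinf by blast
qed

lemma P_inf_point: "P_inf f \<in> points f" and P_inf_pole: "\<not> ord_ge (P_inf f) X 0"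
  and affine_X: "p \<in> points f \<Longrightarrow> p \<noteq> P_inf f \<Longrightarrow> ord_ge p X 0"
  using special_data by metis+

lemma finite_O_points: "finite (O_points f)" and card_O_points: "card (O_points f) = N"
  using special_data card_image by (metis finite_atLeastAtMost finite_imageI, metis card_atLeastAtMost diff_Suc_1)

lemma O_points_point: "p \<in> O_points f \<Longrightarrow> p \<in> points f"
  by (simp add: O_points_def)

lemma O_point_X: "p \<in> O_points f \<Longrightarrow> valuation.eq (ord_ge p) X (int n')"
  and O_point_Y: "p \<in> O_points f \<Longrightarrow> valuation.eq (ord_ge p) Y (int k')"
  using special_data by metis+

lemma finite_special_points: "finite (special_points f)"
  using special_data by (metis finite_Un finite_atLeastAtMost finite_imageI finite.emptyI finite_insert)

lemma point_values:
  assumes "p \<in> points f" "ord_ge p X 0"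
  obtains c d where "lies_over f p (c, d)" "eval_xy f c d = 0"
proof -
  interpret curve_point f p by unfold_locales (rule assms(1))
  obtain c where c: "ord_ge p (X - const c) 1" using X_value[OF assms(2)] .
  obtain d where d: "ord_ge p (Y - const d) 1" using residue[OF Y_regular[OF assms]] .
  show thesis using that[of c d] c d eval_f_eq_0[OF c d] by (simp add: lies_over_iff)
qed

lemma finite_fibre: "finite {d. eval_xy f c d = 0}"
proof -
  define q where "q = map_poly (\<lambda>h. poly h c) f"
  have "poly.coeff q n = poly (lead_coeff f) c" by (simp add: q_def coeff_map_poly degree_f_eq)
  then have "q \<noteq> 0" unfolding lead_coeff_f by (auto simp: poly_power)
  moreover have "poly q d = eval_xy f c d" for d
    unfolding q_def eval_xy_def by (induction f) (simp_all add: Polynomial.map_poly_pCons)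
  ultimately show ?thesis using poly_roots_finite[of q] by simp
qed

text \<open>At a zero of \<open>h\<close> that is not special, x takes a root of the constant
  coefficient of an algebraic relation for \<open>h\<close>, and y one of finitely many values above
  it. By smoothness only one point lies over each such pair.\<close>

lemma finite_zeros:
  assumes "\<not> F dvd h"
  shows "finite {p \<in> points f. ord_ge p h 1}"
proof -
  obtain G where G: "poly.coeff G 0 \<noteq> 0" "F dvd (\<Sum>i\<le>degree G. ev (poly.coeff G i) X * h ^ i)"
    using algebraic_relation_nonzero_constant_term[OF assms] .
  let ?Z = "{p \<in> points f. ord_ge p h 1} - special_points f"
  \<comment> \<open>The origin is excluded because smoothness is only known away from it; the points
    above it are special.\<close>
  define S where "S = (SIGMA c:{c. poly (poly.coeff G 0) c = 0}. {d. eval_xy f c d = 0}) - {(0, 0)}"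
  have S: "finite S" unfolding S_def using poly_roots_finite[OF G(1)] finite_fibre by auto
  have "finite {p \<in> points f. lies_over f p z}" if "z \<in> S" for z
  proof -
    obtain c d where z: "z = (c, d)" by (cases z)
    then have "eval_xy f c d = 0" "(c, d) \<noteq> (0, 0)" using that by (auto simp: S_def)
    then have "eval_xy (map_poly pderiv f) c d \<noteq> 0 \<or> eval_xy (pderiv f) c d \<noteq> 0"
      using smooth unfolding smooth_away_from_origin_def by blast
    then have "p = p'" if "p \<in> points f" "p' \<in> points f" "lies_over f p z" "lies_over f p' z" for p p'
      using point_unique[of p p' c d] that n unfolding z lies_over_iff degree_f_eq
      by (auto simp: curve_point_def curve_point_axioms_def plane_curve_axioms)
    then have "{p \<in> points f. lies_over f p z} \<subseteq> {THE p. p \<in> points f \<and> lies_over f p z}"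
      by (auto intro!: the_equality[symmetric])
    then show ?thesis by (rule finite_subset) simp
  qed
  then have "finite (\<Union>z\<in>S. {p \<in> points f. lies_over f p z})" using S by blast
  moreover have "?Z \<subseteq> (\<Union>z\<in>S. {p \<in> points f. lies_over f p z})"
  proof
    fix p assume p: "p \<in> ?Z"
    then interpret curve_point f p by unfold_locales simp
    have X: "ord_ge p X 0" "\<not> ord_ge p X 1" using p by (auto simp: special_points_iff)
    obtain c d where cd: "lies_over f p (c, d)" "eval_xy f c d = 0" using point_values[OF point X(1)] .
    have h: "ord_ge p h 1" using p by simp
    have "ord_ge p (\<Sum>i<degree G. ev (poly.coeff G (Suc i)) X * h ^ Suc i) 1"
    proof (rule ge_sum)
      fix i
      have "ord_ge p (ev (poly.coeff G (Suc i)) X * h ^ Suc i) (0 + int (Suc i) * 1)"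
        by (intro ge_mult ge_ev ge_power X h)
      then show "ord_ge p (ev (poly.coeff G (Suc i)) X * h ^ Suc i) 1" by (rule ge_mono) simp
    qed
    from ge_diff[OF ord_ge_F[OF G(2)] this] have "ord_ge p (ev (poly.coeff G 0) X) 1"
      by (simp add: sum.atMost_shift)
    from ge_diff[OF this ge_ev_diff[of X c "poly.coeff G 0"]] cd(1)
    have "poly (poly.coeff G 0) c = 0" by (simp add: lies_over_iff ge_const_pos_iff)
    moreover have "(c, d) \<noteq> (0, 0)" using X(2) cd(1) by (auto simp: lies_over_iff)
    ultimately show "p \<in> (\<Union>z\<in>S. {p \<in> points f. lies_over f p z})"
      using cd point by (auto simp: S_def)
  qed
  ultimately have "finite ?Z" by (rule finite_subset[rotated])
  then show ?thesis using finite_special_points by (rule finite_Diff2[THEN iffD1, rotated])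
qed

lemma finite_zeros_and_poles:
  assumes "\<not> F dvd h"
  shows "finite {p \<in> points f. p (h mod F) \<noteq> 0}"
proof -
  obtain g where g: "F dvd g * h - 1" "\<not> F dvd g" using exists_inverse[OF assms] .
  have "{p \<in> points f. p (h mod F) \<noteq> 0} \<subseteq> {p \<in> points f. ord_ge p h 1} \<union> {p \<in> points f. ord_ge p g 1}"
  proof clarify
    fix p assume p: "p \<in> points f" "p (h mod F) \<noteq> 0" "\<not> ord_ge p g 1"
    interpret curve_point f p by unfold_locales (rule p(1))
    have "eq (g * h) (p (g mod F) + p (h mod F))" by (intro eq_mult eq_point g assms)
    then have "p (g mod F) + p (h mod F) = 0" using eq_cong_F[OF g(1)] eq_unique[OF eq_1] by metis
    then show "ord_ge p h 1" using p(2,3) g(2) by (auto simp: ord_ge_def)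
  qed
  then show ?thesis using finite_zeros[OF assms] finite_zeros[OF g(2)] by (meson finite_UnI finite_subset)
qed

end

sublocale spectral_curve \<subseteq> riemann_curve f "P_inf f" "genus_value n m k"
  by unfold_locales (use finite_zeros_and_poles P_inf_point P_inf_pole affine_X gen in blast)+

sublocale spectral_curve \<subseteq> inf: curve_point f "P_inf f"
  by unfold_locales (rule P_inf_point)

section \<open>Orders and leading terms of x, y and \<open>y ^ a - x ^ b\<close> at P\<close>

context spectral_curve begin

lemma X_eq_0: "p \<in> points f \<Longrightarrow> p \<noteq> P_inf f \<Longrightarrow> p \<notin> O_points f \<Longrightarrow> valuation.eq (ord_ge p) X 0"
proof -
  assume p: "p \<in> points f" "p \<noteq> P_inf f" "p \<notin> O_points f"
  interpret curve_point f p by unfold_locales (rule p(1))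
  have X: "ord_ge p X 0" using affine_X p by blast
  have "\<not> ord_ge p X 1"
  proof
    assume X1: "ord_ge p X 1"
    then have "p \<in> special_points f" using p(1) by (simp add: special_points_iff)
    moreover obtain \<epsilon> :: "nat \<Rightarrow> complex" and A Op where sp: "special_points f = A ` {1..m} \<union> Op ` {1..N} \<union> {P_inf f}"
      "\<And>r. r \<in> {1..m} \<Longrightarrow> \<epsilon> r \<noteq> 0 \<and> lies_over f (A r) ((- 1) ^ n * \<epsilon> r, 0)" "O_points f = Op ` {1..N}"
      using special_data by metis
    ultimately obtain r where r: "r \<in> {1..m}" "p = A r" using p(2,3) by auto
    then have e: "\<epsilon> r \<noteq> 0" "ord_ge p (X - const ((- 1) ^ n * \<epsilon> r)) 1" using sp(2) by (auto simp: lies_over_iff)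
    from ge_diff[OF X1 e(2)] have "(- 1) ^ n * \<epsilon> r = 0" by (simp add: ge_const_pos_iff)
    then show False using e(1) by simp
  qed
  with X show ?thesis by (simp add: eq_def)
qed

lemma P_inf_not_O: "P_inf f \<notin> O_points f"
proof
  assume "P_inf f \<in> O_points f"
  then have "ord_ge (P_inf f) X 1" by (simp add: O_points_def lies_over_iff)
  then have "ord_ge (P_inf f) X 0" by (rule inf.ge_mono) simp
  then show False using P_inf_pole by simp
qed

text \<open>A principal divisor has degree 0, and x has \<open>N\<close> zeros, each of order
  \<open>n'\<close>, with \<open>n' N = n\<close>.\<close>

lemma X_P: "inf.eq X (- int n)"
proof -
  have keys: "Poly_Mapping.keys (pdiv X) \<subseteq> O_points f \<union> {P_inf f}"
  proof
    fix p assume p: "p \<in> Poly_Mapping.keys (pdiv X)"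
    then have "mult_at (pdiv X) p \<noteq> 0" by (simp add: in_keys_iff)
    then show "p \<in> O_points f \<union> {P_inf f}"
      using mult_at_pdiv_outside[OF not_F_dvd_X] pdiv_eqI[OF _ X_eq_0] by blast
  qed
  have "0 = div_degree (pdiv X)" using not_F_dvd_X by simp
  also have "\<dots> = (\<Sum>p\<in>O_points f \<union> {P_inf f}. mult_at (pdiv X) p)"
    using keys finite_O_points by (intro div_degree_eq) auto
  also have "\<dots> = (\<Sum>p\<in>O_points f. int n') + mult_at (pdiv X) (P_inf f)"
    using finite_O_points P_inf_not_O pdiv_eqI[OF O_points_point O_point_X] by simp
  also have "(\<Sum>p\<in>O_points f. int n') = int n" using card_O_points arg_cong[OF n'N, of int] by (simp add: mult.commute)
  finally have "mult_at (pdiv X) (P_inf f) = - int n" by simp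
  then show ?thesis using pdiv_eq[OF not_F_dvd_X P_inf_point] by simp
qed

lemma not_F_dvd_Y: "\<not> F dvd Y"
  by (rule degree_less_not_F_dvd) (use n in \<open>simp_all add: Y_def emb_pCons degree_f_eq\<close>)

text \<open>Up to sign the edge part of \<open>f\<close> is \<open>Z ^ M\<close>, so on the curve
  \<open>Z ^ M\<close> equals \<open>rest\<close> up to sign, whose pole order at \<open>P\<close>
  is smaller than that of \<open>Y ^ n\<close>.\<close>

definition Z :: rat_fun where "Z = Y ^ a - X ^ b"

lemma F_dvd_Z_rest: "F dvd const ((- 1) ^ n) * Z ^ M + emb rest"
  using F_dvd_emb_f by (simp add: emb_f Z_def)

lemma Z_power_eq_iff: "inf.eq (Z ^ M) d \<longleftrightarrow> inf.eq (emb rest) d"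
proof -
  have "inf.eq (Z ^ M) d \<longleftrightarrow> inf.eq (const ((- 1) ^ n) * Z ^ M) (0 + d)"
    by (rule inf.eq_mult_cancel[symmetric]) (rule inf.eq_const, simp)
  also have "\<dots> \<longleftrightarrow> inf.eq (- emb rest) d"
    unfolding add_0 by (rule inf.eq_cong_F) (use F_dvd_Z_rest in simp)
  finally show ?thesis by simp
qed

text \<open>If \<open>Y ^ a\<close> and \<open>X ^ b\<close> had different orders, the smaller one
  would pass to \<open>Z\<close>, and \<open>Z ^ M\<close> would have a smaller order than every
  monomial of \<open>rest\<close>, to which it is equal up to sign.\<close>

lemma Y_P: "inf.eq Y (- int (m + k))"
proof -
  obtain e where e: "inf.eq Y e" using inf.eq_point[OF not_F_dvd_Y] by blast
  define s where "s = int (m + k)"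
  have rest_w: "int n * int j + s * int i < int n * s" if "coeff_xy rest j i \<noteq> 0" for j i
    using rest_weight[OF that] M_pos by (simp add: W_def s_def)
  have rest_i: "int i \<le> int n" if "coeff_xy rest j i \<noteq> 0" for j i
    using that rest_coeff_0[of i] by (cases "i \<ge> n") (auto simp: coeff_xy_def)
  have mon: "ord_ge (P_inf f) (X ^ j * Y ^ i) (- (int n * int j) + int i * e)" for j i
    using inf.ge_mult[OF inf.ge_power[OF inf.eq_imp_ge[OF X_P]] inf.ge_power[OF inf.eq_imp_ge[OF e]]]
    by (simp add: mult.commute)
  have w: "int a * s = int b * int n" using arg_cong[OF a_weight, of int] unfolding s_def of_nat_mult .
  have Ya: "inf.eq (Y ^ a) (int a * e)" and Xb: "inf.eq (X ^ b) (- (int a * s))"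
    using inf.eq_power[OF e] inf.eq_power[OF X_P, of b] w by simp_all
  have aM': "int M * int a = int n" using arg_cong[OF aM, of int] unfolding of_nat_mult by (simp only: mult.commute)
  consider "e > - s" | "e < - s" | "e = - s" by linarith
  then show ?thesis
  proof cases
    case 1
    then have "- (int a * s) + 1 \<le> int a * e"
    proof -
      have "int a * 1 \<le> int a * (e + s)" using 1 by (intro mult_left_mono) auto
      then show ?thesis using a_pos by (simp add: algebra_simps)
    qed
    then have "ord_ge (P_inf f) (Y ^ a) (- (int a * s) + 1)" using inf.ge_mono[OF inf.eq_imp_ge[OF Ya]] by blast
    then have "inf.eq (- (X ^ b) + Y ^ a) (- (int a * s))" using Xb by (intro inf.eq_add_ge) simp_all
    then have "inf.eq (Z ^ M) (int M * (- (int a * s)))" by (intro inf.eq_power) (simp add: Z_def)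
    then have "inf.eq (emb rest) (- (int n * s))" unfolding Z_power_eq_iff using aM' by (simp flip: mult.assoc)
    moreover have "ord_ge (P_inf f) (emb rest) (- (int n * s) + 1)"
    proof (rule inf.ge_emb_bound)
      fix j i assume c: "coeff_xy rest j i \<noteq> 0"
      have "- (int n * s) + 1 \<le> - (int n * int j) + int i * e"
      proof -
        have "int i * (- s) \<le> int i * e" using 1 by (intro mult_left_mono) auto
        then show ?thesis using rest_w[OF c] by (simp add: algebra_simps)
      qed
      then show "ord_ge (P_inf f) (X ^ j * Y ^ i) (- (int n * s) + 1)" using inf.ge_mono[OF mon] by blast
    qed
    ultimately show ?thesis by (simp add: inf.eq_def)
  next
    case 2
    then have "int a * e + 1 \<le> - (int a * s)"
    proof -
      have "int a * 1 \<le> int a * (- e - s)" using 2 by (intro mult_left_mono) auto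
      then show ?thesis using a_pos by (simp add: algebra_simps)
    qed
    then have "ord_ge (P_inf f) (- (X ^ b)) (int a * e + 1)" using inf.ge_mono[OF inf.eq_imp_ge[OF Xb]] by simp
    then have "inf.eq (Y ^ a + - (X ^ b)) (int a * e)" using Ya by (intro inf.eq_add_ge)
    then have "inf.eq (Z ^ M) (int M * (int a * e))" by (intro inf.eq_power) (simp add: Z_def)
    then have "inf.eq (emb rest) (int n * e)" unfolding Z_power_eq_iff using aM' by (simp flip: mult.assoc)
    moreover have "ord_ge (P_inf f) (emb rest) (int n * e + 1)"
    proof (rule inf.ge_emb_bound)
      fix j i assume c: "coeff_xy rest j i \<noteq> 0"
      have "int n * e + 1 \<le> - (int n * int j) + int i * e"
      proof -
        have "int n * (s + e) \<le> int i * (s + e)" using 2 rest_i[OF c] by (intro mult_right_mono_neg) auto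
        then show ?thesis using rest_w[OF c] by (simp add: algebra_simps)
      qed
      then show "ord_ge (P_inf f) (X ^ j * Y ^ i) (int n * e + 1)" using inf.ge_mono[OF mon] by blast
    qed
    ultimately show ?thesis by (simp add: inf.eq_def)
  next
    case 3
    then show ?thesis using e by (simp add: s_def)
  qed
qed

lemma monomial_P: "inf.eq (X ^ j * Y ^ i) (- (int n * int j + int (m + k) * int i))"
  using inf.eq_mult[OF inf.eq_power[OF X_P, of j] inf.eq_power[OF Y_P, of i]] by (simp add: algebra_simps)

lemma rest_P_ge: "ord_ge (P_inf f) (emb rest) (- W)"
  using inf.ge_emb_bound rest_weight inf.ge_mono[OF inf.eq_imp_ge[OF monomial_P]] by (meson neg_le_iff_le)

text \<open>As \<open>W = M (b n - 1)\<close>, it suffices to divide the bound \<open>- W\<close>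
  for the order of \<open>Z ^ M\<close> by \<open>M\<close>.\<close>

lemma Z_P_ge: "ord_ge (P_inf f) Z (1 - int (b * n))"
proof (rule ccontr)
  assume "\<not> ?thesis"
  then obtain e where e: "e < 1 - int (b * n)" "inf.eq Z e" using inf.ge_or_eq by blast
  have "inf.eq (emb rest) (int M * e)" using inf.eq_power[OF e(2)] by (simp flip: Z_power_eq_iff)
  then have "- W \<le> int M * e" using rest_P_ge inf.eq_ge_iff by blast
  moreover have "int M * e \<le> int M * (- int (b * n))" using e(1) by (intro mult_left_mono) auto
  moreover have "int M * int (b * n) = int n * int (m + k)"
    using arg_cong[OF bM, of int] unfolding of_nat_mult by (metis mult.assoc mult.commute)
  ultimately show False using M_pos unfolding W_def by linarith
qed

text \<open>Differences of points of \<open>L_c\<close> are multiples of \<open>(b, - a)\<close>, and \<open>y^a / x^b\<close> takes the value 1 at \<open>P\<close>.\<close>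

lemma monomials_asymp_le:
  assumes eqn: "n * j + (m + k) * i = n * j' + (m + k) * i'" and w: "int n * int j + int (m + k) * int i = w"
    and le: "i' \<le> i"
  shows "ord_ge (P_inf f) (X ^ j * Y ^ i - X ^ j' * Y ^ i') (1 - w)"
proof -
  define d where "d = i - i'"
  have i: "i = i' + d" using le by (simp add: d_def)
  have "n * j + (m + k) * d = n * j'" using eqn by (simp add: i algebra_simps)
  then have "a * M * j + b * M * d = a * M * j'" unfolding aM bM .
  then have "M * (a * j + b * d) = M * (a * j')" by (simp add: algebra_simps)
  then have e: "a * j + b * d = a * j'" using M_pos by simp
  then have "a dvd b * d" by (metis dvd_add_right_iff dvd_triv_left)
  moreover have "coprime a b"
    unfolding a_def b_def M_def by (rule div_gcd_coprime) (use n in simp)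
  ultimately have "a dvd d" by (simp add: coprime_dvd_mult_right_iff)
  then obtain c where d: "d = a * c" ..
  then have "a * (j + b * c) = a * j'" using e by (simp add: algebra_simps)
  then have j': "j' = j + b * c" using a_pos by simp
  have YX: "ord_ge (P_inf f) ((Y ^ a) ^ c - (X ^ b) ^ c) (1 - int (b * n) * int c)"
  proof (induction c)
    case (Suc c)
    have ab: "int a * int (m + k) = int (b * n)" using arg_cong[OF a_weight, of int] unfolding of_nat_mult .
    have "ord_ge (P_inf f) (Y ^ a) (- int (b * n))"
      using inf.ge_power[OF inf.eq_imp_ge[OF Y_P], of a] unfolding mult_minus_right ab .
    moreover have "ord_ge (P_inf f) ((X ^ b) ^ c) (- int (b * n) * int c)"
      using inf.ge_power[OF inf.ge_power[OF inf.eq_imp_ge[OF X_P], of b], of c] by (simp add: mult_ac)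
    moreover have "ord_ge (P_inf f) (Y ^ a - X ^ b) (- int (b * n) + 1)" using Z_P_ge by (simp add: Z_def add.commute)
    moreover have "ord_ge (P_inf f) ((Y ^ a) ^ c - (X ^ b) ^ c) (- int (b * n) * int c + 1)" using Suc by (simp add: add.commute)
    ultimately have "ord_ge (P_inf f) (Y ^ a * (Y ^ a) ^ c - X ^ b * (X ^ b) ^ c) (- int (b * n) + - int (b * n) * int c + 1)"
      by (intro inf.asymp_mult)
    moreover have "- int (b * n) + - int (b * n) * int c + 1 = 1 - int (b * n) * int (Suc c)" by (simp add: algebra_simps)
    ultimately show ?case unfolding power_Suc by simp
  qed simp
  have "ord_ge (P_inf f) ((X ^ j * Y ^ i') * ((Y ^ a) ^ c - (X ^ b) ^ c)) (- (int n * int j + int (m + k) * int i') + (1 - int (b * n) * int c))"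
    by (rule inf.ge_mult[OF inf.eq_imp_ge[OF monomial_P] YX])
  moreover have "(X ^ j * Y ^ i') * ((Y ^ a) ^ c - (X ^ b) ^ c) = X ^ j * Y ^ i - X ^ j' * Y ^ i'"
  proof -
    have "Y ^ i = Y ^ i' * (Y ^ a) ^ c" "X ^ j' = X ^ j * (X ^ b) ^ c"
      by (simp_all only: i d j' power_add power_mult)
    then show ?thesis by (simp only: algebra_simps)
  qed
  moreover have "- (int n * int j + int (m + k) * int i') + (1 - int (b * n) * int c) = 1 - w"
  proof -
    have "int (b * n) * int c = int (m + k) * int d" using arg_cong[OF a_weight, of "\<lambda>w. int (w * c)"] unfolding d by (simp only: of_nat_mult mult_ac)
    then show ?thesis using w by (simp add: i algebra_simps)
  qed
  ultimately show ?thesis by (simp only:)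
qed

lemma monomials_asymp:
  assumes "n * j + (m + k) * i = n * j' + (m + k) * i'" "int n * int j + int (m + k) * int i = w"
  shows "ord_ge (P_inf f) (X ^ j * Y ^ i - X ^ j' * Y ^ i') (1 - w)"
proof (cases "i' \<le> i")
  case False
  have "int n * int j' + int (m + k) * int i' = w"
    using assms(2) arg_cong[OF assms(1), of int] unfolding of_nat_add of_nat_mult by linarith
  then have "ord_ge (P_inf f) (X ^ j' * Y ^ i' - X ^ j * Y ^ i) (1 - w)"
    using monomials_asymp_le[OF assms(1)[symmetric]] False by simp
  then show ?thesis using inf.ge_minus_commute by blast
qed (use monomials_asymp_le[OF assms] in simp)

lemma Lc_iff: "(j, i) \<in> Lc \<longleftrightarrow> int n * int j + int (m + k) * int i = W"
proof -
  have "n * 1 \<le> n * (m + k)" using m by (intro mult_left_mono) auto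
  then have "gcd n (m + k) \<le> n * (m + k)" using M_le unfolding M_def by linarith
  then have W: "int (n * (m + k) - gcd n (m + k)) = W" by (simp add: of_nat_diff W_def M_def)
  have "(j, i) \<in> Lc \<longleftrightarrow> int ((m + k) * i + n * j) = int (n * (m + k) - gcd n (m + k))"
    unfolding of_nat_eq_iff by (simp add: Lc_def)
  then show ?thesis unfolding W by (simp add: add.commute)
qed

lemma finite_Lc: "finite Lc"
proof (rule finite_subset)
  show "Lc \<subseteq> {..n * (m + k)} \<times> {..n * (m + k)}"
  proof clarify
    fix j i assume "(j, i) \<in> Lc"
    then have "(m + k) * i + n * j \<le> n * (m + k)" by (simp add: Lc_def)
    moreover have "i \<le> (m + k) * i" "j \<le> n * j" using m n by simp_all
    ultimately have "j \<le> n * (m + k)" "i \<le> n * (m + k)" by linarith+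
    then show "j \<in> {..n * (m + k)} \<and> i \<in> {..n * (m + k)}" by simp
  qed
qed simp

lemma Lc_less: "(j, i) \<in> Lc \<Longrightarrow> i < n"
proof (rule ccontr)
  assume ji: "(j, i) \<in> Lc" and "\<not> i < n"
  then have "int (m + k) * int n \<le> int (m + k) * int i" by (intro mult_left_mono) auto
  moreover have "0 \<le> int n * int j" by simp
  ultimately show False using ji M_pos unfolding Lc_iff W_def mult.commute[of "int n" "int (m + k)"] by linarith
qed

text \<open>If \<open>n - i\<close> and \<open>j\<close> were even, \<open>M = (m + k) (n - i) - n j\<close> would be divisible by \<open>2 M\<close>.\<close>

lemma Lc_sign: "(j, i) \<in> Lc \<Longrightarrow> (- 1) ^ ((n - i - 1) * j + i) = (- 1 :: complex) ^ Suc n"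
proof -
  assume ji: "(j, i) \<in> Lc"
  define c where "c = n - i"
  have i: "i < n" "n = i + c" using Lc_less[OF ji] by (simp_all add: c_def)
  have eqM: "int (m + k) * int c - int n * int j = int M"
    using ji i(2) unfolding Lc_iff W_def by (simp add: algebra_simps)
  have "\<not> (even c \<and> even j)"
  proof
    assume ev: "even c \<and> even j"
    then obtain c' j' where cj: "c = 2 * c'" "j = 2 * j'" by blast
    have "int M dvd int (m + k) * int c' - int n * int j'"
      unfolding M_def by (intro dvd_diff dvd_mult2) (simp_all del: of_nat_add)
    then obtain e where "int (m + k) * int c' - int n * int j' = int M * e" ..
    then have "int M * (2 * e) = 2 * (int (m + k) * int c' - int n * int j')" by simp
    also have "\<dots> = int M" using eqM by (simp add: cj algebra_simps)
    finally have "int M * (2 * e) = int M * 1" by simp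
    then have "2 * e = 1" using M_pos by simp
    then show False by presburger
  qed
  moreover have "even ((n - i - 1) * j + i) \<longleftrightarrow> even (Suc n)" if "\<not> (even c \<and> even j)"
    using that i by (cases "even j"; cases "even i") auto
  ultimately show ?thesis by (metis neg_one_even_power neg_one_odd_power)
qed

text \<open>Hence the edge part has no term on \<open>Lc\<close>, where the weight is smaller by
  \<open>M\<close>.\<close>

lemma edge_homogeneous: "homogeneous_xy n (m + k) (n * (m + k)) (edge_poly n m k)"
proof -
  have "homogeneous_xy n (m + k) (b * n) ([:0, 1:] ^ a - [:[:0, 1:]:] ^ b)"
    using homogeneous_xy_power[OF homogeneous_xy_y, of n "m + k" a] homogeneous_xy_power[OF homogeneous_xy_x, of n "m + k" b]
    unfolding a_weight by (rule homogeneous_xy_diff)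
  moreover have "M * (b * n) = n * (m + k)" unfolding bM[symmetric] by (simp only: mult_ac)
  moreover note homogeneous_xy_power[OF calculation(1), of M]
  ultimately
  have "homogeneous_xy n (m + k) (0 + n * (m + k)) ([:[:(- 1) ^ n:]:] * ([:0, 1:] ^ a - [:[:0, 1:]:] ^ b) ^ M)"
    using \<open>M * (b * n) = n * (m + k)\<close> by (intro homogeneous_xy_mult homogeneous_xy_const) (simp only:)
  moreover have "[:[:(- 1) ^ e:]:] = (- 1 :: complex poly poly) ^ e" for e
  proof (induction e)
    case (Suc e)
    have "[:[:(- 1) ^ Suc e:]:] = - [:[:(- 1 :: complex) ^ e:]:]" by simp
    then show ?case using Suc by simp
  qed (simp add: one_pCons)
  ultimately show ?thesis by (simp add: edge_eq)
qed

lemma coeff_rest_Lc: "(j, i) \<in> Lc \<Longrightarrow> coeff_xy rest j i = coeff_xy f j i"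
proof -
  assume ji: "(j, i) \<in> Lc"
  have "coeff_xy (edge_poly n m k) j i = 0"
  proof (rule ccontr)
    assume "coeff_xy (edge_poly n m k) j i \<noteq> 0"
    then have "n * j + (m + k) * i = n * (m + k)" using edge_homogeneous by (simp add: homogeneous_xy_def)
    then have "int n * int j + int (m + k) * int i = int n * int (m + k)" by (simp flip: of_nat_mult of_nat_add)
    then show False using ji M_pos by (simp add: Lc_iff W_def)
  qed
  then show ?thesis by (simp add: rest_def coeff_xy_def)
qed

lemma fc_eq: "f_c n m k f = (- 1) ^ Suc n * (\<Sum>(j, i)\<in>Lc. coeff_xy f j i)"
  unfolding f_c_def Lc_def[symmetric] sum_distrib_left
  by (rule sum.cong[OF refl]) (use Lc_sign in \<open>auto simp: case_prod_beta\<close>)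

lemma Lc_nonempty: obtains j i where "(j, i) \<in> Lc"
proof -
  have "Lc \<noteq> {}" using fc fc_eq by auto
  then show thesis using that by fast
qed

text \<open>All monomials on \<open>Lc\<close> have the same leading term at \<open>P\<close> and
  the others have larger order, so the leading coefficient is the sum of the coefficients on
  \<open>Lc\<close>, which is \<open>f_c\<close> up to sign.\<close>

lemma rest_asymp:
  assumes "(j0, i0) \<in> Lc"
  shows "ord_ge (P_inf f) (emb rest - const ((- 1) ^ Suc n * f_c n m k f) * (X ^ j0 * Y ^ i0)) (1 - W)"
proof -
  let ?mon = "\<lambda>(j, i). X ^ j * Y ^ i" and ?c = "\<lambda>(j, i). coeff_xy rest j i"
  define T where "T = {(j, i). coeff_xy rest j i \<noteq> 0} \<union> Lc"
  have T: "finite T" unfolding T_def using finite_support_xy finite_Lc by blast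
  have "emb rest = (\<Sum>z\<in>T. const (?c z) * ?mon z)"
    using emb_sum_support[OF T, of rest] by (simp add: T_def case_prod_beta mult.assoc)
  also have "\<dots> = (\<Sum>z\<in>Lc. const (?c z) * ?mon z) + (\<Sum>z\<in>T - Lc. const (?c z) * ?mon z)"
    using sum.subset_diff[of Lc T] T by (simp add: T_def add.commute)
  finally have eqn: "emb rest = (\<Sum>z\<in>Lc. const (?c z) * ?mon z) + (\<Sum>z\<in>T - Lc. const (?c z) * ?mon z)" .
  have "ord_ge (P_inf f) (\<Sum>z\<in>T - Lc. const (?c z) * ?mon z) (1 - W)"
  proof (rule inf.ge_sum)
    fix z assume z: "z \<in> T - Lc"
    obtain j i where ji: "z = (j, i)" by (cases z)
    have "int n * int j + int (m + k) * int i \<le> W" "int n * int j + int (m + k) * int i \<noteq> W"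
      using z rest_weight[of j i] by (auto simp: T_def ji Lc_iff)
    then have "ord_ge (P_inf f) (X ^ j * Y ^ i) (1 - W)"
      by (intro inf.ge_mono[OF inf.eq_imp_ge[OF monomial_P]]) simp
    then show "ord_ge (P_inf f) (const (?c z) * ?mon z) (1 - W)" unfolding ji prod.case by (rule inf.ge_const_mult)
  qed
  moreover have "ord_ge (P_inf f) (\<Sum>z\<in>Lc. const (?c z) * (?mon z - X ^ j0 * Y ^ i0)) (1 - W)"
  proof (rule inf.ge_sum)
    fix z assume z: "z \<in> Lc"
    obtain j i where ji: "z = (j, i)" by (cases z)
    have "n * j + (m + k) * i = n * j0 + (m + k) * i0" using z assms by (simp add: Lc_def ji)
    moreover have "int n * int j + int (m + k) * int i = W" using z by (simp add: ji Lc_iff)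
    ultimately show "ord_ge (P_inf f) (const (?c z) * (?mon z - X ^ j0 * Y ^ i0)) (1 - W)"
      unfolding ji prod.case by (intro inf.ge_const_mult monomials_asymp)
  qed
  moreover have "(\<Sum>z\<in>Lc. const (?c z)) = const ((- 1) ^ Suc n * f_c n m k f)"
  proof -
    have hom: "const (sum h A) = (\<Sum>z\<in>A. const (h z))" for h :: "nat \<times> nat \<Rightarrow> complex" and A
      by (induction A rule: infinite_finite_induct) (simp_all add: const_add)
    have "(\<Sum>z\<in>Lc. ?c z) = (\<Sum>(j, i)\<in>Lc. coeff_xy f j i)"
      by (rule sum.cong[OF refl]) (use coeff_rest_Lc in auto)
    also have "\<dots> = (- 1) ^ Suc n * f_c n m k f"
      unfolding fc_eq mult.assoc[symmetric] by (simp flip: power_mult_distrib)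
    finally show ?thesis using hom[of ?c Lc] by simp
  qed
  then have "emb rest - const ((- 1) ^ Suc n * f_c n m k f) * (X ^ j0 * Y ^ i0) =
      (\<Sum>z\<in>Lc. const (?c z) * (?mon z - X ^ j0 * Y ^ i0)) + (\<Sum>z\<in>T - Lc. const (?c z) * ?mon z)"
    unfolding eqn right_diff_distrib sum_subtractf sum_distrib_right[symmetric] by simp
  ultimately show ?thesis using inf.ge_add by simp
qed

text \<open>The sign of the edge part cancels the one in \<open>fc_eq\<close>, so the leading
  coefficient is \<open>f_c\<close> itself.\<close>

lemma Z_power_asymp:
  assumes "(j0, i0) \<in> Lc"
  shows "ord_ge (P_inf f) (Z ^ M - const (f_c n m k f) * (X ^ j0 * Y ^ i0)) (1 - W)"
proof -
  let ?s = "const ((- 1) ^ n)" and ?t = "const (f_c n m k f) * (X ^ j0 * Y ^ i0)"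
  have ss: "?s * (?s * h) = h" for h
    by (simp add: mult.assoc[symmetric] flip: const_mult power_mult_distrib)
  have "ord_ge (P_inf f) (?s * Z ^ M + emb rest - (emb rest - const ((- 1) ^ Suc n * f_c n m k f) * (X ^ j0 * Y ^ i0))) (1 - W)"
    by (intro inf.ge_diff rest_asymp assms ord_ge_F F_dvd_Z_rest)
  also have "?s * Z ^ M + emb rest - (emb rest - const ((- 1) ^ Suc n * f_c n m k f) * (X ^ j0 * Y ^ i0)) = ?s * (Z ^ M - ?t)"
    by (simp add: const_mult const_uminus algebra_simps)
  finally have "ord_ge (P_inf f) (?s * (?s * (Z ^ M - ?t))) (1 - W)" by (rule inf.ge_const_mult)
  then show ?thesis unfolding ss .
qed

text \<open>Because \<open>f_c\<close> is nonzero, \<open>Z ^ M\<close> has order exactly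
  \<open>- W\<close>, and an M-th root can be taken of this equality.\<close>

lemma Z_P: "inf.eq Z (1 - int (b * n))"
proof -
  obtain j i where ji: "(j, i) \<in> Lc" using Lc_nonempty .
  have "inf.eq (X ^ j * Y ^ i) (- W)" using monomial_P[of j i] ji unfolding Lc_iff by (simp only:)
  then have "inf.eq (const (f_c n m k f) * (X ^ j * Y ^ i)) (0 + - W)"
    by (intro inf.eq_mult inf.eq_const fc)
  then have "inf.eq (Z ^ M) (- W)" using inf.eq_cong[of "Z ^ M" _ "- W"] Z_power_asymp[OF ji] by simp
  moreover have "- W = int M * (1 - int (b * n))"
  proof -
    have "int M * int (b * n) = int n * int (m + k)"
      using arg_cong[OF bM, of int] unfolding of_nat_mult by (metis mult.assoc mult.commute)
    then show ?thesis unfolding W_def right_diff_distrib by linarith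
  qed
  moreover have "M = Suc (M - 1)" using M_pos by simp
  ultimately show ?thesis using inf.eq_power_iff[of Z "M - 1"] by metis
qed

text \<open>The edge part contributes \<open>M a Z ^ (M - 1) Y ^ (a - 1)\<close> up to sign, of
  known order. Differentiation takes a factor of pole order \<open>m + k\<close> from each monomial
  of \<open>rest\<close>, which leaves strictly larger orders.\<close>

lemma pderiv_f_P: "inf.eq (emb (pderiv f)) (int M - 1 - int (n - 1) * int (m + k))"
proof -
  interpret e: comm_ring_hom emb by (rule comm_ring_hom_emb)
  let ?y = "[:0, 1:] :: complex poly poly" and ?x = "[:[:0, 1:]:] :: complex poly poly"
  let ?d = "int M - 1 - int (n - 1) * int (m + k)"
  have pw: "pderiv (q ^ c) = of_nat c * q ^ (c - 1) * pderiv q" for q :: "complex poly poly" and c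
  proof (cases c)
    case (Suc d)
    have "pderiv (q ^ c) = [:of_nat c:] * q ^ d * pderiv q" unfolding Suc pderiv_power_Suc by simp
    then show ?thesis by (simp add: Suc of_nat_poly[of "Suc d", where ?'a = "complex poly"] del: of_nat_Suc mult_pCons_left)
  qed simp
  have x: "pderiv (?x ^ b) = 0" and y: "pderiv (?y ^ a) = of_nat a * ?y ^ (a - 1)" and s: "pderiv ((- 1) ^ n :: complex poly poly) = 0"
    by (simp_all add: pw pderiv_pCons pderiv_minus flip: one_pCons)
  have "pderiv (edge_poly n m k) = (- 1) ^ n * (of_nat M * (?y ^ a - ?x ^ b) ^ (M - 1) * (of_nat a * ?y ^ (a - 1)))"
    by (simp add: edge_eq pderiv_mult s pw[of _ M] pderiv_diff x y)
  moreover have "emb (of_nat c) = const (of_nat c)" for c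
    by (induction c) (simp_all add: const_add)
  ultimately have "emb (pderiv (edge_poly n m k)) = const ((- 1) ^ n * of_nat M * of_nat a) * (Z ^ (M - 1) * Y ^ (a - 1))"
    by (simp add: e.hom_mult e.hom_power e.hom_uminus Z_def X_def Y_def const_mult const_power const_uminus mult_ac)
  moreover have "inf.eq (const ((- 1) ^ n * of_nat M * of_nat a) * (Z ^ (M - 1) * Y ^ (a - 1)))
      (0 + (int (M - 1) * (1 - int (b * n)) + int (a - 1) * (- int (m + k))))"
    by (intro inf.eq_mult inf.eq_const inf.eq_power Z_P Y_P) (use M_pos a_pos in simp)
  moreover have "0 + (int (M - 1) * (1 - int (b * n)) + int (a - 1) * (- int (m + k))) = ?d"
  proof -
    have "int (b * n) = int a * int (m + k)" using arg_cong[OF a_weight, of int] unfolding of_nat_mult by simp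
    moreover have "int M * (int a * int (m + k)) = int n * int (m + k)"
      using arg_cong[OF aM, of int] unfolding of_nat_mult by (metis mult.assoc mult.commute)
    moreover have "int (M - 1) = int M - 1" "int (a - 1) = int a - 1" "int (n - 1) = int n - 1"
      using M_pos a_pos n by (simp_all add: of_nat_diff)
    ultimately show ?thesis
      by (simp only: left_diff_distrib right_diff_distrib mult_minus_right mult_1 mult_1_right)
  qed
  ultimately have "inf.eq (emb (pderiv (edge_poly n m k))) ?d" by simp
  moreover have "ord_ge (P_inf f) (emb (pderiv rest)) (?d + 1)"
  proof (rule inf.ge_emb_bound)
    fix j i assume "coeff_xy (pderiv rest) j i \<noteq> 0"
    then have "coeff_xy rest j (Suc i) \<noteq> 0" by (auto simp: coeff_xy_def coeff_pderiv of_nat_poly simp del: of_nat_Suc)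
    from rest_weight[OF this]
    have "?d + 1 \<le> - (int n * int j + int (m + k) * int i)" using n by (simp add: W_def of_nat_diff algebra_simps)
    then show "ord_ge (P_inf f) (X ^ j * Y ^ i) (?d + 1)" by (rule inf.ge_mono[OF inf.eq_imp_ge[OF monomial_P]])
  qed
  moreover have "emb (pderiv f) = emb (pderiv (edge_poly n m k)) + emb (pderiv rest)"
    by (simp add: rest_def flip: fract_poly_add pderiv_add)
  ultimately show ?thesis using inf.eq_add_ge by simp
qed

end

section \<open>Banded matrices\<close>

text \<open>\<open>banded n w l A\<close> says that the infinite array \<open>(s, t) \<mapsto> band_coeff n A s t\<close>, which is periodic
  under \<open>(s, t) \<mapsto> (s + n, t + n)\<close>, is supported on \<open>l \<le> t - s \<le> w\<close> with entries 1 for \<open>t - s = w\<close>.\<close>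

definition band_coeff :: "nat \<Rightarrow> (nat \<Rightarrow> nat \<Rightarrow> complex poly) \<Rightarrow> nat \<Rightarrow> nat \<Rightarrow> complex" where
  "band_coeff n A s t = poly.coeff (A s (t mod n)) (t div n)"

definition banded :: "nat \<Rightarrow> nat \<Rightarrow> nat \<Rightarrow> (nat \<Rightarrow> nat \<Rightarrow> complex poly) \<Rightarrow> bool" where
  "banded n w l A \<longleftrightarrow> (\<forall>s<n. \<forall>t. (band_coeff n A s t \<noteq> 0 \<longrightarrow> s + l \<le> t \<and> t \<le> s + w) \<and>
     (t = s + w \<longrightarrow> band_coeff n A s t = 1))"

text \<open>The offset \<open>r + d n - c\<close> of the term \<open>x ^ d\<close> at
  \<open>(r, c)\<close> is the negative of the difference of indices that defines the band of Lax
  matrices.\<close>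

definition banded_mat :: "nat \<Rightarrow> nat \<Rightarrow> nat \<Rightarrow> complex poly mat \<Rightarrow> bool" where
  "banded_mat n w l B \<longleftrightarrow> B \<in> carrier_mat n n \<and> (\<forall>r<n. \<forall>c<n. \<forall>d.
     (poly.coeff (B $$ (r, c)) d \<noteq> 0 \<longrightarrow> int l \<le> int r + int d * int n - int c \<and> int r + int d * int n - int c \<le> int w) \<and>
     (int r + int d * int n - int c = int w \<longrightarrow> poly.coeff (B $$ (r, c)) d = 1))"

lemma banded_matD:
  assumes "banded_mat n w l B" "r < n" "c < n"
  shows "poly.coeff (B $$ (r, c)) d \<noteq> 0 \<Longrightarrow> int l \<le> int r + int d * int n - int c"
    and "poly.coeff (B $$ (r, c)) d \<noteq> 0 \<Longrightarrow> int r + int d * int n - int c \<le> int w"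
    and "int r + int d * int n - int c = int w \<Longrightarrow> poly.coeff (B $$ (r, c)) d = 1"
  using assms unfolding banded_mat_def by blast+

text \<open>Reversing rows and columns turns the offset into \<open>t - s\<close>. This is why the
  right eigenvector is numbered from its last component.\<close>

lemma banded_columns:
  assumes "banded_mat n w l B" "n > 0"
  shows "banded n w l (\<lambda>s t. B $$ (n - 1 - s, n - 1 - t))"
proof -
  have off: "int (n - 1 - s) + int (t div n) * int n - int (n - 1 - t mod n) = int t - int s" if "s < n" for s t
  proof -
    have "int (n - 1 - x) = int n - 1 - int x" if "x < n" for x
      using that by (simp add: of_nat_diff)
    then have "int (n - 1 - s) = int n - 1 - int s" "int (n - 1 - t mod n) = int n - 1 - int (t mod n)"
      using \<open>s < n\<close> mod_less_divisor[OF assms(2)] by blast+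
    moreover have "int (t div n) * int n + int (t mod n) = int t"
      using div_mult_mod_eq[of t n] by (metis of_nat_add of_nat_mult)
    ultimately show ?thesis by linarith
  qed
  show ?thesis
    unfolding banded_def band_coeff_def
  proof (intro allI impI)
    fix s t assume s: "s < n"
    have "n - 1 - s < n" "n - 1 - t mod n < n" using assms(2) by auto
    note * = banded_matD[OF assms(1) this, of "t div n", unfolded off[OF s]]
    show "(poly.coeff (B $$ (n - 1 - s, n - 1 - t mod n)) (t div n) \<noteq> 0 \<longrightarrow> s + l \<le> t \<and> t \<le> s + w) \<and>
        (t = s + w \<longrightarrow> poly.coeff (B $$ (n - 1 - s, n - 1 - t mod n)) (t div n) = 1)"
      using * by fastforce
  qed
qed

text \<open>For the left eigenvector, transposition alone turns the offset into
  \<open>t - s\<close>.\<close>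

lemma banded_rows:
  assumes "banded_mat n w l B" "n > 0"
  shows "banded n w l (\<lambda>s t. B $$ (t, s))"
proof -
  have off: "int (t mod n) + int (t div n) * int n - int s = int t - int s" for s t
    using div_mult_mod_eq[of t n] by (metis add.commute of_nat_add of_nat_mult)
  show ?thesis
    unfolding banded_def band_coeff_def
  proof (intro allI impI)
    fix s t assume "s < n"
    have "t mod n < n" using assms(2) by auto
    note * = banded_matD[OF assms(1) this \<open>s < n\<close>, of "t div n", unfolded off]
    show "(poly.coeff (B $$ (t mod n, s)) (t div n) \<noteq> 0 \<longrightarrow> s + l \<le> t \<and> t \<le> s + w) \<and>
        (t = s + w \<longrightarrow> poly.coeff (B $$ (t mod n, s)) (t div n) = 1)"
      using * by fastforce
  qed
qed

lemma banded_one: "n > 0 \<Longrightarrow> banded_mat n 0 0 (1\<^sub>m n)"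
  unfolding banded_mat_def
proof safe
  fix r c d assume rc: "r < n" "c < n" "n > 0"
  show "1\<^sub>m n \<in> carrier_mat n n" by simp
  have off: "d = 0 \<and> r = c" if "int r + int d * int n - int c = 0"
  proof -
    have "d = 0"
    proof (rule ccontr)
      assume "d \<noteq> 0"
      then have "1 * int n \<le> int d * int n" by (intro mult_right_mono) auto
      then show False using that rc by linarith
    qed
    then show ?thesis using that by simp
  qed
  {
    assume "poly.coeff (1\<^sub>m n $$ (r, c)) d \<noteq> (0::complex)"
    then have "r = c" "d = 0" using rc by (auto simp: coeff_eq_0 split: if_splits)
    then show "int 0 \<le> int r + int d * int n - int c" "int r + int d * int n - int c \<le> int 0" by simp_all
  }
  assume "int r + int d * int n - int c = int 0"
  then show "poly.coeff (1\<^sub>m n $$ (r, c)) d = (1::complex)" using off rc by simp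
qed

text \<open>Offsets add under multiplication. At the extreme offset both factors must be on their
  extreme diagonals, which leaves a single summand, equal to 1.\<close>

lemma banded_mult:
  assumes A: "banded_mat n w l A" and B: "banded_mat n w' l' B" and n: "n > 0"
  shows "banded_mat n (w + w') (l + l') (A * B)"
  unfolding banded_mat_def
proof (intro conjI allI impI)
  have carr: "A \<in> carrier_mat n n" "B \<in> carrier_mat n n" using A B by (simp_all add: banded_mat_def)
  then show "A * B \<in> carrier_mat n n" by simp
  fix r c d assume rc: "r < n" "c < n"
  let ?g = "\<lambda>(j, i). poly.coeff (A $$ (r, j)) i * poly.coeff (B $$ (j, c)) (d - i)"
  have "(A * B) $$ (r, c) = (\<Sum>j<n. A $$ (r, j) * B $$ (j, c))"
    using carr rc by (auto simp: scalar_prod_def lessThan_atLeast0)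
  then have coeff: "poly.coeff ((A * B) $$ (r, c)) d = (\<Sum>z\<in>{..<n} \<times> {..d}. ?g z)"
    by (simp add: coeff_sum coeff_mult sum.cartesian_product)
  have bounds: "int l \<le> int r + int i * int n - int j \<and> int r + int i * int n - int j \<le> int w \<and>
      int l' \<le> int j + int (d - i) * int n - int c \<and> int j + int (d - i) * int n - int c \<le> int w' \<and>
      int (d - i) = int d - int i" if "(j, i) \<in> {..<n} \<times> {..d}" "?g (j, i) \<noteq> 0" for j i
  proof -
    have "j < n" "i \<le> d" "poly.coeff (A $$ (r, j)) i \<noteq> 0" "poly.coeff (B $$ (j, c)) (d - i) \<noteq> 0"
      using that by auto
    then show ?thesis
      using banded_matD[OF A rc(1), of j i] banded_matD[OF B _ rc(2), of j "d - i"] by (simp add: of_nat_diff)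
  qed
  {
    assume "poly.coeff ((A * B) $$ (r, c)) d \<noteq> 0"
    then obtain z where z: "z \<in> {..<n} \<times> {..d}" "?g z \<noteq> 0" unfolding coeff by (rule sum.not_neutral_contains_not_neutral)
    obtain j i where ji: "z = (j, i)" by (cases z)
    note b = bounds[of j i, OF z[unfolded ji]]
    then have "int (d - i) * int n = int d * int n - int i * int n" by (simp add: left_diff_distrib)
    then show "int (l + l') \<le> int r + int d * int n - int c"
      "int r + int d * int n - int c \<le> int (w + w')" using b by linarith+
  }
  assume e: "int r + int d * int n - int c = int (w + w')"
  \<comment> \<open>The solution of \<open>r + i n - j = w\<close> with \<open>j < n\<close>: the
    one place in row \<open>r\<close> of \<open>A\<close> on its extreme diagonal.\<close>
  define j where "j = nat ((int r - int w) mod int n)"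
  define i where "i = nat (- ((int r - int w) div int n))"
  have j: "int j = (int r - int w) mod int n" "j < n" using n by (simp_all add: j_def nat_less_iff)
  have "(int r - int w) div int n \<le> 0"
  proof -
    have "(int r - int w) div int n \<le> int r div int n" using n by (intro zdiv_mono1) auto
    then show ?thesis using rc by simp
  qed
  then have i: "int i = - ((int r - int w) div int n)" by (simp add: i_def)
  have ri: "int r + int i * int n - int j = int w"
    using div_mult_mod_eq[of "int r - int w" "int n"] unfolding i j(1) mult_minus_left by linarith
  have "int i \<le> int d"
  proof (rule ccontr)
    assume "\<not> ?thesis"
    then have "(int d + 1) * int n \<le> int i * int n" by (intro mult_right_mono) auto
    then have "int d * int n + int n \<le> int i * int n" by (simp add: distrib_right)
    then show False using e ri j(2) by simp
  qed
  then have id: "i \<le> d" "int (d - i) = int d - int i" by (simp_all add: of_nat_diff)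
  have "(\<Sum>z\<in>{..<n} \<times> {..d}. ?g z) = (\<Sum>z\<in>{(j, i)}. ?g z)"
  proof (rule sum.mono_neutral_right)
    show "{(j, i)} \<subseteq> {..<n} \<times> {..d}" using j id by simp
    show "\<forall>z\<in>{..<n} \<times> {..d} - {(j, i)}. ?g z = 0"
    proof (rule ballI, rule ccontr)
      fix z assume z: "z \<in> {..<n} \<times> {..d} - {(j, i)}" "?g z \<noteq> 0"
      obtain j' i' where ji: "z = (j', i')" by (cases z)
      have zz: "(j', i') \<in> {..<n} \<times> {..d}" "?g (j', i') \<noteq> 0" using z unfolding ji by auto
      note b = bounds[OF zz]
      have "int (d - i') * int n = int d * int n - int i' * int n" using b by (simp add: left_diff_distrib)
      then have ri': "int r + int i' * int n - int j' = int w" using b e by linarith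
      have "int j' = (int r - int w) mod int n"
      proof -
        have "int r - int w = int j' + int n * (- int i')" using ri' by (simp add: algebra_simps)
        then have "(int r - int w) mod int n = int j' mod int n" by (metis mod_mult_self2)
        then show ?thesis using zz(1) by simp
      qed
      then have "j' = j" using j(1) by simp
      then have "int i' * int n = int i * int n" using ri ri' by linarith
      then have "i' = i" using n by simp
      then show False using z(1) ji \<open>j' = j\<close> by simp
    qed
  qed simp
  also have "\<dots> = 1"
  proof -
    have "int j + int (d - i) * int n - int c = int w'" using e ri unfolding id(2) left_diff_distrib by simp
    then show ?thesis using A B rc j(2) ri unfolding banded_mat_def by auto
  qed
  finally show "poly.coeff ((A * B) $$ (r, c)) d = 1" using coeff by simp
qed

lemma banded_power: "banded_mat n w l A \<Longrightarrow> n > 0 \<Longrightarrow> banded_mat n (i * w) (i * l) (A ^\<^sub>m i)"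
proof (induction i)
  case 0
  then have "dim_row A = n" by (auto simp: banded_mat_def)
  then show ?case using banded_one[OF 0(2)] by simp
next
  case (Suc i)
  then show ?case using banded_mult[of n "i * w" "i * l" "A ^\<^sub>m i" w l A] by (simp add: add.commute)
qed

lemma Q_mat_carrier [simp]: "Q_mat n d \<in> carrier_mat n n"
  by (simp add: Q_mat_def)

lemma banded_Q_mat:
  assumes n: "n \<ge> 2" and l: "l = 0 \<or> l = 1 \<and> (\<forall>i<n. q i = 0)"
  shows "banded_mat n 1 l (Q_mat n q)"
  unfolding banded_mat_def
proof (intro conjI allI impI)
  fix r c d assume rc: "r < n" "c < n"
  have entry: "Q_mat n q $$ (r, c) = (if r = c then [:q r:] else if r = c + 1 then 1 else if r = 0 \<and> c = n - 1 then [:0, 1:] else 0)"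
    using rc by (simp add: Q_mat_def)
  {
    assume nz: "poly.coeff (Q_mat n q $$ (r, c)) d \<noteq> 0"
    then consider "r = c" "d = 0" "q r \<noteq> 0" | "r = c + 1" "d = 0" | "r = 0" "c = n - 1" "d = 1"
      unfolding entry by (auto simp: coeff_pCons one_pCons split: if_splits nat.splits)
    then have "int l \<le> int r + int d * int n - int c \<and> int r + int d * int n - int c \<le> int 1"
      using n l rc by cases (auto simp: of_nat_diff)
    then show "int l \<le> int r + int d * int n - int c" "int r + int d * int n - int c \<le> int 1" by auto
  }
  assume e: "int r + int d * int n - int c = int 1"
  have "d \<le> 1"
  proof (rule ccontr)
    assume "\<not> d \<le> 1"
    then have "2 * int n \<le> int d * int n" by (intro mult_right_mono) auto
    then show False using e rc n by linarith
  qed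
  then consider "d = 0" | "d = 1" by linarith
  then show "poly.coeff (Q_mat n q $$ (r, c)) d = 1"
  proof cases
    case 1
    then have "r = c + 1" using e by simp
    then show ?thesis using 1 unfolding entry by simp
  next
    case 2
    then have "c = n - 1" "r = 0" using e rc n by auto
    then show ?thesis using 2 n unfolding entry by simp
  qed
qed simp

text \<open>Each factor \<open>Q\<close> has offsets 0 and 1, and each \<open>P\<close> only 1, so
  \<open>m\<close> of the former and \<open>k\<close> of the latter give the band from
  \<open>k\<close> to \<open>m + k\<close>.\<close>

lemma banded_alpha:
  assumes n: "n \<ge> 2"
  shows "banded_mat n (m + k) k (alpha n m k q)"
proof -
  have "banded_mat n (length xs) 0 (foldr (\<lambda>i B. Q_mat n (\<lambda>j. q $$ (i, j)) * B) xs (1\<^sub>m n))" for xs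
  proof (induction xs)
    case Nil
    show ?case using banded_one n by simp
  next
    case (Cons i xs)
    from banded_mult[OF banded_Q_mat[of n 0] Cons] n show ?case by simp
  qed
  from this[of "[0..<m]"] have "banded_mat n m 0 (foldr (\<lambda>i B. Q_mat n (\<lambda>j. q $$ (i, j)) * B) [0..<m] (1\<^sub>m n))" by simp
  moreover have "banded_mat n (k * 1) (k * 1) (P_mat n ^\<^sub>m k)"
    unfolding P_mat_def by (rule banded_power[OF banded_Q_mat]) (use n in auto)
  ultimately have "banded_mat n (m + k * 1) (0 + k * 1) (alpha n m k q)"
    unfolding alpha_def using n by (intro banded_mult) auto
  then show ?thesis by simp
qed

lemma lax_matrices_eq:
  assumes "n > 0"
  shows "L \<in> lax_matrices n m k \<longleftrightarrow> banded_mat n (m + k) k L"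
proof
  assume "L \<in> lax_matrices n m k"
  then obtain a where L: "L \<in> carrier_mat n n"
    and a: "\<And>i j. i < n \<Longrightarrow> (j - int i = - int m - int k \<longrightarrow> a i j = 1) \<and> (j - int i < - int m - int k \<or> j - int i > - int k \<longrightarrow> a i j = 0)"
    and c: "\<And>i j l. i < n \<Longrightarrow> j < n \<Longrightarrow> poly.coeff (L $$ (i, j)) l = a i (int j - int l * int n)"
    unfolding lax_matrices_def by blast
  show "banded_mat n (m + k) k L"
    unfolding banded_mat_def
  proof (intro conjI allI impI L)
    fix r s d assume rs: "r < n" "s < n"
    note a' = a[OF rs(1), of "int s - int d * int n"]
    {
      assume "poly.coeff (L $$ (r, s)) d \<noteq> 0"
      then have "\<not> (int s - int d * int n - int r < - int m - int k \<or> int s - int d * int n - int r > - int k)"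
        using a' c[OF rs] by auto
      then show "int k \<le> int r + int d * int n - int s" "int r + int d * int n - int s \<le> int (m + k)" by auto
    }
    assume "int r + int d * int n - int s = int (m + k)"
    then have "int s - int d * int n - int r = - int m - int k" by simp
    then show "poly.coeff (L $$ (r, s)) d = 1" using a' c[OF rs] by simp
  qed
next
  assume B: "banded_mat n (m + k) k L"
  \<comment> \<open>For \<open>t >= n\<close> the exponent \<open>- (t div n)\<close> would be
    negative; such positions are outside the band, where the array is 0.\<close>
  define a where "a i t = (if t < int n then poly.coeff (L $$ (i, nat (t mod int n))) (nat (- (t div int n))) else 0)" for i t
  have dm: "int r + int (nat (- (t div int n))) * int n - int (nat (t mod int n)) = int r - t" if "t < int n" for r t
  proof -
    have "t div int n \<le> (int n - 1) div int n" using that assms by (intro zdiv_mono1) auto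
    also have "\<dots> = 0" using assms by simp
    finally have "int (nat (- (t div int n))) = - (t div int n)" by simp
    moreover have "int (nat (t mod int n)) = t mod int n" using assms by simp
    ultimately show ?thesis using div_mult_mod_eq[of t "int n"] by (simp only: mult_minus_left)
  qed
  have "nat (t mod int n) < n" for t using assms by (simp add: nat_less_iff)
  then have a: "(t - int i = - int m - int k \<longrightarrow> a i t = 1) \<and> (t - int i < - int m - int k \<or> t - int i > - int k \<longrightarrow> a i t = 0)" if "i < n" for i t
  proof (cases "t < int n")
    case True
    note dm = dm[OF True, of i]
    have "(int i - t = int (m + k) \<longrightarrow> a i t = 1) \<and> (a i t \<noteq> 0 \<longrightarrow> int k \<le> int i - t \<and> int i - t \<le> int (m + k))"
      using banded_matD[OF B that \<open>nat (t mod int n) < n\<close>, of "nat (- (t div int n))", unfolded dm] True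
      unfolding a_def by auto
    then show ?thesis by auto
  next
    case False
    then show ?thesis using that by (auto simp: a_def)
  qed
  have c: "poly.coeff (L $$ (i, j)) l = a i (int j - int l * int n)" if "i < n" "j < n" for i j l
  proof -
    have "(int j + (- int l) * int n) mod int n = int j" "(int j + (- int l) * int n) div int n = - int l"
      using that assms by (simp_all only: mod_mult_self1 div_mult_self1, simp_all)
    moreover have "int j - int l * int n < int n"
      using that mult_nonneg_nonneg[of "int l" "int n"] by linarith
    ultimately show ?thesis by (simp add: a_def)
  qed
  show "L \<in> lax_matrices n m k" unfolding lax_matrices_def using a c B
    by (auto simp: banded_mat_def intro!: exI[of _ a])
qed

section \<open>Eigenvectors of banded matrices\<close>

lemma (in valuation) ge_subst: "ge g d \<Longrightarrow> g = h \<Longrightarrow> d = e \<Longrightarrow> ge h e"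
  and eq_subst: "eq g d \<Longrightarrow> g = h \<Longrightarrow> d = e \<Longrightarrow> eq h e"
  by simp_all

definition (in plane_curve) eigenvector :: "nat \<Rightarrow> (nat \<Rightarrow> nat \<Rightarrow> complex poly) \<Rightarrow> rat_fun \<Rightarrow> (nat \<Rightarrow> rat_fun) \<Rightarrow> bool" where
  "eigenvector n A h v \<longleftrightarrow> (\<forall>s<n. F dvd h * v s - (\<Sum>t<n. ev (A s t) X * v t))"

text \<open>The sequence \<open>v_0, ..., v_(n - 1), x v_0, ..., x v_(n - 1), x^2 v_0, ...\<close>\<close>

definition (in plane_curve) extend :: "nat \<Rightarrow> (nat \<Rightarrow> rat_fun) \<Rightarrow> nat \<Rightarrow> rat_fun" where
  "extend n v t = X ^ (t div n) * v (t mod n)"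

context spectral_curve begin

lemma n_pos: "n > 0"
  using n by simp

lemma extend_less: "t < n \<Longrightarrow> extend n v t = v t"
  by (simp add: extend_def)

lemma extend_add: "extend n v (t + q * n) = X ^ q * extend n v t"
  using n_pos by (simp add: extend_def power_add mult_ac)

text \<open>Reading \<open>x ^ d v_t\<close> as the term with index \<open>d n + t\<close> of the
  extended sequence turns the polynomial matrix into an infinite array of constants.\<close>

lemma banded_apply:
  assumes A: "banded n w l A" and s: "s < n"
  shows "(\<Sum>t<n. ev (A s t) X * v t) = (\<Sum>t\<le>s + w. const (band_coeff n A s t) * extend n v t)"
proof -
  define D where "D = Max (insert (s + w) ((\<lambda>t. degree (A s t)) ` {..<n}))"
  have D: "s + w \<le> D" "\<And>t. t < n \<Longrightarrow> degree (A s t) \<le> D" by (auto simp: D_def intro!: Max_ge)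
  let ?g = "\<lambda>t. const (band_coeff n A s t) * extend n v t"
  have "(\<Sum>t<n. ev (A s t) X * v t) = (\<Sum>t<n. \<Sum>d\<le>D. const (poly.coeff (A s t) d) * X ^ d * v t)"
    by (rule sum.cong[OF refl]) (simp add: ev_altdef'[OF D(2)] sum_distrib_right)
  also have "\<dots> = (\<Sum>d<Suc D. \<Sum>t<n. ?g (d * n + t))"
    unfolding lessThan_Suc_atMost
    by (subst sum.swap) (auto intro!: sum.cong simp: band_coeff_def extend_def mult.assoc)
  also have "\<dots> = (\<Sum>d<Suc D. sum ?g {d * n..<d * n + n})"
    by (intro sum.cong[OF refl] sum.reindex_bij_witness[of _ "\<lambda>t. t - d * n" "\<lambda>t. d * n + t" for d]) auto
  also have "\<dots> = sum ?g {..<Suc D * n}" by (rule sum.nat_group)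
  also have "\<dots> = sum ?g {..s + w}"
  proof (rule sum.mono_neutral_right)
    have "s + w < Suc D" using D(1) by simp
    moreover have "Suc D \<le> Suc D * n" by (metis One_nat_def Suc_leI mult.right_neutral mult_le_mono2 n_pos)
    ultimately have "s + w < Suc D * n" by (rule less_le_trans)
    then show "{..s + w} \<subseteq> {..<Suc D * n}" by auto
    show "\<forall>t\<in>{..<Suc D * n} - {..s + w}. ?g t = 0"
      using A s unfolding banded_def by force
  qed simp
  finally show ?thesis .
qed

lemma eigenvector_banded:
  assumes "banded n w l A" "eigenvector n A h v" "s < n"
  shows "F dvd h * extend n v s - (extend n v (s + w) + (\<Sum>t<s + w. const (band_coeff n A s t) * extend n v t))"
proof -
  have "band_coeff n A s (s + w) = 1" using assms(1,3) by (simp add: banded_def)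
  then have *: "(\<Sum>t<n. ev (A s t) X * v t) = extend n v (s + w) + (\<Sum>t<s + w. const (band_coeff n A s t) * extend n v t)"
    unfolding banded_apply[OF assms(1,3)] lessThan_Suc_atMost[symmetric] by (simp add: add.commute)
  have "F dvd h * v s - (\<Sum>t<n. ev (A s t) X * v t)" using assms(2,3) by (simp add: eigenvector_def)
  then show ?thesis unfolding * extend_less[OF assms(3)] .
qed

end

text \<open>\<open>A\<close> plays the role of \<open>L\<close>, and \<open>C\<close> that of \<open>L^a\<close>.\<close>

locale eigen_sequence = spectral_curve +
  fixes A C :: "nat \<Rightarrow> nat \<Rightarrow> complex poly"
  assumes banded_A: "banded n (m + k) k A" and banded_C: "banded n (b * n) (a * k) C"
begin

text \<open>In this locale \<open>C\<close> is not tied to \<open>A\<close>, so the relation for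
  \<open>Y ^ a\<close> is asked for separately.\<close>

definition eigen :: "(nat \<Rightarrow> rat_fun) \<Rightarrow> bool" where
  "eigen v \<longleftrightarrow> eigenvector n A Y v \<and> eigenvector n C (Y ^ a) v"

text \<open>The entries next to the extreme diagonal of the power of \<open>L\<close>; at
  \<open>n - 1 - l\<close> with \<open>l < M\<close> they are the numbers \<open>c\<close>, see
  \<open>attached_c_eq\<close>.\<close>

definition top :: "nat \<Rightarrow> complex" where "top s = band_coeff n C (s mod n) (s mod n + b * n - 1)"

lemma bn: "b * n \<ge> 1"
  using b_pos n_pos by (simp add: Suc_le_eq)

lemma int_bn: "int (b * n - 1) = int (b * n) - 1" "int (s + b * n - 1) = int s + int (b * n) - 1"
proof -
  have "1 \<le> s + b * n" using bn by linarith
  from of_nat_diff[OF bn, where ?'a = int] of_nat_diff[OF this, where ?'a = int]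
  show "int (b * n - 1) = int (b * n) - 1" "int (s + b * n - 1) = int s + int (b * n) - 1"
    by (simp_all only: of_nat_add of_nat_1)
qed

text \<open>The top term of \<open>Y ^ a * e_s\<close> is \<open>e_(s + b n) = X ^ b * e_s\<close>.
  Subtracting it makes the term with index \<open>s + b n - 1\<close> the highest one.\<close>

lemma Z_extend:
  assumes "eigen v" "s < n"
  shows "F dvd Z * extend n v s - (const (top s) * extend n v (s + b * n - 1) +
    (\<Sum>t<s + b * n - 1. const (band_coeff n C s t) * extend n v t))"
proof -
  have "s + b * n = Suc (s + b * n - 1)" using bn by simp
  then have "(\<Sum>t<s + b * n. const (band_coeff n C s t) * extend n v t) =
      const (top s) * extend n v (s + b * n - 1) + (\<Sum>t<s + b * n - 1. const (band_coeff n C s t) * extend n v t)"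
    using assms(2) by (metis (no_types, lifting) add.commute mod_less sum.lessThan_Suc top_def)
  moreover have "extend n v (s + b * n) = X ^ b * extend n v s" by (rule extend_add)
  moreover have "Z * extend n v s = Y ^ a * extend n v s - X ^ b * extend n v s"
    by (simp add: Z_def left_diff_distrib)
  moreover have "F dvd Y ^ a * extend n v s - (extend n v (s + b * n) + (\<Sum>t<s + b * n. const (band_coeff n C s t) * extend n v t))"
    using assms by (intro eigenvector_banded[OF banded_C]) (auto simp: eigen_def)
  ultimately show ?thesis by (simp only: diff_diff_eq)
qed

lemma Y_extend:
  assumes "eigen v" "s < n"
  shows "F dvd Y * extend n v s - (extend n v (s + (m + k)) + (\<Sum>t<s + (m + k). const (band_coeff n A s t) * extend n v t))"
  using assms by (intro eigenvector_banded[OF banded_A]) (auto simp: eigen_def)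

text \<open>The minimum of \<open>v_P (e_t) + t\<close> propagates from \<open>s\<close> to \<open>s - 1\<close> since \<open>Z\<close> maps \<open>e_s\<close> to a multiple of
  \<open>e_(s + b n - 1)\<close> plus terms \<open>e_t\<close> with smaller \<open>t\<close>.\<close>

lemma pole_orders_exist:
  assumes v: "eigen v" and nz: "s0 < n" "\<not> F dvd v s0"
  obtains d where "\<And>t. inf.eq (extend n v t) (d - int t)"
proof -
  let ?e = "extend n v" and ?S = "{s. s < n \<and> \<not> F dvd v s}"
  let ?ord = "\<lambda>s. P_inf f (v s mod F) + int s"
  define d where "d = Min (?ord ` ?S)"
  have fin: "finite (?ord ` ?S)" "?ord ` ?S \<noteq> {}" using nz by auto
  have ge0: "ord_ge (P_inf f) (v s) (d - int s)" if "s < n" for s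
  proof (cases "F dvd v s")
    case False
    then have "d \<le> ?ord s" unfolding d_def using fin(1) that by (intro Min_le) auto
    then show ?thesis by (simp add: ord_ge_def)
  qed (rule ord_ge_F)
  have shift: "int (t div n) * - int n + (d - int (t mod n)) = d - int t" for t
  proof -
    have "int (t div n) * int n + int (t mod n) = int t"
      using div_mult_mod_eq[of t n] by (metis of_nat_add of_nat_mult)
    then show ?thesis unfolding mult_minus_right by linarith
  qed
  have ge: "ord_ge (P_inf f) (?e t) (d - int t)" for t
    using inf.ge_mult[OF inf.ge_power[OF inf.eq_imp_ge[OF X_P], of "t div n"] ge0[of "t mod n"]] n_pos
    unfolding extend_def shift by simp
  have periodic: "inf.eq (?e t) (d - int t) \<longleftrightarrow> inf.eq (v (t mod n)) (d - int (t mod n))" for t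
    using inf.eq_mult_cancel[OF inf.eq_power[OF X_P, of "t div n"], of "v (t mod n)" "d - int (t mod n)"]
    unfolding extend_def shift .
  have step: "inf.eq (v ((s + b * n - 1) mod n)) (d - int ((s + b * n - 1) mod n))"
    if s: "s < n" and eq: "inf.eq (v s) (d - int s)" for s
  proof -
    let ?u = "s + b * n - 1"
    note u = int_bn(2)[of s]
    have "ord_ge (P_inf f) (\<Sum>t<?u. const (band_coeff n C s t) * ?e t) (d - int ?u + 1)"
    proof (rule inf.ge_sum)
      fix t assume "t \<in> {..<?u}"
      then have "int t < int ?u" unfolding of_nat_less_iff by simp
      then have "d - int ?u + 1 \<le> d - int t" by linarith
      then show "ord_ge (P_inf f) (const (band_coeff n C s t) * ?e t) (d - int ?u + 1)"
        using inf.ge_const_mult inf.ge_mono ge by blast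
    qed
    from inf.ge_add[OF this ord_ge_F[OF Z_extend[OF v s]]]
    have "ord_ge (P_inf f) (Z * ?e s - const (top s) * ?e ?u) (d - int ?u + 1)" by simp
    moreover have "inf.eq (Z * ?e s) (d - int ?u)"
      unfolding extend_less[OF s] u by (rule inf.eq_subst[OF inf.eq_mult[OF Z_P eq]]) simp_all
    \<comment> \<open>Both \<open>Z\<close> and the component with index \<open>s\<close> have exact
      orders, which also rules out \<open>top s = 0\<close>.\<close>
    ultimately have ex: "inf.eq (const (top s) * ?e ?u) (d - int ?u)" using inf.eq_cong by blast
    then have "top s \<noteq> 0" by auto
    then have "inf.eq (?e ?u) (d - int ?u)"
      using ex inf.eq_mult_cancel[OF inf.eq_const, of "top s" "?e ?u" "d - int ?u"] by simp
    then show ?thesis using periodic by blast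
  qed
  have desc: "inf.eq (v j) (d - int j)" if "inf.eq (v s) (d - int s)" "j \<le> s" "s < n" for s j
    using that
  proof (induction s)
    case (Suc s)
    have "(Suc s + b * n - 1) mod n = s" using Suc.prems by simp
    then have "inf.eq (v s) (d - int s)" using step[OF Suc.prems(3,1)] by simp
    then show ?case using Suc by (cases "j = Suc s") auto
  qed simp
  have "d \<in> ?ord ` ?S" unfolding d_def using fin by (rule Min_in)
  then obtain s where s: "s < n" "\<not> F dvd v s" "d = ?ord s" by auto
  then have "inf.eq (v s) (d - int s)" by (simp add: inf.eq_iff)
  \<comment> \<open>The minimum descends from \<open>s\<close> to 0, passes from 0 to
    \<open>n - 1\<close> because \<open>b n - 1\<close> is congruent to it modulo \<open>n\<close>,
    and descends from there to every residue.\<close>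
  from desc[OF this _ s(1), of 0] have "inf.eq (v 0) (d - int 0)" by simp
  from step[OF n_pos this] have "inf.eq (v (n - 1)) (d - int (n - 1))"
  proof -
    have "0 + b * n - 1 = n - 1 + (b - 1) * n" using b_pos n_pos by (simp add: algebra_simps diff_mult_distrib)
    then have "(0 + b * n - 1) mod n = (n - 1) mod n" unfolding mod_mult_self1 by (simp only: mod_mult_self1)
    also have "\<dots> = n - 1" using n_pos by simp
    finally have "(0 + b * n - 1) mod n = n - 1" .
    with step[OF n_pos \<open>inf.eq (v 0) (d - int 0)\<close>] show ?thesis by simp
  qed
  from desc[OF this, of "t mod n" for t] have "inf.eq (v (t mod n)) (d - int (t mod n))" for t
    using n_pos by (simp add: less_Suc_eq_le[symmetric])
  then show thesis using that periodic by blast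
qed

text \<open>All components of a nonzero eigenvector have finite order. Hence eigenvectors with the
  same component 0 agree, which takes the place of a dimension count for the eigenspace.\<close>

lemma eigen_zero:
  assumes "eigen v" "s < n" "F dvd v s" "t < n"
  shows "F dvd v t"
proof (rule ccontr)
  assume "\<not> F dvd v t"
  then obtain d where "\<And>t. inf.eq (extend n v t) (d - int t)" using pole_orders_exist[OF assms(1,4)] by blast
  from this[of s] show False using assms(2,3) by (simp add: extend_less inf.eq_iff)
qed

lemma eigen_diff: "eigen v \<Longrightarrow> eigen w \<Longrightarrow> eigen (\<lambda>s. v s - h * w s)"
proof -
  assume *: "eigen v" "eigen w"
  have "eigenvector n B c (\<lambda>s. v s - h * w s)" if "eigenvector n B c v" "eigenvector n B c w" for B c
    unfolding eigenvector_def
  proof (intro allI impI)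
    fix s assume "s < n"
    then have "F dvd c * v s - (\<Sum>t<n. ev (B s t) X * v t)" "F dvd c * w s - (\<Sum>t<n. ev (B s t) X * w t)"
      using that by (auto simp: eigenvector_def)
    then have "F dvd (c * v s - (\<Sum>t<n. ev (B s t) X * v t)) - h * (c * w s - (\<Sum>t<n. ev (B s t) X * w t))"
      by (intro dvd_diff[OF _ dvd_mult])
    then show "F dvd c * (v s - h * w s) - (\<Sum>t<n. ev (B s t) X * (v t - h * w t))"
      by (simp add: right_diff_distrib sum_subtractf sum_distrib_left algebra_simps)
  qed
  then show ?thesis using * by (simp add: eigen_def)
qed

lemma eigen_proportional:
  assumes "eigen v" "eigen w" "F dvd w 0 - 1" "t < n"
  shows "F dvd v t - v 0 * w t"
proof -
  have "v 0 - v 0 * w 0 = - v 0 * (w 0 - 1)" by (simp add: algebra_simps)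
  then have "F dvd v 0 - v 0 * w 0" using assms(3) by simp
  then show ?thesis using eigen_zero[OF eigen_diff[OF assms(1,2), of "v 0"] n_pos _ assms(4)] by simp
qed

lemma pole_orders:
  assumes "eigen v" "F dvd v 0 - 1"
  shows "inf.eq (extend n v t) (- int t)"
proof -
  have "inf.eq (v 0) 0" using inf.eq_cong_F[OF assms(2)] inf.eq_1 by blast
  then have "\<not> F dvd v 0" by (rule inf.eq_imp_not_F_dvd)
  then obtain d where d: "\<And>t. inf.eq (extend n v t) (d - int t)" using pole_orders_exist[OF assms(1) n_pos] by blast
  from d[of 0] \<open>inf.eq (v 0) 0\<close> have "d = 0" using inf.eq_unique n_pos by (fastforce simp: extend_less)
  then show ?thesis using d by simp
qed

lemma extend_mod: "extend n v s = X ^ (s div n) * extend n v (s mod n)"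
  using n_pos by (simp add: extend_def)

text \<open>The common form of the expansions of \<open>Y\<close> (\<open>i = 0\<close>,
  \<open>c = 1\<close>) and \<open>Z\<close> (\<open>i = 1\<close>, \<open>c = top\<close>), carried
  from \<open>s < n\<close> to all \<open>s\<close> by a power of x.\<close>

lemma asymp_extend:
  assumes v: "eigen v" "F dvd v 0 - 1"
    and h: "\<And>s. s < n \<Longrightarrow> F dvd h * extend n v s - (c s * extend n v (s + u - i) + (\<Sum>t<s + u - i. const (D s t) * extend n v t))"
    and u: "u \<ge> i" and c: "\<And>s. c (s mod n) = c s"
  shows "ord_ge (P_inf f) (h * extend n v s - c s * extend n v (s + u - i)) (1 - int (s + u - i))"
proof -
  let ?s = "s mod n" and ?q = "s div n"
  have "ord_ge (P_inf f) (\<Sum>t<?s + u - i. const (D ?s t) * extend n v t) (1 - int (?s + u - i))"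
  proof (rule inf.ge_sum)
    fix t assume "t \<in> {..<?s + u - i}"
    then have "1 - int (?s + u - i) \<le> - int t" by simp
    then show "ord_ge (P_inf f) (const (D ?s t) * extend n v t) (1 - int (?s + u - i))"
      using inf.ge_const_mult inf.ge_mono inf.eq_imp_ge[OF pole_orders[OF v]] by blast
  qed
  from inf.ge_add[OF this ord_ge_F[OF h[OF mod_less_divisor[OF n_pos, of s]]]]
  have "ord_ge (P_inf f) (h * extend n v ?s - c ?s * extend n v (?s + u - i)) (1 - int (?s + u - i))" by simp
  from inf.ge_mult[OF inf.eq_imp_ge[OF inf.eq_power[OF X_P, of ?q]] this]
  have "ord_ge (P_inf f) (X ^ ?q * (h * extend n v ?s - c ?s * extend n v (?s + u - i))) (int ?q * - int n + (1 - int (?s + u - i)))" .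
  moreover have su: "s + u - i = (?s + u - i) + ?q * n"
    using u div_mult_mod_eq[of s n] by linarith
  then have "X ^ ?q * (h * extend n v ?s - c ?s * extend n v (?s + u - i)) = h * extend n v s - c s * extend n v (s + u - i)"
    unfolding su extend_add by (subst (3) extend_mod) (simp add: c algebra_simps)
  moreover have "int ?q * - int n + (1 - int (?s + u - i)) = 1 - int (s + u - i)" by (simp add: su)
  ultimately show ?thesis by (simp only:)
qed

lemma Z_asymp:
  assumes "eigen v" "F dvd v 0 - 1"
  shows "ord_ge (P_inf f) (Z * extend n v s - const (top s) * extend n v (s + b * n - 1)) (1 - int (s + b * n - 1))"
  by (rule asymp_extend[OF assms Z_extend[OF assms(1)] bn]) (simp_all add: top_def)

lemma Y_asymp:
  assumes "eigen v" "F dvd v 0 - 1"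
  shows "ord_ge (P_inf f) (Y * extend n v s - extend n v (s + (m + k))) (1 - int (s + (m + k)))"
  using asymp_extend[OF assms, of Y "\<lambda>_. 1" "m + k" 0 "band_coeff n A"] Y_extend[OF assms(1)] by simp

text \<open>With \<open>top s = 0\<close>, \<open>Z\<close> times the component would have a larger
  order than the sum of their exact orders.\<close>

lemma top_nonzero:
  assumes "eigen v" "F dvd v 0 - 1"
  shows "top s \<noteq> 0"
proof
  let ?u = "s + b * n - 1"
  assume "top s = 0"
  then have "ord_ge (P_inf f) (Z * extend n v s) (1 - int ?u)" using Z_asymp[OF assms, of s] by simp
  moreover have "inf.eq (Z * extend n v s) (- int ?u)"
    by (rule inf.eq_subst[OF inf.eq_mult[OF Z_P pole_orders[OF assms, of s]] refl]) (simp only: int_bn)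
  ultimately show False by (simp add: inf.eq_ge_iff)
qed

lemma monomial_asymp:
  assumes "eigen v" "F dvd v 0 - 1"
  shows "ord_ge (P_inf f) (X ^ j * Y ^ i * extend n v s - extend n v (s + n * j + (m + k) * i)) (1 - int (s + n * j + (m + k) * i))"
proof (induction i)
  case 0
  then show ?case using extend_add[of v s j] by (simp add: mult.commute)
next
  case (Suc i)
  let ?u = "s + n * j + (m + k) * i"
  have "ord_ge (P_inf f) (Y * (X ^ j * Y ^ i * extend n v s) - Y * extend n v ?u) (- int (m + k) + (- int ?u) + 1)"
    by (intro inf.asymp_mult_left inf.eq_imp_ge[OF Y_P] inf.ge_subst[OF Suc refl]) simp
  moreover have "ord_ge (P_inf f) (Y * extend n v ?u - extend n v (?u + (m + k))) (- int (m + k) + (- int ?u) + 1)"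
    by (rule inf.ge_subst[OF Y_asymp[OF assms, of ?u] refl]) simp
  ultimately have "ord_ge (P_inf f) (Y * (X ^ j * Y ^ i * extend n v s) - extend n v (?u + (m + k))) (- int (m + k) + (- int ?u) + 1)"
    by (rule inf.asymp_trans)
  then show ?case by (simp add: algebra_simps)
qed

lemma Z_power_asymp_extend:
  assumes "eigen v" "F dvd v 0 - 1"
  shows "ord_ge (P_inf f) (Z ^ i * extend n v s - const (\<Prod>l<i. top (s + l * (b * n - 1))) * extend n v (s + i * (b * n - 1)))
    (1 - int (s + i * (b * n - 1)))"
proof (induction i)
  case (Suc i)
  let ?u = "s + i * (b * n - 1)" and ?c = "\<Prod>l<i. top (s + l * (b * n - 1))"
  have Zo: "ord_ge (P_inf f) Z (- int (b * n - 1))" using Z_P_ge unfolding int_bn by simp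
  have "ord_ge (P_inf f) (Z * (Z ^ i * extend n v s) - Z * (const ?c * extend n v ?u)) (- int (b * n - 1) + (- int ?u) + 1)"
    by (intro inf.asymp_mult_left Zo inf.ge_subst[OF Suc refl]) simp
  moreover have "ord_ge (P_inf f) (const ?c * (Z * extend n v ?u - const (top ?u) * extend n v (?u + b * n - 1))) (1 - int (?u + b * n - 1))"
    by (intro inf.ge_const_mult Z_asymp assms)
  moreover have "1 - int (?u + b * n - 1) = - int (b * n - 1) + (- int ?u) + 1" unfolding int_bn by simp
  ultimately have "ord_ge (P_inf f) (Z * (Z ^ i * extend n v s) - Z * (const ?c * extend n v ?u) +
      const ?c * (Z * extend n v ?u - const (top ?u) * extend n v (?u + b * n - 1))) (- int (b * n - 1) + (- int ?u) + 1)"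
    using inf.ge_add by metis
  moreover have "Z * (Z ^ i * extend n v s) - Z * (const ?c * extend n v ?u) +
      const ?c * (Z * extend n v ?u - const (top ?u) * extend n v (?u + b * n - 1)) =
      Z ^ Suc i * extend n v s - const (\<Prod>l<Suc i. top (s + l * (b * n - 1))) * extend n v (?u + b * n - 1)"
    by (simp add: const_mult algebra_simps)
  moreover have "?u + b * n - 1 = s + Suc i * (b * n - 1)" unfolding mult_Suc using bn by linarith
  moreover have "- int (b * n - 1) + (- int ?u) + 1 = 1 - int (s + Suc i * (b * n - 1))" by simp
  ultimately show ?case by (simp only:)
qed simp

text \<open>Comparing \<open>Z^M e_(n - 1)\<close> with the monomials on \<open>L_c\<close>, applied to \<open>e_(n - 1)\<close>.\<close>

lemma prod_top:
  assumes "eigen v" "F dvd v 0 - 1"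
  shows "(\<Prod>l<M. top (n - 1 - l)) = f_c n m k f"
proof -
  obtain j i where ji: "(j, i) \<in> Lc" using Lc_nonempty .
  let ?w = "n * j + (m + k) * i" and ?c = "\<Prod>l<M. top (n - 1 + l * (b * n - 1))" and ?e = "extend n v"
  have w: "int ?w = W" using ji unfolding Lc_iff by simp
  have "int (M * (b * n - 1)) = W"
  proof -
    have "int M * int (b * n) = int n * int (m + k)"
      using arg_cong[OF bM, of int] unfolding of_nat_mult by (metis mult.assoc mult.commute)
    then show ?thesis unfolding W_def of_nat_mult[of M] int_bn by (simp only: right_diff_distrib mult_1_right)
  qed
  with w have Mw: "M * (b * n - 1) = ?w" by (metis of_nat_eq_iff)
  have 1: "ord_ge (P_inf f) (Z ^ M * ?e (n - 1) - const ?c * ?e (n - 1 + ?w)) (1 - int (n - 1 + ?w))"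
    using Z_power_asymp_extend[OF assms, of M "n - 1"] unfolding Mw .
  have "ord_ge (P_inf f) (const (f_c n m k f) * (X ^ j * Y ^ i * ?e (n - 1) - ?e (n - 1 + ?w))) (1 - int (n - 1 + ?w))"
    using monomial_asymp[OF assms, of j i "n - 1"] by (intro inf.ge_const_mult) (simp add: add.assoc)
  moreover have "ord_ge (P_inf f) ((Z ^ M - const (f_c n m k f) * (X ^ j * Y ^ i)) * ?e (n - 1)) (1 - W + - int (n - 1))"
    by (intro inf.ge_mult Z_power_asymp ji inf.eq_imp_ge[OF pole_orders[OF assms]])
  moreover have "1 - W + - int (n - 1) = 1 - int (n - 1 + ?w)" using w by simp
  ultimately have "ord_ge (P_inf f) (const (f_c n m k f) * (X ^ j * Y ^ i * ?e (n - 1) - ?e (n - 1 + ?w)) +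
      (Z ^ M - const (f_c n m k f) * (X ^ j * Y ^ i)) * ?e (n - 1)) (1 - int (n - 1 + ?w))"
    using inf.ge_add by metis
  also have "const (f_c n m k f) * (X ^ j * Y ^ i * ?e (n - 1) - ?e (n - 1 + ?w)) +
      (Z ^ M - const (f_c n m k f) * (X ^ j * Y ^ i)) * ?e (n - 1) = Z ^ M * ?e (n - 1) - const (f_c n m k f) * ?e (n - 1 + ?w)"
    by (simp add: algebra_simps)
  finally have "ord_ge (P_inf f) (Z ^ M * ?e (n - 1) - const (f_c n m k f) * ?e (n - 1 + ?w)) (1 - int (n - 1 + ?w))" .
  from inf.ge_diff[OF this 1]
  have "ord_ge (P_inf f) (const (?c - f_c n m k f) * ?e (n - 1 + ?w)) (1 - int (n - 1 + ?w))"
    by (simp add: const_diff algebra_simps)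
  moreover have "\<not> ord_ge (P_inf f) (const (?c - f_c n m k f) * ?e (n - 1 + ?w)) (1 - int (n - 1 + ?w))" if "?c \<noteq> f_c n m k f"
    using inf.eq_mult[OF inf.eq_const pole_orders[OF assms], of "?c - f_c n m k f" "n - 1 + ?w"] that
    by (simp add: inf.eq_ge_iff)
  ultimately have "?c = f_c n m k f" by blast
  \<comment> \<open>The step \<open>b n - 1\<close> is congruent to -1 modulo \<open>n\<close>.
    Starting from \<open>n - 1\<close> keeps the indices nonnegative, since
    \<open>l < M <= n\<close>.\<close>
  moreover have "top (n - 1 + l * (b * n - 1)) = top (n - 1 - l)" if "l < M" for l
  proof -
    have "l < n" using that M_le by simp
    then have "n - 1 + l * (b * n - 1) = n - 1 - l + (l * b) * n" using bn n_pos by (simp add: diff_mult_distrib2 algebra_simps)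
    then have "(n - 1 + l * (b * n - 1)) mod n = (n - 1 - l) mod n" by simp
    then show ?thesis unfolding top_def by simp
  qed
  ultimately show ?thesis by simp
qed

end

section \<open>The cofactors of \<open>L(x) - y\<close>\<close>

locale lax_matrix = spectral_curve +
  fixes L :: "complex poly mat"
  assumes banded_L: "banded_mat n (m + k) k L" and beta_L: "beta n L = f"
begin

definition Dl :: "nat \<Rightarrow> nat \<Rightarrow> rat_fun" where "Dl i j = emb (cofactor (char_mat n L) i j)"

lemma L_carrier [simp]: "L \<in> carrier_mat n n"
  using banded_L by (simp add: banded_mat_def)

lemma L_dim [simp]: "dim_row L = n" "dim_col L = n"
  using L_carrier by (simp_all del: L_carrier)

lemma pow_carrier [simp]: "L ^\<^sub>m i \<in> carrier_mat n n"
  by (rule pow_carrier_mat) simp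

lemma char_mat_carrier [simp]: "char_mat n L \<in> carrier_mat n n"
  unfolding char_mat_def by (rule minus_carrier_mat) simp

lemma char_mat_dim [simp]: "dim_row (char_mat n L) = n" "dim_col (char_mat n L) = n"
  using char_mat_carrier by (simp_all del: char_mat_carrier)

lemma char_mat_index: "r < n \<Longrightarrow> c < n \<Longrightarrow> char_mat n L $$ (r, c) = [:L $$ (r, c):] - (if r = c then [:0, 1:] else 0)"
  by (simp add: char_mat_def one_pCons)

lemma banded_pow: "banded_mat n (b * n) (a * k) (L ^\<^sub>m a)"
  using banded_power[OF banded_L n_pos, of a] by (simp add: a_weight)

text \<open>The product of \<open>L - y\<close> with its adjugate is \<open>f\<close>, which
  vanishes on the curve: in its second index the cofactor is a right eigenvector. The product in the
  other order makes it a left eigenvector in its first index.\<close>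

lemma Dl_right:
  assumes "i < n" "i' < n"
  shows "F dvd Y * Dl i' i - (\<Sum>c<n. ev (L $$ (i, c)) X * Dl i' c)"
proof -
  interpret e: comm_ring_hom emb by (rule comm_ring_hom_emb)
  have "(\<Sum>c<n. char_mat n L $$ (i, c) * cofactor (char_mat n L) i' c) = (char_mat n L * adj_mat (char_mat n L)) $$ (i, i')"
    using assms adj_mat(1)[OF char_mat_carrier]
    by (simp add: scalar_prod_def adj_mat_def lessThan_atLeast0)
  also have "\<dots> = (if i = i' then f else 0)"
    unfolding adj_mat(2)[OF char_mat_carrier] using assms beta_L by (simp add: beta_def)
  finally have "F dvd emb (\<Sum>c<n. char_mat n L $$ (i, c) * cofactor (char_mat n L) i' c)"
    using F_dvd_emb_f by simp
  also have "emb (\<Sum>c<n. char_mat n L $$ (i, c) * cofactor (char_mat n L) i' c) =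
      (\<Sum>c<n. ev (L $$ (i, c)) X * Dl i' c - (if i = c then Y * Dl i' c else 0))"
    unfolding e.hom_sum
    by (rule sum.cong[OF refl])
      (use assms in \<open>simp add: char_mat_index e.hom_mult e.hom_minus Dl_def emb_const Y_def left_diff_distrib del: mult_pCons_left\<close>)
  also have "\<dots> = (\<Sum>c<n. ev (L $$ (i, c)) X * Dl i' c) - Y * Dl i' i"
    using assms by (simp add: sum_subtractf)
  finally show ?thesis by (rule dvd_diff_commute[THEN iffD1])
qed

lemma Dl_left:
  assumes "i < n" "j < n"
  shows "F dvd Y * Dl i j - (\<Sum>r<n. ev (L $$ (r, i)) X * Dl r j)"
proof -
  interpret e: comm_ring_hom emb by (rule comm_ring_hom_emb)
  have "(\<Sum>r<n. char_mat n L $$ (r, i) * cofactor (char_mat n L) r j) = (adj_mat (char_mat n L) * char_mat n L) $$ (j, i)"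
    using assms adj_mat(1)[OF char_mat_carrier]
    by (simp add: scalar_prod_def adj_mat_def lessThan_atLeast0 mult.commute)
  also have "\<dots> = (if i = j then f else 0)"
    unfolding adj_mat(3)[OF char_mat_carrier] using assms beta_L by (simp add: beta_def)
  finally have "F dvd emb (\<Sum>r<n. char_mat n L $$ (r, i) * cofactor (char_mat n L) r j)"
    using F_dvd_emb_f by simp
  also have "emb (\<Sum>r<n. char_mat n L $$ (r, i) * cofactor (char_mat n L) r j) =
      (\<Sum>r<n. ev (L $$ (r, i)) X * Dl r j - (if r = i then Y * Dl r j else 0))"
    unfolding e.hom_sum
    by (rule sum.cong[OF refl])
      (use assms in \<open>simp add: char_mat_index e.hom_mult e.hom_minus Dl_def emb_const Y_def left_diff_distrib del: mult_pCons_left\<close>)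
  also have "\<dots> = (\<Sum>r<n. ev (L $$ (r, i)) X * Dl r j) - Y * Dl i j"
    using assms by (simp add: sum_subtractf)
  finally show ?thesis by (rule dvd_diff_commute[THEN iffD1])
qed

lemma pow_Suc_index: "r < n \<Longrightarrow> c < n \<Longrightarrow> (L ^\<^sub>m Suc i) $$ (r, c) = (\<Sum>j<n. (L ^\<^sub>m i) $$ (r, j) * L $$ (j, c))"
  using index_mult_mat(1)[of r "L ^\<^sub>m i" c L] pow_carrier[of i]
  by (simp add: scalar_prod_def lessThan_atLeast0)

lemma ev_sum: "ev (\<Sum>i\<in>I. q i) h = (\<Sum>i\<in>I. ev (q i) h)"
  by (induction I rule: infinite_finite_induct) (simp_all add: ev_add)

lemma power_right:
  assumes h: "\<And>i. i < n \<Longrightarrow> F dvd y * h i - (\<Sum>c<n. ev (L $$ (i, c)) X * h c)"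
  shows "i < n \<Longrightarrow> F dvd y ^ e * h i - (\<Sum>c<n. ev ((L ^\<^sub>m e) $$ (i, c)) X * h c)"
proof (induction e arbitrary: i)
  case 0
  have "(\<Sum>c<n. ev ((L ^\<^sub>m 0) $$ (i, c)) X * h c) = (\<Sum>c<n. if c = i then h c else 0)"
    using 0 by (intro sum.cong refl) auto
  then show ?case using 0 by simp
next
  case (Suc e)
  have "(\<Sum>c<n. ev ((L ^\<^sub>m Suc e) $$ (i, c)) X * h c) = (\<Sum>c<n. \<Sum>j<n. ev ((L ^\<^sub>m e) $$ (i, j)) X * (ev (L $$ (j, c)) X * h c))"
    using Suc.prems by (intro sum.cong refl) (simp add: pow_Suc_index ev_sum ev_mult sum_distrib_right mult.assoc del: pow_mat.simps)
  also have "\<dots> = (\<Sum>j<n. ev ((L ^\<^sub>m e) $$ (i, j)) X * (\<Sum>c<n. ev (L $$ (j, c)) X * h c))"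
    by (subst sum.swap) (simp add: sum_distrib_left)
  finally have eqn: "y ^ Suc e * h i - (\<Sum>c<n. ev ((L ^\<^sub>m Suc e) $$ (i, c)) X * h c) =
      y * (y ^ e * h i - (\<Sum>j<n. ev ((L ^\<^sub>m e) $$ (i, j)) X * h j)) +
      (\<Sum>j<n. ev ((L ^\<^sub>m e) $$ (i, j)) X * (y * h j - (\<Sum>c<n. ev (L $$ (j, c)) X * h c)))"
    by (simp add: right_diff_distrib sum_subtractf sum_distrib_left mult_ac del: pow_mat.simps)
  show ?case unfolding eqn
    by (intro dvd_add dvd_mult dvd_sum Suc.IH Suc.prems h) auto
qed

lemma power_left:
  assumes h: "\<And>i. i < n \<Longrightarrow> F dvd y * h i - (\<Sum>r<n. ev (L $$ (r, i)) X * h r)"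
  shows "i < n \<Longrightarrow> F dvd y ^ e * h i - (\<Sum>r<n. ev ((L ^\<^sub>m e) $$ (r, i)) X * h r)"
proof (induction e arbitrary: i)
  case 0
  have "(\<Sum>r<n. ev ((L ^\<^sub>m 0) $$ (r, i)) X * h r) = (\<Sum>r<n. if r = i then h r else 0)"
    using 0 by (intro sum.cong refl) auto
  then show ?case using 0 by simp
next
  case (Suc e)
  have "(\<Sum>r<n. ev ((L ^\<^sub>m Suc e) $$ (r, i)) X * h r) = (\<Sum>r<n. \<Sum>j<n. ev (L $$ (j, i)) X * (ev ((L ^\<^sub>m e) $$ (r, j)) X * h r))"
    using Suc.prems by (intro sum.cong refl) (simp add: pow_Suc_index ev_sum ev_mult sum_distrib_left mult_ac del: pow_mat.simps)
  also have "\<dots> = (\<Sum>j<n. ev (L $$ (j, i)) X * (\<Sum>r<n. ev ((L ^\<^sub>m e) $$ (r, j)) X * h r))"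
    by (subst sum.swap) (simp add: sum_distrib_left)
  finally have eqn: "y ^ Suc e * h i - (\<Sum>r<n. ev ((L ^\<^sub>m Suc e) $$ (r, i)) X * h r) =
      y ^ e * (y * h i - (\<Sum>j<n. ev (L $$ (j, i)) X * h j)) +
      (\<Sum>j<n. ev (L $$ (j, i)) X * (y ^ e * h j - (\<Sum>r<n. ev ((L ^\<^sub>m e) $$ (r, j)) X * h r)))"
    by (simp add: right_diff_distrib sum_subtractf sum_distrib_left mult_ac del: pow_mat.simps)
  show ?case unfolding eqn
    by (intro dvd_add dvd_mult dvd_sum Suc.IH Suc.prems h) auto
qed

end

sublocale lax_matrix \<subseteq> col: eigen_sequence n m k f "\<lambda>s t. L $$ (n - 1 - s, n - 1 - t)" "\<lambda>s t. (L ^\<^sub>m a) $$ (n - 1 - s, n - 1 - t)"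
  by unfold_locales (rule banded_columns[OF banded_L n_pos], rule banded_columns[OF banded_pow n_pos])

sublocale lax_matrix \<subseteq> row: eigen_sequence n m k f "\<lambda>s t. L $$ (t, s)" "\<lambda>s t. (L ^\<^sub>m a) $$ (t, s)"
  by unfold_locales (rule banded_rows[OF banded_L n_pos], rule banded_rows[OF banded_pow n_pos])

section \<open>The normalised eigenvectors and the orders of the cofactors at P\<close>

context lax_matrix begin

lemma col_eigen: "i < n \<Longrightarrow> col.eigen (\<lambda>s. Dl i (n - 1 - s))"
proof -
  assume i: "i < n"
  have reindex: "(\<Sum>t<n. g (n - 1 - t)) = (\<Sum>c<n. g c)" for g :: "nat \<Rightarrow> rat_fun"
    using sum.nat_diff_reindex[of g n] by simp
  show ?thesis
    unfolding col.eigen_def eigenvector_def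
  proof (intro conjI allI impI)
    fix s assume "s < n"
    have s: "n - 1 - s < n" using n_pos by simp
    show "F dvd Y * Dl i (n - 1 - s) - (\<Sum>t<n. ev (L $$ (n - 1 - s, n - 1 - t)) X * Dl i (n - 1 - t))"
      using Dl_right[OF s i] reindex[of "\<lambda>c. ev (L $$ (n - 1 - s, c)) X * Dl i c"] by simp
    show "F dvd Y ^ a * Dl i (n - 1 - s) - (\<Sum>t<n. ev ((L ^\<^sub>m a) $$ (n - 1 - s, n - 1 - t)) X * Dl i (n - 1 - t))"
      using power_right[OF Dl_right[OF _ i] s, of a] reindex[of "\<lambda>c. ev ((L ^\<^sub>m a) $$ (n - 1 - s, c)) X * Dl i c"] by simp
  qed
qed

lemma row_eigen: "j < n \<Longrightarrow> row.eigen (\<lambda>s. Dl s j)"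
  unfolding row.eigen_def eigenvector_def using Dl_left power_left[OF Dl_left] by blast

lemma char_mat_delete: "i < n \<Longrightarrow> cofactor (char_mat n L) i i = (- 1) ^ (n - 1) * char_poly (mat_delete L i i)"
proof -
  assume i: "i < n"
  have "mat_delete (char_mat n L) i i = (- 1) \<cdot>\<^sub>m char_poly_matrix (mat_delete L i i)"
    by (rule eq_matI) (use i in \<open>auto simp: mat_delete_def char_poly_matrix_def char_mat_def\<close>)
  then have "det (mat_delete (char_mat n L) i i) = (- 1) ^ (n - 1) * char_poly (mat_delete L i i)"
    by (simp add: char_poly_def char_poly_matrix_def)
  then show ?thesis by (simp add: cofactor_def)
qed

lemma char_poly_L: "f = (- 1) ^ n * char_poly L"
proof -
  have "char_mat n L = (- 1) \<cdot>\<^sub>m char_poly_matrix L"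
    by (rule eq_matI) (auto simp: char_poly_matrix_def char_mat_def)
  then show ?thesis using beta_L by (simp add: beta_def char_poly_def char_poly_matrix_def)
qed

text \<open>In y a diagonal cofactor has degree \<open>n - 1\<close>, below the degree of
  \<open>f\<close>.\<close>

lemma diagonal_nonzero: "i < n \<Longrightarrow> \<not> F dvd Dl i i"
proof -
  assume i: "i < n"
  have c: "mat_delete L i i \<in> carrier_mat (n - 1) (n - 1)" by (rule mat_delete_carrier) simp
  have "degree (cofactor (char_mat n L) i i) = n - 1 \<and> cofactor (char_mat n L) i i \<noteq> 0"
  proof -
    have "(- 1 :: complex poly poly) ^ (n - 1) = 1 \<or> (- 1 :: complex poly poly) ^ (n - 1) = - 1"
      by (cases "even (n - 1)") auto
    moreover have "char_poly (mat_delete L i i) \<noteq> 0" using degree_monic_char_poly[OF c] by auto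
    ultimately show ?thesis
      unfolding char_mat_delete[OF i] using degree_monic_char_poly[OF c] by auto
  qed
  moreover have "degree (emb h) = degree h" for h by (simp add: degree_map_poly)
  ultimately show ?thesis unfolding Dl_def using n_pos
    by (intro degree_less_not_F_dvd) (simp_all add: degree_f_eq)
qed

text \<open>The cofactors with first index \<open>i\<close> form an eigenvector with nonzero
  diagonal component, so \<open>eigen_zero\<close> excludes zeros.\<close>

lemma Dl_nonzero: "i < n \<Longrightarrow> j < n \<Longrightarrow> \<not> F dvd Dl i j"
  using col.eigen_zero[OF col_eigen, of i "n - 1 - j" "n - 1 - i"] diagonal_nonzero[of i] by auto

text \<open>The derivative of a characteristic polynomial is the sum of the characteristic
  polynomials of the matrices with one row and the same column deleted.\<close>

lemma trace_cofactors: "(\<Sum>i<n. Dl i i) = - emb (pderiv f)"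
proof -
  interpret e: comm_ring_hom emb by (rule comm_ring_hom_emb)
  have one: "pderiv ((- 1) ^ e :: complex poly poly) = 0" for e
    by (induction e) (simp_all add: pderiv_mult pderiv_minus)
  have "(\<Sum>i<n. cofactor (char_mat n L) i i) = (- 1) ^ (n - 1) * pderiv (char_poly L)"
    unfolding pderiv_char_poly[OF L_carrier] sum_distrib_left by (rule sum.cong) (simp_all add: char_mat_delete)
  also have "\<dots> = - pderiv f"
  proof -
    have "pderiv f = (- 1) ^ n * pderiv (char_poly L)" by (subst char_poly_L) (simp add: pderiv_mult one)
    also have "(- 1 :: complex poly poly) ^ n = - ((- 1) ^ (n - 1))" using n_pos by (cases n) auto
    finally show ?thesis by simp
  qed
  finally show ?thesis unfolding Dl_def e.hom_sum[symmetric] by (simp add: e.hom_uminus)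
qed

text \<open>The normalised right and left eigenvectors.\<close>

definition vc :: "nat \<Rightarrow> rat_fun" where
  "vc s = Dl (n - 1) (n - 1 - s) * inv\<^bsub>K\<^esub> (Dl (n - 1) (n - 1) mod F)"

definition vr :: "nat \<Rightarrow> rat_fun" where
  "vr s = Dl s 0 * inv\<^bsub>K\<^esub> (Dl 0 0 mod F)"

abbreviation e :: "nat \<Rightarrow> rat_fun" where "e \<equiv> extend n vc"
abbreviation eb :: "nat \<Rightarrow> rat_fun" where "eb \<equiv> extend n vr"

lemma inv_K: "\<not> F dvd h \<Longrightarrow> inv\<^bsub>K\<^esub> (h mod F) \<in> carrier K \<and> F dvd h * inv\<^bsub>K\<^esub> (h mod F) - 1"
proof -
  interpret K: field K by (rule field_K)
  assume "\<not> F dvd h"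
  then have "h mod F \<in> Units K" unfolding K.field_Units by (simp add: dvd_eq_mod_eq_0)
  then have "inv\<^bsub>K\<^esub> (h mod F) \<in> carrier K" "(h mod F) \<otimes>\<^bsub>K\<^esub> inv\<^bsub>K\<^esub> (h mod F) = \<one>\<^bsub>K\<^esub>"
    by (rule K.Units_inv_closed, rule K.Units_r_inv)
  then show ?thesis by (simp add: mod_mult_left_eq F_dvd_diff_iff)
qed

lemma vc_0: "F dvd vc 0 - 1" and vr_0: "F dvd vr 0 - 1"
  using inv_K diagonal_nonzero[of "n - 1"] diagonal_nonzero[of 0] n_pos by (simp_all add: vc_def vr_def)

lemma eigenvector_scale: "eigenvector n B y v \<Longrightarrow> eigenvector n B y (\<lambda>s. v s * h)"
  unfolding eigenvector_def
proof (intro allI impI)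
  fix s assume "\<forall>s<n. F dvd y * v s - (\<Sum>t<n. ev (B s t) X * v t)" "s < n"
  then have "F dvd (y * v s - (\<Sum>t<n. ev (B s t) X * v t)) * h" by simp
  then show "F dvd y * (v s * h) - (\<Sum>t<n. ev (B s t) X * (v t * h))"
    by (simp add: left_diff_distrib sum_distrib_right mult.assoc)
qed

lemma eigen_vc: "col.eigen vc" and eigen_vr: "row.eigen vr"
  using col_eigen[of "n - 1"] row_eigen[of 0] n_pos eigenvector_scale
  unfolding col.eigen_def row.eigen_def vc_def vr_def by auto

lemma e_pole: "inf.eq (e t) (- int t)" and eb_pole: "inf.eq (eb t) (- int t)"
  using col.pole_orders[OF eigen_vc vc_0] row.pole_orders[OF eigen_vr vr_0] by simp_all

lemma e_nonzero: "\<not> F dvd e t" and eb_nonzero: "\<not> F dvd eb t"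
  using e_pole eb_pole inf.eq_imp_not_F_dvd by blast+

text \<open>The adjugate of a singular matrix has rank 1.\<close>

lemma rank_one:
  assumes "s < n" "u < n"
  shows "F dvd Dl u (n - 1 - s) - vc s * vr u * Dl 0 (n - 1)"
proof -
  have "F dvd Dl u (n - 1 - s) - Dl u (n - 1) * vc s"
    using col.eigen_proportional[of "\<lambda>s. Dl u (n - 1 - s)" vc s] col_eigen[OF assms(2)] eigen_vc vc_0 assms(1) by simp
  moreover have "F dvd Dl u (n - 1) - Dl 0 (n - 1) * vr u"
    using row.eigen_proportional[of "\<lambda>s. Dl s (n - 1)" vr u] row_eigen[of "n - 1"] eigen_vr vr_0 assms(2) n_pos by simp
  ultimately have "F dvd (Dl u (n - 1 - s) - Dl u (n - 1) * vc s) + (Dl u (n - 1) - Dl 0 (n - 1) * vr u) * vc s"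
    by (intro dvd_add dvd_mult2)
  then show ?thesis by (simp add: algebra_simps)
qed

lemma rank_one_extend:
  "F dvd X ^ (t div n + u div n) * Dl (u mod n) (n - 1 - t mod n) - e t * eb u * Dl 0 (n - 1)"
proof -
  have "F dvd X ^ (t div n + u div n) * (Dl (u mod n) (n - 1 - t mod n) - vc (t mod n) * vr (u mod n) * Dl 0 (n - 1))"
    using n_pos by (intro dvd_mult rank_one) auto
  then show ?thesis by (simp add: extend_def power_add algebra_simps)
qed

text \<open>Both are the coefficient of \<open>x ^ b\<close> in the entry
  \<open>(n - 1 - t, n - t)\<close> of the power \<open>a\<close> of \<open>L\<close>.\<close>

lemma top_eq: "1 \<le> t \<Longrightarrow> t < n \<Longrightarrow> row.top (n - t) = col.top t"
proof -
  assume t: "1 \<le> t" "t < n"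
  have "n - t + b * n - 1 = n - 1 - t + b * n" "t + b * n - 1 = t - 1 + b * n" "n - 1 - (t - 1) = n - t"
    using t by linarith+
  moreover have "(r + b * n) mod n = r" "(r + b * n) div n = b" if "r < n" for r using that by simp_all
  moreover have "(n - t) mod n = n - t" "t mod n = t" "n - 1 - t < n" "t - 1 < n" using t by auto
  ultimately show ?thesis unfolding row.top_def col.top_def band_coeff_def by (simp only:)
qed

text \<open>The product of \<open>Z\<close>, \<open>e (t + 1)\<close> and
  \<open>eb (n - 1 - t)\<close> is expanded in two ways, with \<open>Z\<close> acting on the right
  or on the left eigenvector; the same constant appears by \<open>top_eq\<close>. So all diagonal
  cofactors share their leading term at \<open>P\<close> and cannot cancel in the trace.\<close>

lemma diagonal_asymp: "t < n \<Longrightarrow> ord_ge (P_inf f) (e t * eb (n - 1 - t) - e 0 * eb (n - 1)) (2 - int n)"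
proof (induction t)
  case (Suc t)
  let ?t = "Suc t" and ?c = "const (col.top (Suc t))"
  have t: "1 \<le> ?t" "?t < n" using Suc.prems by simp_all
  have e1: "e (?t + b * n - 1) = X ^ b * e t" using extend_add[of vc t b] by simp
  have "n - ?t + b * n - 1 = n - 1 - ?t + b * n" using t by linarith
  then have e2: "eb (n - ?t + b * n - 1) = X ^ b * eb (n - 1 - ?t)" using extend_add[of vr "n - 1 - ?t" b] by simp
  have "ord_ge (P_inf f) (Z * e ?t - ?c * (X ^ b * e t)) (1 - int (?t + b * n - 1))"
    using col.Z_asymp[OF eigen_vc vc_0, of ?t] unfolding e1 .
  from inf.ge_mult[OF this inf.eq_imp_ge[OF eb_pole[of "n - ?t"]]]
  have 1: "ord_ge (P_inf f) ((Z * e ?t - ?c * (X ^ b * e t)) * eb (n - ?t)) (2 - int (b * n) - int n)"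
    by (rule inf.ge_subst[OF _ refl]) (use t in \<open>simp add: of_nat_diff\<close>)
  have "ord_ge (P_inf f) (Z * eb (n - ?t) - ?c * (X ^ b * eb (n - 1 - ?t))) (1 - int (n - ?t + b * n - 1))"
    using row.Z_asymp[OF eigen_vr vr_0, of "n - ?t"] unfolding e2 top_eq[OF t] .
  from inf.ge_mult[OF this inf.eq_imp_ge[OF e_pole[of ?t]]]
  have 2: "ord_ge (P_inf f) ((Z * eb (n - ?t) - ?c * (X ^ b * eb (n - 1 - ?t))) * e ?t) (2 - int (b * n) - int n)"
  proof (rule inf.ge_subst[OF _ refl])
    have "n - ?t + b * n - 1 = b * n + (n - 1 - ?t)" using t by linarith
    then show "1 - int (n - ?t + b * n - 1) + - int ?t = 2 - int (b * n) - int n" using t by (simp add: of_nat_diff)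
  qed
  have "(Z * e ?t - ?c * (X ^ b * e t)) * eb (n - ?t) - (Z * eb (n - ?t) - ?c * (X ^ b * eb (n - 1 - ?t))) * e ?t
      = ?c * X ^ b * (e ?t * eb (n - 1 - ?t) - e t * eb (n - ?t))" by (simp add: algebra_simps)
  with inf.ge_diff[OF 1 2] have "ord_ge (P_inf f) (?c * X ^ b * (e ?t * eb (n - 1 - ?t) - e t * eb (n - ?t))) (2 - int (b * n) - int n)"
    by simp
  moreover have "inf.eq (?c * X ^ b) (0 + int b * - int n)"
    by (intro inf.eq_mult inf.eq_const inf.eq_power X_P col.top_nonzero[OF eigen_vc vc_0])
  moreover have "2 - int (b * n) - int n = 0 + int b * - int n + (2 - int n)" by simp
  ultimately have "ord_ge (P_inf f) (e ?t * eb (n - 1 - ?t) - e t * eb (n - ?t)) (2 - int n)"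
    using inf.ge_mult_cancel by metis
  moreover have "n - 1 - t = n - ?t" by simp
  ultimately show ?case using inf.asymp_trans Suc by (metis Suc_lessD)
qed simp

text \<open>By \<open>rank_one\<close> the trace is \<open>D0l\<close> times a sum of
  \<open>n\<close> terms with the same leading term of order \<open>1 - n\<close>, and its order is
  that of the derivative of \<open>f\<close>.\<close>

lemma Dl_P: "inf.eq (Dl 0 (n - 1)) (int n - 2 + int M - int (n - 1) * int (m + k))"
proof -
  let ?S = "\<Sum>t<n. e t * eb (n - 1 - t)"
  have "ord_ge (P_inf f) (\<Sum>t<n. e t * eb (n - 1 - t) - e 0 * eb (n - 1)) (2 - int n)"
    by (rule inf.ge_sum) (use diagonal_asymp in simp)
  then have "ord_ge (P_inf f) (?S - of_nat n * (e 0 * eb (n - 1))) (2 - int n)"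
    by (simp add: sum_subtractf)
  moreover have "of_nat c = const (of_nat c)" for c by (induction c) (simp_all add: const_add)
  moreover have "inf.eq (const (of_nat n) * (e 0 * eb (n - 1))) (0 + (- int 0 + - int (n - 1)))"
    by (intro inf.eq_mult inf.eq_const e_pole eb_pole) (use n_pos in simp)
  moreover have "0 + (- int 0 + - int (n - 1)) = 1 - int n" using n_pos by (simp add: of_nat_diff)
  ultimately have S: "inf.eq ?S (1 - int n)"
    using inf.eq_cong[of ?S "const (of_nat n) * (e 0 * eb (n - 1))" "1 - int n"] by simp
  have "F dvd (\<Sum>t<n. Dl (n - 1 - t) (n - 1 - t) - e t * eb (n - 1 - t) * Dl 0 (n - 1))"
    by (rule dvd_sum) (use rank_one n_pos in \<open>simp add: extend_less\<close>)
  then have "F dvd (\<Sum>t<n. Dl (n - 1 - t) (n - 1 - t)) - ?S * Dl 0 (n - 1)"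
    by (simp add: sum_subtractf sum_distrib_right)
  also have "(\<Sum>t<n. Dl (n - 1 - t) (n - 1 - t)) = - emb (pderiv f)"
    using sum.nat_diff_reindex[of "\<lambda>i. Dl i i" n] trace_cofactors by simp
  finally have "inf.eq (- emb (pderiv f)) d \<longleftrightarrow> inf.eq (?S * Dl 0 (n - 1)) d" for d by (rule inf.eq_cong_F)
  then have "inf.eq (?S * Dl 0 (n - 1)) (1 - int n + (int n - 2 + int M - int (n - 1) * int (m + k)))"
    using pderiv_f_P by (simp add: algebra_simps)
  then show ?thesis using inf.eq_mult_cancel[OF S] by blast
qed

end

section \<open>The divisors of an eigenvector\<close>

context spectral_curve begin

abbreviation SO :: divisor where "SO \<equiv> \<Sum>p\<in>O_points f. frag_of p"

lemma mult_at_SO [simp]: "mult_at SO p = (if p \<in> O_points f then 1 else 0)"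
  unfolding lookup_sum using finite_O_points by simp

lemma degree_SO [simp]: "div_degree SO = int N"
  using card_O_points by simp

text \<open>The division by 2 in \<open>genus_value\<close> is exact: for even \<open>n\<close> the
  numbers \<open>M\<close> and \<open>N\<close> have the parities of \<open>m + k\<close> and
  \<open>k\<close>, and for odd \<open>n\<close> both are odd.\<close>

lemma twice_genus: "2 * genus_value n m k = int ((n - 1) * m) - int M - int N + 2"
proof -
  have "even ((int n - 1) * int m - int M - int N + 2)"
  proof (cases "even n")
    case True
    have M: "even M \<longleftrightarrow> even (m + k)" and N: "even N \<longleftrightarrow> even k"
      unfolding M_def N_def using True by (simp_all add: gcd_greatest_iff dvd_trans[of 2] )
    then show ?thesis using True by auto
  next
    case False
    then have "odd M" "odd N" unfolding M_def N_def using dvd_trans gcd_dvd1 by blast+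
    then show ?thesis using False by auto
  qed
  moreover have "int (n - 1) = int n - 1" using n by (simp add: of_nat_diff)
  ultimately show ?thesis unfolding genus_value_def M_def[symmetric] N_def[symmetric] by simp
qed

text \<open>The least effective divisor \<open>D\<close> away from \<open>P\<close> such that \<open>v_s, v_(s + 1), \<dots>\<close> are sections of \<open>D\<close> there.\<close>

definition pole_div :: "(nat \<Rightarrow> rat_fun) \<Rightarrow> nat \<Rightarrow> divisor" where
  "pole_div v s = Abs_poly_mapping (\<lambda>p. if p \<in> points f - {P_inf f}
     then Max ((\<lambda>t. - mult_at (pdiv (extend n v t)) p) ` {s..<s + n}) else 0)"

end

locale nonzero_vector = spectral_curve +
  fixes v :: "nat \<Rightarrow> rat_fun"
  assumes nonzero: "\<not> F dvd extend n v t"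
begin

abbreviation "w \<equiv> extend n v"
abbreviation "DD \<equiv> pole_div v"

lemma mult_at_pole_div: "mult_at (DD s) p = (if p \<in> points f - {P_inf f}
     then Max ((\<lambda>t. - mult_at (pdiv (w t)) p) ` {s..<s + n}) else 0)"
proof -
  have ne: "{s..<s + n} \<noteq> {}" using n_pos by simp
  have "{p. (if p \<in> points f - {P_inf f} then Max ((\<lambda>t. - mult_at (pdiv (w t)) p) ` {s..<s + n}) else 0) \<noteq> 0}
      \<subseteq> (\<Union>t\<in>{s..<s + n}. Poly_Mapping.keys (pdiv (w t)))"
  proof
    fix p assume p: "p \<in> {p. (if p \<in> points f - {P_inf f} then Max ((\<lambda>t. - mult_at (pdiv (w t)) p) ` {s..<s + n}) else 0) \<noteq> 0}"
    show "p \<in> (\<Union>t\<in>{s..<s + n}. Poly_Mapping.keys (pdiv (w t)))"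
    proof (rule ccontr)
      assume "p \<notin> (\<Union>t\<in>{s..<s + n}. Poly_Mapping.keys (pdiv (w t)))"
      then have z: "- mult_at (pdiv (w t)) p = 0" if "t \<in> {s..<s + n}" for t using that by (simp add: in_keys_iff)
      have "(\<lambda>t. - mult_at (pdiv (w t)) p) ` {s..<s + n} = (\<lambda>_. 0) ` {s..<s + n}"
        by (rule image_cong[OF refl z])
      then have "Max ((\<lambda>t. - mult_at (pdiv (w t)) p) ` {s..<s + n}) = 0"
        unfolding image_constant_conv using ne by simp
      then show False using p by (simp split: if_splits)
    qed
  qed
  then have "finite {p. (if p \<in> points f - {P_inf f} then Max ((\<lambda>t. - mult_at (pdiv (w t)) p) ` {s..<s + n}) else 0) \<noteq> 0}"
    by (rule finite_subset) simp
  then show ?thesis by (simp add: pole_div_def)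
qed

lemma pole_div_Div: "DD s \<in> Div"
  unfolding Div_iff mult_at_pole_div by simp

lemma pole_div_P [simp]: "mult_at (DD s) (P_inf f) = 0"
  by (simp add: mult_at_pole_div)

lemma pole_div_outside [simp]: "p \<notin> points f \<Longrightarrow> mult_at (DD s) p = 0"
  by (simp add: mult_at_pole_div)

lemma pole_div_attained:
  assumes "p \<in> points f" "p \<noteq> P_inf f"
  obtains t where "t \<ge> s" "t < s + n" "mult_at (DD s) p = - mult_at (pdiv (w t)) p"
proof -
  have "Max ((\<lambda>t. - mult_at (pdiv (w t)) p) ` {s..<s + n}) \<in> (\<lambda>t. - mult_at (pdiv (w t)) p) ` {s..<s + n}"
    using n_pos by (intro Max_in) auto
  then obtain t where "t \<in> {s..<s + n}" "Max ((\<lambda>t. - mult_at (pdiv (w t)) p) ` {s..<s + n}) = - mult_at (pdiv (w t)) p"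
    by (rule imageE) simp
  then show thesis using that[of t] assms by (simp add: mult_at_pole_div)
qed

lemma pdiv_shift: "pdiv (w (t + q * n)) = pdiv (X ^ q) + pdiv (w t)"
  unfolding extend_add by (rule pdiv_mult) (use not_F_dvd_X nonzero in \<open>auto simp: F_dvd_power_iff\<close>)

text \<open>The maximum over one period suffices, because multiplication by x creates no poles away
  from \<open>P\<close>.\<close>

lemma pole_div_bound:
  assumes "p \<in> points f" "p \<noteq> P_inf f" "t \<ge> s"
  shows "- mult_at (pdiv (w t)) p \<le> mult_at (DD s) p"
proof -
  interpret curve_point f p by unfold_locales (rule assms(1))
  define r where "r = s + (t - s) mod n"
  define q where "q = (t - s) div n"
  have t: "t = r + q * n" using assms(3) div_mult_mod_eq[of "t - s" n] unfolding r_def q_def by linarith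
  have "eq (X ^ q) (mult_at (pdiv (X ^ q)) p)" by (rule pdiv_eq) (use not_F_dvd_X assms(1) in \<open>auto simp: F_dvd_power_iff\<close>)
  moreover have "ord_ge p (X ^ q) 0" using ge_power[OF affine_X[OF assms(1,2)], of q] by simp
  ultimately have "mult_at (pdiv (X ^ q)) p \<ge> 0" by (simp add: eq_ge_iff)
  then have "- mult_at (pdiv (w t)) p \<le> - mult_at (pdiv (w r)) p" unfolding t pdiv_shift by simp
  also have "\<dots> \<le> mult_at (DD s) p"
    unfolding mult_at_pole_div using assms n_pos by (auto simp: r_def intro!: Max_ge)
  finally show ?thesis .
qed

lemma ge_pole_div:
  assumes "p \<in> points f" "p \<noteq> P_inf f" "t \<ge> s"
  shows "ord_ge p (w t) (- mult_at (DD s) p)"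
  using pole_div_bound[OF assms] valuation.eq_ge_iff[OF valuation_point[OF assms(1)] pdiv_eq[OF nonzero assms(1)]] by simp

lemma pole_div_mono: "s \<le> t \<Longrightarrow> effective (DD s - DD t)"
  unfolding effective_def
proof
  fix p assume st: "s \<le> t"
  show "0 \<le> mult_at (DD s - DD t) p"
  proof (cases "p \<in> points f \<and> p \<noteq> P_inf f")
    case True
    then obtain r where r: "r \<ge> t" "mult_at (DD t) p = - mult_at (pdiv (w r)) p" using pole_div_attained by blast
    then show ?thesis using pole_div_bound[of p s r] True st by simp
  qed (auto simp: mult_at_pole_div)
qed

text \<open>Shifting the sequence by \<open>n\<close> multiplies it by x, whose zeros are those of
  order \<open>n'\<close> over the origin.\<close>

lemma pole_div_add_n: "DD (s + n) = DD s - frag_cmul (int n') SO"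
proof (rule poly_mapping_eqI)
  fix p
  show "mult_at (DD (s + n)) p = mult_at (DD s - frag_cmul (int n') SO) p"
  proof (cases "p \<in> points f - {P_inf f}")
    case True
    then have p: "p \<in> points f" "p \<noteq> P_inf f" by auto
    interpret curve_point f p by unfold_locales (rule p(1))
    have X: "mult_at (pdiv X) p = (if p \<in> O_points f then int n' else 0)"
      using pdiv_eqI[OF p(1) O_point_X] pdiv_eqI[OF p(1) X_eq_0[OF p]] by simp
    have shift: "mult_at (pdiv (w (t + n))) p = mult_at (pdiv X) p + mult_at (pdiv (w t)) p" for t
      using pdiv_shift[of t 1] by simp
    show ?thesis
    proof (rule order_antisym)
      obtain t where t: "t \<ge> s + n" "mult_at (DD (s + n)) p = - mult_at (pdiv (w t)) p" using pole_div_attained[OF p] by blast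
      define r where "r = t - n"
      have "t = r + n" "r \<ge> s" using t(1) by (simp_all add: r_def)
      then show "mult_at (DD (s + n)) p \<le> mult_at (DD s - frag_cmul (int n') SO) p"
        using pole_div_bound[OF p \<open>r \<ge> s\<close>] t(2) shift[of r] X by simp
    next
      obtain t where t: "t \<ge> s" "mult_at (DD s) p = - mult_at (pdiv (w t)) p" using pole_div_attained[OF p] by blast
      then show "mult_at (DD s - frag_cmul (int n') SO) p \<le> mult_at (DD (s + n)) p"
        using pole_div_bound[OF p, of "s + n" "t + n"] shift[of t] X by (cases "p \<in> O_points f") simp_all
    qed
  next
    case False
    then show ?thesis using P_inf_not_O O_points_point by (auto simp: mult_at_pole_div)
  qed
qed

lemma degree_pole_div_add_n: "div_degree (DD (s + n)) = div_degree (DD s) - int n"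
proof -
  have "int n' * int N = int n" using arg_cong[OF n'N, of int] unfolding of_nat_mult .
  then show ?thesis unfolding pole_div_add_n div_degree_diff div_degree_cmul degree_SO by simp
qed

text \<open>\<open>DD (s + t)\<close> lies between \<open>DD (s + n)\<close> and
  \<open>DD s\<close>, which only differ over the origin.\<close>

lemma pole_div_off_O: "p \<notin> O_points f \<Longrightarrow> t \<le> n \<Longrightarrow> mult_at (DD (s + t)) p = mult_at (DD s) p"
proof -
  assume p: "p \<notin> O_points f" "t \<le> n"
  have "0 \<le> mult_at (DD s - DD (s + t)) p" "0 \<le> mult_at (DD (s + t) - DD (s + n)) p"
    using pole_div_mono[of s "s + t"] pole_div_mono[of "s + t" "s + n"] p(2) unfolding effective_def by auto
  then show ?thesis using p(1) unfolding pole_div_add_n by simp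
qed

end

locale pole_sequence_vector = nonzero_vector +
  assumes poles: "inf.eq (w t) (- int t)" and w0: "w 0 = 1 \<or> F dvd w 0 - 1"
begin

lemma degree_pole_div_ge: "div_degree (DD s) = genus_value n m k - int s + int (ell (DD s + frag_cmul (int s - 1) (frag_of (P_inf f))))"
  by (rule pole_sequence(1)[of "DD s" s w]) (use pole_div_Div poles ge_pole_div in auto)

lemma ell_pole_div: "ell (DD s + frag_cmul (int s - 1 + int r) (frag_of (P_inf f))) = ell (DD s + frag_cmul (int s - 1) (frag_of (P_inf f))) + r"
  by (rule pole_sequence(2)[of "DD s" s w]) (use pole_div_Div poles ge_pole_div in auto)

lemma pole_div_0_effective: "effective (DD 0)"
  unfolding effective_def
proof
  fix p
  show "0 \<le> mult_at (DD 0) p"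
  proof (cases "p \<in> points f \<and> p \<noteq> P_inf f")
    case True
    have "pdiv (w 0) = 0" using w0 pdiv_cong by auto
    then show ?thesis using pole_div_bound[of p 0 0] True by simp
  qed (auto simp: mult_at_pole_div)
qed

end

locale regular_sequence = pole_sequence_vector +
  assumes degree_DD_le_n: "s \<le> n \<Longrightarrow> div_degree (DD s) = genus_value n m k - int s"
begin

lemma degree_DD: "div_degree (DD s) = genus_value n m k - int s"
proof (induction s rule: less_induct)
  case (less s)
  show ?case
  proof (cases "s \<le> n")
    case False
    then have "div_degree (DD (s - n)) = genus_value n m k - int (s - n)" using less n_pos by simp
    then show ?thesis using degree_pole_div_add_n[of "s - n"] False by (simp add: of_nat_diff)
  qed (rule degree_DD_le_n)
qed

lemma ell_DD_zero: "ell (DD s + frag_cmul (int s - 1) (frag_of (P_inf f))) = 0"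
  using degree_pole_div_ge[of s] degree_DD[of s] by simp

lemma LL_DD_zero: "LL (DD s + frag_cmul (int s - 1) (frag_of (P_inf f))) = {0}"
  using ell_DD_zero[of s] ell_0_iff[of "DD s + frag_cmul (int s - 1) (frag_of (P_inf f))"] pole_div_Div P_inf_point by simp

lemma ell_DD_one: "ell (DD s + frag_cmul (int s) (frag_of (P_inf f))) = 1"
  using ell_pole_div[of s 1] ell_DD_zero[of s] by simp

definition opt :: "nat \<Rightarrow> point" where "opt s = (THE p. DD s - DD (Suc s) = frag_of p)"

text \<open>An effective divisor of degree 1 is a point, and by \<open>pole_div_off_O\<close>
  nothing changes except over the origin.\<close>

lemma opt: "DD s - DD (Suc s) = frag_of (opt s)" and opt_O: "opt s \<in> O_points f"
proof -
  let ?D = "DD s - DD (Suc s)"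
  have eff: "effective ?D" by (rule pole_div_mono) simp
  have deg: "div_degree ?D = 1" unfolding div_degree_diff degree_DD by simp
  then have "?D \<noteq> 0" by force
  then obtain p where p: "p \<in> Poly_Mapping.keys ?D" by fastforce
  then have pos: "mult_at ?D p > 0" using eff by (metis effective_def in_keys_iff order_le_less)
  then have "effective (?D - frag_of p)" using eff by (auto simp: effective_def)
  then have D: "?D = frag_of p" by (rule effective_degree_eq) (simp only: deg div_degree_frag_of)
  have "opt s = p" unfolding opt_def D frag_of_eq by (rule the_equality) auto
  with D show o: "?D = frag_of (opt s)" by simp
  have "p \<in> O_points f"
  proof (rule ccontr)
    assume "p \<notin> O_points f"
    then have "mult_at (DD (Suc s)) p = mult_at (DD s) p" using pole_div_off_O[of p 1 s] n_pos by simp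
    then show False using pos by simp
  qed
  then show "opt s \<in> O_points f" using D o frag_of_eq by metis
qed

lemma sum_opt: "(\<Sum>j\<in>{s..<s + r}. frag_of (opt j)) = DD s - DD (s + r)"
  by (induction r) (simp_all flip: opt)

end

section \<open>Degrees and orders for a Lax matrix\<close>

context lax_matrix begin

sublocale e: nonzero_vector n m k f vc
  by unfold_locales (rule e_nonzero)

sublocale eb: nonzero_vector n m k f vr
  by unfold_locales (rule eb_nonzero)

sublocale e: pole_sequence_vector n m k f vc
  by unfold_locales (use e_pole vc_0 in \<open>auto simp: extend_less n_pos\<close>)

sublocale eb: pole_sequence_vector n m k f vr
  by unfold_locales (use eb_pole vr_0 in \<open>auto simp: extend_less n_pos\<close>)

abbreviation "D0l \<equiv> Dl 0 (n - 1)"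

lemma D0l_nonzero: "\<not> F dvd D0l"
  using Dl_nonzero n_pos by simp

lemma Dl_regular: "p \<in> points f \<Longrightarrow> p \<noteq> P_inf f \<Longrightarrow> ord_ge p (Dl i j) 0"
proof -
  assume p: "p \<in> points f" "p \<noteq> P_inf f"
  interpret curve_point f p by unfold_locales (rule p(1))
  show ?thesis unfolding Dl_def using affine_X[OF p] Y_regular[OF p(1)] by (intro ge_emb) auto
qed

lemma sum_skip: "i < n \<Longrightarrow> (\<Sum>x<n - 1. g (if x < i then x else Suc x)) = (\<Sum>x<n. g x) - (g i :: int)"
proof -
  assume i: "i < n"
  have "(\<Sum>x<n - 1. g (if x < i then x else Suc x)) = sum g ({..<n} - {i})"
  proof (rule sum.reindex_bij_witness[of _ "\<lambda>x. if x < i then x else x - 1" "\<lambda>x. if x < i then x else Suc x"])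
  qed (use i in auto)
  then show ?thesis using i by (simp add: sum_diff1)
qed

text \<open>With \<open>N v(x) = n\<close> and \<open>N v(y) = k\<close> at the points over the origin, the entry \<open>(r, c)\<close> of \<open>L - y\<close>
  has order at least \<open>(c - r + k) / N\<close>.\<close>

lemma Dl_O:
  assumes p: "p \<in> O_points f" and ij: "i < n" "j < n"
    and D: "int N * (D - 1) < int (n - 1) * int k + int i - int j"
  shows "ord_ge p (Dl i j) D"
proof -
  interpret em: comm_ring_hom emb by (rule comm_ring_hom_emb)
  interpret curve_point f p by unfold_locales (rule O_points_point[OF p])
  have nN: "int N * int n' = int n" and kN: "int N * int k' = int k"
    using arg_cong[OF n'N, of int] arg_cong[OF k'N, of int] by (simp_all add: mult.commute)
  have entry: "\<exists>d. ord_ge p (emb (char_mat n L $$ (r, c))) d \<and> int c + int k - int r \<le> int N * d" if rc: "r < n" "c < n" for r c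
  proof -
    \<comment> \<open>The ceiling of \<open>(c + k - r) / N\<close>.\<close>
    define d where "d = - ((int r - int k - int c) div int N)"
    have dN: "x \<ge> d" if "int N * x \<ge> int c + int k - int r" for x
    proof -
      have "int N * (- x) div int N \<le> (int r - int k - int c) div int N" using that N_pos by (intro zdiv_mono1) auto
      moreover have "int N * (- x) div int N = - x" using N_pos by (intro nonzero_mult_div_cancel_left) simp
      ultimately show ?thesis unfolding d_def by linarith
    qed
    have "int c + int k - int r \<le> int N * d"
    proof -
      have "int N * ((int r - int k - int c) div int N) \<le> int r - int k - int c"
        using mult_div_mod_eq[of "int N" "int r - int k - int c"] pos_mod_sign[of "int N" "int r - int k - int c"] N_pos
        by linarith
      moreover have "int N * d = - (int N * ((int r - int k - int c) div int N))" unfolding d_def by (rule mult_minus_right)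
      ultimately show ?thesis by linarith
    qed
    moreover have "ord_ge p (emb [:L $$ (r, c):]) d"
    proof (rule ge_emb_bound)
      fix l i assume nz: "coeff_xy [:L $$ (r, c):] l i \<noteq> 0"
      then have "i = 0" "poly.coeff (L $$ (r, c)) l \<noteq> 0" by (auto simp: coeff_xy_def coeff_pCons split: nat.splits)
      then have "int k \<le> int r + int l * int n - int c" using banded_matD(1)[OF banded_L rc] by blast
      then have "int N * (int l * int n') \<ge> int c + int k - int r" using nN by (simp add: mult.left_commute)
      from dN[OF this] have "ord_ge p (X ^ l) d" using ge_mono[OF eq_imp_ge[OF eq_power[OF O_point_X[OF p]]]] by blast
      then show "ord_ge p (X ^ l * Y ^ i) d" using \<open>i = 0\<close> by simp
    qed
    moreover have "ord_ge p Y d" if "r = c"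
      using dN[of "int k'"] kN that ge_mono[OF eq_imp_ge[OF O_point_Y[OF p]]] by simp
    ultimately show ?thesis
      using rc by (intro exI[of _ d]) (auto simp: char_mat_index Y_def[symmetric] intro!: ge_diff)
  qed
  define B where "B = map_mat emb (mat_delete (char_mat n L) i j)"
  let ?r = "\<lambda>x. if x < i then x else Suc x" and ?c = "\<lambda>x. if x < j then x else Suc x"
  have carrier: "B \<in> carrier_mat (n - 1) (n - 1)" unfolding B_def using mat_delete_carrier[OF char_mat_carrier] by simp
  have "ord_ge p (det B) D"
  proof (rule scaled_ge_det[OF carrier, of "int N" "\<lambda>x. int (?c x) + int k" "\<lambda>x. int (?r x)"])
    fix x y assume xy: "x < n - 1" "y < n - 1"
    then have "B $$ (x, y) = emb (char_mat n L $$ (?r x, ?c y))" by (simp add: B_def mat_delete_def)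
    moreover have "?r x < n" "?c y < n" using xy by auto
    ultimately show "\<exists>d. ord_ge p (B $$ (x, y)) d \<and> int (?c y) + int k - int (?r x) \<le> int N * d" using entry by simp
  next
    \<comment> \<open>With row \<open>i\<close> and column \<open>j\<close> missing,
      \<open>n - 1\<close> terms \<open>k\<close> remain and the indices cancel up to
      \<open>i - j\<close>.\<close>
    have "(\<Sum>x<n - 1. int (?c x) + int k) - (\<Sum>x<n - 1. int (?r x)) = int (n - 1) * int k + int i - int j"
      using sum_skip[OF ij(1), of int] sum_skip[OF ij(2), of int] by (simp add: sum.distrib)
    then show "int N * (D - 1) < (\<Sum>x<n - 1. int (?c x) + int k) - (\<Sum>x<n - 1. int (?r x))" using D by simp
  qed (use N_pos in simp)
  moreover have "Dl i j = (- 1) ^ (i + j) * det B"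
    unfolding Dl_def cofactor_def B_def by (simp add: em.hom_mult em.hom_power em.hom_uminus em.hom_det)
  moreover have "ord_ge p ((- 1) ^ e) 0" for e :: nat
    using ge_power[OF ge_uminus[OF ge_one], of e] by simp
  ultimately show ?thesis using ge_mult[of "(- 1) ^ (i + j)" 0 "det B" D] by simp
qed

text \<open>A lower bound for the order of \<open>e t * eb u * D0l\<close> over the origin when
  \<open>t + u >= n\<close>: by \<open>Dl_O\<close> the product of \<open>N\<close> and the order is
  at least \<open>(n - 1) k + t + u - n + 1\<close>, which exceeds
  \<open>(n - 1) k = N (n - 1) k'\<close>, and orders are integers.\<close>

definition o_shift :: int where "o_shift = int ((n - 1) * k') + 1"

lemma product_O:
  assumes p: "p \<in> O_points f" and tu: "t + u \<ge> n"
  shows "ord_ge p (e t * eb u * D0l) o_shift"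
proof -
  interpret curve_point f p by unfold_locales (rule O_points_point[OF p])
  define q where "q = t div n + u div n"
  let ?D = "o_shift - int q * int n'"
  have nN: "int N * int n' = int n" and kN: "int N * int k' = int k"
    using arg_cong[OF n'N, of int] arg_cong[OF k'N, of int] by (simp_all add: mult.commute)
  have tn: "t mod n < n" "u mod n < n" "n - 1 - t mod n < n" using n_pos by simp_all
  have "int t = int (t div n) * int n + int (t mod n)" "int u = int (u div n) * int n + int (u mod n)"
    by (metis div_mult_mod_eq of_nat_add of_nat_mult)+
  then have tuq: "int t + int u = int q * int n + int (t mod n) + int (u mod n)" by (simp add: q_def distrib_right)
  have "int N * (?D - 1) = int (n - 1) * int k - int q * int n"
  proof -
    have "int N * (?D - 1) = int (n - 1) * (int N * int k') - int q * (int N * int n')"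
      unfolding o_shift_def of_nat_mult by (simp add: algebra_simps)
    then show ?thesis unfolding nN kN .
  qed
  moreover have "int (n - 1 - t mod n) = int n - 1 - int (t mod n)" using tn(1) by (simp add: of_nat_diff)
  ultimately have "int N * (?D - 1) < int (n - 1) * int k + int (u mod n) - int (n - 1 - t mod n)"
    using tuq tu by linarith
  from ge_mult[OF ge_power[OF eq_imp_ge[OF O_point_X[OF p]], of q] Dl_O[OF p tn(2,3) this]]
  have "ord_ge p (X ^ q * Dl (u mod n) (n - 1 - t mod n)) o_shift" by simp
  then show ?thesis using ord_ge_cong[OF rank_one_extend[of t u, folded q_def]] by blast
qed

lemma product_affine:
  assumes "p \<in> points f" "p \<noteq> P_inf f"
  shows "ord_ge p (e t * eb u * D0l) 0"
proof -
  interpret curve_point f p by unfold_locales (rule assms(1))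
  have "ord_ge p (X ^ (t div n + u div n) * Dl (u mod n) (n - 1 - t mod n)) 0"
    using ge_mult[OF ge_power[OF affine_X[OF assms]] Dl_regular[OF assms]] by fastforce
  then show ?thesis using ord_ge_cong[OF rank_one_extend] by blast
qed

text \<open>The common value of \<open>D_s + D'_(n - s)\<close>, where \<open>D\<close> and \<open>D'\<close> belong to the right and left eigenvectors.\<close>

definition total :: divisor where
  "total = pdiv D0l - frag_cmul (mult_at (pdiv D0l) (P_inf f)) (frag_of (P_inf f)) - frag_cmul o_shift SO"

lemma D0l_P: "mult_at (pdiv D0l) (P_inf f) = int n - 2 + int M - int (n - 1) * int (m + k)"
  using pdiv_eqI[OF P_inf_point Dl_P] .

text \<open>The divisor of \<open>D0l\<close> has degree 0, so only the subtracted multiples of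
  \<open>P\<close> and \<open>SO\<close> count. The value is the sum of the lower bounds for the
  degrees of \<open>pole_div vc s\<close> and \<open>pole_div vr (n - s)\<close>.\<close>

lemma degree_total: "div_degree total = 2 * genus_value n m k - int n"
proof -
  have kN: "int k' * int N = int k" using arg_cong[OF k'N, of int] by simp
  have "int N * o_shift = int (n - 1) * (int k' * int N) + int N"
    unfolding o_shift_def of_nat_mult by (simp only: distrib_left mult_1_right mult_ac)
  then have "o_shift * int N = int (n - 1) * int k + int N" unfolding kN by (simp only: mult.commute)
  moreover have "int (n - 1) * int (m + k) = int (n - 1) * int m + int (n - 1) * int k" unfolding of_nat_add by (rule distrib_left)
  moreover have "0 - (a - 2 + b - c) * 1 - d = e - b - h + 2 - a" if "d = g + h" "c = e + g" for a b c d e g h :: int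
    using that by simp
  ultimately show ?thesis
    unfolding total_def div_degree_diff div_degree_cmul degree_SO div_degree_frag_of degree_pdiv[OF D0l_nonzero] D0l_P twice_genus of_nat_mult
    by blast
qed

text \<open>At each point both multiplicities are attained by single components, whose indices again
  add up to at least \<open>n\<close>, so the order of their product with \<open>D0l\<close> is
  bounded.\<close>

lemma total_bound: "s + u \<ge> n \<Longrightarrow> effective (total - (pole_div vc s + pole_div vr u))"
  unfolding effective_def
proof
  fix p assume su: "s + u \<ge> n"
  show "0 \<le> mult_at (total - (pole_div vc s + pole_div vr u)) p"
  proof (cases "p \<in> points f \<and> p \<noteq> P_inf f")
    case True
    then have p: "p \<in> points f" "p \<noteq> P_inf f" by auto
    interpret curve_point f p by unfold_locales (rule p(1))
    obtain t where t: "t \<ge> s" "mult_at (pole_div vc s) p = - mult_at (pdiv (e t)) p" using e.pole_div_attained[OF p] by blast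
    obtain t' where t': "t' \<ge> u" "mult_at (pole_div vr u) p = - mult_at (pdiv (eb t')) p" using eb.pole_div_attained[OF p] by blast
    have ex: "eq (e t * eb t' * D0l) (mult_at (pdiv (e t)) p + mult_at (pdiv (eb t')) p + mult_at (pdiv D0l) p)"
      by (intro eq_mult pdiv_eq e_nonzero eb_nonzero D0l_nonzero p)
    have "(if p \<in> O_points f then o_shift else 0) \<le> mult_at (pdiv (e t)) p + mult_at (pdiv (eb t')) p + mult_at (pdiv D0l) p"
      using product_O[of p t t'] product_affine[OF p, of t t'] su t(1) t'(1) unfolding eq_ge_iff[OF ex] by auto
    then show ?thesis using t(2) t'(2) p by (cases "p \<in> O_points f") (simp_all add: total_def)
  next
    case False
    then have "p \<notin> O_points f" using P_inf_not_O O_points_point by blast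
    moreover have "mult_at (pdiv D0l) p = 0" if "p \<notin> points f" by (rule mult_at_pdiv_outside[OF D0l_nonzero that])
    ultimately show ?thesis using False P_inf_point
      by (cases "p = P_inf f") (simp_all add: total_def)
  qed
qed

lemma degrees:
  assumes "s \<le> n"
  shows "div_degree (pole_div vc s) = genus_value n m k - int s" (is ?A)
    and "div_degree (pole_div vr (n - s)) = genus_value n m k - int (n - s)" (is ?B)
    and "pole_div vc s + pole_div vr (n - s) = total" (is ?C)
proof -
  have eff: "effective (total - (pole_div vc s + pole_div vr (n - s)))" using assms by (intro total_bound) simp
  from effective_degree_nonneg[OF this] degree_total
  have "div_degree (pole_div vc s) + div_degree (pole_div vr (n - s)) \<le> 2 * genus_value n m k - int n" by simp
  moreover have "div_degree (pole_div vc s) \<ge> genus_value n m k - int s" using e.degree_pole_div_ge[of s] by simp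
  moreover have "div_degree (pole_div vr (n - s)) \<ge> genus_value n m k - int (n - s)" using eb.degree_pole_div_ge[of "n - s"] by simp
  ultimately show A: ?A and B: ?B using assms by (simp_all add: of_nat_diff)
  have "div_degree total = div_degree (pole_div vc s + pole_div vr (n - s))" using A B assms degree_total by (simp add: of_nat_diff)
  from effective_degree_eq[OF eff this] show ?C by simp
qed

sublocale e: regular_sequence n m k f vc
  by unfold_locales (rule degrees(1))

sublocale eb: regular_sequence n m k f vr
proof unfold_locales
  fix s assume "s \<le> n"
  then show "div_degree (pole_div vr s) = genus_value n m k - int s" using degrees(2)[of "n - s"] by simp
qed

end

section \<open>The ordering of the points over the origin\<close>

lemma O_sum_Suc: "O_sum ord j (i + 1) = O_sum ord j i + frag_of (O_at ord (i + 1))"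
proof -
  consider "j \<le> i" | "j = i + 1" | "j > i + 1" by linarith
  then show ?thesis
  proof cases
    case 1
    then have "{j..i + 1} = insert (i + 1) {j..i}" by auto
    then show ?thesis using 1 by (simp add: O_sum_def add.commute)
  next
    case 3
    then have "{i + 1..j - 1} = insert (i + 1) {i + 1 + 1..j - 1}" by auto
    then show ?thesis using 3 by (simp add: O_sum_def)
  qed (simp add: O_sum_def)
qed

lemma O_sum_empty: "O_sum ord (j + 1) j = 0"
  by (simp add: O_sum_def)

lemma O_sum_pred: "O_sum ord j (i - 1) = O_sum ord j i - frag_of (O_at ord i)"
  using O_sum_Suc[of ord j "i - 1"] by simp

text \<open>The sign convention makes \<open>O_sum\<close> additive like an integral, whatever the
  order of the bounds.\<close>

lemma O_sum_append: "O_sum ord (j + 1) i + O_sum ord (i + 1) l = O_sum ord (j + 1) l"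
proof (induction l rule: int_induct[where k = i])
  case base
  then show ?case by (simp add: O_sum_empty)
next
  case (step1 l)
  then show ?case by (simp add: O_sum_Suc flip: add.assoc)
next
  case (step2 l)
  then show ?case by (simp add: O_sum_pred diff_eq_eq flip: add_diff_eq)
qed

lemma O_sum_nonneg: "j \<le> i + 1 \<Longrightarrow> mult_at (O_sum ord j i) p \<ge> 0"
  by (auto simp: O_sum_def lookup_sum intro!: sum_nonneg)

context spectral_curve begin

lemma pdiv_X: "pdiv X = frag_cmul (int n') SO - frag_cmul (int n) (frag_of (P_inf f))"
proof (rule poly_mapping_eqI)
  fix p
  consider "p \<notin> points f" | "p = P_inf f" | "p \<in> points f" "p \<noteq> P_inf f" by blast
  then show "mult_at (pdiv X) p = mult_at (frag_cmul (int n') SO - frag_cmul (int n) (frag_of (P_inf f))) p"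
  proof cases
    case 1
    moreover from 1 have "p \<notin> O_points f" "p \<noteq> P_inf f" using O_points_point P_inf_point by blast+
    ultimately show ?thesis using mult_at_pdiv_outside[OF not_F_dvd_X] by simp
  next
    case 2
    then show ?thesis using pdiv_eqI[OF P_inf_point X_P] P_inf_not_O by simp
  next
    case 3
    then show ?thesis using pdiv_eqI[OF 3(1) O_point_X] pdiv_eqI[OF 3(1) X_eq_0[OF 3]] by simp
  qed
qed

text \<open>The indices from 1 to \<open>n\<close> run \<open>n'\<close> times through the
  \<open>N\<close> points.\<close>

lemma O_sum_period:
  assumes "ord \<in> orderings (O_points f)"
  shows "O_sum ord 1 (int n) = frag_cmul (int n') SO"
proof -
  have o: "distinct ord" "set ord = O_points f" using assms by (auto simp: orderings_def)
  then have len: "length ord = N" using distinct_card[OF o(1)] card_O_points by simp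
  have block: "O_sum ord (int (q * N) + 1) (int (q * N) + int N) = SO" for q
  proof -
    have "O_sum ord (int (q * N) + 1) (int (q * N) + int r) = (\<Sum>i<r. frag_of (ord ! i))" if "r \<le> N" for r
      using that
    proof (induction r)
      case (Suc r)
      have "(int (q * N) + int r) mod int N = int r" using Suc.prems by (simp add: mod_pos_pos_trivial)
      then have "O_at ord (int (q * N) + int r + 1) = ord ! r" by (simp add: O_at_def len)
      then show ?case using Suc O_sum_Suc[of ord "int (q * N) + 1" "int (q * N) + int r"]
        by (simp add: ac_simps)
    qed (use O_sum_empty in simp)
    from this[of N] have "O_sum ord (int (q * N) + 1) (int (q * N) + int N) = (\<Sum>i<N. frag_of (ord ! i))" by simp
    also have "\<dots> = SO" unfolding o(2)[symmetric] len[symmetric]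
      by (rule sum.reindex_bij_betw[OF bij_betw_nth[OF o(1) refl refl]])
    finally show ?thesis .
  qed
  have "O_sum ord 1 (int (q * N)) = frag_cmul (int q) SO" for q
  proof (induction q)
    case (Suc q)
    have "O_sum ord 1 (int (q * N) + int N) = O_sum ord 1 (int (q * N)) + SO"
      using O_sum_append[of ord 0 "int (q * N)" "int (q * N) + int N"] block[of q] by simp
    moreover have "int (Suc q * N) = int (q * N) + int N" "int (Suc q) = int q + 1" by simp_all
    ultimately show ?case unfolding Suc.IH by (simp only: frag_cmul_distrib frag_cmul_one)
  qed (use O_sum_empty[of ord 0] in simp)
  from this[of n'] show ?thesis by (simp add: n'N)
qed

end

section \<open>Periodicity of the pole divisors and the ordering defined by them\<close>

context lax_matrix begin

abbreviation DD :: "nat \<Rightarrow> divisor" where "DD \<equiv> pole_div vc"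

text \<open>Multiplication by \<open>y\<close> maps \<open>e_s\<close> into the span of the \<open>e_t\<close> with \<open>t \<ge> s + k\<close>.\<close>

lemma Y_e_ge:
  assumes p: "p \<in> points f" "p \<noteq> P_inf f" and "t \<ge> s"
  shows "ord_ge p (Y * e t) (- mult_at (DD (s + k)) p)"
proof -
  interpret curve_point f p by unfold_locales (rule p(1))
  define r where "r = t mod n"
  define q where "q = t div n"
  define c where "c = band_coeff n (\<lambda>s t. L $$ (n - 1 - s, n - 1 - t)) r"
  have r: "r < n" and t: "t = r + q * n" using n_pos by (simp_all add: r_def q_def)
  have dvd: "F dvd Y * e r - (e (r + (m + k)) + (\<Sum>u<r + (m + k). const (c u) * e u))"
    unfolding c_def by (rule col.Y_extend[OF eigen_vc r])
  have "X ^ q * (Y * e r - (e (r + (m + k)) + (\<Sum>u<r + (m + k). const (c u) * e u))) =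
      Y * e t - (e (r + (m + k) + q * n) + (\<Sum>u<r + (m + k). const (c u) * e (u + q * n)))"
    unfolding t extend_add by (simp add: algebra_simps sum_distrib_left)
  then have dvd': "F dvd Y * e t - (e (r + (m + k) + q * n) + (\<Sum>u<r + (m + k). const (c u) * e (u + q * n)))"
    using dvd_mult[OF dvd, of "X ^ q"] by simp
  have "ord_ge p (e (r + (m + k) + q * n) + (\<Sum>u<r + (m + k). const (c u) * e (u + q * n))) (- mult_at (DD (s + k)) p)"
  proof (intro ge_add ge_sum)
    show "ord_ge p (e (r + (m + k) + q * n)) (- mult_at (DD (s + k)) p)"
      using assms(3) by (intro e.ge_pole_div p) (simp add: t)
    fix u
    show "ord_ge p (const (c u) * e (u + q * n)) (- mult_at (DD (s + k)) p)"
    proof (cases "c u = 0")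
      case False
      then have "u \<ge> r + k" using col.banded_A r unfolding banded_def c_def by blast
      then have "s + k \<le> u + q * n" using assms(3) t by linarith
      then show ?thesis by (intro ge_const_mult e.ge_pole_div p)
    qed (simp add: ord_ge_F)
  qed
  with ord_ge_cong[OF dvd'] show ?thesis by blast
qed

text \<open>Over the origin y has order \<open>k'\<close>, so \<open>Y_e_ge\<close> gives an
  inequality of divisors. Both sides have the same degree because \<open>k' N = k\<close>.\<close>

lemma DD_add_k: "DD (s + k) = DD s - frag_cmul (int k') SO"
proof -
  have kN: "int k' * int N = int k" using arg_cong[OF k'N, of int] by simp
  have "effective (DD (s + k) - (DD s - frag_cmul (int k') SO))"
    unfolding effective_def
  proof
    fix p
    show "0 \<le> mult_at (DD (s + k) - (DD s - frag_cmul (int k') SO)) p"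
    proof (cases "p \<in> O_points f")
      case True
      then have p: "p \<in> points f" "p \<noteq> P_inf f" using O_points_point P_inf_not_O by auto
      interpret curve_point f p by unfold_locales (rule p(1))
      obtain t where t: "t \<ge> s" "mult_at (DD s) p = - mult_at (pdiv (e t)) p" using e.pole_div_attained[OF p] by blast
      have ex: "eq (Y * e t) (int k' + mult_at (pdiv (e t)) p)"
        by (intro eq_mult O_point_Y True pdiv_eq e_nonzero p)
      show ?thesis using Y_e_ge[OF p t(1)] t(2) True unfolding eq_ge_iff[OF ex] by simp
    next
      case False
      then show ?thesis using e.pole_div_off_O[OF False k(2), of s] by simp
    qed
  qed
  moreover have "div_degree (DD (s + k)) = div_degree (DD s - frag_cmul (int k') SO)"
    unfolding div_degree_diff div_degree_cmul degree_SO e.degree_DD kN by simp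
  ultimately show ?thesis by (rule effective_degree_eq)
qed

text \<open>As \<open>N\<close> is the gcd of \<open>n\<close> and \<open>k\<close>, the shifts by
  \<open>n\<close> and by \<open>k\<close> combine to a shift by \<open>N\<close>.\<close>

lemma DD_add_N: "DD (s + N) = DD s - SO"
proof -
  obtain x y where xy: "k * x = n * y + N"
    using bezout_nat[of k n] k unfolding N_def by (auto simp: gcd.commute)
  have iterate: "DD (s + x * j) = DD s - frag_cmul (int (x * c)) SO" if step: "\<And>s. DD (s + j) = DD s - frag_cmul (int c) SO" for s x j c
  proof (induction x)
    case (Suc x)
    have *: "s + Suc x * j = s + x * j + j" "int (Suc x * c) = int (x * c) + int c" by simp_all
    show ?case unfolding * step Suc frag_cmul_distrib by (rule diff_diff_add)
  qed simp
  note 1 = iterate[OF DD_add_k] and 2 = iterate[OF e.pole_div_add_n]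
  have "s + x * k = s + N + y * n" using xy by (simp add: mult.commute)
  then have "DD s - frag_cmul (int (x * k')) SO = DD (s + N) - frag_cmul (int (y * n')) SO"
    using 1[of s x] 2[of "s + N" y] by (simp only:)
  then have "DD (s + N) = DD s - frag_cmul (int (x * k')) SO + frag_cmul (int (y * n')) SO"
    by (simp add: diff_eq_eq)
  moreover have "(x * k') * N = (y * n' + 1) * N"
  proof -
    have *: "x * k' * N = k * x" "y * n' * N = n * y"
      unfolding mult.assoc k'N n'N by (simp_all only: mult.commute)
    show ?thesis unfolding distrib_right mult_1 * by (rule xy)
  qed
  then have "x * k' = y * n' + 1" using N_pos by (simp only: mult_cancel2) simp
  ultimately show ?thesis by (simp add: frag_cmul_distrib)
qed

lemma opt_add_N: "e.opt (s + N) = e.opt s"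
proof -
  have "frag_of (e.opt (s + N)) = frag_of (e.opt s)"
    unfolding e.opt[symmetric] using DD_add_N[of s] DD_add_N[of "Suc s"] by simp
  then show ?thesis by (simp add: frag_of_eq)
qed

lemma opt_mod: "e.opt (s mod N) = e.opt s"
proof -
  have "e.opt (r + q * N) = e.opt r" for r q
    by (induction q) (simp_all add: opt_add_N add.assoc[symmetric] add.commute[of N])
  from this[of "s mod N" "s div N"] show ?thesis by (simp only: mod_div_mult_eq)
qed

text \<open>Over one period the points add up to \<open>SO\<close>, so every point over the origin
  occurs, and by counting only once.\<close>

lemma opt_bij: "inj_on e.opt {..<N} \<and> e.opt ` {..<N} = O_points f"
proof -
  have "(\<Sum>j<N. frag_of (e.opt j)) = SO"
    using e.sum_opt[of 0 N] DD_add_N[of 0] by (simp add: lessThan_atLeast0)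
  then have *: "(\<Sum>j<N. mult_at (frag_of (e.opt j)) p) = mult_at SO p" for p by (metis lookup_sum)
  have "p \<in> e.opt ` {..<N}" if "p \<in> O_points f" for p
  proof (rule ccontr)
    assume "p \<notin> e.opt ` {..<N}"
    then have "mult_at (frag_of (e.opt j)) p = 0" if "j \<in> {..<N}" for j using that by auto
    then have "(\<Sum>j<N. mult_at (frag_of (e.opt j)) p) = 0" by (rule sum.neutral[rule_format])
    then show False using *[of p] that by simp
  qed
  then have im: "e.opt ` {..<N} = O_points f" using e.opt_O by auto
  then show ?thesis using card_O_points by (simp add: eq_card_imp_inj_on)
qed

text \<open>Reversed so that the point with number \<open>n - s\<close> is the difference of
  \<open>DD s\<close> and \<open>DD (Suc s)\<close>, see \<open>O_at_ordering\<close>.\<close>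

definition ordering :: "point list" where
  "ordering = map (\<lambda>i. e.opt (N - 1 - i)) [0..<N]"

lemma ordering: "ordering \<in> orderings (O_points f)"
proof -
  have "(\<lambda>i. e.opt (N - 1 - i)) ` {..<N} = O_points f"
  proof -
    have "(\<lambda>i. N - 1 - i) ` {..<N} = {..<N}"
    proof (intro equalityI subsetI)
      fix i assume "i \<in> {..<N}"
      then show "i \<in> (\<lambda>i. N - 1 - i) ` {..<N}" by (intro image_eqI[of _ _ "N - 1 - i"]) auto
    qed auto
    then show ?thesis using opt_bij by (metis image_image)
  qed
  then have "set ordering = O_points f" by (simp add: ordering_def lessThan_atLeast0)
  moreover from this have "distinct ordering" using card_O_points by (intro card_distinct) (simp add: ordering_def)
  ultimately show ?thesis by (simp add: orderings_def)
qed

lemma O_at_ordering: "O_at ordering (int n - int s) = e.opt s"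
proof -
  have "(int n - int s - 1) mod int N = int (N - 1 - s mod N)"
  proof -
    have "s mod N < N" using N_pos by simp
    then have c: "int (N - 1 - s mod N) = int N - 1 - int (s mod N)" by (simp add: of_nat_diff)
    have "int n = int n' * int N" using arg_cong[OF n'N, of int] by simp
    moreover have "int s = int (s div N) * int N + int (s mod N)" by (metis div_mult_mod_eq of_nat_add of_nat_mult)
    ultimately have "int n - int s - 1 = int (N - 1 - s mod N) + (int n' - int (s div N) - 1) * int N"
      unfolding c by (simp add: algebra_simps)
    then have "(int n - int s - 1) mod int N = int (N - 1 - s mod N) mod int N" by simp
    also have "\<dots> = int (N - 1 - s mod N)" using N_pos by (intro mod_pos_pos_trivial) auto
    finally show ?thesis .
  qed
  moreover have "N - 1 - (N - 1 - s mod N) = s mod N" "N - 1 - s mod N < N" using N_pos mod_less_divisor[OF N_pos, of s] by auto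
  moreover have "length ordering = N" "ordering ! i = e.opt (N - 1 - i)" if "i < N" for i
    using that by (simp_all add: ordering_def)
  ultimately show ?thesis unfolding O_at_def by (metis nat_int opt_mod)
qed

lemma O_sum_ordering: "O_sum ordering (int n - int s + 1) (int n) = DD 0 - DD s"
proof (induction s)
  case (Suc s)
  have "O_sum ordering (int n - int (Suc s) + 1) (int n - int s) = frag_of (e.opt s)"
    by (simp add: O_sum_def O_at_ordering)
  moreover have "O_sum ordering (int n - int (Suc s) + 1) (int n) =
      O_sum ordering (int n - int (Suc s) + 1) (int n - int s) + O_sum ordering (int n - int s + 1) (int n)"
    by (rule O_sum_append[symmetric])
  ultimately show ?case unfolding Suc e.opt[symmetric] by simp
qed (use O_sum_empty in simp)

end

section \<open>The divisor attached to a Lax matrix\<close>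

context lax_matrix begin

lemma DD_0_Div: "DD 0 \<in> Div"
  by (rule e.pole_div_Div)

lemma DD_0_general: "effective (DD 0)" "general_div n m k f (DD 0)"
  using e.pole_div_0_effective e.degree_DD[of 0] e.ell_DD_one[of 0] DD_0_Div
  by (simp_all add: general_div_def RR_dim_iff)

text \<open>Subtracting the points with numbers \<open>n - \<kappa>\<close> to \<open>n\<close>
  turns \<open>DD 0\<close> into \<open>DD (\<kappa> + 1)\<close>, which has no sections with poles
  of order at most \<open>\<kappa>\<close> at \<open>P\<close>.\<close>

lemma DD_0_regular: "regular_div n m k f ordering (DD 0)"
  unfolding regular_div_def
proof (intro conjI allI impI DD_0_general)
  fix \<kappa> :: int assume "\<kappa> > 0"
  define r where "r = nat \<kappa>"
  have r: "\<kappa> = int r" using \<open>\<kappa> > 0\<close> by (simp add: r_def)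
  have "O_sum ordering (int n - \<kappa>) (int n) = DD 0 - DD (Suc r)"
    using O_sum_ordering[of "Suc r"] by (simp add: r)
  then have eqn: "DD 0 + frag_cmul \<kappa> (frag_of (P_inf f)) - O_sum ordering (int n - \<kappa>) (int n) =
      DD (Suc r) + frag_cmul (int (Suc r) - 1) (frag_of (P_inf f))" by (simp add: r)
  show "RR_dim f (DD 0 + frag_cmul \<kappa> (frag_of (P_inf f)) - O_sum ordering (int n - \<kappa>) (int n)) 0"
    unfolding eqn using e.ell_DD_zero[of "Suc r"] e.pole_div_Div[of "Suc r"] P_inf_point by (simp add: RR_dim_iff)
qed

lemma Delta_eq: "Delta n f L i j = Dl (i - 1) (j - 1) mod F"
  by (simp add: Delta_def fun_of_eq Dl_def)

lemma normalised_general: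
  assumes "effective (D + pdiv h + frag_cmul (int s) (frag_of (P_inf f)))" "\<not> F dvd h" "D \<in> Div"
    "div_degree D = genus_value n m k - int s" "ell (D + frag_cmul (int s) (frag_of (P_inf f))) = 1"
  shows "general_div n m k f (D + pdiv h + frag_cmul (int s) (frag_of (P_inf f)))"
proof -
  let ?D = "D + pdiv h + frag_cmul (int s) (frag_of (P_inf f))"
  have D: "?D \<in> Div" using assms P_inf_point pdiv_in_Div by simp
  have "?D - pdiv h = D + frag_cmul (int s) (frag_of (P_inf f))" by simp
  then have "ell ?D = 1" using ell_diff_pdiv[OF D assms(2)] assms(5) by simp
  then show ?thesis using D assms(4) degree_pdiv[OF assms(2)] by (simp add: general_div_def RR_dim_iff)
qed

text \<open>With \<open>s = n - j\<close> and \<open>s = i - 1\<close> these are the two families of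
  divisors in the formula for the cofactors.\<close>

lemma D_effective: "effective (DD s + pdiv (e s) + frag_cmul (int s) (frag_of (P_inf f)))"
  and D'_effective: "effective (pole_div vr s + pdiv (eb s) + frag_cmul (int s) (frag_of (P_inf f)))"
proof -
  have *: "effective (D + pdiv h + frag_cmul (int s) (frag_of (P_inf f)))"
    if "D \<in> Div" "\<not> F dvd h" "inf.eq h (- int s)" "\<And>p. p \<in> points f \<Longrightarrow> p \<noteq> P_inf f \<Longrightarrow> - mult_at (pdiv h) p \<le> mult_at D p"
      "mult_at D (P_inf f) = 0" for D h
    unfolding effective_def
  proof
    fix p
    consider "p \<notin> points f" | "p = P_inf f" | "p \<in> points f" "p \<noteq> P_inf f" by blast
    then show "0 \<le> mult_at (D + pdiv h + frag_cmul (int s) (frag_of (P_inf f))) p"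
    proof cases
      case 1
      then have "p \<noteq> P_inf f" using P_inf_point by blast
      then show ?thesis using that(1) mult_at_pdiv_outside[OF that(2) 1] 1 by (simp add: Div_iff)
    next
      case 2
      then show ?thesis using pdiv_eqI[OF P_inf_point that(3)] that(5) by simp
    next
      case 3
      then show ?thesis using that(4)[OF 3] by simp
    qed
  qed
  show "effective (DD s + pdiv (e s) + frag_cmul (int s) (frag_of (P_inf f)))"
    by (rule *[OF e.pole_div_Div e_nonzero e_pole]) (use e.pole_div_bound in auto)
  show "effective (pole_div vr s + pdiv (eb s) + frag_cmul (int s) (frag_of (P_inf f)))"
    by (rule *[OF eb.pole_div_Div eb_nonzero eb_pole]) (use eb.pole_div_bound in auto)
qed

lemma D_general: "general_div n m k f (DD s + pdiv (e s) + frag_cmul (int s) (frag_of (P_inf f)))"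
  and D'_general: "general_div n m k f (pole_div vr s + pdiv (eb s) + frag_cmul (int s) (frag_of (P_inf f)))"
  by (rule normalised_general[OF D_effective e_nonzero e.pole_div_Div e.degree_DD e.ell_DD_one],
      rule normalised_general[OF D'_effective eb_nonzero eb.pole_div_Div eb.degree_DD eb.ell_DD_one])

lemma pdiv_Dl:
  assumes "s < n" "u < n"
  shows "pdiv (Dl u (n - 1 - s)) = pdiv (e s) + pdiv (eb u) + pdiv D0l"
proof -
  have "pdiv (Dl u (n - 1 - s)) = pdiv (e s * eb u * D0l)"
    using pdiv_cong[OF rank_one[OF assms]] assms by (simp add: extend_less)
  also have "\<dots> = pdiv (e s) + pdiv (eb u) + pdiv D0l"
    using e_nonzero eb_nonzero D0l_nonzero by (simp add: pdiv_mult F_dvd_mult_iff)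
  finally show ?thesis .
qed

lemma R_div_eq: "R_div n m k f = frag_cmul (int k' - 1) SO + frag_cmul ((int n - 1) * int m - int k - int M) (frag_of (P_inf f))"
  by (simp add: R_div_def k'_def N_def M_def)

text \<open>Over the origin this amounts to \<open>n k' = k n'\<close>, and at \<open>P\<close> to
  the order found in \<open>Dl_P\<close>.\<close>

lemma D0l_eq: "pdiv D0l = total + frag_cmul (int n - 2) (frag_of (P_inf f)) - R_div n m k f + frag_cmul (int k) (pdiv X)"
proof (rule poly_mapping_eqI)
  fix p
  have "n * k' = k * n'" by (metis n'N k'N mult.commute mult.left_commute)
  then have nk: "int n * int k' = int k * int n'" using of_nat_mult by metis
  have n1: "int (n - 1) = int n - 1" using n_pos by (simp add: of_nat_diff)
  have o: "o_shift = int k * int n' - int k' + 1"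
    unfolding o_shift_def of_nat_mult n1 using nk by (simp add: left_diff_distrib)
  have P: "mult_at (pdiv D0l) (P_inf f) = int n - 2 + int M - ((int n - 1) * int m + int n * int k - int k)"
    unfolding D0l_P n1 by (simp add: algebra_simps)
  show "mult_at (pdiv D0l) p = mult_at (total + frag_cmul (int n - 2) (frag_of (P_inf f)) - R_div n m k f + frag_cmul (int k) (pdiv X)) p"
    unfolding R_div_eq total_def pdiv_X o P using P_inf_not_O
    by (cases "p = P_inf f"; cases "p \<in> O_points f") (simp_all add: P algebra_simps)
qed

text \<open>By additivity the points with numbers \<open>j + 1\<close> to \<open>i - 1\<close> sum
  to \<open>DD (n - i + 1) - DD (n - j)\<close>. The first term combines with
  \<open>pole_div vr (i - 1)\<close> to \<open>total\<close>, the second cancels.\<close>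

lemma Delta_divisor:
  assumes i: "i \<in> {1..n}" and j: "j \<in> {1..n}" and O: "\<And>s. s \<le> n \<Longrightarrow> O_sum ord (int n - int s + 1) (int n) = DD 0 - DD s"
  shows "div_of f (Delta n f L i j) =
     (DD (n - j) + pdiv (e (n - j)) + frag_cmul (int (n - j)) (frag_of (P_inf f)))
     + (pole_div vr (i - 1) + pdiv (eb (i - 1)) + frag_cmul (int (i - 1)) (frag_of (P_inf f)))
     + frag_cmul (int j - int i - 1) (frag_of (P_inf f))
     + O_sum ord (int j + 1) (int i - 1) - R_div n m k f + frag_cmul (int k) (div_of f (x_fun f))"
proof -
  define s where "s = n - j"
  define u where "u = i - 1"
  have su: "s < n" "u < n" "j - 1 = n - 1 - s" "int j = int n - int s" "int i = int u + 1"
    using i j by (auto simp: s_def u_def)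
  have "O_sum ord (int n - int s + 1) (int u) + O_sum ord (int u + 1) (int n) = DD 0 - DD s"
    unfolding O_sum_append using O su(1) by simp
  moreover have "O_sum ord (int u + 1) (int n) = DD 0 - DD (n - u)"
    using O[of "n - u"] su(2) by (simp add: of_nat_diff)
  ultimately have "O_sum ord (int n - int s + 1) (int u) + (DD 0 - DD (n - u)) = DD 0 - DD s" by simp
  then have "O_sum ord (int n - int s + 1) (int u) = DD (n - u) - DD s" unfolding eq_diff_eq[symmetric] by simp
  then have os: "O_sum ord (int j + 1) (int i - 1) = DD (n - u) - DD s" unfolding su(4,5) by simp
  have "total = DD (n - u) + pole_div vr u" using degrees(3)[of "n - u"] su(2) by simp
  moreover have "div_of f (x_fun f) = pdiv X" by (simp add: x_fun_eq pdiv_def)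
  moreover have "frag_cmul (int s) (frag_of (P_inf f)) + frag_cmul (int u) (frag_of (P_inf f)) + frag_cmul (int n - int s - (int u + 1) - 1) (frag_of (P_inf f))
      = frag_cmul (int n - 2) (frag_of (P_inf f))"
    by (simp flip: frag_cmul_distrib)
  moreover have "div_of f (Delta n f L i j) = pdiv (e s) + pdiv (eb u) + pdiv D0l"
    unfolding Delta_eq su(3) u_def[symmetric] using pdiv_Dl[OF su(1,2)] by (simp add: pdiv_def)
  moreover have "A + B + (T + Z - R + X) = (S + A + p) + (U + B + q) + r + (V - S) - R + X"
    if "T = V + U" "p + q + r = Z" for A B T Z R X S U V p q r :: divisor
    using that by (simp add: algebra_simps flip: that(2))
  ultimately show ?thesis
    unfolding s_def[symmetric] u_def[symmetric] os D0l_eq unfolding su(4,5) by (simp only:)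
qed

text \<open>The condition under the definite description in
  \<open>attached_ordering\<close>.\<close>

definition ordering_admissible :: "point list \<Rightarrow> bool" where
  "ordering_admissible ord \<longleftrightarrow> ord \<in> orderings (O_points f) \<and>
     (\<exists>D D' :: nat \<Rightarrow> divisor.
        (\<forall>j \<in> {1..n}. effective (D j) \<and> general_div n m k f (D j) \<and>
                       effective (D' j) \<and> general_div n m k f (D' j)) \<and>
        (\<forall>i \<in> {1..n}. \<forall>j \<in> {1..n}.
           div_of f (Delta n f L i j) =
             D j + D' i + frag_cmul (int j - int i - 1) (frag_of (P_inf f))
             + O_sum ord (int j + 1) (int i - 1) - R_div n m k f
             + frag_cmul (int k) (div_of f (x_fun f))))"

lemma ordering_admissible: "ordering_admissible ordering"
  unfolding ordering_admissible_def
proof (intro conjI exI ballI ordering)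
  fix i j assume ij: "i \<in> {1..n}" "j \<in> {1..n}"
  show "div_of f (Delta n f L i j) =
     (\<lambda>j. DD (n - j) + pdiv (e (n - j)) + frag_cmul (int (n - j)) (frag_of (P_inf f))) j
     + (\<lambda>i. pole_div vr (i - 1) + pdiv (eb (i - 1)) + frag_cmul (int (i - 1)) (frag_of (P_inf f))) i
     + frag_cmul (int j - int i - 1) (frag_of (P_inf f))
     + O_sum ordering (int j + 1) (int i - 1) - R_div n m k f + frag_cmul (int k) (div_of f (x_fun f))"
    by (rule Delta_divisor[OF ij O_sum_ordering])
qed (rule D_effective D'_effective D_general D'_general)+

lemma DD_0_minimal:
  assumes E: "effective E"
    and bound: "\<And>s p. s < n \<Longrightarrow> p \<in> points f \<Longrightarrow> p \<noteq> P_inf f \<Longrightarrow> - mult_at (pdiv (e s)) p \<le> mult_at E p"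
  shows "effective (E - DD 0)"
  unfolding effective_def
proof
  fix p
  show "0 \<le> mult_at (E - DD 0) p"
  proof (cases "p \<in> points f \<and> p \<noteq> P_inf f")
    case True
    then have p: "p \<in> points f" "p \<noteq> P_inf f" by auto
    obtain t where "t < 0 + n" "mult_at (DD 0) p = - mult_at (pdiv (e t)) p" using e.pole_div_attained[OF p] by blast
    then show ?thesis using bound[OF _ p, of t] by simp
  next
    case False
    then show ?thesis using E by (auto simp: e.mult_at_pole_div effective_def)
  qed
qed

lemma O_sum_P: "ord \<in> orderings (O_points f) \<Longrightarrow> mult_at (O_sum ord j i) (P_inf f) = 0"
proof -
  assume ord: "ord \<in> orderings (O_points f)"
  have o: "distinct ord" "set ord = O_points f" using ord by (auto simp: orderings_def)
  then have len: "length ord = N" using distinct_card[OF o(1)] card_O_points by simp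
  have "O_at ord r \<in> O_points f" for r
  proof -
    have "nat ((r - 1) mod int N) < N" using N_pos by (simp add: nat_less_iff)
    then show ?thesis unfolding O_at_def o(2)[symmetric] len by (intro nth_mem) (simp add: len)
  qed
  then have "P_inf f \<noteq> O_at ord r" for r using P_inf_not_O by metis
  then have "mult_at (frag_of (O_at ord r)) (P_inf f) = 0" for r by simp
  then have "mult_at (\<Sum>r\<in>S. frag_of (O_at ord r)) (P_inf f) = 0" for S unfolding lookup_sum by (intro sum.neutral) blast
  then show ?thesis by (simp add: O_sum_def)
qed

lemma O_sum_degree: "div_degree (O_sum ord j i) = i - j + 1"
  by (simp add: O_sum_def)

text \<open>Whatever divisors the condition provides, effectiveness makes \<open>E n\<close> bound
  the poles of all \<open>e s\<close>, so \<open>E n\<close> is at least \<open>DD 0\<close>, and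
  the degrees force equality. The same argument with \<open>DD 0 - ?OS s\<close> and the
  \<open>e t\<close> for \<open>t >= s\<close> identifies that divisor with
  \<open>DD s\<close>.\<close>

lemma ordering_admissible_O_sum:
  assumes adm: "ordering_admissible ord" and s: "s \<le> n"
  shows "O_sum ord (int n - int s + 1) (int n) = DD 0 - DD s"
proof -
  obtain E E' :: "nat \<Rightarrow> divisor" where ord: "ord \<in> orderings (O_points f)"
    and gen: "\<And>j. j \<in> {1..n} \<Longrightarrow> effective (E j) \<and> general_div n m k f (E j)"
    and Delta: "\<And>i j. i \<in> {1..n} \<Longrightarrow> j \<in> {1..n} \<Longrightarrow>
       div_of f (Delta n f L i j) = E j + E' i + frag_cmul (int j - int i - 1) (frag_of (P_inf f))
             + O_sum ord (int j + 1) (int i - 1) - R_div n m k f + frag_cmul (int k) (div_of f (x_fun f))"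
    using adm unfolding ordering_admissible_def by blast
  let ?OS = "\<lambda>s. O_sum ord (int n - int s + 1) (int n)"
  \<comment> \<open>The quotient of the cofactors \<open>(n, n - s)\<close> and
    \<open>(n, n)\<close> is \<open>e s\<close>; comparing their divisors eliminates
    \<open>E'\<close> and \<open>R\<close>.\<close>
  have E: "E (n - s) = E n + pdiv (e s) + frag_cmul (int s) (frag_of (P_inf f)) - ?OS s" if s: "s < n" for s
  proof -
    have n1: "n \<in> {1..n}" "n - s \<in> {1..n}" "n - s - 1 = n - 1 - s" "int (n - s) = int n - int s" using s by auto
    have dv: "div_of f (Delta n f L n (n - s)) = div_of f (Delta n f L n n) + pdiv (e s)"
    proof -
      have e0: "pdiv (e 0) = 0" using pdiv_cong[OF vc_0] n_pos by (simp add: extend_less)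
      show ?thesis
        using pdiv_Dl[OF s, of "n - 1"] pdiv_Dl[OF n_pos, of "n - 1"] n_pos e0 by (simp add: Delta_eq n1(3) flip: pdiv_def)
    qed
    have os: "?OS s = O_sum ord (int n - int s + 1) (int n - 1) - O_sum ord (int n + 1) (int n - 1)"
    proof -
      let ?C = "O_sum ord (int n) (int n)"
      have ab: "O_sum ord (int n - int s + 1) (int n - 1) + ?C = ?OS s" "O_sum ord (int n + 1) (int n - 1) + ?C = 0"
        using O_sum_append[of ord "int n - int s" "int n - 1" "int n"] O_sum_append[of ord "int n" "int n - 1" "int n"]
        by (simp_all add: O_sum_empty)
      have "?OS s = (O_sum ord (int n - int s + 1) (int n - 1) + ?C) - (O_sum ord (int n + 1) (int n - 1) + ?C)"
        unfolding ab by simp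
      then show ?thesis unfolding add_diff_cancel_right .
    qed
    have q: "frag_cmul (int n - int s - int n - 1) (frag_of (P_inf f)) = frag_cmul (int n - int n - 1) (frag_of (P_inf f)) - frag_cmul (int s) (frag_of (P_inf f))"
      by (intro poly_mapping_eqI) simp
    have shift: "A = B + e + p - OS" if "A + E' + q' + O1 - R + X = (B + E' + q + O2 - R + X) + e" "OS = O1 - O2" "q' = q - p"
      for A B E' q q' O1 O2 R X e OS p :: divisor
      using that(1) unfolding that(2,3) by (simp add: algebra_simps)
    show ?thesis
      by (rule shift[OF dv[unfolded Delta[OF n1(1,2)] Delta[OF n1(1,1)] n1(4)] os q])
  qed
  have OSn: "mult_at (?OS s) p \<ge> 0" for s p by (rule O_sum_nonneg) simp
  have bound: "mult_at (?OS s) p - mult_at (pdiv (e s)) p \<le> mult_at (E n) p"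
    if "s < n" "p \<noteq> P_inf f" for s p
  proof -
    have "n - s \<in> {1..n}" using that by auto
    then have "0 \<le> mult_at (E (n - s)) p" using gen unfolding effective_def by blast
    then show ?thesis unfolding E[OF that(1)] using that(2) by simp
  qed
  have "n \<in> {1..n}" using n_pos by simp
  note En = gen[OF this]
  have "effective (E n - DD 0)"
  proof (rule DD_0_minimal)
    fix s p assume "s < n" "p \<noteq> P_inf f"
    then show "- mult_at (pdiv (e s)) p \<le> mult_at (E n) p" using bound[of s p] OSn[of s p] by simp
  qed (use En in blast)
  then have En0: "E n = DD 0"
    by (rule effective_degree_eq) (use En e.degree_DD[of 0] in \<open>simp add: general_div_def\<close>)
  have period: "?OS n = frag_cmul (int n') SO" using O_sum_period[OF ord] by simp
  have mono: "mult_at (?OS s) p \<le> mult_at (?OS t) p" if "s \<le> t" for s t p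
  proof -
    have "?OS t = O_sum ord (int n - int t + 1) (int n - int s) + ?OS s" by (rule O_sum_append[symmetric])
    moreover have "0 \<le> mult_at (O_sum ord (int n - int t + 1) (int n - int s)) p"
      by (rule O_sum_nonneg) (use that in simp)
    ultimately show ?thesis by simp
  qed
  have "effective (DD 0 - ?OS s - DD s)"
    unfolding effective_def
  proof
    fix p
    consider "p \<notin> points f" | "p = P_inf f" | "p \<in> points f" "p \<noteq> P_inf f" by blast
    then show "0 \<le> mult_at (DD 0 - ?OS s - DD s) p"
    proof cases
      case 1
      then have "p \<notin> O_points f" using O_points_point by blast
      then have "mult_at (?OS n) p = 0" unfolding period by simp
      then have "mult_at (?OS s) p = 0" using mono[OF s, of p] OSn[of s p] by simp
      then show ?thesis using 1 by simp
    next
      case 2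
      then show ?thesis using O_sum_P[OF ord] by simp
    next
      case 3
      obtain t where t: "t \<ge> s" "t < s + n" "mult_at (DD s) p = - mult_at (pdiv (e t)) p" using e.pole_div_attained[OF 3] by blast
      show ?thesis
      proof (cases "t < n")
        case True
        then show ?thesis using bound[OF True 3(2)] mono[OF t(1), of p] t(3) unfolding En0 by simp
      next
        \<comment> \<open>For \<open>t >= n\<close> a factor x is split off. Its zeros over the
          origin are the full period \<open>?OS n\<close>, which is at least
          \<open>?OS s\<close>.\<close>
        case False
        define u where "u = t - n"
        have u: "t = u + 1 * n" "u < n" using False t(2) s by (auto simp: u_def)
        have "mult_at (pdiv (e t)) p = mult_at (pdiv X) p + mult_at (pdiv (e u)) p"
          unfolding u(1) e.pdiv_shift by simp
        also have "mult_at (pdiv X) p = mult_at (?OS n) p" unfolding period pdiv_X using 3(2) by simp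
        finally show ?thesis using bound[OF u(2) 3(2)] OSn[of u p] mono[OF s, of p] t(3) unfolding En0 by simp
      qed
    qed
  qed
  moreover have "div_degree (DD 0 - ?OS s) = div_degree (DD s)"
    unfolding div_degree_diff O_sum_degree e.degree_DD by simp
  ultimately have "DD 0 - ?OS s = DD s" by (rule effective_degree_eq)
  then show ?thesis by (simp add: algebra_simps)
qed

lemma ordering_unique:
  assumes adm: "ordering_admissible ord"
  shows "ord = ordering"
proof (rule nth_equalityI)
  have "ord \<in> orderings (O_points f)" using adm by (simp add: ordering_admissible_def)
  then have "distinct ord" "set ord = O_points f" by (auto simp: orderings_def)
  then have len: "length ord = N" using distinct_card card_O_points by metis
  then show "length ord = length ordering" by (simp add: ordering_def)
  have at: "frag_of (O_at ord (int n - int s)) = DD s - DD (Suc s)"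
    if "\<And>s. s \<le> n \<Longrightarrow> O_sum ord (int n - int s + 1) (int n) = DD 0 - DD s" "s < n" for ord s
  proof -
    have "O_sum ord (int n - int (Suc s) + 1) (int n - int s) = frag_of (O_at ord (int n - int s))"
      by (simp add: O_sum_def)
    moreover have "O_sum ord (int n - int (Suc s) + 1) (int n) =
        O_sum ord (int n - int (Suc s) + 1) (int n - int s) + O_sum ord (int n - int s + 1) (int n)"
      by (rule O_sum_append[symmetric])
    ultimately have "frag_of (O_at ord (int n - int s)) + (DD 0 - DD s) = DD 0 - DD (Suc s)"
      using that(1)[of s] that(1)[of "Suc s"] that(2) by (simp only: Suc_leI less_imp_le)
    then have "frag_of (O_at ord (int n - int s)) = (DD 0 - DD (Suc s)) - (DD 0 - DD s)" unfolding eq_diff_eq .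
    then show ?thesis by simp
  qed
  fix r assume r: "r < length ord"
  \<comment> \<open>So every position of the list is reached by some \<open>s < n\<close>.\<close>
  have "N \<le> n" unfolding N_def using n_pos by (intro gcd_le1_nat) simp
  then have rn: "n - 1 - r < n" "int n - int (n - 1 - r) = int r + 1" using r len n_pos by auto
  have "O_at ord (int r + 1) = O_at ordering (int r + 1)"
    using at[of ord, OF ordering_admissible_O_sum[OF adm] rn(1)] at[of ordering, OF O_sum_ordering rn(1)]
    unfolding rn(2) by (metis frag_of_eq)
  moreover have "O_at xs (int r + 1) = xs ! r" if "length xs = N" for xs
    using r len that by (simp add: O_at_def)
  ultimately show "ord ! r = ordering ! r" using len by (simp add: ordering_def)
qed

lemma attached_ordering_eq: "attached_ordering n m k f L = ordering"
  unfolding attached_ordering_def ordering_admissible_def[symmetric]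
  using ordering_admissible ordering_unique by (intro the_equality)

lemma h_fun_eq: "s < n \<Longrightarrow> h_fun n f L (n - s) = e s mod F"
proof -
  assume s: "s < n"
  then have "n - s - 1 = n - 1 - s" by simp
  then show ?thesis using s by (simp add: h_fun_def Delta_eq extend_less vc_def mod_mult_left_eq)
qed

lemma D_admissible_iff: "D_admissible n m k f L D \<longleftrightarrow> D \<in> Div \<and> effective D \<and>
  (\<forall>s\<in>{1..n - 1}. effective (pdiv (e s) + D - (DD 0 - DD s - frag_cmul (int s) (frag_of (P_inf f)))))"
proof -
  let ?Q = "\<lambda>i. effective (div_of f (h_fun n f L i) + D - (O_sum ordering (int i + 1) (int n) - frag_cmul (int n - int i) (frag_of (P_inf f))))"
  have Q: "?Q (n - s) \<longleftrightarrow> effective (pdiv (e s) + D - (DD 0 - DD s - frag_cmul (int s) (frag_of (P_inf f))))"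
    if "s \<in> {1..n - 1}" for s
  proof -
    have sn: "s < n" "int (n - s) = int n - int s" using that by auto
    then show ?thesis unfolding h_fun_eq[OF sn(1)] sn(2) O_sum_ordering pdiv_def[symmetric] by simp
  qed
  have "(\<forall>i\<in>{1..n - 1}. ?Q i) \<longleftrightarrow> (\<forall>s\<in>{1..n - 1}. ?Q (n - s))"
  proof
    assume *: "\<forall>i\<in>{1..n - 1}. ?Q i"
    show "\<forall>s\<in>{1..n - 1}. ?Q (n - s)"
    proof
      fix s assume "s \<in> {1..n - 1}"
      then have "n - s \<in> {1..n - 1}" by auto
      with * show "?Q (n - s)" by blast
    qed
  next
    assume *: "\<forall>s\<in>{1..n - 1}. ?Q (n - s)"
    show "\<forall>i\<in>{1..n - 1}. ?Q i"
    proof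
      fix i assume "i \<in> {1..n - 1}"
      then have "n - i \<in> {1..n - 1}" "n - (n - i) = i" by auto
      with * show "?Q i" by metis
    qed
  qed
  then show ?thesis using Q unfolding D_admissible_def attached_ordering_eq by simp
qed

text \<open>\<open>D_effective\<close> makes \<open>DD 0\<close> admissible. Conversely, as
  \<open>DD 0 - DD s\<close> is effective, an admissible divisor bounds the poles of
  \<open>e s\<close> away from \<open>P\<close>, and \<open>DD_0_minimal\<close> applies.\<close>

lemma attached_divisor_eq: "attached_divisor n m k f L = DD 0"
proof -
  have adm: "D_admissible n m k f L (DD 0)"
    unfolding D_admissible_iff
  proof (intro conjI ballI DD_0_Div DD_0_general)
    fix s
    have "pdiv (e s) + DD 0 - (DD 0 - DD s - frag_cmul (int s) (frag_of (P_inf f))) = DD s + pdiv (e s) + frag_cmul (int s) (frag_of (P_inf f))"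
      by (simp add: algebra_simps)
    then show "effective (pdiv (e s) + DD 0 - (DD 0 - DD s - frag_cmul (int s) (frag_of (P_inf f))))"
      using D_effective[of s] by (simp only:)
  qed
  have min: "effective (E - DD 0)" if E: "D_admissible n m k f L E" for E
  proof (rule DD_0_minimal)
    fix s p assume s: "s < n" and p: "p \<in> points f" "p \<noteq> P_inf f"
    show "- mult_at (pdiv (e s)) p \<le> mult_at E p"
    \<comment> \<open>Admissibility imposes no condition for \<open>s = 0\<close>; there the
      function is 1 and effectiveness is enough.\<close>
    proof (cases "s = 0")
      case True
      have "pdiv (e 0) = 0" using pdiv_cong[OF vc_0] n_pos by (simp add: extend_less)
      then show ?thesis using True E by (simp add: D_admissible_iff effective_def)
    next
      case False
      then have "s \<in> {1..n - 1}" using s by auto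
      then have "effective (pdiv (e s) + E - (DD 0 - DD s - frag_cmul (int s) (frag_of (P_inf f))))"
        using E unfolding D_admissible_iff by blast
      moreover have "effective (DD 0 - DD s)" by (rule e.pole_div_mono) simp
      ultimately have "0 \<le> mult_at (pdiv (e s) + E - (DD 0 - DD s - frag_cmul (int s) (frag_of (P_inf f)))) p"
        "0 \<le> mult_at (DD 0 - DD s) p" unfolding effective_def by blast+
      then show ?thesis using p(2) by simp
    qed
  qed (use E in \<open>simp add: D_admissible_iff\<close>)
  show ?thesis
    unfolding attached_divisor_def
  proof (rule the_equality)
    show "D_admissible n m k f L (DD 0) \<and> (\<forall>E. D_admissible n m k f L E \<longrightarrow> effective (E - DD 0))"
      using adm min by blast
    fix D assume D: "D_admissible n m k f L D \<and> (\<forall>E. D_admissible n m k f L E \<longrightarrow> effective (E - D))"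
    then have "effective (D - DD 0)" "effective (DD 0 - D)" using adm min by blast+
    then have "0 \<le> mult_at (D - DD 0) p" "0 \<le> mult_at (DD 0 - D) p" for p unfolding effective_def by blast+
    then have "mult_at D p = mult_at (DD 0) p" for p by (metis diff_ge_0_iff_ge mult_at_minus order_antisym)
    then show "D = DD 0" by (rule poly_mapping_eqI)
  qed
qed

end

section \<open>The numbers \<open>c\<close>\<close>

context lax_matrix begin

text \<open>The exponent is \<open>b\<close>, except for \<open>l = n - 1\<close>, where the column
  index wraps around to 0 and the exponent is \<open>b - 1\<close>.\<close>

lemma c_entry_top:
  assumes "l < n"
  shows "poly.coeff (c_entry n m k L l) ((n - 1 - l + b * n - 1) div n) = col.top (n - 1 - l)"
proof -
  let ?t = "n - 1 - l + b * n - 1"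
  have "n - 1 - ?t mod n = (l + 1) mod n"
  proof (cases "l + 1 < n")
    case True
    then have t: "?t = n - 2 - l + b * n" by linarith
    have "?t mod n = n - 2 - l" unfolding t mod_mult_self1 using True by simp
    then show ?thesis using True by simp
  next
    case False
    then have l: "l = n - 1" using assms by linarith
    have "b * n = n + (b - 1) * n" using b_pos by (cases b) simp_all
    then have t: "?t = n - 1 + (b - 1) * n" using l n_pos by linarith
    have "?t mod n = n - 1" unfolding t mod_mult_self1 using n_pos by simp
    then show ?thesis using l n_pos by simp
  qed
  moreover have "(n - 1 - l) mod n = n - 1 - l" "n - 1 - (n - 1 - l) = l" using assms by auto
  ultimately show ?thesis unfolding col.top_def band_coeff_def c_entry_def M_def[symmetric] a_def[symmetric] by simp
qed

text \<open>The band of the power of a Lax matrix bounds the exponent, and \<open>L\<close> itself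
  attains the bound because its \<open>top\<close> entries are nonzero.\<close>

lemma c_power_eq:
  assumes l: "l < n"
  shows "c_power n m k l = (n - 1 - l + b * n - 1) div n"
  unfolding c_power_def
proof (rule Greatest_equality)
  have "L \<in> lax_matrices n m k" using banded_L lax_matrices_eq[OF n_pos] by blast
  moreover have "poly.coeff (c_entry n m k L l) ((n - 1 - l + b * n - 1) div n) \<noteq> 0"
    unfolding c_entry_top[OF l] by (rule col.top_nonzero[OF eigen_vc vc_0])
  ultimately show "\<exists>L\<in>lax_matrices n m k. poly.coeff (c_entry n m k L l) ((n - 1 - l + b * n - 1) div n) \<noteq> 0" by blast
next
  fix d assume "\<exists>L\<in>lax_matrices n m k. poly.coeff (c_entry n m k L l) d \<noteq> 0"
  then obtain L' where "banded_mat n (m + k) k L'" "poly.coeff ((L' ^\<^sub>m a) $$ (l, (l + 1) mod n)) d \<noteq> 0"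
    unfolding Bex_def lax_matrices_eq[OF n_pos] c_entry_def M_def[symmetric] a_def[symmetric] by blast
  with banded_matD(2)[OF banded_power[OF this(1) n_pos, of a] l, of "(l + 1) mod n" d]
  have *: "int l + int d * int n - int ((l + 1) mod n) \<le> int (b * n)"
    using n_pos by (simp add: a_weight)
  have "d * n \<le> n - 1 - l + b * n - 1"
  proof (cases "l + 1 < n")
    case True
    then have "int d * int n < int (b * n) + 2" using * by simp
    then have "d * n < b * n + 2" by (simp flip: of_nat_mult)
    \<comment> \<open>The band condition only gives \<open>d n <= b n + 1\<close>; that
      \<open>n >= 2\<close> excludes \<open>d > b\<close>.\<close>
    moreover have "d \<le> b"
    proof (rule ccontr)
      assume "\<not> d \<le> b"
      then have "(b + 1) * n \<le> d * n" by (intro mult_right_mono) auto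
      then have "n < 2" using calculation by simp
      then show False using n by simp
    qed
    then have "d * n \<le> b * n" by simp
    ultimately show ?thesis using True by linarith
  next
    case False
    then have "l + 1 = n" using l by simp
    then have l': "l = n - 1" "(l + 1) mod n = 0" by (simp, simp only: mod_self)
    then have "int d * int n + int n \<le> int (b * n) + 1" using * n_pos by (simp add: of_nat_diff)
    then have "int (d * n + n) \<le> int (b * n + 1)" by simp
    then have "d * n + n \<le> b * n + 1" by (simp only: of_nat_le_iff)
    then show ?thesis using l' n by linarith
  qed
  from div_le_mono[OF this, of n] show "d \<le> (n - 1 - l + b * n - 1) div n" using n_pos by simp
qed

lemma attached_c_eq: "attached_c n m k L = map (\<lambda>l. col.top (n - 1 - l)) [0..<M]"
  unfolding attached_c_def M_def[symmetric]
  by (rule map_cong[OF refl]) (use M_le c_entry_top c_power_eq in auto)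

lemma attached_c_S_set: "attached_c n m k L \<in> S_set n m k f"
proof -
  have "prod_list (map g [0..<r]) = (\<Prod>l<r. g l)" for g :: "nat \<Rightarrow> complex" and r
    by (induction r) (simp_all add: mult.commute)
  then have "prod_list (attached_c n m k L) = f_c n m k f"
    unfolding attached_c_eq using col.prod_top[OF eigen_vc vc_0] by simp
  moreover have "0 \<notin> set (attached_c n m k L)"
    unfolding attached_c_eq using col.top_nonzero[OF eigen_vc vc_0] by auto
  moreover have "length (attached_c n m k L) = gcd n (m + k)" by (simp add: attached_c_def)
  ultimately show ?thesis by (simp add: S_set_def)
qed

end

section \<open>The spectral data determine the Lax matrix\<close>

context spectral_curve begin

lemma const_diff: "const (c - d) = const c - const d"
  using const_add[of c "- d"] by (simp add: const_uminus)

text \<open>The pole orders at \<open>P\<close> are distinct, so the coefficient of the largest one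
  has to vanish.\<close>

lemma combination_zero:
  assumes e: "\<And>t. inf.eq (e t) (- int t)" and dvd: "F dvd (\<Sum>t<u. const (d t) * e t)" and t: "t < u"
  shows "d t = 0"
  using dvd t
proof (induction u arbitrary: t)
  case (Suc u)
  have "d u = 0"
  proof (rule ccontr)
    assume nz: "d u \<noteq> 0"
    have "ord_ge (P_inf f) (\<Sum>t<u. const (d t) * e t) (- int u + 1)"
    proof (rule inf.ge_sum)
      fix t assume "t \<in> {..<u}"
      then have "- int u + 1 \<le> - int t" by simp
      then show "ord_ge (P_inf f) (const (d t) * e t) (- int u + 1)"
        using inf.ge_const_mult inf.ge_mono inf.eq_imp_ge[OF e[of t]] by blast
    qed
    moreover have "inf.eq (const (d u) * e u) (0 + - int u)" by (intro inf.eq_mult inf.eq_const e nz)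
    ultimately have "inf.eq (const (d u) * e u + (\<Sum>t<u. const (d t) * e t)) (0 + - int u)"
      using inf.eq_add_ge by simp
    then have "inf.eq (\<Sum>t<Suc u. const (d t) * e t) (- int u)" by (simp add: add.commute)
    then show False using Suc.prems(1) inf.eq_imp_not_F_dvd by blast
  qed
  then show ?case using Suc by (cases "t = u") (simp_all add: less_Suc_eq)
qed simp

lemma leading_zero:
  assumes "inf.eq h (- int t)" "ord_ge (P_inf f) (const c * h) (1 - int t)"
  shows "c = 0"
proof (rule ccontr)
  assume "c \<noteq> 0"
  from inf.eq_mult[OF inf.eq_const[OF this] assms(1)] show False using assms(2) by (simp add: inf.eq_ge_iff)
qed

lemma lax_matrix_determined:
  assumes "lax_matrix n m k f L" "lax_matrix n m k f L'"
    and c: "attached_c n m k L = attached_c n m k L'"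
    and ord: "attached_ordering n m k f L = attached_ordering n m k f L'"
    and D: "attached_divisor n m k f L = attached_divisor n m k f L'"
  shows "L = L'"
proof -
  interpret A: lax_matrix n m k f L by (rule assms(1))
  interpret B: lax_matrix n m k f L' by (rule assms(2))
  have DD: "A.DD s = B.DD s" for s
    using A.O_sum_ordering[of s] B.O_sum_ordering[of s] ord D
    unfolding A.attached_ordering_eq B.attached_ordering_eq A.attached_divisor_eq B.attached_divisor_eq by simp
  have "\<exists>c. F dvd B.e s - const c * A.e s" for s
  proof -
    obtain c where c: "ord_ge (P_inf f) (B.e s - const c * A.e s) (- int s + 1)"
      using inf.residue_quotient[OF inf.eq_imp_ge[OF B.e_pole] A.e_pole] by blast
    have "ord_ge p (B.e s - const c * A.e s) (- mult_at (A.DD s + frag_cmul (int s - 1) (frag_of (P_inf f))) p)" if p: "p \<in> points f" for p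
    proof (cases "p = P_inf f")
      case True
      then show ?thesis using c by simp
    next
      case False
      interpret curve_point f p by unfold_locales (rule p)
      show ?thesis using A.e.ge_pole_div[OF p False, of s s] B.e.ge_pole_div[OF p False, of s s] False unfolding DD
        by (auto intro!: ge_diff ge_const_mult)
    qed
    then have "(B.e s - const c * A.e s) mod F \<in> LL (A.DD s + frag_cmul (int s - 1) (frag_of (P_inf f)))"
      unfolding LL_def by (simp del: mult_at_add)
    then show ?thesis unfolding A.e.LL_DD_zero by (auto simp: dvd_eq_mod_eq_0)
  qed
  then obtain \<mu> where \<mu>: "\<And>s. F dvd B.e s - const (\<mu> s) * A.e s" by metis
  have unique: "c = \<mu> s" if "ord_ge (P_inf f) (B.e s - const c * A.e s) (1 - int s)" for c s
  proof -
    from inf.ge_diff[OF that ord_ge_F[OF \<mu>[of s]]]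
    have "ord_ge (P_inf f) (const (\<mu> s - c) * A.e s) (1 - int s)"
      by (simp add: const_diff left_diff_distrib)
    from leading_zero[OF A.e_pole this] show ?thesis by simp
  qed
  have \<mu>_n: "\<mu> (s + n) = \<mu> s" for s
  proof (rule unique[symmetric], rule ord_ge_F)
    have "B.e (s + n) - const (\<mu> s) * A.e (s + n) = X * (B.e s - const (\<mu> s) * A.e s)"
      using extend_add[of B.vc s 1] extend_add[of A.vc s 1] by (simp add: algebra_simps)
    then show "F dvd B.e (s + n) - const (\<mu> s) * A.e (s + n)" using \<mu> by simp
  qed
  \<comment> \<open>\<open>\<tau>\<close> and \<open>\<tau>'\<close> are the leading coefficients of
    \<open>h\<close> applied to the two sequences. For \<open>h = Y\<close> both are 1; for
    \<open>h = Z\<close> they are values of \<open>top\<close>.\<close>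
  have transfer: "\<tau>' * \<mu> u = \<mu> s * \<tau>"
    if "ord_ge (P_inf f) (h * A.e s - const \<tau> * A.e u) (1 - int u)"
      "ord_ge (P_inf f) (h * B.e s - const \<tau>' * B.e u) (1 - int u)" for h s u \<tau> \<tau>'
  proof -
    have 1: "ord_ge (P_inf f) (const (\<mu> s) * (h * A.e s - const \<tau> * A.e u) - (h * B.e s - const \<tau>' * B.e u)) (1 - int u)"
      by (intro inf.ge_diff inf.ge_const_mult that)
    have 2: "F dvd h * (B.e s - const (\<mu> s) * A.e s) - const \<tau>' * (B.e u - const (\<mu> u) * A.e u)"
      by (intro dvd_diff dvd_mult \<mu>)
    have "ord_ge (P_inf f) ((const (\<mu> s) * (h * A.e s - const \<tau> * A.e u) - (h * B.e s - const \<tau>' * B.e u)) +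
       (h * (B.e s - const (\<mu> s) * A.e s) - const \<tau>' * (B.e u - const (\<mu> u) * A.e u))) (1 - int u)"
      by (rule inf.ge_add[OF 1 ord_ge_F[OF 2]])
    moreover have "(const (\<mu> s) * (h * A.e s - const \<tau> * A.e u) - (h * B.e s - const \<tau>' * B.e u)) +
       (h * (B.e s - const (\<mu> s) * A.e s) - const \<tau>' * (B.e u - const (\<mu> u) * A.e u)) = const (\<tau>' * \<mu> u - \<mu> s * \<tau>) * A.e u"
      by (simp add: const_diff const_mult algebra_simps)
    ultimately show ?thesis using leading_zero[OF A.e_pole] by fastforce
  qed
  have \<mu>_mk: "\<mu> (s + (m + k)) = \<mu> s" for s
    using transfer[of Y s 1 "s + (m + k)" 1] A.col.Y_asymp[OF A.eigen_vc A.vc_0, of s] B.col.Y_asymp[OF B.eigen_vc B.vc_0, of s]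
    by simp
  have iterate: "\<mu> (s + x * j) = \<mu> s" if "\<And>s. \<mu> (s + j) = \<mu> s" for s x j
  proof (induction x)
    case (Suc x)
    have "s + Suc x * j = s + x * j + j" by simp
    then show ?case using that Suc by metis
  qed simp
  obtain x y where xy: "(m + k) * x = n * y + M"
    using bezout_nat[of "m + k" n] m unfolding M_def by (auto simp: gcd.commute)
  have \<mu>_M: "\<mu> (s + M) = \<mu> s" for s
  proof -
    have "s + M + y * n = s + x * (m + k)" using xy by (simp add: mult.commute)
    then show ?thesis using iterate[of n "s + M" y, OF \<mu>_n] iterate[of "m + k" s x, OF \<mu>_mk] by metis
  qed
  have top: "A.col.top (n - 1 - l) = B.col.top (n - 1 - l)" if "l < M" for l
    using c that unfolding A.attached_c_eq B.attached_c_eq by (simp add: map_eq_conv)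
  have step: "\<mu> (Suc s) = \<mu> s" if "Suc s < M" for s
  proof -
    have "M dvd n" unfolding M_def by simp
    then obtain r where r: "n - M = r * M" by (metis dvd_diff_nat dvd_refl dvdE mult.commute)
    \<comment> \<open>The numbers \<open>c\<close> only give \<open>top\<close> at the last
      \<open>M\<close> indices below \<open>n\<close>; \<open>s\<close> is moved there by
      \<open>n - M\<close>, a multiple of the period \<open>M\<close>.\<close>
    define t where "t = s + (n - M)"
    have t: "Suc t = n - 1 - (M - 1 - Suc s)" "Suc t + b * n - 1 = t + b * n" using that M_le by (auto simp: t_def)
    have "\<mu> (t + b * n) = \<mu> (Suc t)"
    proof -
      have "A.col.top (Suc t) = B.col.top (Suc t)" unfolding t(1) by (rule top) (use that in simp)
      moreover have "A.col.top (Suc t) \<noteq> 0" by (rule A.col.top_nonzero[OF A.eigen_vc A.vc_0])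
      ultimately show ?thesis
        using transfer[of Z "Suc t" _ "Suc t + b * n - 1"] A.col.Z_asymp[OF A.eigen_vc A.vc_0, of "Suc t"] B.col.Z_asymp[OF B.eigen_vc B.vc_0, of "Suc t"]
        unfolding t(2) by (metis mult.commute mult_cancel_left)
    qed
    moreover have "\<mu> (t + b * n) = \<mu> t" by (rule iterate[OF \<mu>_n])
    moreover have "\<mu> t = \<mu> s" "\<mu> (Suc t) = \<mu> (Suc s)" unfolding t_def r
      using iterate[OF \<mu>_M, of s r] iterate[OF \<mu>_M, of "Suc s" r] by simp_all
    ultimately show ?thesis by simp
  qed
  have "\<mu> 0 = 1"
  proof (rule unique[symmetric], rule ord_ge_F)
    have "F dvd (B.vc 0 - 1) - (A.vc 0 - 1)" by (intro dvd_diff A.vc_0 B.vc_0)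
    then show "F dvd B.e 0 - const 1 * A.e 0" using n_pos by (simp add: extend_less)
  qed
  then have lt: "\<mu> s = 1" if "s < M" for s
    using that by (induction s) (simp_all add: step)
  have one: "\<mu> s = 1" for s
    using iterate[OF \<mu>_M, of "s mod M" "s div M"] lt[of "s mod M"] M_pos by (simp add: mult.commute)
  have e: "F dvd B.e s - A.e s" for s using \<mu>[of s] by (simp add: one)
  have coeff: "band_coeff n (\<lambda>s t. L $$ (n - 1 - s, n - 1 - t)) s t = band_coeff n (\<lambda>s t. L' $$ (n - 1 - s, n - 1 - t)) s t"
    if s: "s < n" for s t
  proof -
    let ?a = "band_coeff n (\<lambda>s t. L $$ (n - 1 - s, n - 1 - t)) s"
    let ?b = "band_coeff n (\<lambda>s t. L' $$ (n - 1 - s, n - 1 - t)) s"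
    let ?u = "s + (m + k)"
    consider "t < ?u" | "t = ?u" | "t > ?u" by linarith
    then show ?thesis
    proof cases
      case 1
      \<comment> \<open>The sequences agree on the curve, so subtracting the two expansions of
        \<open>Y\<close> leaves a vanishing combination of the \<open>A.e t\<close>.\<close>
      have "F dvd Y * (B.e s - A.e s) - (B.e ?u - A.e ?u) - (\<Sum>t<?u. const (?b t) * (B.e t - A.e t))
         + (Y * A.e s - (A.e ?u + (\<Sum>t<?u. const (?a t) * A.e t)))
         - (Y * B.e s - (B.e ?u + (\<Sum>t<?u. const (?b t) * B.e t)))"
        by (intro dvd_diff dvd_add dvd_mult dvd_sum e A.col.Y_extend[OF A.eigen_vc s] B.col.Y_extend[OF B.eigen_vc s])
      also have "Y * (B.e s - A.e s) - (B.e ?u - A.e ?u) - (\<Sum>t<?u. const (?b t) * (B.e t - A.e t))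
         + (Y * A.e s - (A.e ?u + (\<Sum>t<?u. const (?a t) * A.e t)))
         - (Y * B.e s - (B.e ?u + (\<Sum>t<?u. const (?b t) * B.e t))) = (\<Sum>t<?u. const (?b t - ?a t) * A.e t)"
        by (simp add: const_diff left_diff_distrib right_diff_distrib sum_subtractf)
      finally have "?b t - ?a t = 0" by (rule combination_zero[OF A.e_pole _ 1, of "\<lambda>t. ?b t - ?a t"])
      then show ?thesis by simp
    next
      case 2
      then show ?thesis using A.col.banded_A B.col.banded_A s unfolding banded_def by metis
    next
      case 3
      then have "\<not> t \<le> ?u" by simp
      then have "?a t = 0" "?b t = 0" using A.col.banded_A B.col.banded_A s unfolding banded_def by blast+
      then show ?thesis by simp
    qed
  qed
  show "L = L'"
  proof (rule eq_matI)
    fix i j assume "i < dim_row L'" "j < dim_col L'"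
    then have ij: "i < n" "j < n" unfolding B.L_dim .
    show "L $$ (i, j) = L' $$ (i, j)"
    proof (rule poly_eqI)
      fix d
      have s: "n - 1 - i < n" "n - 1 - j < n" using n_pos by simp_all
      have r: "n - 1 - (n - 1 - i) = i" "n - 1 - (n - 1 - j) = j" using ij by simp_all
      have md: "(n - 1 - j + d * n) mod n = n - 1 - j" "(n - 1 - j + d * n) div n = d"
        unfolding mod_mult_self1 by (rule mod_less[OF s(2)]) (use div_mult_self1[of n "n - 1 - j" d] div_less[OF s(2)] n_pos in linarith)
      show "poly.coeff (L $$ (i, j)) d = poly.coeff (L' $$ (i, j)) d"
        using coeff[OF s(1), of "n - 1 - j + d * n"] unfolding band_coeff_def md r .
    qed
  qed (simp_all only: A.L_dim B.L_dim)
qed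

end

section \<open>Recovering the factors of a Lax matrix\<close>

text \<open>Over an integral domain the adjugate replaces the inverse, up to a nonzero scalar
  factor.\<close>

lemma mat_cancel_right:
  fixes B :: "'a :: idom mat"
  assumes A: "A \<in> carrier_mat r n" "C \<in> carrier_mat r n" and B: "B \<in> carrier_mat n n" "det B \<noteq> 0"
    and eq: "A * B = C * B"
  shows "A = C"
proof -
  have *: "D * B * adj_mat B = det B \<cdot>\<^sub>m D" if "D \<in> carrier_mat r n" for D
    using that assoc_mult_mat[OF that B(1) adj_mat(1)[OF B(1)]] adj_mat(2)[OF B(1)]
    by (simp add: mult_smult_distrib[OF that one_carrier_mat])
  have "det B \<cdot>\<^sub>m A = det B \<cdot>\<^sub>m C" using *[OF A(1)] *[OF A(2)] eq by simp
  then have "det B * A $$ (i, j) = det B * C $$ (i, j)" if "i < r" "j < n" for i j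
    using A that by (metis carrier_matD index_smult_mat(1))
  then show ?thesis using A B(2) by (intro eq_matI) auto
qed

lemma mat_cancel_left:
  fixes B :: "'a :: idom mat"
  assumes A: "A \<in> carrier_mat n r" "C \<in> carrier_mat n r" and B: "B \<in> carrier_mat n n" "det B \<noteq> 0"
    and eq: "B * A = B * C"
  shows "A = C"
proof -
  have *: "adj_mat B * (B * D) = det B \<cdot>\<^sub>m D" if "D \<in> carrier_mat n r" for D
    using that assoc_mult_mat[OF adj_mat(1)[OF B(1)] B(1) that] adj_mat(3)[OF B(1)]
    by (simp add: mult_smult_assoc_mat[OF one_carrier_mat that] flip: assoc_mult_mat)
  have "det B \<cdot>\<^sub>m A = det B \<cdot>\<^sub>m C" using *[OF A(1)] *[OF A(2)] eq by simp
  then have "det B * A $$ (i, j) = det B * C $$ (i, j)" if "i < n" "j < r" for i j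
    using A that by (metis carrier_matD index_smult_mat(1))
  then show ?thesis using A B(2) by (intro eq_matI) auto
qed

text \<open>The first row has two nonzero entries, and their minors are triangular.\<close>

lemma det_Q_mat:
  assumes n: "n \<ge> 2"
  shows "det (Q_mat n d) = [:\<Prod>j<n. d j:] + (- 1) ^ (n - 1) * [:0, 1:]"
proof -
  let ?Q = "Q_mat n d"
  have Q: "?Q $$ (i, j) = (if i = j then [:d i:] else if i = j + 1 then 1 else if i = 0 \<and> j = n - 1 then [:0, 1:] else 0)"
    if "i < n" "j < n" for i j
    using that by (simp add: Q_mat_def)
  have first: "det (mat_delete ?Q 0 0) = [:\<Prod>j<n - 1. d (Suc j):]"
  proof -
    have c: "mat_delete ?Q 0 0 \<in> carrier_mat (n - 1) (n - 1)" by (rule mat_delete_carrier) simp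
    have "det (mat_delete ?Q 0 0) = prod_list (diag_mat (mat_delete ?Q 0 0))"
      by (rule det_lower_triangular[OF _ c]) (simp add: mat_delete_def Q Q_mat_def)
    also have "\<dots> = (\<Prod>j<n - 1. [:d (Suc j):])"
      unfolding prod_list_diag_prod using c by (intro prod.cong) (auto simp: mat_delete_def Q_mat_def)
    also have "\<dots> = [:\<Prod>j<n - 1. d (Suc j):]"
    proof -
      have "(\<Prod>j<r. [:g j:]) = [:\<Prod>j<r. g j:]" for g :: "nat \<Rightarrow> complex" and r
        by (induction r) (simp_all add: one_pCons mult.commute)
      then show ?thesis .
    qed
    finally show ?thesis .
  qed
  have last: "det (mat_delete ?Q 0 (n - 1)) = 1"
  proof -
    have c: "mat_delete ?Q 0 (n - 1) \<in> carrier_mat (n - 1) (n - 1)" by (rule mat_delete_carrier) simp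
    have "det (mat_delete ?Q 0 (n - 1)) = prod_list (diag_mat (mat_delete ?Q 0 (n - 1)))"
    proof (rule det_upper_triangular[OF _ c])
      show "upper_triangular (mat_delete ?Q 0 (n - 1))"
        unfolding upper_triangular_def by (auto simp: mat_delete_def Q_mat_def)
    qed
    also have "\<dots> = 1"
      unfolding prod_list_diag_prod using c by (intro prod.neutral) (auto simp: mat_delete_def Q_mat_def)
    finally show ?thesis .
  qed
  have "det ?Q = (\<Sum>j<n. ?Q $$ (0, j) * cofactor ?Q 0 j)"
    using n by (intro laplace_expansion_row) auto
  also have "\<dots> = (\<Sum>j\<in>{0, n - 1}. ?Q $$ (0, j) * cofactor ?Q 0 j)"
    using n by (intro sum.mono_neutral_right) (auto simp: Q)
  also have "\<dots> = [:d 0:] * [:\<Prod>j<n - 1. d (Suc j):] + [:0, 1:] * (- 1) ^ (n - 1)"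
    using n first last by (simp add: cofactor_def Q)
  also have "[:d 0:] * [:\<Prod>j<n - 1. d (Suc j):] = [:\<Prod>j<n. d j:]"
  proof -
    have "{..<n} = {..<Suc (n - 1)}" using n by simp
    then show ?thesis by (simp only: prod.lessThan_Suc_shift) simp
  qed
  finally show ?thesis by (simp add: mult.commute)
qed

lemma poly_det_Q_mat: "n \<ge> 2 \<Longrightarrow> poly (det (Q_mat n d)) c = (\<Prod>j<n. d j) - (- 1) ^ n * c"
proof -
  assume n: "n \<ge> 2"
  have "(- 1 :: complex) ^ n = - ((- 1) ^ (n - 1))" using n by (cases n) auto
  then show ?thesis unfolding det_Q_mat[OF n] by (simp add: poly_power)
qed

lemma det_Q_mat_nonzero: "n \<ge> 2 \<Longrightarrow> det (Q_mat n d) \<noteq> 0"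
proof
  assume n: "n \<ge> 2" and "det (Q_mat n d) = 0"
  then have "poly (det (Q_mat n d)) c = 0" for c by simp
  then have *: "(\<Prod>j<n. d j) - (- 1) ^ n * c = 0" for c unfolding poly_det_Q_mat[OF n] .
  have "x = 0" if "P - x * 0 = 0" "P - x * 1 = 0" for P x :: complex using that by simp
  from this[OF *[of 0] *[of 1]] show False by simp
qed

text \<open>A list of diagonals in place of the rows of \<open>q\<close>, so that factors can be
  split off by induction.\<close>

definition Q_prod :: "nat \<Rightarrow> (nat \<Rightarrow> complex) list \<Rightarrow> complex poly mat" where
  "Q_prod n ds = foldr (\<lambda>d B. Q_mat n d * B) ds (1\<^sub>m n)"

lemma Q_prod_simps [simp]: "Q_prod n [] = 1\<^sub>m n" "Q_prod n (d # ds) = Q_mat n d * Q_prod n ds"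
  by (simp_all add: Q_prod_def)

lemma Q_prod_carrier [simp]: "Q_prod n ds \<in> carrier_mat n n"
  by (induction ds) (simp_all add: mult_carrier_mat[OF Q_mat_carrier])

lemma alpha_eq: "alpha n m k q = Q_prod n (map (\<lambda>i j. q $$ (i, j)) [0..<m]) * P_mat n ^\<^sub>m k"
  by (simp add: alpha_def Q_prod_def foldr_map comp_def)

lemma poly_det_Q_prod: "n \<ge> 2 \<Longrightarrow> poly (det (Q_prod n ds)) c = (\<Prod>d\<leftarrow>ds. (\<Prod>j<n. d j) - (- 1) ^ n * c)"
  by (induction ds) (simp_all add: det_mult[OF Q_mat_carrier Q_prod_carrier] poly_det_Q_mat)

lemma P_power_carrier [simp]: "P_mat n ^\<^sub>m k \<in> carrier_mat n n"
  by (rule pow_carrier_mat) (simp add: P_mat_def)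

lemma det_P_power: "det (P_mat n ^\<^sub>m k) = det (P_mat n) ^ k"
proof (induction k)
  case (Suc k)
  have "P_mat n \<in> carrier_mat n n" by (simp add: P_mat_def)
  from det_mult[OF P_power_carrier this] show ?case using Suc by simp
qed simp

text \<open>The row vector with entries \<open>u_0 = 1\<close>, \<open>u_(j + 1) = - d_j u_j\<close> spans the left kernel of \<open>Q_mat n d\<close> at
  the zero of its determinant.\<close>

lemma comm_ring_hom_poly: "comm_ring_hom (\<lambda>p :: 'a :: comm_ring_1 poly. poly p c)"
  by unfold_locales simp_all

lemma poly_det: "det (map_mat (\<lambda>p. poly p c) A) = poly (det A) (c :: 'a :: comm_ring_1)"
  by (rule comm_ring_hom.hom_det[OF comm_ring_hom_poly])

lemma poly_mat_mult: "A \<in> carrier_mat r n \<Longrightarrow> B \<in> carrier_mat n s \<Longrightarrow>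
    map_mat (\<lambda>p. poly p c) (A * B) = map_mat (\<lambda>p. poly p c) A * map_mat (\<lambda>p. poly p (c :: 'a :: comm_ring_1)) B"
  by (rule semiring_hom.mat_hom_mult) (unfold_locales, simp_all)

text \<open>The kernel vector of the first factor kills the whole product. The remaining factors of
  the other factorisation are invertible at \<open>c\<close>, so it also kills
  \<open>Q_mat n e\<close>, and comparing entries gives \<open>u j * d j = u j * e j\<close> with
  nonzero \<open>u j\<close>. The first factors then agree and are cancelled.\<close>

lemma Q_prod_inj:
  assumes n: "n \<ge> 2" and "length ds = length es"
    and "map (\<lambda>d. \<Prod>j<n. d j) ds = map (\<lambda>d. \<Prod>j<n. d j) es"
    and "distinct (map (\<lambda>d. \<Prod>j<n. d j) ds)" "0 \<notin> set (map (\<lambda>d. \<Prod>j<n. d j) ds)"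
    and "Q_prod n ds = Q_prod n es" "i < length ds" "j < n"
  shows "(ds ! i) j = (es ! i) j"
  using assms(2-)
proof (induction ds es arbitrary: i rule: list_induct2)
  case (Cons d ds e es)
  let ?\<epsilon> = "\<lambda>d. \<Prod>j<n. d j"
  define c where "c = (- 1) ^ n * ?\<epsilon> d"
  let ?ev = "map_mat (\<lambda>p. poly p c)"
  define u where "u j = (\<Prod>i<j. - d i)" for j
  define U where "U = mat 1 n (\<lambda>(_, j). u j)"
  have U: "U \<in> carrier_mat 1 n" by (simp add: U_def)
  have evc: "?ev (Q_mat n d) \<in> carrier_mat n n" "?ev (Q_prod n ds) \<in> carrier_mat n n" for d ds by simp_all
  have U_Q: "(U * ?ev (Q_mat n d')) $$ (0, j) = u j * d' j + (if j = n - 1 then c else u (Suc j))" if j: "j < n" for d' j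
  proof -
    have "(U * ?ev (Q_mat n d')) $$ (0, j) = (\<Sum>i<n. u i * poly (Q_mat n d' $$ (i, j)) c)"
      using j by (simp add: U_def Q_mat_def scalar_prod_def lessThan_atLeast0)
    also have "\<dots> = (\<Sum>i<n. (if i = j then u j * d' j else 0) + (if i = j + 1 then u i else 0) + (if i = 0 then if j = n - 1 then c else 0 else 0))"
      by (rule sum.cong[OF refl]) (use j n in \<open>auto simp: Q_mat_def u_def\<close>)
    also have "\<dots> = u j * d' j + (if j + 1 < n then u (j + 1) else 0) + (if j = n - 1 then c else 0)"
      unfolding sum.distrib using j n by simp
    also have "\<dots> = u j * d' j + (if j = n - 1 then c else u (Suc j))" using j by auto
    finally show ?thesis .
  qed
  have d_nz: "d j \<noteq> 0" if "j < n" for j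
    using Cons.prems(3) that by auto
  have u_nz: "u j \<noteq> 0" if "j < n" for j
    unfolding u_def using d_nz that by auto
  have kernel: "U * ?ev (Q_mat n d) = 0\<^sub>m 1 n"
  proof (rule eq_matI)
    fix i j assume "i < dim_row (0\<^sub>m 1 n)" "j < dim_col (0\<^sub>m 1 n)"
    then have ij: "i = 0" "j < n" by simp_all
    have "u j * d j + (if j = n - 1 then c else u (Suc j)) = 0"
    proof (cases "j = n - 1")
      case True
      have Suc: "Suc j = n" using True n by simp
      have "u j * d j = - (\<Prod>i<Suc j. - d i)" by (simp add: u_def)
      also have "\<dots> = - c" unfolding Suc c_def by (simp add: prod_uminus)
      finally show ?thesis using True by simp
    qed (simp add: u_def)
    then show "(U * ?ev (Q_mat n d)) $$ (i, j) = 0\<^sub>m 1 n $$ (i, j)"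
      using U_Q[OF ij(2), of d] ij by simp
  qed (simp_all add: U_def Q_mat_def)
  have prod_nz: "det (?ev (Q_prod n es)) \<noteq> 0"
  proof -
    have "det (?ev (Q_prod n es)) = (\<Prod>e\<leftarrow>es. ?\<epsilon> e - ?\<epsilon> d)"
      unfolding poly_det poly_det_Q_prod[OF n] c_def by (simp flip: mult.assoc power_add)
    moreover have "?\<epsilon> d \<notin> set (map ?\<epsilon> es)" using Cons.prems(1,2) by (metis distinct.simps(2) list.simps(9) list.inject)
    moreover have "(\<Prod>e\<leftarrow>es. g e - x) \<noteq> 0" if "x \<notin> set (map g es)" for g :: "(nat \<Rightarrow> complex) \<Rightarrow> complex" and x es
      using that by (induction es) auto
    ultimately show ?thesis by metis
  qed
  have "U * ?ev (Q_mat n e) * ?ev (Q_prod n es) = U * ?ev (Q_prod n (e # es))"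
    using poly_mat_mult[OF Q_mat_carrier Q_prod_carrier] assoc_mult_mat[OF U evc] by simp
  also have "\<dots> = U * ?ev (Q_prod n (d # ds))" unfolding Cons.prems(4) ..
  also have "\<dots> = U * ?ev (Q_mat n d) * ?ev (Q_prod n ds)"
    using poly_mat_mult[OF Q_mat_carrier Q_prod_carrier] assoc_mult_mat[OF U evc] by simp
  also have "\<dots> = 0\<^sub>m 1 n * ?ev (Q_prod n es)"
    unfolding kernel left_mult_zero_mat[OF evc(2)] ..
  finally have "U * ?ev (Q_mat n e) = 0\<^sub>m 1 n"
    by (rule mat_cancel_right[OF mult_carrier_mat[OF U evc(1)] zero_carrier_mat evc(2) prod_nz])
  then have "u j * d j = u j * e j" if "j < n" for j
    using U_Q[OF that, of d] U_Q[OF that, of e] kernel by simp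
  then have de: "d j = e j" if "j < n" for j using u_nz that by simp
  have "Q_mat n d = Q_mat n e" unfolding Q_mat_def by (rule cong_mat) (auto simp: de)
  then have "Q_mat n d * Q_prod n ds = Q_mat n d * Q_prod n es" using Cons.prems(4) by simp
  then have "Q_prod n ds = Q_prod n es"
    by (rule mat_cancel_left[OF Q_prod_carrier Q_prod_carrier Q_mat_carrier det_Q_mat_nonzero[OF n]])
  then show ?case using Cons.IH[of "i - 1"] Cons.prems de by (cases i) auto
qed simp

section \<open>The points A_r as zeros of the determinant of L(x)\<close>

context spectral_curve begin

lemma A_points_eq:
  obtains \<epsilon> :: "nat \<Rightarrow> complex" where "inj_on \<epsilon> {1..m}" "A_points f = (\<lambda>r. ((- 1) ^ n * \<epsilon> r, 0)) ` {1..m}"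
    "\<And>r. r \<in> {1..m} \<Longrightarrow> \<epsilon> r \<noteq> 0 \<and> eval_xy f ((- 1) ^ n * \<epsilon> r) 0 = 0"
proof -
  obtain \<epsilon> :: "nat \<Rightarrow> complex" and A Op where *: "special_points f = A ` {1..m} \<union> Op ` {1..N} \<union> {P_inf f}" "inj_on \<epsilon> {1..m}"
    "\<And>r. r \<in> {1..m} \<Longrightarrow> \<epsilon> r \<noteq> 0 \<and> lies_over f (A r) ((- 1) ^ n * \<epsilon> r, 0)" "O_points f = Op ` {1..N}"
    using special_data by metis
  have pt: "p \<in> points f" if "p \<in> special_points f" for p using that by (simp add: special_points_iff)
  have A: "A r \<in> special_points f" if "r \<in> {1..m}" for r using *(1) that by blast
  have "A_points f = (\<lambda>r. ((- 1) ^ n * \<epsilon> r, 0)) ` {1..m}"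
  proof (intro equalityI subsetI)
    fix z :: "complex \<times> complex" assume "z \<in> A_points f"
    then obtain a p where z: "z = (a, 0)" "a \<noteq> 0" "p \<in> special_points f" "lies_over f p (a, 0)"
      unfolding A_points_def by blast
    interpret curve_point f p by unfold_locales (rule pt[OF z(3)])
    have X: "ord_ge p (X - const a) 1" using z(4) by (simp add: lies_over_iff)
    consider r where "r \<in> {1..m}" "p = A r" | "p \<in> O_points f" | "p = P_inf f" using z(3) unfolding *(1,4) by blast
    then show "z \<in> (\<lambda>r. ((- 1) ^ n * \<epsilon> r, 0)) ` {1..m}"
    proof cases
      case 1
      then have "ord_ge p (X - const ((- 1) ^ n * \<epsilon> r)) 1" using *(3) by (simp add: lies_over_iff)
      from ge_diff[OF this X] have "ord_ge p (const (a - (- 1) ^ n * \<epsilon> r)) 1" by (simp add: const_diff)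
      then have "a = (- 1) ^ n * \<epsilon> r" by (simp add: ge_const_pos_iff)
      then show ?thesis using 1(1) z(1) by blast
    next
      case 2
      then have "ord_ge p X 1" by (simp add: O_points_def lies_over_iff)
      from ge_diff[OF this X] have "a = 0" by (simp add: ge_const_pos_iff)
      then show ?thesis using z(2) by simp
    next
      case 3
      then show ?thesis using ge_regular[OF X] P_inf_pole by simp
    qed
  next
    fix z :: "complex \<times> complex" assume "z \<in> (\<lambda>r. ((- 1) ^ n * \<epsilon> r, 0)) ` {1..m}"
    then obtain r where "r \<in> {1..m}" "z = ((- 1) ^ n * \<epsilon> r, 0)" by blast
    then show "z \<in> A_points f" using *(3)[of r] A[of r] unfolding A_points_def by fastforce
  qed
  moreover have "eval_xy f ((- 1) ^ n * \<epsilon> r) 0 = 0" if r: "r \<in> {1..m}" for r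
  proof -
    interpret curve_point f "A r" by unfold_locales (rule pt[OF A[OF r]])
    show ?thesis using *(3)[OF r] unfolding lies_over_iff by (intro eval_f_eq_0) auto
  qed
  ultimately show thesis using that *(2,3) by blast
qed

end

lemma (in lax_matrix) eval_f_y0: "eval_xy f c 0 = poly (det L) c"
proof -
  have "map_mat (\<lambda>p. poly p 0) (char_mat n L) = L"
    by (rule eq_matI) (simp_all add: char_mat_index)
  then have "poly (det (char_mat n L)) 0 = det L" by (metis poly_det)
  then show ?thesis using beta_L by (simp add: beta_def eval_xy_def)
qed

context spectral_curve begin

lemma lax_matrix_alpha: "psi n m k q = f \<Longrightarrow> lax_matrix n m k f (alpha n m k q)"
  by unfold_locales (simp_all add: banded_alpha n psi_def)

lemma attached_A_eq: "attached_A n m q = map (\<lambda>r. ((- 1) ^ n * (\<Prod>j<n. q $$ (r, j)), 0)) [0..<m]"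
  by (simp add: attached_A_def)

text \<open>At the abscissa of each \<open>A_r\<close> the determinant of \<open>L\<close> vanishes,
  while \<open>P_mat\<close> is invertible there since the abscissa is nonzero. So each of the
  \<open>m\<close> distinct values on the curve is the product of some row of \<open>q\<close>, and
  with only \<open>m\<close> rows the correspondence is one to one.\<close>

lemma factors:
  assumes "psi n m k q = f"
  shows "inj_on (\<lambda>i. \<Prod>j<n. q $$ (i, j)) {..<m}" and "i < m \<Longrightarrow> (\<Prod>j<n. q $$ (i, j)) \<noteq> 0"
    and "attached_A n m q \<in> orderings (A_points f)"
proof -
  interpret lax_matrix n m k f "alpha n m k q" by (rule lax_matrix_alpha[OF assms])
  let ?\<epsilon> = "\<lambda>i. \<Prod>j<n. q $$ (i, j)"
  obtain \<epsilon> :: "nat \<Rightarrow> complex" where \<epsilon>: "inj_on \<epsilon> {1..m}" "A_points f = (\<lambda>r. ((- 1) ^ n * \<epsilon> r, 0)) ` {1..m}"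
    "\<And>r. r \<in> {1..m} \<Longrightarrow> \<epsilon> r \<noteq> 0 \<and> eval_xy f ((- 1) ^ n * \<epsilon> r) 0 = 0" using A_points_eq by metis
  have "\<epsilon> r \<in> ?\<epsilon> ` {..<m}" if r: "r \<in> {1..m}" for r
  proof -
    define c where "c = (- 1) ^ n * \<epsilon> r"
    have c: "c \<noteq> 0" "(- 1) ^ n * c = \<epsilon> r" using \<epsilon>(3)[OF r] by (simp_all add: c_def flip: mult.assoc power_add)
    have P: "poly (det (P_mat n)) c \<noteq> 0" unfolding P_mat_def poly_det_Q_mat[OF n] using c(1) n_pos by (simp add: zero_power)
    have "det (alpha n m k q) = det (Q_prod n (map (\<lambda>i j. q $$ (i, j)) [0..<m])) * det (P_mat n) ^ k"
      unfolding alpha_eq det_P_power[symmetric] by (rule det_mult[of _ n]) simp_all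
    then have "poly (det (Q_prod n (map (\<lambda>i j. q $$ (i, j)) [0..<m]))) c * poly (det (P_mat n)) c ^ k = 0"
      using \<epsilon>(3)[OF r] eval_f_y0[of c] by (simp add: c_def poly_power)
    then have "(\<Prod>i\<leftarrow>[0..<m]. ?\<epsilon> i - \<epsilon> r) = 0"
      using P unfolding poly_det_Q_prod[OF n] c(2) by (simp add: comp_def)
    then show ?thesis by (force simp: prod_list_zero_iff)
  qed
  then have sub: "\<epsilon> ` {1..m} \<subseteq> ?\<epsilon> ` {..<m}" by blast
  have cm: "card (\<epsilon> ` {1..m}) = m" using card_image[OF \<epsilon>(1)] by simp
  have "card (?\<epsilon> ` {..<m}) \<le> m" using card_image_le[of "{..<m}" ?\<epsilon>] by simp
  then have im: "\<epsilon> ` {1..m} = ?\<epsilon> ` {..<m}" using card_subset_eq[OF _ sub] card_mono[OF _ sub] cm by simp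
  then show inj: "inj_on ?\<epsilon> {..<m}" using cm by (intro eq_card_imp_inj_on) simp_all
  have mem: "?\<epsilon> i \<in> \<epsilon> ` {1..m}" if "i < m" for i using im that by auto
  then show "i < m \<Longrightarrow> ?\<epsilon> i \<noteq> 0" using \<epsilon>(3) by fastforce
  have "set (attached_A n m q) = (\<lambda>e. ((- 1) ^ n * e, 0)) ` (?\<epsilon> ` {..<m})"
    unfolding attached_A_eq by (auto simp: image_image)
  also have "\<dots> = A_points f" unfolding im[symmetric] \<epsilon>(2) by (auto simp: image_image)
  finally have "set (attached_A n m q) = A_points f" .
  moreover have "distinct (attached_A n m q)"
    unfolding attached_A_eq distinct_map using inj by (auto simp: inj_on_def)
  ultimately show "attached_A n m q \<in> orderings (A_points f)" by (simp add: orderings_def)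
qed

lemma phi_mem:
  assumes q: "psi n m k q = f"
  shows "phi n m k f q \<in> regular_spectral_data n m k f"
proof -
  interpret lax_matrix n m k f "alpha n m k q" by (rule lax_matrix_alpha[OF q])
  have "div_class f (DD 0) \<in> Pic f (genus_value n m k)"
    unfolding Pic_def using DD_0_Div e.degree_DD[of 0] by auto
  then show ?thesis
    using attached_c_S_set ordering factors(3)[OF q] DD_0_general(1) DD_0_regular e.degree_DD[of 0]
    unfolding phi_def Let_def regular_spectral_data_def attached_divisor_eq attached_ordering_eq by auto
qed

lemma phi_inj:
  assumes q: "q \<in> phase_space n m" "psi n m k q = f" and q': "q' \<in> phase_space n m" "psi n m k q' = f"
    and eq: "phi n m k f q = phi n m k f q'"
  shows "q = q'"
proof -
  interpret A: lax_matrix n m k f "alpha n m k q" by (rule lax_matrix_alpha[OF q(2)])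
  interpret B: lax_matrix n m k f "alpha n m k q'" by (rule lax_matrix_alpha[OF q'(2)])
  have data: "div_class f (A.DD 0) = div_class f (B.DD 0)"
    "attached_c n m k (alpha n m k q) = attached_c n m k (alpha n m k q')"
    "attached_ordering n m k f (alpha n m k q) = attached_ordering n m k f (alpha n m k q')"
    "attached_A n m q = attached_A n m q'"
    using eq unfolding phi_def Let_def A.attached_divisor_eq B.attached_divisor_eq by simp_all
  have "ell (A.DD 0) = 1" using A.e.ell_DD_one[of 0] by simp
  then have "A.DD 0 = B.DD 0"
    using linearly_equivalent_unique[OF A.DD_0_Div A.DD_0_general(1) _ B.DD_0_Div B.DD_0_general(1) data(1)] by simp
  then have L: "alpha n m k q = alpha n m k q'"
    using lax_matrix_determined[OF A.lax_matrix_axioms B.lax_matrix_axioms data(2,3)]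
    unfolding A.attached_divisor_eq B.attached_divisor_eq by simp
  let ?rows = "\<lambda>q :: complex mat. map (\<lambda>i j. q $$ (i, j)) [0..<m]"
  have "Q_prod n (?rows q) = Q_prod n (?rows q')"
  proof (rule mat_cancel_right[OF Q_prod_carrier Q_prod_carrier])
    show "P_mat n ^\<^sub>m k \<in> carrier_mat n n" by simp
    show "det (P_mat n ^\<^sub>m k) \<noteq> 0" unfolding det_P_power using det_Q_mat_nonzero[OF n] by (simp add: P_mat_def)
  qed (use L in \<open>simp add: alpha_eq\<close>)
  moreover have "map (\<lambda>d. \<Prod>j<n. d j) (?rows q) = map (\<lambda>d. \<Prod>j<n. d j) (?rows q')"
    using data(4) by (simp add: attached_A_eq)
  moreover have "distinct (map (\<lambda>d. \<Prod>j<n. d j) (?rows q))" "0 \<notin> set (map (\<lambda>d. \<Prod>j<n. d j) (?rows q))"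
    using factors(1,2)[OF q(2)] by (auto simp: distinct_map inj_on_def comp_def)
  ultimately have "(?rows q ! i) j = (?rows q' ! i) j" if "i < m" "j < n" for i j
    using Q_prod_inj[OF n, of "?rows q" "?rows q'" i j] that by simp
  then show ?thesis using q(1) q'(1) unfolding phase_space_def by (intro eq_matI) auto
qed

end

theorem theorem5p4:
  fixes n m k :: nat and f :: "complex poly poly"
  assumes "n \<ge> 2" and "m \<ge> 1" and "1 \<le> k" and "k \<le> n"
    and "f \<in> ring_V n m k"
  shows "inj_on (phi n m k f) ({q \<in> phase_space n m. psi n m k q = f} \<inter> ring_M n m k) \<and>
    phi n m k f ` ({q \<in> phase_space n m. psi n m k q = f} \<inter> ring_M n m k)
      \<subseteq> regular_spectral_data n m k f"
proof -
  interpret spectral_curve n m k f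
    by unfold_locales (use assms in \<open>auto simp: ring_V_def\<close>)
  show ?thesis using phi_mem phi_inj by (auto intro!: inj_onI)
qed

end
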